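(* Let $\beta:=\max\{\|Kb\|_{L^\infty(\Omega)},\|b\|_{L^\infty(\Omega)},\|Kc\|_{L^\infty(\Omega)},\|c\|_{L^\infty(\Omega)}\}$ and $\gamma_*:=288\,\beta^2\,C_{\mathrm{tr}}^2\,\delta^{-1}$, with the discrete trace constant $C_{\mathrm{tr}}$ and the multiplier positivity constant $\delta$ of the context. For all $\gamma_1>0$, all $\gamma_2,\gamma_3>\gamma_*$, and any polynomial discrete space (linear subspace) $V_h\subset\mathbb P^p(\mathcal T_h)$, $p\ge1$, there exists a unique $u_h\in V_h$ such that $$\mathcal A_h(u_h,v_h)+\mathcal A_J(u_h,v_h)=L_h(v_h)\qquad\forall v_h\in V_h .$$
   Context: **Problem data.** $K=K(y)$ is a real function of $y$ only with $K(y)y>0$ for $y\ne0$, $K\in C^0(\overline\Omega)\cap C^1(\Omega)$, $K'>0$. $\Omega\subset\mathbb R^2$ is a bounded domain whose boundary is decomposed as $\Gamma_0\cup\Gamma_1\cup\Gamma_2$: $\Gamma_0=\partial\Omega\cap\{y>0\}$ is a Lipschitz curve, and $\partial\Omega\cap\{y<0\}$ is the union of the characteristic curves $\Gamma_1$: $x=-1+\int_y^0\sqrt{-K(t)}\,dt$ and $\Gamma_2$: $x=1-\int_y^0\sqrt{-K(t)}\,dt$, starting at $(-1,0)$ and $(1,0)$ respectively and meeting at $(0,y_c)$, $y_c<0$. With $\mathbf n=(n_x,n_y)^\top$ the outward unit normal, $Kn_x^2+n_y^2=0$ on $\Gamma_1\cup\Gamma_2$. The unit tangent is $\mathbf t=(-n_y,n_x)^\top$;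 $v_t=\nabla v\cdot\mathbf t$. $\mathbf W:=\mathrm{diag}(K,1)$. The boundary value problem is $Ku_{xx}+u_{yy}=f$ in $\Omega$, $u=g$ on $\Gamma_0\cup\Gamma_1$, with $f\in L^2(\Omega)$ and $g$ sufficiently regular ($g$ and its tangential derivative $g_t$ in $L^2(\Gamma_0\cup\Gamma_1)$, so that $L_h$ below is defined). **Mesh.** $\{\mathcal T_h\}_{h\in\mathcal H}$ is a sequence of partitions of $\Omega$ into disjoint open elements $T$ ($h_T=\operatorname{diam}T$, $h=\sup_T h_T$). Elements whose closure meets $\partial\Omega$ in at most a point are polygons; the others may have curved facets lying exactly on $\partial\Omega$. For distinct $T,T'$, $\partial T\cap\partial T'$ is empty, a point, or a straight segment (then called an interior facet); boundary facets are the sets $\partial T\cap\Gamma_j$ of positive length. Hanging nodes are allowed. $\mathcal F_T$: facets of $T$; $\mathcal F_h^{\mathrm I}$: interior facets; $\mathcal F_h^j$: facets in $\Gamma_j$; $\mathcal F_h^{\mathrm D}=\mathcal F_h^0\cup\mathcal F_h^1$; $h_F=\operatorname{diam}F$. Assumptions: (i) there is $0<r_\star\le\frac12$ such that every $T$ is star-shaped with respect to a ball centered in $T$ of radius $r_\star h_T$; (ii) there is $C_g>0$ with $h_T\le C_gh_F$ for all $T$ and $F\in\mathcal F_T$. $C_{\mathrm{tr}}>0$ is a constant such that $\|v\|_{L^2(\partial T)}\le C_{\mathrm{tr}}\,p\,h_T^{-1/2}\|v\|_{L^2(T)}$ for all $h\in\mathcal H$, $T\in\mathcal T_h$, $p\ge1$,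 $v\in\mathbb P^p(T)$ (it exists, with $C_{\mathrm{tr}}\le\sqrt{6/r_\star}$). $\mathbb P^p(T)$: polynomials of total degree $\le p$; $\mathbb P^p(\mathcal T_h)$: elementwise version. On $F=\partial T_+\cap\partial T_-$: averages $\{\!\{\cdot\}\!\}$ are arithmetic means of the two traces, $[\![\varphi]\!]=\varphi_+\mathbf n_{T_+}+\varphi_-\mathbf n_{T_-}$ for scalar $\varphi$ (a vector). On boundary facets $[\![\varphi]\!]=\varphi\mathbf n$. **Multiplier.** $\mathbf m=(b,c)^\top$, $\mathcal Mv:=bv_x+cv_y$, where: $b=b(x)$, $c=c(y)$, $b,c\in C^0(\overline\Omega)\cap C^1(\Omega)$; there is $\delta>0$ with $-Kb_x+(Kc)_y\ge\delta$ and $b_x-c_y\ge\delta$ in $\Omega$; $b+c\sqrt{-K}\le0$ on $\Gamma_2$; $\mathbf m\cdot\mathbf n\ge0$ on $\Gamma_0$. **Forms** (with penalty parameters $\gamma_1,\gamma_2,\gamma_3>0$): $$\mathcal A_h(u,v)=-\sum_{T}\int_T\mathbf W\nabla u\cdot\nabla(\mathcal Mv)+\sum_{F\in\mathcal F_h^{\mathrm I}}\int_F\{\!\{\mathbf W\nabla u\}\!\}\cdot[\![\mathcal Mv]\!]+\sum_{F\in\mathcal F_h^{\mathrm D}\cup\mathcal F_h^2}\int_F\mathbf W\nabla u\cdot\mathbf n\,\mathcal Mv,$$ $$\mathcal A_J(u,v)=\sum_{F\in\mathcal F_h^{\mathrm I}\cup\mathcal F_h^{\mathrm D}}\frac{\gamma_1}{h_F^3}\int_F[\![u]\!]\cdot[\![v]\!]+\sum_{F\in\mathcal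 F_h^{\mathrm I}}\frac{\gamma_2p^2}{h_F}\int_F\big([\![u_x]\!]\cdot[\![v_x]\!]+[\![u_y]\!]\cdot[\![v_y]\!]\big)+\sum_{F\in\mathcal F_h^{\mathrm D}}\frac{\gamma_3p^2}{h_F}\int_Fu_tv_t,$$ $$L_h(v)=\sum_T\int_Tf\,\mathcal Mv+\sum_{F\in\mathcal F_h^{\mathrm D}}\frac{\gamma_1}{h_F^3}\int_Fgv+\sum_{F\in\mathcal F_h^{\mathrm D}}\frac{\gamma_3p^2}{h_F}\int_Fg_tv_t.$$ *)

theory Defs
  imports "HOL-Analysis.Analysis"
begin

type_synonym pt = "real \<times> real"

section \<open>The domain and its boundary\<close>

record tricomi_data =
  coefK :: "real \<Rightarrow> real"
  region :: "pt set"
  y_crit :: real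
  upper_arc :: "real \<Rightarrow> pt"

datatype boundary_part = Upper | CharLeft | CharRight

fun Gam :: "tricomi_data \<Rightarrow> boundary_part \<Rightarrow> pt set" where
  "Gam D Upper = {z \<in> frontier (region D). snd z > 0}"
| "Gam D CharLeft = {(x, y). y_crit D \<le> y \<and> y \<le> 0 \<and>
     x = - 1 + integral {y..0} (\<lambda>t. sqrt (- coefK D t))}"
| "Gam D CharRight = {(x, y). y_crit D \<le> y \<and> y \<le> 0 \<and>
     x = 1 - integral {y..0} (\<lambda>t. sqrt (- coefK D t))}"

text \<open>Parametrisations over the unit interval of the three parts of the boundary (up to the
  end points of \<open>Upper\<close>), used only to define integrals with respect to arc length.\<close>

fun Gam_arc :: "tricomi_data \<Rightarrow> boundary_part \<Rightarrow> real \<Rightarrow> pt" where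
  "Gam_arc D Upper s = upper_arc D s"
| "Gam_arc D CharLeft s =
     (- 1 + integral {s * y_crit D..0} (\<lambda>t. sqrt (- coefK D t)), s * y_crit D)"
| "Gam_arc D CharRight s =
     (1 - integral {s * y_crit D..0} (\<lambda>t. sqrt (- coefK D t)), s * y_crit D)"

definition tricomi_domain :: "tricomi_data \<Rightarrow> bool" where
  "tricomi_domain D \<longleftrightarrow>
     (let K = coefK D; \<Omega> = region D; yc = y_crit D in
       open \<Omega> \<and> connected \<Omega> \<and> bounded \<Omega> \<and> \<Omega> \<noteq> {} \<and>
       continuous_on (snd ` closure \<Omega>) K \<and> K C1_differentiable_on (snd ` \<Omega>) \<and>
       (\<forall>y \<in> snd ` closure \<Omega>. y \<noteq> 0 \<longrightarrow> K y * y > 0) \<and>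
       (\<forall>y \<in> snd ` \<Omega>. deriv K y > 0) \<and>
       frontier \<Omega> = Gam D Upper \<union> Gam D CharLeft \<union> Gam D CharRight \<and>
       yc < 0 \<and> integral {yc..0} (\<lambda>t. sqrt (- K t)) = 1 \<and>
       arc (upper_arc D) \<and> (\<exists>L. L-lipschitz_on {0..1} (upper_arc D)) \<and>
       pathstart (upper_arc D) = (1, 0) \<and> pathfinish (upper_arc D) = (- 1, 0) \<and>
       Gam D Upper = upper_arc D ` {0<..<1})"

text \<open>The outward unit normal of an open set, defined through its blow-up: near \<open>z\<close> the set
  is asymptotically the half plane with outward normal \<open>n\<close>.  On a Lipschitz boundary such a
  vector exists at almost every point, and it is unique wherever it exists.\<close>

definition is_outer_normal :: "pt set \<Rightarrow> pt \<Rightarrow> pt \<Rightarrow> bool" where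
  "is_outer_normal S z n \<longleftrightarrow> z \<in> frontier S \<and> norm n = 1 \<and>
     (\<forall>\<epsilon>>0. \<exists>r>0. \<forall>w. norm (w - z) < r \<longrightarrow>
        ((w - z) \<bullet> n < - \<epsilon> * norm (w - z) \<longrightarrow> w \<in> S) \<and>
        ((w - z) \<bullet> n > \<epsilon> * norm (w - z) \<longrightarrow> w \<notin> S))"

definition outer_normal :: "pt set \<Rightarrow> pt \<Rightarrow> pt" where
  "outer_normal S z = (THE n. is_outer_normal S z n)"

definition tangent_of :: "pt \<Rightarrow> pt" where
  "tangent_of n = (- snd n, fst n)"

section \<open>Integrals and function spaces\<close>

text \<open>The integral of \<open>\<phi>\<close> with respect to arc length over the part of the simple arc \<open>\<gamma>\<close>
  that lies in \<open>F\<close>.\<close>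

definition curve_integral :: "(real \<Rightarrow> pt) \<Rightarrow> pt set \<Rightarrow> (pt \<Rightarrow> real) \<Rightarrow> real" where
  "curve_integral \<gamma> F \<phi> =
     (LINT s : {s \<in> {0..1}. \<gamma> s \<in> F} | lebesgue. \<phi> (\<gamma> s) * norm (vector_derivative \<gamma> (at s)))"

definition segment_integral :: "pt set \<Rightarrow> (pt \<Rightarrow> real) \<Rightarrow> real" where
  "segment_integral F \<phi> =
     (let (a, b) = (SOME (a, b). F = closed_segment a b) in curve_integral (linepath a b) F \<phi>)"

definition boundary_integral :: "tricomi_data \<Rightarrow> pt set \<Rightarrow> (pt \<Rightarrow> real) \<Rightarrow> real" where
  "boundary_integral D F \<phi> =
     (\<Sum>j \<in> {Upper, CharLeft, CharRight}. curve_integral (Gam_arc D j) F \<phi>)"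

definition L2_on :: "pt set \<Rightarrow> (pt \<Rightarrow> real) \<Rightarrow> bool" where
  "L2_on S f \<longleftrightarrow> set_borel_measurable lebesgue S f \<and> set_integrable lebesgue S (\<lambda>z. (f z)\<^sup>2)"

definition L2_on_curve :: "(real \<Rightarrow> pt) \<Rightarrow> (pt \<Rightarrow> real) \<Rightarrow> bool" where
  "L2_on_curve \<gamma> \<phi> \<longleftrightarrow>
     set_borel_measurable lebesgue {0..1} (\<lambda>s. \<phi> (\<gamma> s) * norm (vector_derivative \<gamma> (at s))) \<and>
     set_integrable lebesgue {0..1} (\<lambda>s. (\<phi> (\<gamma> s))\<^sup>2 * norm (vector_derivative \<gamma> (at s)))"

definition Linf_norm :: "pt set \<Rightarrow> (pt \<Rightarrow> real) \<Rightarrow> real" where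
  "Linf_norm S \<phi> = Inf {C. 0 \<le> C \<and> (AE z in lebesgue. z \<in> S \<longrightarrow> \<bar>\<phi> z\<bar> \<le> C)}"

text \<open>\<open>gt\<close> is the weak derivative of \<open>g\<close> along \<open>\<gamma>\<close> in the direction of the unit tangent
  obtained by rotating the outward normal of \<open>\<Omega>\<close>.  The inner product with the tangent corrects
  for the speed and the orientation of \<open>\<gamma>\<close>; ``almost everywhere'' refers to arc length.\<close>

definition tangential_derivative ::
    "pt set \<Rightarrow> (real \<Rightarrow> pt) \<Rightarrow> (pt \<Rightarrow> real) \<Rightarrow> (pt \<Rightarrow> real) \<Rightarrow> bool" where
  "tangential_derivative \<Omega> \<gamma> g gt \<longleftrightarrow>
     (\<exists>C. AE s in lebesgue. s \<in> {0..1} \<longrightarrow> vector_derivative \<gamma> (at s) \<noteq> 0 \<longrightarrow>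
        g (\<gamma> s) = C + (LINT r : {0..s} | lebesgue.
          gt (\<gamma> r) * (vector_derivative \<gamma> (at r) \<bullet> tangent_of (outer_normal \<Omega> (\<gamma> r)))))"

definition boundary_data :: "tricomi_data \<Rightarrow> (pt \<Rightarrow> real) \<Rightarrow> (pt \<Rightarrow> real) \<Rightarrow> bool" where
  "boundary_data D g gt \<longleftrightarrow> (\<forall>j \<in> {Upper, CharLeft}.
     L2_on_curve (Gam_arc D j) g \<and> L2_on_curve (Gam_arc D j) gt \<and>
     tangential_derivative (region D) (Gam_arc D j) g gt)"

section \<open>The multiplier\<close>

definition admissible_multiplier ::
    "tricomi_data \<Rightarrow> (real \<Rightarrow> real) \<Rightarrow> (real \<Rightarrow> real) \<Rightarrow> real \<Rightarrow> bool" where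
  "admissible_multiplier D b c \<delta> \<longleftrightarrow>
     (let K = coefK D; \<Omega> = region D in
       continuous_on (fst ` closure \<Omega>) b \<and> b C1_differentiable_on (fst ` \<Omega>) \<and>
       continuous_on (snd ` closure \<Omega>) c \<and> c C1_differentiable_on (snd ` \<Omega>) \<and>
       \<delta> > 0 \<and>
       (\<forall>(x, y) \<in> \<Omega>. - K y * deriv b x + deriv (\<lambda>t. K t * c t) y \<ge> \<delta> \<and>
                     deriv b x - deriv c y \<ge> \<delta>) \<and>
       (\<forall>(x, y) \<in> Gam D CharRight. b x + c y * sqrt (- K y) \<le> 0) \<and>
       (\<forall>(x, y) \<in> Gam D Upper. \<forall>n. is_outer_normal \<Omega> (x, y) n \<longrightarrow> (b x, c y) \<bullet> n \<ge> 0))"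

section \<open>Meshes\<close>

definition segment_set :: "pt set \<Rightarrow> bool" where
  "segment_set F \<longleftrightarrow> (\<exists>a b. a \<noteq> b \<and> F = closed_segment a b)"

definition interior_facets :: "pt set set \<Rightarrow> pt set set" where
  "interior_facets \<T> = {F. segment_set F \<and>
     (\<exists>T \<in> \<T>. \<exists>T' \<in> \<T>. T \<noteq> T' \<and> F = frontier T \<inter> frontier T')}"

definition boundary_facets :: "tricomi_data \<Rightarrow> pt set set \<Rightarrow> boundary_part \<Rightarrow> pt set set" where
  "boundary_facets D \<T> j = {F. \<exists>T \<in> \<T>. F = frontier T \<inter> Gam D j \<and>
     curve_integral (Gam_arc D j) F (\<lambda>_. 1) > 0}"

definition dirichlet_facets :: "tricomi_data \<Rightarrow> pt set set \<Rightarrow> pt set set" where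
  "dirichlet_facets D \<T> = boundary_facets D \<T> Upper \<union> boundary_facets D \<T> CharLeft"

definition elem_interior_facets :: "pt set set \<Rightarrow> pt set \<Rightarrow> pt set set" where
  "elem_interior_facets \<T> T = {F. segment_set F \<and>
     (\<exists>T' \<in> \<T>. T \<noteq> T' \<and> F = frontier T \<inter> frontier T')}"

definition elem_boundary_facets :: "tricomi_data \<Rightarrow> pt set \<Rightarrow> pt set set" where
  "elem_boundary_facets D T = (\<Union>j. boundary_facets D {T} j)"

text \<open>The facets of \<open>T\<close> cover its boundary up to finitely many points, so integration
  over the boundary of \<open>T\<close> is summation over its facets.\<close>

definition elem_boundary_integral ::
    "tricomi_data \<Rightarrow> pt set set \<Rightarrow> pt set \<Rightarrow> (pt \<Rightarrow> real) \<Rightarrow> real" where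
  "elem_boundary_integral D \<T> T \<phi> =
     (\<Sum>F \<in> elem_interior_facets \<T> T. segment_integral F \<phi>) +
     (\<Sum>F \<in> elem_boundary_facets D T. boundary_integral D F \<phi>)"

definition star_shaped_wrt_ball :: "pt set \<Rightarrow> pt \<Rightarrow> real \<Rightarrow> bool" where
  "star_shaped_wrt_ball T x r \<longleftrightarrow> ball x r \<subseteq> T \<and> (\<forall>w \<in> ball x r. \<forall>z \<in> T. closed_segment w z \<subseteq> T)"

definition polygonal :: "pt set \<Rightarrow> bool" where
  "polygonal T \<longleftrightarrow> (\<exists>\<S>. finite \<S> \<and> (\<forall>S \<in> \<S>. segment_set S) \<and> frontier T = \<Union>\<S>)"

definition is_mesh :: "tricomi_data \<Rightarrow> pt set set \<Rightarrow> bool" where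
  "is_mesh D \<T> \<longleftrightarrow>
     finite \<T> \<and> (\<forall>T \<in> \<T>. open T \<and> T \<noteq> {} \<and> T \<subseteq> region D) \<and>
     (\<forall>T \<in> \<T>. \<forall>T' \<in> \<T>. T \<noteq> T' \<longrightarrow> T \<inter> T' = {}) \<and>
     region D \<subseteq> (\<Union>T \<in> \<T>. closure T) \<and>
     (\<forall>T \<in> \<T>. \<forall>T' \<in> \<T>. T \<noteq> T' \<longrightarrow>
        frontier T \<inter> frontier T' = {} \<or> (\<exists>z. frontier T \<inter> frontier T' = {z}) \<or>
        segment_set (frontier T \<inter> frontier T')) \<and>
     (\<forall>T \<in> \<T>. (\<exists>z. closure T \<inter> frontier (region D) \<subseteq> {z}) \<longrightarrow> polygonal T) \<and>
     (\<forall>T \<in> \<T>. \<exists>\<S>. finite \<S> \<and> (\<forall>S \<in> \<S>. segment_set S) \<and>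
        frontier T \<subseteq> frontier (region D) \<union> \<Union>\<S>)"

text \<open>The family is indexed by the mesh sizes themselves.\<close>

definition mesh_family ::
    "tricomi_data \<Rightarrow> real set \<Rightarrow> (real \<Rightarrow> pt set set) \<Rightarrow> real \<Rightarrow> real \<Rightarrow> bool" where
  "mesh_family D H \<T> rstar Cg \<longleftrightarrow>
     0 < rstar \<and> rstar \<le> 1 / 2 \<and> Cg > 0 \<and>
     (\<forall>h \<in> H. is_mesh D (\<T> h) \<and> h = (SUP T \<in> \<T> h. diameter T) \<and>
       (\<forall>T \<in> \<T> h.
          (\<exists>x \<in> T. star_shaped_wrt_ball T x (rstar * diameter T)) \<and>
          (\<forall>F \<in> elem_interior_facets (\<T> h) T \<union> elem_boundary_facets D T.
             diameter T \<le> Cg * diameter F)))"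

section \<open>Discrete functions\<close>

definition poly_space :: "nat \<Rightarrow> (pt \<Rightarrow> real) set" where
  "poly_space p = {q. \<exists>a :: nat \<Rightarrow> nat \<Rightarrow> real.
     q = (\<lambda>(x, y). \<Sum>i\<le>p. \<Sum>j\<le>p - i. a i j * x ^ i * y ^ j)}"

text \<open>A broken polynomial assigns to every element a polynomial, which is identified with the
  polynomial function it induces on the whole plane.  Its trace from \<open>T\<close> on the boundary
  of \<open>T\<close> is therefore a plain evaluation.  The value off the mesh is normalised to zero.\<close>

type_synonym broken = "pt set \<Rightarrow> pt \<Rightarrow> real"

definition broken_poly_space :: "nat \<Rightarrow> pt set set \<Rightarrow> broken set" where
  "broken_poly_space p \<T> =
     {v. (\<forall>T \<in> \<T>. v T \<in> poly_space p) \<and> (\<forall>T. T \<notin> \<T> \<longrightarrow> v T = (\<lambda>_. 0))}"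

definition linear_subspace :: "broken set \<Rightarrow> bool" where
  "linear_subspace V \<longleftrightarrow> (\<lambda>T z. 0) \<in> V \<and> (\<forall>u \<in> V. \<forall>v \<in> V. (\<lambda>T z. u T z + v T z) \<in> V) \<and>
     (\<forall>k. \<forall>v \<in> V. (\<lambda>T z. k * v T z) \<in> V)"

definition trace_constant ::
    "tricomi_data \<Rightarrow> real set \<Rightarrow> (real \<Rightarrow> pt set set) \<Rightarrow> real \<Rightarrow> bool" where
  "trace_constant D H \<T> Ctr \<longleftrightarrow> Ctr > 0 \<and>
     (\<forall>h \<in> H. \<forall>T \<in> \<T> h. \<forall>p\<ge>1. \<forall>q \<in> poly_space p.
        sqrt (elem_boundary_integral D (\<T> h) T (\<lambda>z. (q z)\<^sup>2))
          \<le> Ctr * real p * diameter T powr (- (1 / 2)) * sqrt (LINT z : T | lebesgue. (q z)\<^sup>2))"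

definition dx :: "(pt \<Rightarrow> real) \<Rightarrow> pt \<Rightarrow> real" where
  "dx q z = deriv (\<lambda>s. q (s, snd z)) (fst z)"

definition dy :: "(pt \<Rightarrow> real) \<Rightarrow> pt \<Rightarrow> real" where
  "dy q z = deriv (\<lambda>s. q (fst z, s)) (snd z)"

definition grad :: "(pt \<Rightarrow> real) \<Rightarrow> pt \<Rightarrow> pt" where
  "grad q z = (dx q z, dy q z)"

definition Wgrad :: "tricomi_data \<Rightarrow> (pt \<Rightarrow> real) \<Rightarrow> pt \<Rightarrow> pt" where
  "Wgrad D q z = (coefK D (snd z) * dx q z, dy q z)"

definition Mop :: "(real \<Rightarrow> real) \<Rightarrow> (real \<Rightarrow> real) \<Rightarrow> (pt \<Rightarrow> real) \<Rightarrow> pt \<Rightarrow> real" where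
  "Mop b c q z = b (fst z) * dx q z + c (snd z) * dy q z"

text \<open>On an interior facet the elements having \<open>F\<close> as a facet are the two neighbours.\<close>

definition facet_elems :: "pt set set \<Rightarrow> pt set \<Rightarrow> pt set set" where
  "facet_elems \<T> F = {T \<in> \<T>. F \<in> elem_interior_facets \<T> T}"

definition avg :: "pt set set \<Rightarrow> pt set \<Rightarrow> (pt set \<Rightarrow> pt \<Rightarrow> pt) \<Rightarrow> pt \<Rightarrow> pt" where
  "avg \<T> F \<Phi> z = (1 / 2) *\<^sub>R (\<Sum>T \<in> facet_elems \<T> F. \<Phi> T z)"

definition jump :: "pt set set \<Rightarrow> pt set \<Rightarrow> broken \<Rightarrow> pt \<Rightarrow> pt" where
  "jump \<T> F \<phi> z = (\<Sum>T \<in> facet_elems \<T> F. \<phi> T z *\<^sub>R outer_normal T z)"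

definition boundary_elem :: "tricomi_data \<Rightarrow> pt set set \<Rightarrow> pt set \<Rightarrow> pt set" where
  "boundary_elem D \<T> F = (THE T. T \<in> \<T> \<and> F \<in> elem_boundary_facets D T)"

definition boundary_jump :: "tricomi_data \<Rightarrow> pt set set \<Rightarrow> pt set \<Rightarrow> broken \<Rightarrow> pt \<Rightarrow> pt" where
  "boundary_jump D \<T> F \<phi> z = \<phi> (boundary_elem D \<T> F) z *\<^sub>R outer_normal (region D) z"

definition dtan :: "tricomi_data \<Rightarrow> (pt \<Rightarrow> real) \<Rightarrow> pt \<Rightarrow> real" where
  "dtan D q z = grad q z \<bullet> tangent_of (outer_normal (region D) z)"

section \<open>The forms\<close>

definition A_h :: "tricomi_data \<Rightarrow> (real \<Rightarrow> real) \<Rightarrow> (real \<Rightarrow> real) \<Rightarrow> pt set set \<Rightarrow>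
    broken \<Rightarrow> broken \<Rightarrow> real" where
  "A_h D b c \<T> u v =
     - (\<Sum>T \<in> \<T>. LINT z : T | lebesgue. Wgrad D (u T) z \<bullet> grad (Mop b c (v T)) z)
     + (\<Sum>F \<in> interior_facets \<T>. segment_integral F (\<lambda>z.
          avg \<T> F (\<lambda>T. Wgrad D (u T)) z \<bullet> jump \<T> F (\<lambda>T. Mop b c (v T)) z))
     + (\<Sum>F \<in> dirichlet_facets D \<T> \<union> boundary_facets D \<T> CharRight. boundary_integral D F (\<lambda>z.
          (Wgrad D (u (boundary_elem D \<T> F)) z \<bullet> outer_normal (region D) z)
            * Mop b c (v (boundary_elem D \<T> F)) z))"

definition A_J :: "tricomi_data \<Rightarrow> pt set set \<Rightarrow> nat \<Rightarrow> real \<Rightarrow> real \<Rightarrow> real \<Rightarrow>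
    broken \<Rightarrow> broken \<Rightarrow> real" where
  "A_J D \<T> p \<gamma>1 \<gamma>2 \<gamma>3 u v =
     (\<Sum>F \<in> interior_facets \<T>. \<gamma>1 / diameter F ^ 3 *
        segment_integral F (\<lambda>z. jump \<T> F u z \<bullet> jump \<T> F v z))
     + (\<Sum>F \<in> dirichlet_facets D \<T>. \<gamma>1 / diameter F ^ 3 *
        boundary_integral D F (\<lambda>z. boundary_jump D \<T> F u z \<bullet> boundary_jump D \<T> F v z))
     + (\<Sum>F \<in> interior_facets \<T>. \<gamma>2 * (real p)\<^sup>2 / diameter F *
        segment_integral F (\<lambda>z.
          jump \<T> F (\<lambda>T. dx (u T)) z \<bullet> jump \<T> F (\<lambda>T. dx (v T)) z +
          jump \<T> F (\<lambda>T. dy (u T)) z \<bullet> jump \<T> F (\<lambda>T. dy (v T)) z))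
     + (\<Sum>F \<in> dirichlet_facets D \<T>. \<gamma>3 * (real p)\<^sup>2 / diameter F *
        boundary_integral D F (\<lambda>z.
          dtan D (u (boundary_elem D \<T> F)) z * dtan D (v (boundary_elem D \<T> F)) z))"

definition L_h :: "tricomi_data \<Rightarrow> (real \<Rightarrow> real) \<Rightarrow> (real \<Rightarrow> real) \<Rightarrow> pt set set \<Rightarrow> nat \<Rightarrow>
    real \<Rightarrow> real \<Rightarrow> (pt \<Rightarrow> real) \<Rightarrow> (pt \<Rightarrow> real) \<Rightarrow> (pt \<Rightarrow> real) \<Rightarrow> broken \<Rightarrow> real" where
  "L_h D b c \<T> p \<gamma>1 \<gamma>3 f g gt v =
     (\<Sum>T \<in> \<T>. LINT z : T | lebesgue. f z * Mop b c (v T) z)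
     + (\<Sum>F \<in> dirichlet_facets D \<T>. \<gamma>1 / diameter F ^ 3 *
        boundary_integral D F (\<lambda>z. g z * v (boundary_elem D \<T> F) z))
     + (\<Sum>F \<in> dirichlet_facets D \<T>. \<gamma>3 * (real p)\<^sup>2 / diameter F *
        boundary_integral D F (\<lambda>z. gt z * dtan D (v (boundary_elem D \<T> F)) z))"

definition beta_const :: "tricomi_data \<Rightarrow> (real \<Rightarrow> real) \<Rightarrow> (real \<Rightarrow> real) \<Rightarrow> real" where
  "beta_const D b c = (let \<Omega> = region D; K = coefK D in
     Max {Linf_norm \<Omega> (\<lambda>(x, y). K y * b x), Linf_norm \<Omega> (\<lambda>(x, y). b x),
          Linf_norm \<Omega> (\<lambda>(x, y). K y * c y), Linf_norm \<Omega> (\<lambda>(x, y). c y)})"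

end

theory Submission
 imports Defs
begin

text \<open>Since the discrete space has finite dimension, it suffices that the form is positive on
 \<open>v \<noteq> 0\<close>. Integration by parts on each element turns \<open>- W\<nabla>v \<cdot> \<nabla>(Mv)\<close> into half of the quadratic form
 bounded below by the multiplier inequalities, minus half of the boundary integral of
 \<open>(m \<cdot> n) (W\<nabla>v \<cdot> \<nabla>v)\<close>. Together with the consistency terms of the method this boundary integral is,
 on interior facets, a product with the jump of \<open>\<nabla>v\<close> as a factor; on the Dirichlet part nonnegative up to
 a product with \<open>v\<^sub>t\<close> as a factor; and on \<open>CharRight\<close> a nonnegative multiple of a square. The penalties and the
 discrete trace inequality absorb these products into the energy. If the form vanishes at \<open>v\<close>, then \<open>v\<close>
 is constant on each element, has no jumps and vanishes on \<open>CharLeft\<close>.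

 The elements have Lipschitz boundaries only. Sweeping an element by the segments from a centre \<open>w\<close>
 expresses the integral of \<open>2 \<phi> + (z - w) \<cdot> \<nabla>\<phi>\<close> by an integral over the boundary; the difference for two
 centres \<open>w\<close> yields the divergence theorem. The derivatives of \<open>b\<close>, \<open>c\<close> and \<open>K\<close> need not be bounded
 near the boundary of the domain, but the multiplier inequalities force them to be integrable.\<close>

text \<open>Three obstacles shape the proof. Outer normals and velocities are defined by description
  or choice and mean something only almost everywhere, so measurability of every boundary term must
  come from explicit formulas. The derivatives of the coefficients are continuous only inside the
  open domain, so even the existence of the weak integrals has to be extracted from the multiplier
  inequalities. The mesh conditions do not say that a facet runs inside the domain and has exactly
  two neighbours; this follows from the star shape of the elements and from the fact that an arc
  does not separate the plane.

  Constants: with penalty weight \<theta> = \<gamma> p^2 / h_F, absorbing the products costs at most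
  4 \<beta>^2 / \<theta> times the boundary integral of |grad v|^2. The trace inequality turns this
  into 4 \<beta>^2 Ctr^2 / \<gamma> times the element integral. Half of the energy \<delta> / 2 is
  spent on it, which is the condition 16 \<beta>^2 Ctr^2 \<le> \<gamma> \<delta>; the threshold with
  the factor 288 supplies it.\<close>

section \<open>Lipschitz curves\<close>

text \<open>Vitali covering argument. The intervals on which F has slope at most p cover E finely,
  so a disjoint countable subfamily inside an open set barely larger than E covers E up to a null
  set. F maps each of them into an interval at most p times as long, and the Lipschitz bound keeps
  the image of the null set null.\<close>

lemma emeasure_image_small_slopes:
 fixes F :: "real \<Rightarrow> real"
 assumes mono: "strict_mono F"
  and lip: "\<And>x y. \<bar>F y - F x\<bar> \<le> L * \<bar>y - x\<bar>"
  and E: "E \<in> sets lebesgue" and p: "p > 0"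
  and slope: "\<And>x d. x \<in> E \<Longrightarrow> d > 0 \<Longrightarrow> \<exists>y. y \<noteq> x \<and> \<bar>y - x\<bar> < d \<and> (F y - F x) / (y - x) < p"
 shows "emeasure lebesgue (F ` E) \<le> ennreal p * emeasure lebesgue E"
proof (rule ennreal_le_epsilon)
 fix e :: real assume "e > 0"
 then have ep: "e / p > 0" using p by simp
 obtain U where U: "open U" "E \<subseteq> U" "(U - E) \<in> lmeasurable" "emeasure lebesgue (U - E) < ennreal (e / p)"
  by (rule sets_lebesgue_outer_open[OF E ep])
 define K where "K = {(c::real, r). r > 0 \<and> cball c r \<subseteq> U \<and> F (c + r) - F (c - r) \<le> p * (2 * r)}"
 have cov: "\<exists>i. i \<in> K \<and> x \<in> cball (fst i) (snd i) \<and> snd i < d" if xE: "x \<in> E" and d0: "0 < d" for x d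
 proof -
  obtain e where e: "e > 0" "ball x e \<subseteq> U" using U(1,2) xE by (meson openE subsetD)
  obtain y where y: "y \<noteq> x" "\<bar>y - x\<bar> < min d e" "(F y - F x) / (y - x) < p"
   using slope[OF xE, of "min d e"] d0 e by auto
  \<comment> \<open>The interval between x and y is written as a closed ball about its midpoint, as
    the covering theorem wants it. The difference quotient is symmetric in x and y, so y may lie on
    either side.\<close>
  define c where "c = (x + y) / 2" define r where "r = \<bar>y - x\<bar> / 2"
  have r: "r > 0" "r < d" using y unfolding r_def by auto
  have "cball c r \<subseteq> ball x e"
  proof
   fix z assume "z \<in> cball c r"
   then have "\<bar>c - z\<bar> \<le> r" by (simp add: dist_real_def)
   moreover have "2 * c = x + y" "2 * r = \<bar>y - x\<bar>" "\<bar>y - x\<bar> < e" using y unfolding c_def r_def by auto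
   ultimately have "\<bar>x - z\<bar> < e" by arith
   then show "z \<in> ball x e" by (simp add: dist_real_def)
  qed
  moreover have "F (c + r) - F (c - r) \<le> p * (2 * r)"
  proof (cases "y > x")
   case True
   then have e: "c + r = y" "c - r = x" "2 * r = y - x" unfolding c_def r_def by (auto simp: field_simps)
   have "F y - F x < p * (y - x)" using y(3) True by (simp add: pos_divide_less_eq)
   then show ?thesis unfolding e by simp
  next
   case False
   then have e: "c + r = x" "c - r = y" "2 * r = x - y" unfolding c_def r_def by (auto simp: field_simps)
   have "F y - F x > p * (y - x)" using y(1,3) False by (simp add: neg_divide_less_eq)
   then show ?thesis unfolding e by (simp add: algebra_simps)
  qed
  ultimately have "(c, r) \<in> K" using r e unfolding K_def by auto
  moreover have "x \<in> cball c r" unfolding c_def r_def by (simp add: dist_real_def field_simps)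
  ultimately show ?thesis using r by (intro exI[of _ "(c, r)"]) auto
 qed
 have rK: "0 < snd i" if "i \<in> K" for i using that unfolding K_def by auto
 obtain C where C: "countable C" "C \<subseteq> K"
   "pairwise (\<lambda>i j. disjnt (cball (fst i) (snd i)) (cball (fst j) (snd j))) C"
   "negligible (E - (\<Union>i\<in>C. cball (fst i) (snd i)))"
  by (rule Vitali_covering_theorem_cballs[of K snd E fst, OF rK cov])
 define N where "N = E - (\<Union>i\<in>C. cball (fst i) (snd i))"
 define J where "J = (\<lambda>i::real\<times>real. {F (fst i - snd i)..F (fst i + snd i)})"
 have "negligible (F ` N)"
  by (rule negligible_locally_Lipschitz_image) (use C(4) lip in \<open>auto simp: N_def intro!: exI[of _ UNIV] exI[of _ L]\<close>)
 then have FN: "F ` N \<in> null_sets lebesgue" by (simp add: negligible_iff_null_sets)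
 have cb: "cball c r = {c - r..c + r}" for c r :: real by (rule cball_eq_atLeastAtMost)
 have sub: "F ` E \<subseteq> F ` N \<union> (\<Union>i\<in>C. J i)" unfolding N_def J_def cb using strict_mono_less_eq[OF mono] by auto
 have disjJ: "disjoint_family_on J C"
 proof (unfold disjoint_family_on_def, intro ballI impI)
  fix i j assume ij: "i \<in> C" "j \<in> C" "i \<noteq> j"
  have pos: "snd i > 0" "snd j > 0" using ij C(2) unfolding K_def by auto
  have "disjnt {fst i - snd i..fst i + snd i} {fst j - snd j..fst j + snd j}"
   using C(3) ij unfolding pairwise_def cb by auto
  then have "fst i + snd i < fst j - snd j \<or> fst j + snd j < fst i - snd i"
   using pos unfolding disjnt_def by (auto simp: Int_atLeastAtMost)
  then have "F (fst i + snd i) < F (fst j - snd j) \<or> F (fst j + snd j) < F (fst i - snd i)"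
   using strict_mono_less[OF mono] by auto
  then show "J i \<inter> J j = {}" unfolding J_def by auto
 qed
 have disjC: "disjoint_family_on (\<lambda>i. cball (fst i) (snd i)) C"
  using C(3) unfolding disjoint_family_on_def pairwise_def disjnt_def by auto
 have "emeasure lebesgue (F ` E) \<le> emeasure lebesgue (F ` N \<union> (\<Union>i\<in>C. J i))"
  using C(1) FN by (intro emeasure_mono[OF sub]) (auto simp: J_def intro!: sets.countable_UN')
 also have "\<dots> = emeasure lebesgue (\<Union>i\<in>C. J i)"
  using C(1) FN by (subst Un_commute, subst emeasure_Un_null_set) (auto simp: J_def intro!: sets.countable_UN')
 also have "\<dots> = (\<integral>\<^sup>+ i. emeasure lebesgue (J i) \<partial>count_space C)"
  using C(1) disjJ by (intro emeasure_UN_countable) (auto simp: J_def)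
 also have "\<dots> \<le> (\<integral>\<^sup>+ i. ennreal p * emeasure lebesgue (cball (fst i) (snd i)) \<partial>count_space C)"
 proof (rule nn_integral_mono)
  fix i assume "i \<in> space (count_space C)"
  then have i: "snd i > 0" "F (fst i + snd i) - F (fst i - snd i) \<le> p * (2 * snd i)"
   using C(2) unfolding K_def by auto
  have "F (fst i - snd i) \<le> F (fst i + snd i)" using i strict_mono_less_eq[OF mono] by auto
  then have "emeasure lebesgue (J i) = ennreal (F (fst i + snd i) - F (fst i - snd i))" unfolding J_def by simp
  also have "\<dots> \<le> ennreal (p * (2 * snd i))" using i by (simp add: ennreal_leI)
  also have "\<dots> = ennreal p * emeasure lebesgue (cball (fst i) (snd i))" using i p by (simp add: cb ennreal_mult)
  finally show "emeasure lebesgue (J i) \<le> ennreal p * emeasure lebesgue (cball (fst i) (snd i))" .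
 qed
 also have "\<dots> = ennreal p * (\<integral>\<^sup>+ i. emeasure lebesgue (cball (fst i) (snd i)) \<partial>count_space C)"
  by (rule nn_integral_cmult) auto
 also have "(\<integral>\<^sup>+ i. emeasure lebesgue (cball (fst i) (snd i)) \<partial>count_space C) =
   emeasure lebesgue (\<Union>i\<in>C. cball (fst i) (snd i))" using C(1) disjC by (intro emeasure_UN_countable[symmetric]) auto
 also have "ennreal p * \<dots> \<le> ennreal p * emeasure lebesgue U"
  using C(2) U(1) unfolding K_def by (intro mult_left_mono emeasure_mono) (auto simp: subset_iff)
 also have "emeasure lebesgue U \<le> emeasure lebesgue E + emeasure lebesgue (U - E)"
  using U E emeasure_subadditive[of E lebesgue "U - E"] by (simp add: Un_absorb1 fmeasurable_def)
 also have "ennreal p * (emeasure lebesgue E + emeasure lebesgue (U - E)) \<le>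
   ennreal p * (emeasure lebesgue E + ennreal (e / p))" using U(4) by (intro mult_left_mono add_left_mono) auto
 also have "\<dots> = ennreal p * emeasure lebesgue E + ennreal e"
  using p \<open>e > 0\<close> by (simp add: distrib_left ennreal_mult[symmetric])
 finally show "emeasure lebesgue (F ` E) \<le> ennreal p * emeasure lebesgue E + ennreal e" by (simp add: mult_left_mono)
qed

text \<open>Gaps are tested for rational p and q only, so that the points with a gap will form a
  countable union. The limit is the supremum of the eventual lower bounds.\<close>

lemma converges_if_no_gap:
 fixes S :: "real \<Rightarrow> real"
 assumes bd: "\<forall>\<^sub>F h in at 0. A \<le> S h \<and> S h \<le> B"
  and gap: "\<And>p q. p \<in> \<rat> \<Longrightarrow> q \<in> \<rat> \<Longrightarrow> p < q \<Longrightarrow>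
    \<not> ((\<exists>\<^sub>F h in at 0. S h < p) \<and> (\<exists>\<^sub>F h in at 0. S h > q))"
 shows "\<exists>l. (S \<longlongrightarrow> l) (at 0)"
proof -
 define P where "P = {p. \<forall>\<^sub>F h in at 0. p \<le> S h}"
 have A: "A \<in> P" unfolding P_def using bd by (auto elim: eventually_mono)
 have B: "p \<le> B" if "p \<in> P" for p
 proof -
  have "\<forall>\<^sub>F h in at (0::real). p \<le> S h" using that unfolding P_def by simp
  then have "\<forall>\<^sub>F h in at (0::real). p \<le> B" using bd by eventually_elim linarith
  then show ?thesis by simp
 qed
 have bda: "bdd_above P" using B by (auto simp: bdd_above_def)
 have "(S \<longlongrightarrow> Sup P) (at 0)"
 proof (rule order_tendstoI)
  fix a assume "a < Sup P"
  then obtain p where "p \<in> P" "a < p" using less_cSup_iff[of P a] A bda by auto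
  then show "\<forall>\<^sub>F h in at 0. a < S h" unfolding P_def by (auto elim: eventually_mono)
 next
  fix a assume a: "Sup P < a"
  obtain p where p: "p \<in> \<rat>" "Sup P < p" "p < a" using Rats_dense_in_real[OF a] by auto
  obtain q where q: "q \<in> \<rat>" "p < q" "q < a" using Rats_dense_in_real[OF p(3)] by auto
  have "p \<notin> P" using cSup_upper[of p P] bda p by auto
  then have "\<exists>\<^sub>F h in at 0. S h < p" unfolding P_def by (simp add: not_eventually not_le)
  then have "\<forall>\<^sub>F h in at 0. S h \<le> q" using gap[OF p(1) q(1) q(2)] by (simp add: not_frequently not_less)
  then show "\<forall>\<^sub>F h in at 0. S h < a" using q by (auto elim: eventually_mono)
 qed
 then show ?thesis ..
qed

lemma frequently_at_0_iff:
 fixes P :: "real \<Rightarrow> bool"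
 shows "(\<exists>\<^sub>F h in at 0. P h) \<longleftrightarrow> (\<forall>d>0. \<exists>h. h \<noteq> 0 \<and> \<bar>h\<bar> < d \<and> P h)"
 unfolding frequently_def eventually_at by (auto simp: dist_real_def)

text \<open>\<open>frequently\<close> at 0 unfolds to a countable intersection, over the size of h,
  of uncountable unions over h. The unions are harmless because each of their members is
  open.\<close>

lemma borel_slope_set:
 fixes F :: "real \<Rightarrow> real"
 assumes "continuous_on UNIV F" and "open {t. P t}"
 shows "{x. \<exists>\<^sub>F h in at 0. P ((F (x + h) - F x) / h)} \<in> sets borel"
proof -
 have eq: "{x. \<exists>\<^sub>F h in at 0. P ((F (x + h) - F x) / h)} =
   (\<Inter>n. \<Union>h\<in>{h. h \<noteq> 0 \<and> \<bar>h\<bar> < inverse (real (Suc n))}. (\<lambda>x. (F (x + h) - F x) / h) -` {t. P t})"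
 proof (intro set_eqI iffI)
  fix x assume "x \<in> {x. \<exists>\<^sub>F h in at 0. P ((F (x + h) - F x) / h)}"
  then show "x \<in> (\<Inter>n. \<Union>h\<in>{h. h \<noteq> 0 \<and> \<bar>h\<bar> < inverse (real (Suc n))}. (\<lambda>x. (F (x + h) - F x) / h) -` {t. P t})"
   unfolding frequently_at_0_iff by auto
 next
  fix x assume x: "x \<in> (\<Inter>n. \<Union>h\<in>{h. h \<noteq> 0 \<and> \<bar>h\<bar> < inverse (real (Suc n))}. (\<lambda>x. (F (x + h) - F x) / h) -` {t. P t})"
  show "x \<in> {x. \<exists>\<^sub>F h in at 0. P ((F (x + h) - F x) / h)}" unfolding frequently_at_0_iff mem_Collect_eq
  proof (intro allI impI)
   fix d :: real assume "d > 0"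
   then obtain n where n: "inverse (real (Suc n)) < d" using reals_Archimedean by blast
   have "x \<in> (\<Union>h\<in>{h. h \<noteq> 0 \<and> \<bar>h\<bar> < inverse (real (Suc n))}. (\<lambda>x. (F (x + h) - F x) / h) -` {t. P t})" using x by blast
   then show "\<exists>h. h \<noteq> 0 \<and> \<bar>h\<bar> < d \<and> P ((F (x + h) - F x) / h)" using n by fastforce
  qed
 qed
 have cont: "open ((\<lambda>x. (F (x + h) - F x) / h) -` {t. P t})" if "h \<noteq> 0" for h by (rule open_vimage[OF assms(2)])
    (use that in \<open>auto intro!: continuous_intros continuous_on_compose2[OF assms(1)]\<close>)
 have "open (\<Union>h\<in>{h. h \<noteq> 0 \<and> \<bar>h\<bar> < inverse (real (Suc n))}. (\<lambda>x. (F (x + h) - F x) / h) -` {t. P t})" for n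
  by (rule open_UN) (use cont in simp)
 then show ?thesis unfolding eq by (intro sets.countable_INT) (auto intro: borel_open)
qed

text \<open>Lebesgue's argument. If at each point of E arbitrarily small increments have slope below
  p and others have slope above q > p, then |F(E)| \<le> p |E|; the inverse function, with
  reciprocal slopes, gives |E| \<le> |F(E)| / q. Hence |E| \<le> (p / q) |E|, and E is null.\<close>

lemma lipschitz_AE_differentiable_real:
 fixes f :: "real \<Rightarrow> real"
 assumes lip: "\<And>x y. \<bar>f y - f x\<bar> \<le> L * \<bar>y - x\<bar>"
 shows "negligible {x. \<not> f differentiable (at x)}"
proof -
 have L: "L \<ge> 0" using lip[of 1 0] by simp
 \<comment> \<open>The added linear term moves all slopes between 1 and 2 L + 1. So F is an
   increasing homeomorphism of the line with 1-Lipschitz inverse, and differentiable where f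
   is.\<close>
 define F where "F x = f x + (L + 1) * x" for x
 have Flow: "F y - F x \<ge> y - x" if "x \<le> y" for x y
  using lip[of y x] that unfolding F_def by (simp add: algebra_simps abs_le_iff)
 have Fup: "F y - F x \<le> (2 * L + 1) * (y - x)" if "x \<le> y" for x y
  using lip[of y x] that unfolding F_def by (simp add: algebra_simps abs_le_iff)
 have Fmono: "strict_mono F" by (rule strict_monoI) (meson Flow diff_gt_0_iff_gt less_le_trans less_imp_le)
 have Flip: "\<bar>F y - F x\<bar> \<le> (2 * L + 1) * \<bar>y - x\<bar>" for x y
  using Flow[of x y] Flow[of y x] Fup[of x y] Fup[of y x] by (cases "x \<le> y") (auto simp: abs_if)
 have Fcont: "continuous_on UNIV F" by (rule lipschitz_on_continuous_on[of "2 * L + 1"])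
    (rule lipschitz_onI, use Flip L in \<open>auto simp: dist_real_def\<close>)
 have Fsurj: "\<exists>x. F x = y" for y
 proof -
  have "F (- \<bar>y - F 0\<bar>) \<le> y" "y \<le> F \<bar>y - F 0\<bar>" using Flow[of "- \<bar>y - F 0\<bar>" 0] Flow[of 0 "\<bar>y - F 0\<bar>"] by auto
  then show ?thesis using IVT'[of F "- \<bar>y - F 0\<bar>" y "\<bar>y - F 0\<bar>"] continuous_on_subset[OF Fcont] by auto
 qed
 define G where "G = inv F"
 have FG: "F (G y) = y" for y unfolding G_def using Fsurj by (metis f_inv_into_f rangeI)
 have GF: "G (F x) = x" for x unfolding G_def using Fmono by (simp add: strict_mono_imp_inj_on)
 have Gmono: "strict_mono G" by (rule strict_monoI) (metis FG Fmono strict_mono_less)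
 have Glip: "\<bar>G y - G x\<bar> \<le> 1 * \<bar>y - x\<bar>" for x y
  using Flow[of "G x" "G y"] Flow[of "G y" "G x"] by (cases "G x \<le> G y") (auto simp: FG abs_if)
 have Gcont: "continuous_on UNIV G" by (rule lipschitz_on_continuous_on[of 1])
    (rule lipschitz_onI, use Glip in \<open>auto simp: dist_real_def\<close>)
 define S where "S x h = (F (x + h) - F x) / h" for x h
 have Sbd: "1 \<le> S x h \<and> S x h \<le> 2 * L + 1" if "h \<noteq> 0" for x h
  using Flow[of x "x + h"] Flow[of "x + h" x] Fup[of x "x + h"] Fup[of "x + h" x] that
  unfolding S_def by (cases "h > 0") (auto simp: field_simps)
 \<comment> \<open>The window from -n to n makes the measure of the set finite, so that it can be
   cancelled at the end.\<close>
 define E where "E p q n = {x. \<exists>\<^sub>F h in at 0. S x h < p} \<inter> {x. \<exists>\<^sub>F h in at 0. S x h > q} \<inter> {- real n<..<real n}" for p q n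
 have Eneg: "negligible (E p q n)" if pq: "p < q" for p q n
 proof (cases "p > 1")
  case False
  have "E p q n = {}"
  proof -
   have "\<not> (\<exists>\<^sub>F h in at 0. S x h < p)" for x
    unfolding frequently_at_0_iff using Sbd[of _ x] False by (meson less_le_trans not_less zero_less_one)
   then show ?thesis unfolding E_def by auto
  qed
  then show ?thesis by simp
 next
  case True
  have EB: "E p q n \<in> sets borel" unfolding E_def S_def
   by (intro sets.Int borel_slope_set[OF Fcont]) (auto simp: open_Collect_less continuous_on_id continuous_on_const)
  have El: "E p q n \<in> sets lebesgue" using EB by (rule sets_completionI_sets[of _ lborel, simplified])
  have vim: "F ` E p q n = G -` E p q n \<inter> space borel" using FG GF by (auto simp: image_iff) metis
  have "F ` E p q n \<in> sets borel" unfolding vim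
   by (rule measurable_sets[OF borel_measurable_continuous_onI[OF Gcont] EB])
  then have FEl: "F ` E p q n \<in> sets lebesgue" by (rule sets_completionI_sets[of _ lborel, simplified])
  have 1: "emeasure lebesgue (F ` E p q n) \<le> ennreal p * emeasure lebesgue (E p q n)"
  proof (rule emeasure_image_small_slopes[OF Fmono Flip El])
   show "p > 0" using True by simp
   fix x d :: real assume "x \<in> E p q n" "d > 0"
   then have "\<exists>h. h \<noteq> 0 \<and> \<bar>h\<bar> < d \<and> S x h < p" unfolding E_def frequently_at_0_iff by blast
   then obtain h where "h \<noteq> 0" "\<bar>h\<bar> < d" "S x h < p" by blast
   then show "\<exists>y. y \<noteq> x \<and> \<bar>y - x\<bar> < d \<and> (F y - F x) / (y - x) < p" unfolding S_def by (intro exI[of _ "x + h"]) auto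
  qed
  have 2: "emeasure lebesgue (G ` F ` E p q n) \<le> ennreal (1 / q) * emeasure lebesgue (F ` E p q n)"
  proof (rule emeasure_image_small_slopes[OF Gmono Glip FEl])
   show "1 / q > 0" using True pq by simp
   fix y d :: real assume y: "y \<in> F ` E p q n" and d: "d > 0"
   then obtain x where x: "y = F x" "x \<in> E p q n" by auto
   have "d / (2 * L + 1) > 0" using d L by simp
   then have "\<exists>h. h \<noteq> 0 \<and> \<bar>h\<bar> < d / (2 * L + 1) \<and> S x h > q" using x unfolding E_def frequently_at_0_iff by blast
   then obtain h where h: "h \<noteq> 0" "\<bar>h\<bar> < d / (2 * L + 1)" "S x h > q" by blast
   have ne: "F (x + h) \<noteq> F x" using h(1) Fmono by (simp add: strict_mono_eq)
   have lt: "\<bar>F (x + h) - F x\<bar> < d" using Flip[of "x + h" x] h(2) L by (simp add: field_simps)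
   have "h / (F (x + h) - F x) = 1 / S x h" unfolding S_def by simp
   also have "\<dots> < 1 / q" using h(3) True pq by (simp add: frac_less2)
   finally show "\<exists>z. z \<noteq> y \<and> \<bar>z - y\<bar> < d \<and> (G z - G y) / (z - y) < 1 / q"
    using ne lt unfolding x(1) by (intro exI[of _ "F (x + h)"]) (simp add: GF)
  qed
  have "G ` F ` E p q n = E p q n" by (auto simp: GF image_iff)
  then have 3: "emeasure lebesgue (E p q n) \<le> ennreal (1 / q) * emeasure lebesgue (F ` E p q n)" using 2 by simp
  have "emeasure lebesgue (E p q n) \<le> emeasure lebesgue {- real n<..<real n}"
   by (rule emeasure_mono) (auto simp: E_def)
  then have fin: "emeasure lebesgue (E p q n) < \<infinity>" by (simp add: le_less_trans)
  then have m: "E p q n \<in> lmeasurable" using El by (simp add: fmeasurable_def)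
  define m where "m = measure lebesgue (E p q n)"
  have em: "emeasure lebesgue (E p q n) = ennreal m" unfolding m_def
   using fin by (simp add: emeasure_eq_ennreal_measure less_top)
  have "ennreal m \<le> ennreal (1 / q) * (ennreal p * ennreal m)"
   using 3 1 em by (metis (no_types, lifting) mult_left_mono order_trans zero_le)
  also have "\<dots> = ennreal (p / q * m)" using True pq by (simp add: m_def ennreal_mult[symmetric])
  finally have "m \<le> p / q * m" using True pq by (simp add: m_def)
  then have "(q - p) * m \<le> 0" using True pq by (simp add: field_simps)
  then have "m = 0" using pq by (simp add: mult_le_0_iff m_def measure_nonneg order_antisym)
  then show ?thesis using m unfolding m_def by (simp add: negligible_iff_measure)
 qed
 define I where "I = {(p :: real, q :: real, n :: nat). p \<in> \<rat> \<and> q \<in> \<rat> \<and> p < q}"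
 have "countable ((\<rat> :: real set) \<times> (\<rat> :: real set) \<times> (UNIV :: nat set))"
  by (intro countable_SIGMA countable_rat) auto
 then have "countable I" by (rule countable_subset[rotated]) (auto simp: I_def)
 then have "negligible (\<Union>((\<lambda>(p, q, n). E p q n) ` I))"
  by (intro negligible_countable_Union) (use Eneg in \<open>auto simp: I_def\<close>)
 moreover have "{x. \<not> f differentiable (at x)} \<subseteq> \<Union>((\<lambda>(p, q, n). E p q n) ` I)"
 proof
  fix x assume "x \<in> {x. \<not> f differentiable (at x)}"
  then have nd: "\<not> f differentiable (at x)" by simp
  have "\<not> (\<exists>l. (S x \<longlongrightarrow> l) (at 0))"
  proof
   assume "\<exists>l. (S x \<longlongrightarrow> l) (at 0)"
   then obtain l where "DERIV F x :> l" unfolding DERIV_def S_def by blast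
   then have "DERIV (\<lambda>x. F x - (L + 1) * x) x :> l - (L + 1)" by (auto intro!: derivative_eq_intros)
   then have "DERIV f x :> l - (L + 1)" unfolding F_def by simp
   then show False using nd by (meson real_differentiable_def)
  qed
  then obtain p q where pq: "p \<in> \<rat>" "q \<in> \<rat>" "p < q" "\<exists>\<^sub>F h in at 0. S x h < p" "\<exists>\<^sub>F h in at 0. S x h > q"
   using converges_if_no_gap[of 1 "S x" "2 * L + 1"] Sbd[of _ x]
   by (metis (mono_tags, lifting) eventually_at_topological UNIV_I open_UNIV)
  obtain n where "\<bar>x\<bar> < real n" using reals_Archimedean2 by blast
  then have "x \<in> E p q n" using pq unfolding E_def by auto
  then show "x \<in> \<Union>((\<lambda>(p, q, n). E p q n) ` I)" using pq by (auto simp: I_def)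
 qed
 ultimately show ?thesis by (rule negligible_subset)
qed


text \<open>At points without a derivative \<open>vector_derivative\<close> is an arbitrary choice,
  which says nothing about measurability. G is a Borel version of the velocity, bounded everywhere,
  and D a Borel set of full measure on which it is the true one.\<close>

lemma lipschitz_curve_derivative:
 fixes g :: "real \<Rightarrow> pt"
 assumes g: "L-lipschitz_on {0..1} g"
 obtains G D where "D \<in> sets borel" "D \<subseteq> {0<..<1}" "negligible ({0..1} - D)"
  "G \<in> borel_measurable borel" "\<And>s. norm (G s) \<le> L"
  "\<And>s. s \<in> D \<Longrightarrow> (g has_vector_derivative G s) (at s)"
proof -
 \<comment> \<open>Clamping the parameter extends the curve to a Lipschitz curve on the whole line,
   where the difference quotients are defined everywhere and continuous.\<close>
 define cl where "cl s = max 0 (min 1 s)" for s :: real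
 have cl: "cl s \<in> {0..1}" "\<bar>cl s - cl t\<bar> \<le> \<bar>s - t\<bar>" for s t unfolding cl_def by auto
 have cl_id: "cl s = s" if "s \<in> {0..1}" for s using that unfolding cl_def by auto
 define gc where "gc = g \<circ> cl"
 have L: "L \<ge> 0" using lipschitz_on_nonneg[OF g] .
 have gc: "dist (gc s) (gc t) \<le> L * \<bar>s - t\<bar>" for s t
 proof -
  have "dist (gc s) (gc t) \<le> L * dist (cl s) (cl t)" unfolding gc_def o_def by (rule lipschitz_onD[OF g cl(1) cl(1)])
  also have "\<dots> \<le> L * \<bar>s - t\<bar>" using cl(2)[of s t] L by (intro mult_left_mono) (auto simp: dist_real_def)
  finally show ?thesis .
 qed
 have gcc: "continuous_on UNIV gc"
  by (rule lipschitz_on_continuous_on[of L]) (rule lipschitz_onI, use gc L in \<open>auto simp: dist_real_def\<close>)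
 have d1: "negligible {x. \<not> (fst \<circ> gc) differentiable (at x)}"
 proof (rule lipschitz_AE_differentiable_real[of _ L])
  fix x y
  have "\<bar>(fst \<circ> gc) y - (fst \<circ> gc) x\<bar> \<le> dist (gc y) (gc x)"
   using dist_fst_le[of "gc y" "gc x"] by (simp add: dist_real_def)
  then show "\<bar>(fst \<circ> gc) y - (fst \<circ> gc) x\<bar> \<le> L * \<bar>y - x\<bar>" using gc[of y x] by simp
 qed
 have d2: "negligible {x. \<not> (snd \<circ> gc) differentiable (at x)}"
 proof (rule lipschitz_AE_differentiable_real[of _ L])
  fix x y
  have "\<bar>(snd \<circ> gc) y - (snd \<circ> gc) x\<bar> \<le> dist (gc y) (gc x)"
   using dist_snd_le[of "gc y" "gc x"] by (simp add: dist_real_def)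
  then show "\<bar>(snd \<circ> gc) y - (snd \<circ> gc) x\<bar> \<le> L * \<bar>y - x\<bar>" using gc[of y x] by simp
 qed
 define B where "B = {x. \<not> (fst \<circ> gc) differentiable (at x)} \<union> {x. \<not> (snd \<circ> gc) differentiable (at x)}"
 have B: "B \<in> null_sets lebesgue" using negligible_Un[OF d1 d2] unfolding B_def negligible_iff_null_sets .
 then obtain N where N: "N \<in> null_sets lborel" "B \<subseteq> N" by (auto simp: null_sets_completion_iff2)
 \<comment> \<open>The set of bad parameters is only known to be Lebesgue null; removing a Borel
   null superset N instead makes D Borel.\<close>
 define D where "D = {0<..<1} - N"
 have DB: "D \<in> sets borel" using N unfolding D_def by auto
 have "{0..1} - D \<subseteq> {0, 1} \<union> N" unfolding D_def by auto
 moreover have "negligible ({0, 1} \<union> N)" using N by (simp add: negligible_iff_null_sets null_sets_completionI)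
 ultimately have Dn: "negligible ({0..1} - D)" by (rule negligible_subset[rotated])
 define Q where "Q n s = real (Suc n) *\<^sub>R (gc (s + 1 / real (Suc n)) - gc s)" for n s
 define G where "G s = (if s \<in> D then lim (\<lambda>n. Q n s) else 0)" for s
 have der: "\<exists>v. (gc has_vector_derivative v) (at s)" if "s \<in> D" for s
 proof -
  have "(fst \<circ> gc) differentiable (at s)" "(snd \<circ> gc) differentiable (at s)"
   using that N unfolding D_def B_def by auto
  then obtain a b where "((fst \<circ> gc) has_vector_derivative a) (at s)" "((snd \<circ> gc) has_vector_derivative b) (at s)"
   unfolding vector_derivative_works by blast
  then have "((\<lambda>s. ((fst \<circ> gc) s, (snd \<circ> gc) s)) has_vector_derivative (a, b)) (at s)"
   by (rule has_vector_derivative_Pair)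
  then show ?thesis by (auto simp: o_def)
 qed
 have lim: "(\<lambda>n. Q n s) \<longlonglongrightarrow> v" if v: "(gc has_vector_derivative v) (at s)" for s v
 proof -
  have "((\<lambda>h. (gc (s + h) - gc s) /\<^sub>R h) \<longlongrightarrow> v) (at 0)"
  proof -
   have "((\<lambda>h. norm (gc (s + h) - gc s - h *\<^sub>R v) / norm h) \<longlongrightarrow> 0) (at 0)"
    using v unfolding has_vector_derivative_def has_derivative_at by blast
   moreover have "\<forall>\<^sub>F h in at 0. norm (gc (s + h) - gc s - h *\<^sub>R v) / norm h = norm ((gc (s + h) - gc s) /\<^sub>R h - v)"
   proof (rule eventually_at_topological[THEN iffD2], intro exI[of _ UNIV] conjI ballI impI)
    fix h :: real assume "h \<noteq> 0"
    then have "(gc (s + h) - gc s) /\<^sub>R h - v = (gc (s + h) - gc s - h *\<^sub>R v) /\<^sub>R h" by (simp add: scaleR_diff_right)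
    then show "norm (gc (s + h) - gc s - h *\<^sub>R v) / norm h = norm ((gc (s + h) - gc s) /\<^sub>R h - v)"
     by (simp add: divide_inverse mult.commute)
   qed auto
   ultimately have "((\<lambda>h. norm ((gc (s + h) - gc s) /\<^sub>R h - v)) \<longlongrightarrow> 0) (at 0)" by (simp cong: tendsto_cong)
   then show ?thesis by (simp add: LIM_zero_iff tendsto_norm_zero_iff)
  qed
  moreover have "filterlim (\<lambda>n. 1 / real (Suc n)) (at 0) sequentially"
   unfolding filterlim_at using LIMSEQ_inverse_real_of_nat by (simp add: inverse_eq_divide)
  ultimately have "(\<lambda>n. (gc (s + 1 / real (Suc n)) - gc s) /\<^sub>R (1 / real (Suc n))) \<longlonglongrightarrow> v" by (rule filterlim_compose)
  then show ?thesis unfolding Q_def by simp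
 qed
 have GB: "G \<in> borel_measurable borel"
 proof -
  have "Q n \<in> borel_measurable borel" for n
   unfolding Q_def by (intro borel_measurable_continuous_onI continuous_intros continuous_on_compose2[OF gcc]) auto
  then have "(\<lambda>s. lim (\<lambda>n. Q n s)) \<in> borel_measurable borel" by (intro borel_measurable_lim_metric)
  then show ?thesis unfolding G_def using DB by (intro measurable_If_set) auto
 qed
 have GD: "(gc has_vector_derivative G s) (at s)" if sD: "s \<in> D" for s
 proof -
  obtain v where v: "(gc has_vector_derivative v) (at s)" using der[OF sD] ..
  then have "G s = v" unfolding G_def using limI[OF lim[OF v]] sD by simp
  then show ?thesis using v by simp
 qed
 have Gn: "norm (G s) \<le> L" for s
 proof (cases "s \<in> D")
  case True
  have "norm (Q n s) \<le> L" for n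
  proof -
   have "norm (gc (s + 1 / real (Suc n)) - gc s) \<le> L * (1 / real (Suc n))"
    using gc[of "s + 1 / real (Suc n)" s] by (simp add: dist_norm del: of_nat_Suc)
   then have "real (Suc n) * norm (gc (s + 1 / real (Suc n)) - gc s) \<le> real (Suc n) * (L * (1 / real (Suc n)))"
    by (intro mult_left_mono) auto
   then show ?thesis unfolding Q_def norm_scaleR abs_of_nat by simp
  qed
  then show ?thesis using lim[OF GD[OF True]] by (intro Lim_norm_ubound[of sequentially "\<lambda>n. Q n s"]) auto
 qed (simp add: G_def L)
 have "(g has_vector_derivative G s) (at s)" if "s \<in> D" for s
 proof (rule has_vector_derivative_transform_within_open[OF GD[OF that], of "{0<..<1}"])
  show "s \<in> {0<..<1}" using that D_def by auto
  show "\<And>t. t \<in> {0<..<1} \<Longrightarrow> gc t = g t" unfolding gc_def by (simp add: cl_id)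
 qed simp
 then show ?thesis using DB Dn GB Gn by (intro that[of D G]) (auto simp: D_def)
qed

section \<open>Change of variables in the plane\<close>

definition cross2 :: "pt \<Rightarrow> pt \<Rightarrow> real" where
 "cross2 a b = fst a * snd b - snd a * fst b"

text \<open>The change of variables theorem speaks of \<open>real^2\<close>; these mutually inverse
  linear isometries transport it to pairs.\<close>

definition vec_of_pt :: "pt \<Rightarrow> real^2" where "vec_of_pt z = vector [fst z, snd z]"
definition pt_of_vec :: "real^2 \<Rightarrow> pt" where "pt_of_vec v = (v $ 1, v $ 2)"

lemma pt_vec_inverse [simp]: "pt_of_vec (vec_of_pt z) = z" "vec_of_pt (pt_of_vec v) = v"
 unfolding vec_of_pt_def pt_of_vec_def by (auto simp: vec_eq_iff forall_2)

lemma bounded_linear_pt_vec: "bounded_linear vec_of_pt" "bounded_linear pt_of_vec"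
 unfolding linear_conv_bounded_linear[symmetric]
 by (auto intro!: linearI simp: vec_of_pt_def pt_of_vec_def vec_eq_iff forall_2)

lemma Basis_vec2: "(Basis :: (real^2) set) = {axis 1 1, axis 2 1}"
 by (auto simp: Basis_vec_def UNIV_2)

lemma Basis_pt: "(Basis :: pt set) = {(1, 0), (0, 1)}"
 by (auto simp: Basis_prod_def)

text \<open>Both maps carry boxes to boxes with the same side lengths, and the values on boxes
  determine \<open>lborel\<close>.\<close>

lemma lborel_distr_pt_vec:
 "distr lborel lborel pt_of_vec = lborel" "distr lborel lborel vec_of_pt = lborel"
proof -
 have m1: "pt_of_vec \<in> borel_measurable borel"
  using bounded_linear_pt_vec(2) by (intro borel_measurable_continuous_onI linear_continuous_on)
 have m2: "vec_of_pt \<in> borel_measurable borel"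
  using bounded_linear_pt_vec(1) by (intro borel_measurable_continuous_onI linear_continuous_on)
 have ax: "axis (1::2) (1::real) \<noteq> axis 2 1" by (simp add: axis_eq_axis)
 have "lborel = distr lborel lborel pt_of_vec"
 proof (rule lborel_eqI)
  fix l u :: pt assume lu: "\<And>b. b \<in> Basis \<Longrightarrow> l \<bullet> b \<le> u \<bullet> b"
  have "pt_of_vec -` box l u = box (vec_of_pt l) (vec_of_pt u)"
   by (auto simp: mem_box Basis_vec2 Basis_pt inner_axis pt_of_vec_def vec_of_pt_def inner_prod_def)
  then have "emeasure (distr lborel lborel pt_of_vec) (box l u) = emeasure lborel (box (vec_of_pt l) (vec_of_pt u))"
   using m1 by (subst emeasure_distr) auto
  also have "\<dots> = (\<Prod>b\<in>Basis. (vec_of_pt u - vec_of_pt l) \<bullet> b)"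
   using lu[of "(1, 0)"] lu[of "(0, 1)"] by (intro emeasure_lborel_box) (auto simp: Basis_vec2 Basis_pt inner_axis vec_of_pt_def inner_prod_def)
  also have "\<dots> = (\<Prod>b\<in>Basis. (u - l) \<bullet> b)"
   using ax by (simp add: Basis_vec2 Basis_pt inner_axis vec_of_pt_def inner_prod_def)
  finally show "emeasure (distr lborel lborel pt_of_vec) (box l u) = (\<Prod>b\<in>Basis. (u - l) \<bullet> b)" .
 qed simp
 then show "distr lborel lborel pt_of_vec = lborel" ..
 have "lborel = distr lborel lborel vec_of_pt"
 proof (rule lborel_eqI)
  fix l u :: "real^2" assume lu: "\<And>b. b \<in> Basis \<Longrightarrow> l \<bullet> b \<le> u \<bullet> b"
  have "vec_of_pt -` box l u = box (pt_of_vec l) (pt_of_vec u)"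
   by (auto simp: mem_box Basis_vec2 Basis_pt inner_axis pt_of_vec_def vec_of_pt_def inner_prod_def)
  then have "emeasure (distr lborel lborel vec_of_pt) (box l u) = emeasure lborel (box (pt_of_vec l) (pt_of_vec u))"
   using m2 by (subst emeasure_distr) auto
  also have "\<dots> = (\<Prod>b\<in>Basis. (pt_of_vec u - pt_of_vec l) \<bullet> b)"
   using lu[of "axis 1 1"] lu[of "axis 2 1"] by (intro emeasure_lborel_box) (auto simp: Basis_vec2 Basis_pt inner_axis pt_of_vec_def inner_prod_def)
  also have "\<dots> = (\<Prod>b\<in>Basis. (u - l) \<bullet> b)"
   using ax by (simp add: Basis_vec2 Basis_pt inner_axis pt_of_vec_def inner_prod_def)
  finally show "emeasure (distr lborel lborel vec_of_pt) (box l u) = (\<Prod>b\<in>Basis. (u - l) \<bullet> b)" .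
 qed simp
 then show "distr lborel lborel vec_of_pt = lborel" ..
qed

text \<open>A Lebesgue set is a Borel set together with a part of a Borel null set, and the preimage
  of the latter is null because X preserves \<open>lborel\<close>.\<close>

lemma lebesgue_transport:
 fixes X :: "'a::euclidean_space \<Rightarrow> 'b::euclidean_space"
 assumes X: "X \<in> borel_measurable borel" and d: "distr lborel lborel X = lborel"
 shows "X \<in> measurable lebesgue lebesgue" "distr lebesgue lebesgue X = lebesgue"
proof -
 have Xl: "X \<in> measurable lborel lborel" using X by simp
 have Xl': "X \<in> measurable lebesgue lborel" using Xl by (rule measurable_completion)
 show m: "X \<in> measurable lebesgue lebesgue"
 proof (rule measurableI)
  fix A assume "A \<in> sets (lebesgue :: 'b measure)"
  then obtain S N N' where A: "A = S \<union> N" "N \<subseteq> N'" "N' \<in> null_sets lborel" "S \<in> sets lborel"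
   by (rule sets_completionE)
  have "emeasure lborel (X -` N') = emeasure (distr lborel lborel X) N'" using A(3) Xl by (subst emeasure_distr) auto
  also have "\<dots> = 0" using A(3) unfolding d by (rule null_setsD1)
  finally have n: "X -` N' \<in> null_sets lborel" using measurable_sets[OF Xl, of N'] A(3) by (auto simp: null_sets_def)
  show "X -` A \<inter> space lebesgue \<in> sets lebesgue" by (rule sets_completionI[of _ "X -` S" "X -` N" "X -` N'"])
     (use A n measurable_sets[OF Xl, of S] in auto)
 qed simp
 have e: "distr lebesgue lborel X = lborel" using distr_completion[OF Xl] d by simp
 have "completion (distr lebesgue lborel X) = distr lebesgue lebesgue X"
  by (rule completion.completion_distr_eq[OF Xl']) (simp add: e)
 then show "distr lebesgue lebesgue X = lebesgue" using e by simp
qed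

lemma set_integral_transport:
 fixes X :: "'a::euclidean_space \<Rightarrow> 'b::euclidean_space" and f :: "'b \<Rightarrow> real"
 assumes X: "X \<in> borel_measurable borel" and d: "distr lborel lborel X = lborel"
  and f: "set_integrable lebesgue S f"
 shows "set_integrable lebesgue (X -` S) (\<lambda>z. f (X z))"
  "(LINT z:X -` S|lebesgue. f (X z)) = (LINT z:S|lebesgue. f z)"
proof -
 note m = lebesgue_transport[OF X d]
 have f': "integrable (distr lebesgue lebesgue X) (\<lambda>z. indicator S z *\<^sub>R f z)"
  unfolding m(2) using f unfolding set_integrable_def .
 have ind: "indicator (X -` S) z = (indicator S (X z) :: real)" for z by (auto simp: indicator_def)
 show "set_integrable lebesgue (X -` S) (\<lambda>z. f (X z))"
  unfolding set_integrable_def ind using integrable_distr[OF m(1) f'] .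
 have "(LINT z|distr lebesgue lebesgue X. indicator S z *\<^sub>R f z) = (LINT z|lebesgue. indicator S (X z) *\<^sub>R f (X z))"
  using f' unfolding m(2) by (intro integral_distr[OF m(1), of "\<lambda>z. indicator S z *\<^sub>R f z", unfolded m(2)] borel_measurable_integrable)
 then show "(LINT z:X -` S|lebesgue. f (X z)) = (LINT z:S|lebesgue. f z)"
  unfolding set_lebesgue_integral_def ind m(2) by simp
qed

text \<open>\<open>u z\<close> and \<open>v z\<close> are the columns of the Jacobian matrix of P,
  so \<open>cross2 (u z) (v z)\<close> is the Jacobian determinant.\<close>

lemma pt_change_of_variables:
 fixes P :: "pt \<Rightarrow> pt" and f :: "pt \<Rightarrow> real"
 assumes A: "A \<in> sets lebesgue" and inj: "inj_on P A"
  and der: "\<And>z. z \<in> A \<Longrightarrow> (P has_derivative (\<lambda>w. fst w *\<^sub>R u z + snd w *\<^sub>R v z)) (at z)"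
  and f: "set_integrable lebesgue (P ` A) f"
 shows "set_integrable lebesgue A (\<lambda>z. \<bar>cross2 (u z) (v z)\<bar> * f (P z))"
  "(LINT z:P ` A|lebesgue. f z) = (LINT z:A|lebesgue. \<bar>cross2 (u z) (v z)\<bar> * f (P z))"
proof -
 have X1: "pt_of_vec \<in> borel_measurable borel"
  using bounded_linear_pt_vec(2) by (intro borel_measurable_continuous_onI linear_continuous_on)
 have X2: "vec_of_pt \<in> borel_measurable borel"
  using bounded_linear_pt_vec(1) by (intro borel_measurable_continuous_onI linear_continuous_on)
 note t1 = set_integral_transport[OF X1 lborel_distr_pt_vec(1)]
 note t2 = set_integral_transport[OF X2 lborel_distr_pt_vec(2)]
 define B where "B = pt_of_vec -` A"
 define Q where "Q = vec_of_pt \<circ> P \<circ> pt_of_vec"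
 define Q' where "Q' x = (\<lambda>w. vec_of_pt (fst (pt_of_vec w) *\<^sub>R u (pt_of_vec x) + snd (pt_of_vec w) *\<^sub>R v (pt_of_vec x)))" for x
 have B: "B \<in> sets lebesgue"
  using measurable_sets[OF lebesgue_transport(1)[OF X1 lborel_distr_pt_vec(1)] A] unfolding B_def by simp
 have derQ: "(Q has_derivative Q' x) (at x within B)" if "x \<in> B" for x
 proof -
  have 1: "(pt_of_vec has_derivative pt_of_vec) (at x within B)"
   by (rule bounded_linear_imp_has_derivative[OF bounded_linear_pt_vec(2)])
  have "(P has_derivative (\<lambda>w. fst w *\<^sub>R u (pt_of_vec x) + snd w *\<^sub>R v (pt_of_vec x))) (at (pt_of_vec x))"
   using der[of "pt_of_vec x"] that unfolding B_def by auto
  from has_derivative_compose[OF 1 this]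
  have "((\<lambda>x. P (pt_of_vec x)) has_derivative (\<lambda>w. fst (pt_of_vec w) *\<^sub>R u (pt_of_vec x) + snd (pt_of_vec w) *\<^sub>R v (pt_of_vec x))) (at x within B)" .
  from bounded_linear.has_derivative[OF bounded_linear_pt_vec(1) this]
  show ?thesis unfolding Q_def Q'_def o_def .
 qed
 have injQ: "inj_on Q B"
  unfolding Q_def B_def inj_on_def using inj by (auto simp: inj_on_def) (metis pt_vec_inverse inj inj_onD)+
 have det: "det (matrix (Q' x)) = cross2 (u (pt_of_vec x)) (v (pt_of_vec x))" for x
  unfolding det_2 matrix_def Q'_def cross2_def vec_of_pt_def pt_of_vec_def by (simp add: axis_def)
 have im: "pt_of_vec -` (P ` A) = Q ` B"
 proof (intro set_eqI iffI)
  fix x assume "x \<in> pt_of_vec -` (P ` A)"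
  then obtain z where z: "z \<in> A" "pt_of_vec x = P z" by auto
  then have "x = Q (vec_of_pt z)" "vec_of_pt z \<in> B" unfolding Q_def B_def by (auto simp flip: z(2))
  then show "x \<in> Q ` B" by blast
 qed (auto simp: Q_def B_def)
 have f2: "set_integrable lebesgue (Q ` B) (\<lambda>x. f (pt_of_vec x))" using t1(1)[OF f] unfolding im .
 define F :: "real^2 \<Rightarrow> real^1" where "F x = vec (f (pt_of_vec x))" for x
 have F: "F absolutely_integrable_on Q ` B" unfolding absolutely_integrable_on_1_iff F_def using f2 by simp
 from has_absolute_integral_change_of_variables[OF B derQ injQ, of F "integral (Q ` B) F"] F
 have 3: "(\<lambda>x. \<bar>det (matrix (Q' x))\<bar> *\<^sub>R F (Q x)) absolutely_integrable_on B"
  "integral B (\<lambda>x. \<bar>det (matrix (Q' x))\<bar> *\<^sub>R F (Q x)) = integral (Q ` B) F" by auto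
 have eq: "(\<bar>det (matrix (Q' x))\<bar> *\<^sub>R F (Q x)) $ 1 = \<bar>cross2 (u (pt_of_vec x)) (v (pt_of_vec x))\<bar> * f (P (pt_of_vec x))" for x
  unfolding det F_def Q_def by simp
 have h: "set_integrable lebesgue B (\<lambda>x. \<bar>cross2 (u (pt_of_vec x)) (v (pt_of_vec x))\<bar> * f (P (pt_of_vec x)))"
  using 3(1) unfolding absolutely_integrable_on_1_iff eq .
 have vB: "vec_of_pt -` B = A" unfolding B_def by auto
 show "set_integrable lebesgue A (\<lambda>z. \<bar>cross2 (u z) (v z)\<bar> * f (P z))" using t2(1)[OF h] unfolding vB by simp
 have "integral B (\<lambda>x. (\<bar>det (matrix (Q' x))\<bar> *\<^sub>R F (Q x)) $ 1) = integral (Q ` B) (\<lambda>x. F x $ 1)"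
  using 3(2) unfolding integral_on_1_eq by (simp add: vec_eq_iff)
 then have 4: "integral B (\<lambda>x. \<bar>cross2 (u (pt_of_vec x)) (v (pt_of_vec x))\<bar> * f (P (pt_of_vec x))) = integral (Q ` B) (\<lambda>x. f (pt_of_vec x))"
  unfolding eq by (simp add: F_def)
 have "(LINT z:P ` A|lebesgue. f z) = (LINT x:Q ` B|lebesgue. f (pt_of_vec x))" using t1(2)[OF f] unfolding im by simp
 also have "\<dots> = (LINT x:B|lebesgue. \<bar>cross2 (u (pt_of_vec x)) (v (pt_of_vec x))\<bar> * f (P (pt_of_vec x)))"
  using 4 set_lebesgue_integral_eq_integral(2)[OF h] set_lebesgue_integral_eq_integral(2)[OF f2] by simp
 also have "\<dots> = (LINT z:A|lebesgue. \<bar>cross2 (u z) (v z)\<bar> * f (P z))" using t2(2)[OF h] unfolding vB by simp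
 finally show "(LINT z:P ` A|lebesgue. f z) = (LINT z:A|lebesgue. \<bar>cross2 (u z) (v z)\<bar> * f (P z))" .
qed

section \<open>Integration over cones\<close>

text \<open>Coordinates on the cone with apex x over the curve g: \<open>fst\<close> is the curve
  parameter, \<open>snd\<close> the fraction of the ray from x to the curve point.\<close>

definition cone_map :: "(real \<Rightarrow> pt) \<Rightarrow> pt \<Rightarrow> real \<times> real \<Rightarrow> pt" where
 "cone_map g x z = x + snd z *\<^sub>R (g (fst z) - x)"

lemma cone_map_has_derivative:
 assumes "(g has_vector_derivative G) (at (fst z))"
 shows "(cone_map g x has_derivative (\<lambda>w. fst w *\<^sub>R (snd z *\<^sub>R G) + snd w *\<^sub>R (g (fst z) - x))) (at z)"
proof -
 have g: "(g has_derivative (\<lambda>h. h *\<^sub>R G)) (at (fst z))" using assms unfolding has_vector_derivative_def .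
 have "((\<lambda>z. g (fst z)) has_derivative (\<lambda>w. fst w *\<^sub>R G)) (at z)"
  by (rule has_derivative_compose[where g = g and f = fst, OF _ g]) (auto intro!: derivative_eq_intros)
 then show ?thesis unfolding cone_map_def by (auto intro!: derivative_eq_intros simp: mult.commute)
qed

text \<open>The integrand is the derivative of r^2 \<phi>(x + r (z - x)), which is 0 at r = 0 and
  \<open>\<phi> z\<close> at r = 1. The leading factor r is the one contributed by the Jacobian of
  \<open>cone_map\<close>.\<close>

lemma cone_fundamental_theorem:
 fixes \<phi> :: "pt \<Rightarrow> real"
 assumes seg: "\<And>r. 0 < r \<Longrightarrow> r < 1 \<Longrightarrow> x + r *\<^sub>R (z - x) \<in> T"
  and xT: "x \<in> T" and zT: "z \<in> C" and TC: "T \<subseteq> C" and cont: "continuous_on C \<phi>"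
  and der: "\<And>w. w \<in> T \<Longrightarrow> (\<phi> has_derivative (\<lambda>h. fst h * \<phi>1 w + snd h * \<phi>2 w)) (at w)"
  and int: "set_integrable lebesgue {0<..<1} (\<lambda>r. r * (2 * \<phi> (x + r *\<^sub>R (z - x)) +
    (fst (r *\<^sub>R (z - x)) * \<phi>1 (x + r *\<^sub>R (z - x)) + snd (r *\<^sub>R (z - x)) * \<phi>2 (x + r *\<^sub>R (z - x)))))"
 shows "(LINT r:{0<..<1}|lebesgue. r * (2 * \<phi> (x + r *\<^sub>R (z - x)) +
    (fst (r *\<^sub>R (z - x)) * \<phi>1 (x + r *\<^sub>R (z - x)) + snd (r *\<^sub>R (z - x)) * \<phi>2 (x + r *\<^sub>R (z - x))))) = \<phi> z"
proof -
 let ?p = "\<lambda>r. x + r *\<^sub>R (z - x)"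
 let ?h = "\<lambda>r. r * (2 * \<phi> (?p r) + (fst (r *\<^sub>R (z - x)) * \<phi>1 (?p r) + snd (r *\<^sub>R (z - x)) * \<phi>2 (?p r)))"
 have mem: "?p r \<in> C" if rI: "r \<in> {0..1}" for r
 proof -
  consider "r = 0" | "r = 1" | "0 < r \<and> r < 1" using rI by fastforce
  then show ?thesis using xT zT TC seg by cases auto
 qed
 have "((\<lambda>r. ?h r) has_integral (1\<^sup>2 * \<phi> (?p 1) - 0\<^sup>2 * \<phi> (?p 0))) {0..1}"
 proof (rule fundamental_theorem_of_calculus_interior)
  show "continuous_on {0..1} (\<lambda>r. r\<^sup>2 * \<phi> (?p r))"
   by (intro continuous_intros continuous_on_compose2[OF cont]) (use mem in auto)
  fix r :: real assume r: "r \<in> {0<..<1}"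
  have p: "(?p has_derivative (\<lambda>h. h *\<^sub>R (z - x))) (at r)" by (auto intro!: derivative_eq_intros)
  have "((\<lambda>r. \<phi> (?p r)) has_derivative (\<lambda>h. fst (h *\<^sub>R (z - x)) * \<phi>1 (?p r) + snd (h *\<^sub>R (z - x)) * \<phi>2 (?p r))) (at r)"
   by (rule has_derivative_compose[OF p der]) (use seg r in auto)
  then have "((\<lambda>r. \<phi> (?p r)) has_real_derivative (fst (z - x) * \<phi>1 (?p r) + snd (z - x) * \<phi>2 (?p r))) (at r)"
   unfolding has_field_derivative_def by (rule has_derivative_eq_rhs) (auto simp: algebra_simps)
  then have "((\<lambda>r. r\<^sup>2 * \<phi> (?p r)) has_real_derivative ?h r) (at r)"
   by (auto intro!: derivative_eq_intros simp: algebra_simps power2_eq_square)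
  then show "((\<lambda>r. r\<^sup>2 * \<phi> (?p r)) has_vector_derivative ?h r) (at r)"
   by (simp add: has_real_derivative_iff_has_vector_derivative)
 qed simp
 then have 1: "(?h has_integral \<phi> z) {0..1}" by simp
 have "(?h has_integral \<phi> z) {0<..<1}" using 1 has_integral_Icc_iff_Ioo by blast
 moreover have "(?h has_integral (LINT r:{0<..<1}|lebesgue. ?h r)) {0<..<1}"
  by (rule has_integral_set_lebesgue[OF int])
 ultimately show ?thesis by (rule has_integral_unique[symmetric])
qed

section \<open>The divergence theorem on star-shaped domains\<close>

abbreviation "ray x z \<equiv> (\<lambda>r. (x :: pt) + r *\<^sub>R (z - x)) ` {0<..<1 :: real}"
text \<open>\<open>cone_density\<close> is the divergence of the field \<phi>(z) (z - w).
  \<open>sweep\<close> is the flux of this field per unit of curve parameter through a boundary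
  point z moving with velocity v, provided that z - w points outwards there.\<close>

abbreviation "sweep \<phi> w v z \<equiv> \<bar>cross2 v (z - w)\<bar> * \<phi> z"
abbreviation "cone_density \<phi> \<phi>1 \<phi>2 w z \<equiv> 2 * \<phi> z + (fst (z - w) * \<phi>1 z + snd (z - w) * \<phi>2 z)"
abbreviation "velocity \<gamma> s \<equiv> vector_derivative (\<gamma> :: real \<Rightarrow> pt) (at s)"

text \<open>Almost everywhere with respect to arc length on the part of the curve parametrised by \<open>S\<close>.\<close>

abbreviation AE_curve :: "(real \<Rightarrow> pt) \<Rightarrow> real set \<Rightarrow> (real \<Rightarrow> bool) \<Rightarrow> bool" where
 "AE_curve \<gamma> S P \<equiv> (AE s in lebesgue. s \<in> S \<longrightarrow> velocity \<gamma> s \<noteq> 0 \<longrightarrow> P s)"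

lemma cross2_scaleR_left: "cross2 (r *\<^sub>R a) b = r * cross2 a b"
 unfolding cross2_def by (simp add: algebra_simps)

text \<open>\<open>cone_map\<close> is Lipschitz on the parameter strip, so it sends the null set of
  parameters over N to a null set.\<close>

lemma negligible_cone:
 assumes N: "negligible N" "N \<subseteq> {0..1}" and g: "L-lipschitz_on {0..1} g"
 shows "negligible (cone_map g x ` (N \<times> {0<..<1}))"
proof (rule negligible_locally_Lipschitz_image)
 obtain N' where N': "N' \<in> null_sets (lborel :: real measure)" "N \<subseteq> N'"
  using N(1) by (auto simp: negligible_iff_null_sets null_sets_completion_iff2)
 have "N' \<times> UNIV \<in> null_sets (lborel \<Otimes>\<^sub>M (lborel :: real measure))"
  using N'(1) by (intro lborel.times_in_null_sets1) auto
 then have "negligible (N' \<times> (UNIV :: real set))"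
  by (simp add: lborel_prod negligible_iff_null_sets null_sets_completionI)
 then show "negligible (N \<times> {0<..<1::real})" by (rule negligible_subset) (use N'(2) in auto)
 obtain M where M: "\<And>s. s \<in> {0..1} \<Longrightarrow> norm (g s) \<le> M"
  using compact_imp_bounded[OF compact_continuous_image[OF lipschitz_on_continuous_on[OF g] compact_Icc]]
  unfolding bounded_iff ball_simps by metis
 have L: "L \<ge> 0" using lipschitz_on_nonneg[OF g] .
 have "norm (cone_map g x y - cone_map g x z) \<le> (M + norm x + L) * norm (y - z)"
  if y: "y \<in> N \<times> {0<..<1}" and z: "z \<in> N \<times> {0<..<1}" for y z
 proof -
  have yz: "fst y \<in> {0..1}" "fst z \<in> {0..1}" "0 < snd z" "snd z < 1" using y z N(2) by auto
  have "cone_map g x y - cone_map g x z = (snd y - snd z) *\<^sub>R (g (fst y) - x) + snd z *\<^sub>R (g (fst y) - g (fst z))"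
   unfolding cone_map_def by (simp add: algebra_simps)
  also have "norm \<dots> \<le> \<bar>snd y - snd z\<bar> * norm (g (fst y) - x) + \<bar>snd z\<bar> * norm (g (fst y) - g (fst z))"
   by (metis norm_scaleR norm_triangle_ineq)
  also have "\<dots> \<le> norm (y - z) * (M + norm x) + 1 * (L * norm (y - z))"
  proof (intro add_mono mult_mono)
   show "\<bar>snd y - snd z\<bar> \<le> norm (y - z)" using dist_snd_le[of y z] by (simp add: dist_norm)
   show "norm (g (fst y) - x) \<le> M + norm x" using M[OF yz(1)] norm_triangle_ineq4[of "g (fst y)" x] by simp
   have "norm (g (fst y) - g (fst z)) \<le> L * \<bar>fst y - fst z\<bar>"
    using lipschitz_onD[OF g yz(1,2)] by (simp add: dist_norm)
   also have "\<dots> \<le> L * norm (y - z)" using dist_fst_le[of y z] L by (intro mult_left_mono) (auto simp: dist_norm)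
   finally show "norm (g (fst y) - g (fst z)) \<le> L * norm (y - z)" .
  qed (use yz in auto)
  finally show ?thesis by (simp add: algebra_simps)
 qed
 then show "\<And>z. z \<in> N \<times> {0<..<1} \<Longrightarrow> \<exists>T B. open T \<and> z \<in> T \<and>
   (\<forall>y\<in>N \<times> {0<..<1} \<inter> T. norm (cone_map g x y - cone_map g x z) \<le> B * norm (y - z))"
  by (intro exI[of _ UNIV] exI[of _ "M + norm x + L"]) auto
qed simp

text \<open>A ray is the cone over the single parameter 0 of a constant curve.\<close>

lemma negligible_ray: "negligible (ray x z)"
proof -
 have "negligible (cone_map (\<lambda>_. z) x ` ({0} \<times> {0<..<1}))"
  by (rule negligible_cone[of _ 0]) (auto simp: lipschitz_on_def)
 moreover have "cone_map (\<lambda>_. z) x ` ({0} \<times> {0<..<1}) = ray x z" unfolding cone_map_def by force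
 ultimately show ?thesis by simp
qed

section \<open>Rays and cones in a set that is star-shaped with respect to a ball\<close>

locale star_domain =
 fixes T :: "pt set" and x0 :: pt and \<rho> :: real
 assumes open_T: "open T" and bounded_T: "bounded T" and rho_pos: "\<rho> > 0"
  and star: "star_shaped_wrt_ball T x0 \<rho>"
begin

lemma ball_subset: "ball x0 \<rho> \<subseteq> T" using star unfolding star_shaped_wrt_ball_def by blast

text \<open>Since z may lie on the frontier, it is replaced by a nearby point z' of T. Moving w to
  w' inside the ball compensates for this: the point in question lies on the segment from w' to z'
  at the same parameter.\<close>

lemma open_segment_subset:
 assumes w: "w \<in> ball x0 \<rho>" and z: "z \<in> closure T" and t: "0 \<le> t" "t < 1"
 shows "w + t *\<^sub>R (z - w) \<in> T"
proof -
 define y where "y = w + t *\<^sub>R (z - w)"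
 obtain e where e: "e > 0" "ball w e \<subseteq> ball x0 \<rho>" using openE[OF open_ball w] by blast
 obtain z' where z': "z' \<in> T" "dist z' z < e * (1 - t)"
  using z e t unfolding closure_approachable by (metis mult_pos_pos diff_gt_0_iff_gt)
 define w' where "w' = w + (t / (1 - t)) *\<^sub>R (z - z')"
 have "dist w w' = (t / (1 - t)) * dist z' z" using t unfolding w'_def by (simp add: dist_norm norm_minus_commute)
 also have "\<dots> \<le> (1 / (1 - t)) * dist z' z" using t by (intro mult_right_mono divide_right_mono) auto
 also have "\<dots> < e" using z' t by (simp add: field_simps)
 finally have "w' \<in> ball x0 \<rho>" using e by auto
 then have "closed_segment w' z' \<subseteq> T" using star z' unfolding star_shaped_wrt_ball_def by blast
 moreover have "(1 - t) *\<^sub>R w' = (1 - t) *\<^sub>R w + t *\<^sub>R (z - z')" using t unfolding w'_def by (simp add: scaleR_add_right)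
 then have "y = (1 - t) *\<^sub>R w' + t *\<^sub>R z'" unfolding y_def by (simp add: algebra_simps)
 then have "y \<in> closed_segment w' z'" using t unfolding in_segment by auto
 ultimately show ?thesis unfolding y_def by blast
qed

text \<open>Of two frontier points on a ray from w the nearer one would belong to T by
  \<open>open_segment_subset\<close>, but the open set T contains no frontier points.\<close>

lemma frontier_ray_unique:
 assumes w: "w \<in> ball x0 \<rho>" and z: "z \<in> frontier T" "z' \<in> frontier T"
  and r: "0 < r" "0 < r'" and eq: "w + r *\<^sub>R (z - w) = w + r' *\<^sub>R (z' - w)"
 shows "z = z' \<and> r = r'"
proof -
 have nT: "z \<notin> T" "z' \<notin> T" using z open_T by (auto simp: frontier_def interior_open)
 have cl: "z \<in> closure T" "z' \<in> closure T" using z by (auto simp: frontier_def)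
 have e: "r *\<^sub>R (z - w) = r' *\<^sub>R (z' - w)" using eq by simp
 have rr: "r = r'"
 proof (rule ccontr)
  assume "r \<noteq> r'"
  then consider "r < r'" | "r' < r" by linarith
  then show False
  proof cases
   case 1
   have "z' - w = (1 / r') *\<^sub>R (r *\<^sub>R (z - w))" unfolding e using r by simp
   also have "\<dots> = (r / r') *\<^sub>R (z - w)" by simp
   finally have "z' = w + (r / r') *\<^sub>R (z - w)" by (simp add: algebra_simps)
   then show False using open_segment_subset[OF w cl(1), of "r / r'"] nT 1 r by auto
  next
   case 2
   have "z - w = (1 / r) *\<^sub>R (r' *\<^sub>R (z' - w))" unfolding e[symmetric] using r by simp
   also have "\<dots> = (r' / r) *\<^sub>R (z' - w)" by simp
   finally have "z = w + (r' / r) *\<^sub>R (z' - w)" by (simp add: algebra_simps)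
   then show False using open_segment_subset[OF w cl(2), of "r' / r"] nT 2 r by auto
  qed
 qed
 then show ?thesis using eq r by simp
qed

lemma ray_cover:
 assumes w: "w \<in> ball x0 \<rho>" and y: "y \<in> T" "y \<noteq> w"
 obtains z r where "z \<in> frontier T" "0 < r" "r < 1" "y = w + r *\<^sub>R (z - w)"
proof -
 have "w \<in> interior T" using w ball_subset open_T by (auto simp: interior_open)
 from ray_to_frontier[OF bounded_T this, of "y - w"] y(2)
 obtain d where d: "0 < d" "w + d *\<^sub>R (y - w) \<in> frontier T" by auto
 have nT: "w + d *\<^sub>R (y - w) \<notin> T" using d(2) open_T by (auto simp: frontier_def interior_open)
 have "d > 1"
 proof (rule ccontr)
  assume "\<not> d > 1"
  then consider "d < 1" | "d = 1" by linarith
  then show False using open_segment_subset[OF w, of y d] d nT y(1) closure_subset by cases auto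
 qed
 then show ?thesis using d by (intro that[of "w + d *\<^sub>R (y - w)" "1 / d"]) auto
qed

text \<open>Change of variables by \<open>cone_map\<close>, whose Jacobian is r times |cross2 G (g -
  w)|, followed by Fubini. The integral along each ray is evaluated by
  \<open>cone_fundamental_theorem\<close> and leaves the value of \<phi> at the boundary
  point.\<close>

lemma cone_piece_integral:
 fixes \<phi> \<phi>1 \<phi>2 :: "pt \<Rightarrow> real"
 assumes w: "w \<in> ball x0 \<rho>"
  and cont: "continuous_on (closure T) \<phi>"
  and der: "\<And>z. z \<in> T \<Longrightarrow> (\<phi> has_derivative (\<lambda>h. fst h * \<phi>1 z + snd h * \<phi>2 z)) (at z)"
  and c1: "continuous_on T \<phi>1" and c2: "continuous_on T \<phi>2"
  and int: "set_integrable lebesgue T (\<lambda>z. cone_density \<phi> \<phi>1 \<phi>2 w z)"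
  and g: "L-lipschitz_on {0..1} g" and S: "S \<in> sets borel" "S \<subseteq> {0..1}"
  and inj: "inj_on g S" and fr: "g ` S \<subseteq> frontier T"
  and D: "D \<in> sets borel" "S \<subseteq> D" and G: "G \<in> borel_measurable borel"
  and gD: "\<And>s. s \<in> S \<Longrightarrow> (g has_vector_derivative G s) (at s)"
 shows "cone_map g w ` (S \<times> {0<..<1}) \<in> sets lebesgue"
  "cone_map g w ` (S \<times> {0<..<1}) \<subseteq> T"
  "set_integrable lebesgue S (\<lambda>s. sweep \<phi> w (G s) (g s))"
  "(LINT z:cone_map g w ` (S \<times> {0<..<1})|lebesgue. cone_density \<phi> \<phi>1 \<phi>2 w z) =
   (LINT s:S|lebesgue. sweep \<phi> w (G s) (g s))"
proof -
 define A where "A = S \<times> {0<..<1::real}"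
 define f where "f z = cone_density \<phi> \<phi>1 \<phi>2 w z" for z
 have AB: "A \<in> sets borel" unfolding A_def borel_prod[symmetric] using S by auto
 have Al: "A \<in> sets lebesgue" using AB by (rule sets_completionI_sets[of _ lborel, simplified])
 have gS: "g s \<in> frontier T" "g s \<in> closure T" if "s \<in> S" for s using fr that by (auto simp: frontier_def)
 have dP: "(cone_map g w has_derivative (\<lambda>h. fst h *\<^sub>R (snd z *\<^sub>R G (fst z)) + snd h *\<^sub>R (g (fst z) - w))) (at z)"
  if zA: "z \<in> A" for z by (rule cone_map_has_derivative[OF gD]) (use zA in \<open>auto simp: A_def\<close>)
 have injP: "inj_on (cone_map g w) A"
 proof (rule inj_onI)
  fix y z assume yz: "y \<in> A" "z \<in> A" "cone_map g w y = cone_map g w z"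
  then have s: "fst y \<in> S" "fst z \<in> S" "0 < snd y" "0 < snd z" unfolding A_def by auto
  have "g (fst y) = g (fst z) \<and> snd y = snd z"
   using yz(3) unfolding cone_map_def by (intro frontier_ray_unique[OF w]) (use s gS in auto)
  then show "y = z" using inj_onD[OF inj _ s(1,2)] by (auto simp: prod_eq_iff)
 qed
 have PT: "cone_map g w ` A \<subseteq> T" using open_segment_subset[OF w gS(2)] unfolding A_def cone_map_def by auto
 then show "cone_map g w ` (S \<times> {0<..<1}) \<subseteq> T" unfolding A_def .
 have "cone_map g w differentiable_on A"
  unfolding differentiable_on_def using dP has_derivative_at_withinI differentiable_def by blast
 then have Pl: "cone_map g w ` A \<in> sets lebesgue" by (intro differentiable_image_in_sets_lebesgue Al) auto
 then show "cone_map g w ` (S \<times> {0<..<1}) \<in> sets lebesgue" unfolding A_def .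
 have fP: "set_integrable lebesgue (cone_map g w ` A) f" using set_integrable_subset[OF int Pl PT] unfolding f_def .
 note cov = pt_change_of_variables[OF Al injP dP fP]
 \<comment> \<open>Fubini is applied to \<open>lborel\<close>, so Borel versions of all functions
   are built: g is extended by clamping its parameter, and the integrand is cut off outside T and
   A.\<close>
 define gc where "gc s = g (max 0 (min 1 s))" for s
 have gcc: "continuous_on UNIV gc" unfolding gc_def
  by (intro continuous_on_compose2[OF lipschitz_on_continuous_on[OF g]] continuous_intros) auto
 have gcS: "gc s = g s" if "s \<in> S" for s using that S(2) unfolding gc_def by (auto simp: subset_iff)
 define fT where "fT z = indicator T z *\<^sub>R f z" for z
 have "continuous_on T f" unfolding f_def
  using continuous_on_subset[OF cont closure_subset] c1 c2 by (intro continuous_intros) auto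
 then have fTB: "fT \<in> borel_measurable borel"
  using borel_measurable_continuous_on_indicator[of T f] open_T unfolding fT_def by auto
 define F where "F z = indicator A z *\<^sub>R (\<bar>cross2 (snd z *\<^sub>R G (fst z)) (gc (fst z) - w)\<bar> * fT (w + snd z *\<^sub>R (gc (fst z) - w)))" for z
 have FB: "F \<in> borel_measurable borel"
 proof -
  have f1: "(fst :: pt \<Rightarrow> real) \<in> borel_measurable borel" "(snd :: pt \<Rightarrow> real) \<in> borel_measurable borel"
   by (auto intro!: borel_measurable_continuous_onI continuous_intros)
  have gm: "(\<lambda>z::pt. gc (fst z)) \<in> borel_measurable borel"
   by (intro borel_measurable_continuous_onI continuous_on_compose2[OF gcc] continuous_intros) auto
  have Gm: "(\<lambda>z::pt. G (fst z)) \<in> borel_measurable borel" using measurable_compose[OF f1(1) G] .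
  have "(\<lambda>z. snd z *\<^sub>R G (fst z)) \<in> borel_measurable borel" using f1(2) Gm by (rule borel_measurable_scaleR)
  moreover have gw: "(\<lambda>z::pt. gc (fst z) - w) \<in> borel_measurable borel" using gm by (intro borel_measurable_diff) auto
  ultimately have "(\<lambda>z. cross2 (snd z *\<^sub>R G (fst z)) (gc (fst z) - w)) \<in> borel_measurable borel" unfolding cross2_def
   by (intro borel_measurable_diff borel_measurable_times measurable_compose[OF _ f1(1)] measurable_compose[OF _ f1(2)] gm) auto
  moreover have "(\<lambda>z. w + snd z *\<^sub>R (gc (fst z) - w)) \<in> borel_measurable borel"
   using f1(2) gw by (intro borel_measurable_add borel_measurable_scaleR) auto
  then have "(\<lambda>z. fT (w + snd z *\<^sub>R (gc (fst z) - w))) \<in> borel_measurable borel"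
   using fTB by (rule measurable_compose)
  ultimately show ?thesis unfolding F_def using AB by (intro borel_measurable_scaleR borel_measurable_times borel_measurable_abs) auto
 qed
 have Feq: "F z = indicator A z *\<^sub>R (\<bar>cross2 (snd z *\<^sub>R G (fst z)) (g (fst z) - w)\<bar> * f (cone_map g w z))" for z
 proof (cases "z \<in> A")
  case True
  then have "gc (fst z) = g (fst z)" using gcS unfolding A_def by auto
  moreover have "cone_map g w z \<in> T" using True PT by auto
  ultimately show ?thesis unfolding F_def fT_def by (simp add: cone_map_def)
 qed (simp add: F_def)
 have "integrable lebesgue F" using cov(1) unfolding set_integrable_def Feq[symmetric] .
 then have "integrable lborel F" using FB by (simp add: integrable_completion)
 then have Fi: "integrable (lborel \<Otimes>\<^sub>M lborel) F" by (simp add: lborel_prod)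
 have I: "(LINT z:cone_map g w ` A|lebesgue. f z) = (LINT s|lborel. LINT r|lborel. F (s, r))"
 proof -
  have "(LINT z:cone_map g w ` A|lebesgue. f z) = (LINT z|lebesgue. F z)"
   using cov(2) unfolding set_lebesgue_integral_def Feq[symmetric] .
  also have "\<dots> = (LINT z|lborel. F z)" using FB by (intro integral_completion) auto
  also have "\<dots> = (LINT z|(lborel \<Otimes>\<^sub>M lborel). F z)" by (simp add: lborel_prod)
  also have "\<dots> = (LINT s|lborel. LINT r|lborel. F (s, r))" using lborel_pair.integral_fst'[OF Fi] by simp
  finally show ?thesis .
 qed
 have inner: "(LINT r|lborel. F (s, r)) = indicator S s *\<^sub>R (sweep \<phi> w (G s) (g s))"
  if i: "integrable lborel (\<lambda>r. F (s, r))" for s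
 proof (cases "s \<in> S")
  case True
  define c where "c = \<bar>cross2 (G s) (g s - w)\<bar>"
  define h where "h r = r * (2 * \<phi> (w + r *\<^sub>R (g s - w)) +
    (fst (r *\<^sub>R (g s - w)) * \<phi>1 (w + r *\<^sub>R (g s - w)) + snd (r *\<^sub>R (g s - w)) * \<phi>2 (w + r *\<^sub>R (g s - w))))" for r
  have Fh: "F (s, r) = c * (indicator {0<..<1} r *\<^sub>R h r)" for r
  proof (cases "r \<in> {0<..<1}")
   case True
   have "\<bar>cross2 (r *\<^sub>R G s) (g s - w)\<bar> = r * c" using True unfolding c_def cross2_scaleR_left abs_mult by simp
   then show ?thesis using True \<open>s \<in> S\<close> unfolding Feq f_def h_def A_def cone_map_def by simp
  qed (simp add: F_def A_def)
  show ?thesis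
  \<comment> \<open>For c = 0 the integrability of h along the ray cannot be recovered from that of
    F, but then both sides vanish.\<close>
  proof (cases "c = 0")
   case True
   then show ?thesis unfolding Fh c_def[symmetric] by simp
  next
   case False
   have hi: "integrable lborel (\<lambda>r. indicator {0<..<1} r *\<^sub>R h r)"
    using i False unfolding Fh by (simp add: integrable_mult_right_iff)
   then have hm: "(\<lambda>r. indicator {0<..<1} r *\<^sub>R h r) \<in> borel_measurable lborel" by simp
   have "set_integrable lebesgue {0<..<1} h"
    unfolding set_integrable_def using hi integrable_completion[OF hm] by simp
   then have "(LINT r:{0<..<1}|lebesgue. h r) = \<phi> (g s)" unfolding h_def
    by (intro cone_fundamental_theorem[where T = T and C = "closure T"])
      (use open_segment_subset[OF w gS(2)[OF True]] w ball_subset gS[OF True] closure_subset cont der in auto)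
   then have "(LINT r|lborel. indicator {0<..<1} r *\<^sub>R h r) = \<phi> (g s)"
    unfolding set_lebesgue_integral_def integral_completion[OF hm] .
   then show ?thesis using True unfolding Fh c_def[symmetric] by simp
  qed
 qed (simp add: F_def A_def)
 define H where "H s = indicator S s *\<^sub>R (sweep \<phi> w (G s) (g s))" for s
 have AEi: "AE s in lborel. (LINT r|lborel. F (s, r)) = H s"
  using lborel_pair.AE_integrable_fst'[OF Fi] unfolding H_def by eventually_elim (rule inner)
 have Hm: "H \<in> borel_measurable borel"
 proof -
  have f1: "(fst :: pt \<Rightarrow> real) \<in> borel_measurable borel" "(snd :: pt \<Rightarrow> real) \<in> borel_measurable borel"
   by (auto intro!: borel_measurable_continuous_onI continuous_intros)
  have gm: "gc \<in> borel_measurable borel" by (intro borel_measurable_continuous_onI gcc)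
  have p: "(\<lambda>z. indicator (closure T) z *\<^sub>R \<phi> z) \<in> borel_measurable borel"
   using cont by (intro borel_measurable_continuous_on_indicator) auto
  have "(\<lambda>s. indicator S s *\<^sub>R (\<bar>cross2 (G s) (gc s - w)\<bar> * (indicator (closure T) (gc s) *\<^sub>R \<phi> (gc s)))) \<in> borel_measurable borel"
   unfolding cross2_def using S(1) G gm
   by (intro borel_measurable_scaleR borel_measurable_times borel_measurable_abs borel_measurable_diff
     measurable_compose[OF gm p] measurable_compose[OF _ f1(1)] measurable_compose[OF _ f1(2)] borel_measurable_indicator) auto
  moreover have "H s = indicator S s *\<^sub>R (\<bar>cross2 (G s) (gc s - w)\<bar> * (indicator (closure T) (gc s) *\<^sub>R \<phi> (gc s)))" for s
   unfolding H_def using gcS gS(2) by (cases "s \<in> S") auto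
  ultimately show ?thesis by presburger
 qed
 have Im: "(\<lambda>s. LINT r|lborel. F (s, r)) \<in> borel_measurable lborel"
  using lborel_pair.integrable_fst'[OF Fi] by (rule borel_measurable_integrable)
 have Hi: "integrable lborel H" using lborel_pair.integrable_fst'[OF Fi] integrable_cong_AE[OF Im _ AEi] Hm by simp
 then have "integrable lebesgue H" using Hm by (simp add: integrable_completion)
 then show "set_integrable lebesgue S (\<lambda>s. sweep \<phi> w (G s) (g s))" unfolding set_integrable_def H_def .
 have "(LINT s|lborel. LINT r|lborel. F (s, r)) = (LINT s|lborel. H s)"
  using Im Hm AEi by (intro integral_cong_AE) auto
 also have "\<dots> = (LINT s|lebesgue. H s)" using Hm by (intro integral_completion[symmetric]) auto
 finally show "(LINT z:cone_map g w ` (S \<times> {0<..<1})|lebesgue. cone_density \<phi> \<phi>1 \<phi>2 w z) =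
   (LINT s:S|lebesgue. sweep \<phi> w (G s) (g s))" using I unfolding f_def A_def H_def set_lebesgue_integral_def by simp
qed

text \<open>The cones from w over the boundary pieces fill T up to a null set and overlap only in
  null sets, so the fluxes of the pieces add up to the integral over T.\<close>

lemma star_flux:
 fixes \<phi> \<phi>1 \<phi>2 :: "pt \<Rightarrow> real" and g :: "'i \<Rightarrow> real \<Rightarrow> pt"
 assumes w: "w \<in> ball x0 \<rho>"
  and cont: "continuous_on (closure T) \<phi>"
  and der: "\<And>z. z \<in> T \<Longrightarrow> (\<phi> has_derivative (\<lambda>h. fst h * \<phi>1 z + snd h * \<phi>2 z)) (at z)"
  and c1: "continuous_on T \<phi>1" and c2: "continuous_on T \<phi>2"
  and int: "set_integrable lebesgue T (\<lambda>z. cone_density \<phi> \<phi>1 \<phi>2 w z)"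
  and I: "finite I" and g: "\<And>i. i \<in> I \<Longrightarrow> (L i)-lipschitz_on {0..1} (g i)"
  and S: "\<And>i. i \<in> I \<Longrightarrow> S i \<in> sets borel" "\<And>i. i \<in> I \<Longrightarrow> S i \<subseteq> {0..1}"
  and inj: "\<And>i. i \<in> I \<Longrightarrow> inj_on (g i) (S i)" and fr: "\<And>i. i \<in> I \<Longrightarrow> g i ` S i \<subseteq> frontier T"
  and cover: "finite (frontier T - (\<Union>i\<in>I. g i ` S i))"
  and disj: "\<And>i j. i \<in> I \<Longrightarrow> j \<in> I \<Longrightarrow> i \<noteq> j \<Longrightarrow> finite (g i ` S i \<inter> g j ` S j)"
 shows "\<And>i. i \<in> I \<Longrightarrow> set_integrable lebesgue (S i) (\<lambda>s. sweep \<phi> w (velocity (g i) s) (g i s))"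
  "(LINT z:T|lebesgue. cone_density \<phi> \<phi>1 \<phi>2 w z) =
   (\<Sum>i\<in>I. LINT s:S i|lebesgue. sweep \<phi> w (velocity (g i) s) (g i s))"
proof -
 define f where "f z = cone_density \<phi> \<phi>1 \<phi>2 w z" for z
 have "\<exists>D G. D \<in> sets borel \<and> negligible ({0..1} - D) \<and> G \<in> borel_measurable borel \<and>
   (\<forall>s\<in>D. (g i has_vector_derivative G s) (at s))" if "i \<in> I" for i
  by (rule lipschitz_curve_derivative[OF g[OF that]]) blast
 then obtain D G where D: "\<And>i. i \<in> I \<Longrightarrow> D i \<in> sets borel" "\<And>i. i \<in> I \<Longrightarrow> negligible ({0..1} - D i)"
  and G: "\<And>i. i \<in> I \<Longrightarrow> G i \<in> borel_measurable borel"
  and gD: "\<And>i s. i \<in> I \<Longrightarrow> s \<in> D i \<Longrightarrow> (g i has_vector_derivative G i s) (at s)" by metis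
 define P where "P i = cone_map (g i) w ` ((S i \<inter> D i) \<times> {0<..<1})" for i
 have piece: "P i \<in> sets lebesgue" "P i \<subseteq> T"
  "set_integrable lebesgue (S i \<inter> D i) (\<lambda>s. sweep \<phi> w (G i s) (g i s))"
  "(LINT z:P i|lebesgue. f z) = (LINT s:S i \<inter> D i|lebesgue. sweep \<phi> w (G i s) (g i s))"
  if i: "i \<in> I" for i unfolding P_def f_def
  by (rule cone_piece_integral[OF w cont der c1 c2 int g[OF i], where D = "D i"];
    use S[OF i] D[OF i] inj[OF i] fr[OF i] G[OF i] gD[OF i] in \<open>auto intro: inj_on_subset\<close>)+
 have eqAE: "AE s in lebesgue. indicator (S i \<inter> D i) s *\<^sub>R (sweep \<phi> w (G i s) (g i s)) =
   indicator (S i) s *\<^sub>R (sweep \<phi> w (velocity (g i) s) (g i s))" if i: "i \<in> I" for i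
 proof (rule AE_I'[of "{0..1} - D i"])
  show "{0..1} - D i \<in> null_sets lebesgue" using D(2)[OF i] by (simp add: negligible_iff_null_sets)
  show "{s \<in> space lebesgue. \<not> (indicator (S i \<inter> D i) s *\<^sub>R (sweep \<phi> w (G i s) (g i s)) =
   indicator (S i) s *\<^sub>R (sweep \<phi> w (velocity (g i) s) (g i s)))} \<subseteq> {0..1} - D i"
  proof
   fix s assume "s \<in> {s \<in> space lebesgue. \<not> (indicator (S i \<inter> D i) s *\<^sub>R (sweep \<phi> w (G i s) (g i s)) =
   indicator (S i) s *\<^sub>R (sweep \<phi> w (velocity (g i) s) (g i s)))}"
   then have ne: "indicator (S i \<inter> D i) s *\<^sub>R (sweep \<phi> w (G i s) (g i s)) \<noteq>
   indicator (S i) s *\<^sub>R (sweep \<phi> w (velocity (g i) s) (g i s))" by blast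
   have "s \<in> S i"
   proof (rule ccontr)
    assume "s \<notin> S i"
    then show False using ne by simp
   qed
   moreover have "s \<notin> D i" using ne vector_derivative_at[OF gD[OF i]] by (auto simp: indicator_def)
   ultimately show "s \<in> {0..1} - D i" using S(2)[OF i] by auto
  qed
 qed
 have int1: "integrable lebesgue (\<lambda>s. indicator (S i \<inter> D i) s *\<^sub>R (sweep \<phi> w (G i s) (g i s)))"
  if i: "i \<in> I" for i using piece(3)[OF i] unfolding set_integrable_def .
 have int2: "integrable lebesgue (\<lambda>s. indicator (S i) s *\<^sub>R (sweep \<phi> w (velocity (g i) s) (g i s)))"
  and val2: "(LINT s:S i|lebesgue. sweep \<phi> w (velocity (g i) s) (g i s)) = (LINT z:P i|lebesgue. f z)"
  if i: "i \<in> I" for i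
 proof -
  have m: "(\<lambda>s. indicator (S i) s *\<^sub>R (sweep \<phi> w (velocity (g i) s) (g i s))) \<in> borel_measurable lebesgue"
   by (rule borel_measurable_AE[OF borel_measurable_integrable[OF int1[OF i]] eqAE[OF i]])
  show "integrable lebesgue (\<lambda>s. indicator (S i) s *\<^sub>R (sweep \<phi> w (velocity (g i) s) (g i s)))"
   using int1[OF i] integrable_cong_AE[OF borel_measurable_integrable[OF int1[OF i]] m eqAE[OF i]] by simp
  show "(LINT s:S i|lebesgue. sweep \<phi> w (velocity (g i) s) (g i s)) = (LINT z:P i|lebesgue. f z)"
   unfolding piece(4)[OF i] unfolding set_lebesgue_integral_def
   using integral_cong_AE[OF borel_measurable_integrable[OF int1[OF i]] m eqAE[OF i]] by simp
 qed
 show "set_integrable lebesgue (S i) (\<lambda>s. sweep \<phi> w (velocity (g i) s) (g i s))"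
  if "i \<in> I" for i using int2[OF that] unfolding set_integrable_def .
 have fi: "set_integrable lebesgue (P i) f" if i: "i \<in> I" for i
  using set_integrable_subset[OF int piece(1,2)[OF i]] unfolding f_def .
 have ov: "AE z in lebesgue. z \<in> P i \<and> z \<in> P j \<longrightarrow> i = j" if ij: "i \<in> I" "j \<in> I" for i j
 proof (cases "i = j")
  case False
  \<comment> \<open>By \<open>frontier_ray_unique\<close> two cones can meet only along rays to
    frontier points that both pieces contain, and there are finitely many of these.\<close>
  define N where "N = (\<Union>z\<in>g i ` S i \<inter> g j ` S j. ray w z)"
  have "negligible A" if A: "A \<in> (\<lambda>z. ray w z) ` (g i ` S i \<inter> g j ` S j)" for A
  proof -
   obtain z where z: "A = ray w z" using A by blast
   show ?thesis unfolding z by (rule negligible_ray)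
  qed
  then have "negligible N" unfolding N_def using disj[OF ij False] by (intro negligible_Union) blast+
  moreover have "P i \<inter> P j \<subseteq> N"
  proof
   fix z assume "z \<in> P i \<inter> P j"
   then obtain s r s' r' where sr: "s \<in> S i" "0 < r" "r < 1" "z = w + r *\<^sub>R (g i s - w)"
    "s' \<in> S j" "0 < r'" "r' < 1" "z = w + r' *\<^sub>R (g j s' - w)" unfolding P_def cone_map_def by auto
   have "g i s = g j s'"
    by (rule frontier_ray_unique[OF w, of _ _ r r', THEN conjunct1]) (use sr fr[OF ij(1)] fr[OF ij(2)] in auto)
   then have "g i s \<in> g i ` S i \<inter> g j ` S j" using sr(1,5) by (metis IntI imageI)
   moreover have "z \<in> ray w (g i s)" using sr(2-4) by auto
   ultimately show "z \<in> N" unfolding N_def by blast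
  qed
  ultimately show ?thesis by (intro AE_I'[of N]) (auto simp: negligible_iff_null_sets)
 qed simp
 define U where "U = (\<Union>i\<in>I. P i)"
 have Ul: "U \<in> sets lebesgue" unfolding U_def using I piece(1) by auto
 have UT: "U \<subseteq> T" unfolding U_def using piece(2) by blast
 \<comment> \<open>All that the cones can miss: the apex, the cones over parameters without a
   derivative, and the rays to frontier points outside all pieces.\<close>
 define N where "N = {w} \<union> (\<Union>i\<in>I. cone_map (g i) w ` (({0..1} - D i) \<times> {0<..<1})) \<union>
   (\<Union>z\<in>frontier T - (\<Union>i\<in>I. g i ` S i). ray w z)"
 have Nn: "negligible N" unfolding N_def
 proof (intro negligible_Un negligible_Union)
  show "negligible A" if A: "A \<in> (\<lambda>i. cone_map (g i) w ` (({0..1} - D i) \<times> {0<..<1})) ` I" for A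
  proof -
   obtain i where "i \<in> I" "A = cone_map (g i) w ` (({0..1} - D i) \<times> {0<..<1})" using A by auto
   then show ?thesis using negligible_cone[OF D(2) _ g, of i i w] by auto
  qed
  show "negligible A" if A: "A \<in> (\<lambda>z. ray w z) ` (frontier T - (\<Union>i\<in>I. g i ` S i))" for A
  proof -
   obtain z where z: "A = ray w z" using A by blast
   show ?thesis unfolding z by (rule negligible_ray)
  qed
 qed (use I cover in auto)
 have TU: "T - U \<subseteq> N"
 proof
  fix y assume y: "y \<in> T - U"
  show "y \<in> N"
  proof (cases "y = w")
   case False
   obtain z r where zr: "z \<in> frontier T" "0 < r" "r < 1" "y = w + r *\<^sub>R (z - w)"
    using ray_cover[OF w, of y] y False by blast
   show ?thesis
   proof (cases "z \<in> (\<Union>i\<in>I. g i ` S i)")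
    case True
    then obtain i s where isf: "i \<in> I" "s \<in> S i" "z = g i s" by auto
    have yc: "y = cone_map (g i) w (s, r)" unfolding cone_map_def using zr isf by simp
    have "s \<notin> D i"
    proof
     assume "s \<in> D i"
     then have "y \<in> P i" unfolding P_def yc using isf zr by auto
     then show False using y isf unfolding U_def by auto
    qed
    then have "(s, r) \<in> ({0..1} - D i) \<times> {0<..<1}" using isf zr S(2)[OF isf(1)] by auto
    then show ?thesis using isf(1) unfolding N_def yc by blast
   next
    case False
    then have "z \<in> frontier T - (\<Union>i\<in>I. g i ` S i)" using zr(1) by blast
    moreover have "y \<in> ray w z" using zr(2-4) by auto
    ultimately show ?thesis unfolding N_def by blast
   qed
  qed (simp add: N_def)
 qed
 have Ti: "integrable lebesgue (\<lambda>z. indicator T z *\<^sub>R f z)" using int unfolding set_integrable_def f_def .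
 have Ui: "integrable lebesgue (\<lambda>z. indicator U z *\<^sub>R f z)"
  using set_integrable_subset[OF int Ul UT] unfolding set_integrable_def f_def .
 have "AE z in lebesgue. indicator T z *\<^sub>R f z = indicator U z *\<^sub>R f z"
  by (rule AE_I'[of N]) (use Nn UT TU in \<open>auto simp: negligible_iff_null_sets indicator_def\<close>)
 then have "(LINT z:T|lebesgue. f z) = (LINT z:U|lebesgue. f z)"
  unfolding set_lebesgue_integral_def using Ti Ui by (intro integral_cong_AE) auto
 also have "\<dots> = (\<Sum>i\<in>I. LINT z:P i|lebesgue. f z)" unfolding U_def
  by (rule set_integral_finite_UN_AE[OF I ov piece(1) fi])
 also have "\<dots> = (\<Sum>i\<in>I. LINT s:S i|lebesgue. sweep \<phi> w (velocity (g i) s) (g i s))" using val2 by simp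
 finally show "(LINT z:T|lebesgue. cone_density \<phi> \<phi>1 \<phi>2 w z) =
   (\<Sum>i\<in>I. LINT s:S i|lebesgue. sweep \<phi> w (velocity (g i) s) (g i s))" unfolding f_def .
qed

end

text \<open>In the plane a vector perpendicular to the unit vector n is a multiple of n turned by a
  right angle. This converts swept area into flux through a curve with normal n.\<close>

lemma abs_cross2_normal:
 assumes n: "norm n = 1" "n \<bullet> v = 0"
 shows "\<bar>cross2 v b\<bar> = norm v * \<bar>b \<bullet> n\<bar>"
proof -
 obtain n1 n2 where nn: "n = (n1, n2)" by (cases n)
 obtain v1 v2 where vv: "v = (v1, v2)" by (cases v)
 obtain b1 b2 where bb: "b = (b1, b2)" by (cases b)
 have 1: "n1\<^sup>2 + n2\<^sup>2 = 1" "n1 * v1 + n2 * v2 = 0" using n unfolding nn vv by (auto simp: norm_Pair)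
 define c where "c = n1 * v2 - n2 * v1"
 have v1: "v1 = - c * n2" and v2: "v2 = c * n1" unfolding c_def using 1 by algebra+
 have "v1\<^sup>2 + v2\<^sup>2 = c\<^sup>2" using v1 v2 1 by algebra
 then have nv: "norm v = \<bar>c\<bar>" unfolding vv norm_Pair by simp
 have "cross2 v b = - c * (b \<bullet> n)" unfolding cross2_def vv bb nn v1 v2 by (simp add: algebra_simps)
 then show ?thesis using nv by (simp add: abs_mult)
qed

lemma abs_cross2_le: "\<bar>cross2 a b\<bar> \<le> norm a * norm b"
proof -
 obtain a1 a2 where a: "a = (a1, a2)" by (cases a)
 obtain b1 b2 where b: "b = (b1, b2)" by (cases b)
 have "(cross2 a b)\<^sup>2 + (a \<bullet> b)\<^sup>2 = (norm a * norm b)\<^sup>2"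
  unfolding a b cross2_def norm_Pair by (simp add: power_mult_distrib) algebra
 then have "(cross2 a b)\<^sup>2 \<le> (norm a * norm b)\<^sup>2" using zero_le_power2[of "a \<bullet> b"] by linarith
 then show ?thesis by (metis abs_le_square_iff abs_of_nonneg mult_nonneg_nonneg norm_ge_zero)
qed

lemma set_integrable_continuous_closure:
 fixes \<phi> :: "pt \<Rightarrow> real"
 assumes "open T" "bounded T" "continuous_on (closure T) \<phi>"
 shows "set_integrable lebesgue T \<phi>"
proof -
 have c: "compact (closure T)" using assms by (simp add: compact_closure)
 have "set_integrable lborel (closure T) \<phi>"
  unfolding set_integrable_def by (rule borel_integrable_compact[OF c assms(3)])
 then have "set_integrable lebesgue (closure T) \<phi>"
  unfolding set_integrable_def by (subst integrable_completion) (auto intro: borel_measurable_integrable)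
 then show ?thesis by (rule set_integrable_subset) (use assms(1) closure_subset in auto)
qed

lemma set_integrable_mult_bounded:
 fixes \<phi> \<psi> :: "'a \<Rightarrow> real"
 assumes \<psi>: "set_integrable M T \<psi>" and \<phi>: "set_borel_measurable M T \<phi>" and b: "\<And>z. z \<in> T \<Longrightarrow> \<bar>\<phi> z\<bar> \<le> B"
 shows "set_integrable M T (\<lambda>z. \<phi> z * \<psi> z)"
proof -
 have "integrable M (\<lambda>z. indicator T z *\<^sub>R (\<phi> z * \<psi> z))"
 proof (rule Bochner_Integration.integrable_bound)
  show "integrable M (\<lambda>z. B * (indicator T z *\<^sub>R \<psi> z))" using \<psi> unfolding set_integrable_def by simp
  have "(\<lambda>z. (indicator T z *\<^sub>R \<phi> z) * (indicator T z *\<^sub>R \<psi> z)) \<in> borel_measurable M"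
   using \<psi> \<phi> unfolding set_integrable_def set_borel_measurable_def by (intro borel_measurable_times) auto
  then show "(\<lambda>z. indicator T z *\<^sub>R (\<phi> z * \<psi> z)) \<in> borel_measurable M"
   by (rule measurable_cong[THEN iffD1, rotated]) (auto simp: indicator_def)
  show "AE z in M. norm (indicator T z *\<^sub>R (\<phi> z * \<psi> z)) \<le> norm (B * (indicator T z *\<^sub>R \<psi> z))"
  proof (rule AE_I2)
   fix z
   show "norm (indicator T z *\<^sub>R (\<phi> z * \<psi> z)) \<le> norm (B * (indicator T z *\<^sub>R \<psi> z))"
   proof (cases "z \<in> T")
    case True
    then have "\<bar>\<phi> z\<bar> \<le> \<bar>B\<bar>" using b[OF True] by linarith
    then show ?thesis using True by (auto simp: abs_mult intro: mult_right_mono)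
   qed simp
  qed
 qed
 then show ?thesis unfolding set_integrable_def .
qed

lemma set_borel_measurable_continuous_open:
 fixes \<phi> :: "pt \<Rightarrow> real"
 assumes "open T" "continuous_on T \<phi>"
 shows "set_borel_measurable lebesgue T \<phi>"
proof -
 have "(\<lambda>z. indicator T z *\<^sub>R \<phi> z) \<in> borel_measurable borel"
  using assms by (intro borel_measurable_continuous_on_indicator) auto
 then have "(\<lambda>z. indicator T z *\<^sub>R \<phi> z) \<in> borel_measurable lborel" by simp
 then show ?thesis unfolding set_borel_measurable_def by (rule measurable_completion)
qed

text \<open>By \<open>normal\<close>, (g - w) . \<nu> is positive for every centre w in the ball, so
  the absolute values in \<open>sweep\<close> drop and the flux becomes affine in w. Subtracting the
  identities for x0 and x0 + k e leaves k e . grad \<phi> inside and, up to sign, k \<phi> (e .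
  \<nu>) on the boundary.\<close>

theorem (in star_domain) star_divergence:
 fixes \<phi> \<phi>1 \<phi>2 :: "pt \<Rightarrow> real" and g :: "'i \<Rightarrow> real \<Rightarrow> pt"
 assumes cont: "continuous_on (closure T) \<phi>"
  and der: "\<And>z. z \<in> T \<Longrightarrow> (\<phi> has_derivative (\<lambda>h. fst h * \<phi>1 z + snd h * \<phi>2 z)) (at z)"
  and c1: "continuous_on T \<phi>1" and c2: "continuous_on T \<phi>2"
  and i1: "set_integrable lebesgue T \<phi>1" and i2: "set_integrable lebesgue T \<phi>2"
  and I: "finite I" and g: "\<And>i. i \<in> I \<Longrightarrow> (L i)-lipschitz_on {0..1} (g i)"
  and S: "\<And>i. i \<in> I \<Longrightarrow> S i \<in> sets borel" "\<And>i. i \<in> I \<Longrightarrow> S i \<subseteq> {0..1}"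
  and inj: "\<And>i. i \<in> I \<Longrightarrow> inj_on (g i) (S i)" and fr: "\<And>i. i \<in> I \<Longrightarrow> g i ` S i \<subseteq> frontier T"
  and cover: "finite (frontier T - (\<Union>i\<in>I. g i ` S i))"
  and disj: "\<And>i j. i \<in> I \<Longrightarrow> j \<in> I \<Longrightarrow> i \<noteq> j \<Longrightarrow> finite (g i ` S i \<inter> g j ` S j)"
  and normal: "\<And>i. i \<in> I \<Longrightarrow> AE s in lebesgue. s \<in> S i \<longrightarrow> velocity (g i) s \<noteq> 0 \<longrightarrow>
    norm (\<nu> i s) = 1 \<and> \<nu> i s \<bullet> velocity (g i) s = 0 \<and> (\<forall>w\<in>ball x0 \<rho>. 0 < (g i s - w) \<bullet> \<nu> i s)"
 shows "(LINT z:T|lebesgue. e \<bullet> (\<phi>1 z, \<phi>2 z)) =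
   (\<Sum>i\<in>I. LINT s:S i|lebesgue. \<phi> (g i s) * (e \<bullet> \<nu> i s) * norm (velocity (g i) s))"
proof (cases "e = 0")
 case False
 define f where "f w z = cone_density \<phi> \<phi>1 \<phi>2 w z" for w z
 have bd: "\<exists>B. \<forall>z\<in>T. \<bar>fst (z - w)\<bar> \<le> B \<and> \<bar>snd (z - w)\<bar> \<le> B" for w
 proof -
  obtain B where B: "\<And>z. z \<in> T \<Longrightarrow> norm z \<le> B" using bounded_T unfolding bounded_iff by auto
  have "\<bar>fst (z - w)\<bar> \<le> B + norm w \<and> \<bar>snd (z - w)\<bar> \<le> B + norm w" if "z \<in> T" for z
   using B[OF that] dist_fst_le[of z w] dist_snd_le[of z w] norm_triangle_ineq4[of z w] by (auto simp: dist_norm)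
  then show ?thesis by blast
 qed
 have fint: "set_integrable lebesgue T (f w)" for w
 proof -
  obtain B where B: "\<And>z. z \<in> T \<Longrightarrow> \<bar>fst (z - w)\<bar> \<le> B" "\<And>z. z \<in> T \<Longrightarrow> \<bar>snd (z - w)\<bar> \<le> B" using bd by blast
  have "set_integrable lebesgue T (\<lambda>z. fst (z - w) * \<phi>1 z)" by (rule set_integrable_mult_bounded[OF i1 _ B(1)])
     (intro set_borel_measurable_continuous_open open_T continuous_intros, assumption)
  moreover have "set_integrable lebesgue T (\<lambda>z. snd (z - w) * \<phi>2 z)"
   by (rule set_integrable_mult_bounded[OF i2 _ B(2)])
     (intro set_borel_measurable_continuous_open open_T continuous_intros, assumption)
  moreover have "set_integrable lebesgue T (\<lambda>z. 2 * \<phi> z)"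
   using set_integrable_continuous_closure[OF open_T bounded_T cont] by simp
  ultimately show ?thesis unfolding f_def by (intro set_integral_add)
 qed
 define c where "c i w s = sweep \<phi> w (velocity (g i) s) (g i s)" for i w s
 have flux: "\<And>i. i \<in> I \<Longrightarrow> set_integrable lebesgue (S i) (c i w)"
  "(LINT z:T|lebesgue. f w z) = (\<Sum>i\<in>I. LINT s:S i|lebesgue. c i w s)" if w: "w \<in> ball x0 \<rho>" for w
  unfolding c_def f_def
  by (rule star_flux[OF w cont der c1 c2 fint[of w, unfolded f_def] I g S inj fr cover disj]; assumption)+
 \<comment> \<open>This factor puts the second centre at distance \<rho> / 2 from x0.\<close>
 define k where "k = \<rho> / (2 * norm e)"
 have k: "k > 0" unfolding k_def using rho_pos False by simp
 define w where "w = x0 + k *\<^sub>R e"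
 have w0: "x0 \<in> ball x0 \<rho>" using rho_pos by simp
 have w: "w \<in> ball x0 \<rho>" using rho_pos False unfolding w_def k_def by (simp add: dist_norm)
 have "f x0 z - f w z = k * (e \<bullet> (\<phi>1 z, \<phi>2 z))" for z unfolding f_def w_def by (cases e) (simp add: algebra_simps)
 then have "k * (LINT z:T|lebesgue. e \<bullet> (\<phi>1 z, \<phi>2 z)) = (LINT z:T|lebesgue. f x0 z - f w z)" by simp
 also have "\<dots> = (LINT z:T|lebesgue. f x0 z) - (LINT z:T|lebesgue. f w z)" by (rule set_integral_diff(2)[OF fint fint])
 also have "\<dots> = (\<Sum>i\<in>I. (LINT s:S i|lebesgue. c i x0 s) - (LINT s:S i|lebesgue. c i w s))"
  unfolding flux(2)[OF w0] flux(2)[OF w] sum_subtractf ..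
 also have "\<dots> = (\<Sum>i\<in>I. k * (LINT s:S i|lebesgue. \<phi> (g i s) * (e \<bullet> \<nu> i s) * norm (velocity (g i) s)))"
 proof (rule sum.cong[OF refl])
  fix i assume i: "i \<in> I"
  have "(LINT s:S i|lebesgue. c i x0 s) - (LINT s:S i|lebesgue. c i w s) = (LINT s:S i|lebesgue. c i x0 s - c i w s)"
   by (rule set_integral_diff(2)[symmetric, OF flux(1)[OF w0 i] flux(1)[OF w i]])
  also have "\<dots> = (LINT s:S i|lebesgue. k * (\<phi> (g i s) * (e \<bullet> \<nu> i s) * norm (velocity (g i) s)))"
  proof -
   have AE: "AE s in lebesgue. indicator (S i) s *\<^sub>R (c i x0 s - c i w s) =
     indicator (S i) s *\<^sub>R (k * (\<phi> (g i s) * (e \<bullet> \<nu> i s) * norm (velocity (g i) s)))" using normal[OF i]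
   proof eventually_elim
    fix s assume n: "s \<in> S i \<longrightarrow> velocity (g i) s \<noteq> 0 \<longrightarrow>
    norm (\<nu> i s) = 1 \<and> \<nu> i s \<bullet> velocity (g i) s = 0 \<and> (\<forall>w\<in>ball x0 \<rho>. 0 < (g i s - w) \<bullet> \<nu> i s)"
    let ?v = "velocity (g i) s"
    show "indicator (S i) s *\<^sub>R (c i x0 s - c i w s) =
     indicator (S i) s *\<^sub>R (k * (\<phi> (g i s) * (e \<bullet> \<nu> i s) * norm ?v))"
    proof (cases "s \<in> S i \<and> ?v \<noteq> 0")
     case True
     then have nn: "norm (\<nu> i s) = 1" "\<nu> i s \<bullet> ?v = 0" "0 < (g i s - x0) \<bullet> \<nu> i s" "0 < (g i s - w) \<bullet> \<nu> i s"
      using n w w0 by auto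
     have "c i x0 s - c i w s = \<phi> (g i s) * norm ?v * ((g i s - x0) \<bullet> \<nu> i s - (g i s - w) \<bullet> \<nu> i s)"
      unfolding c_def abs_cross2_normal[OF nn(1,2)] using nn(3,4) by (simp add: algebra_simps)
     also have "(g i s - x0) \<bullet> \<nu> i s - (g i s - w) \<bullet> \<nu> i s = k * (e \<bullet> \<nu> i s)"
      unfolding w_def by (simp add: inner_diff_left inner_add_left)
     finally show ?thesis by simp
    qed (auto simp: c_def cross2_def)
   qed
   have m1: "(\<lambda>s. indicator (S i) s *\<^sub>R (c i x0 s - c i w s)) \<in> borel_measurable lebesgue"
    using set_integral_diff(1)[OF flux(1)[OF w0 i] flux(1)[OF w i]] unfolding set_integrable_def
    by (rule borel_measurable_integrable)
   show ?thesis unfolding set_lebesgue_integral_def by (rule integral_cong_AE[OF m1 borel_measurable_AE[OF m1 AE] AE])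
  qed
  also have "\<dots> = k * (LINT s:S i|lebesgue. \<phi> (g i s) * (e \<bullet> \<nu> i s) * norm (velocity (g i) s))" by simp
  finally show "(LINT s:S i|lebesgue. c i x0 s) - (LINT s:S i|lebesgue. c i w s) =
   k * (LINT s:S i|lebesgue. \<phi> (g i s) * (e \<bullet> \<nu> i s) * norm (velocity (g i) s))" .
 qed
 finally show ?thesis using k unfolding sum_distrib_left[symmetric] by simp
qed (simp add: set_lebesgue_integral_def)

section \<open>Outer normals\<close>

text \<open>Moving from z in the direction m - n enters the set according to n and leaves it
  according to m.\<close>

lemma is_outer_normal_unique:
 assumes n: "is_outer_normal S z n" and m: "is_outer_normal S z m"
 shows "n = m"
proof (rule ccontr)
 assume ne: "n \<noteq> m"
 have u: "norm n = 1" "norm m = 1" using n m unfolding is_outer_normal_def by auto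
 define d where "d = m - n"
 define c where "c = n \<bullet> m"
 have dn: "d \<bullet> n = c - 1" "d \<bullet> m = 1 - c" unfolding d_def c_def using u
  by (simp_all add: inner_diff_left inner_commute[of m n] dot_square_norm)
 have nd: "norm d > 0" unfolding d_def using ne by simp
 have "(norm d)\<^sup>2 = 2 * (1 - c)" unfolding power2_norm_eq_inner using dn unfolding d_def
  by (simp add: inner_diff_right)
 then have c: "c < 1" using nd by (smt (verit) zero_less_power2)
 \<comment> \<open>The displacement d has normal component 1 - c per length |d| with respect to m,
   and the opposite with respect to n. Half of this ratio leaves room for both strict
   inequalities.\<close>
 define \<epsilon> where "\<epsilon> = (1 - c) / (2 * norm d)"
 have e: "\<epsilon> > 0" unfolding \<epsilon>_def using c nd by simp
 obtain r where r: "r > 0" "\<And>w. norm (w - z) < r \<Longrightarrow> (w - z) \<bullet> n < - \<epsilon> * norm (w - z) \<Longrightarrow> w \<in> S"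
  using n e unfolding is_outer_normal_def by blast
 obtain r' where r': "r' > 0" "\<And>w. norm (w - z) < r' \<Longrightarrow> (w - z) \<bullet> m > \<epsilon> * norm (w - z) \<Longrightarrow> w \<notin> S"
  using m e unfolding is_outer_normal_def by blast
 define t where "t = min r r' / (2 * norm d)"
 have t: "t > 0" unfolding t_def using r r' nd by simp
 define w where "w = z + t *\<^sub>R d"
 have nw: "norm (w - z) = t * norm d" unfolding w_def using t by simp
 have "t * norm d = min r r' / 2" unfolding t_def using nd by simp
 then have lt: "norm (w - z) < r" "norm (w - z) < r'" using nw r r' by auto
 have en: "\<epsilon> * norm (w - z) = t * (1 - c) / 2" unfolding nw \<epsilon>_def using nd by simp
 have "t * (1 - c) > 0" using t c by simp
 moreover have "(w - z) \<bullet> n = - (t * (1 - c))" "(w - z) \<bullet> m = t * (1 - c)"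
  unfolding w_def by (simp_all add: dn algebra_simps)
 ultimately have "(w - z) \<bullet> n < - \<epsilon> * norm (w - z)" "(w - z) \<bullet> m > \<epsilon> * norm (w - z)" using en by linarith+
 then show False using r(2) r'(2) lt by blast
qed

lemma outer_normal_eq: "is_outer_normal S z n \<Longrightarrow> outer_normal S z = n"
 unfolding outer_normal_def using is_outer_normal_unique by blast

text \<open>This lets the normal of an element touching the boundary be identified with the normal
  of the domain.\<close>

lemma is_outer_normal_local:
 assumes e: "e > 0" and eq: "S \<inter> ball z e = S' \<inter> ball z e" and n: "is_outer_normal S z n"
 shows "is_outer_normal S' z n" unfolding is_outer_normal_def
proof (intro conjI allI impI)
 have fr: "z \<in> frontier S" using n unfolding is_outer_normal_def by auto
 show "norm n = 1" using n unfolding is_outer_normal_def by auto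
 show "z \<in> frontier S'" unfolding frontier_straddle mem_Collect_eq
 proof (intro allI impI)
  fix d :: real assume "d > 0"
  then have "min d e > 0" using e by simp
  then have "(\<exists>x\<in>S. dist z x < min d e) \<and> (\<exists>x. x \<notin> S \<and> dist z x < min d e)"
   using fr unfolding frontier_straddle by blast
  then show "(\<exists>x\<in>S'. dist z x < d) \<and> (\<exists>x. x \<notin> S' \<and> dist z x < d)" using eq by (auto simp: set_eq_iff)
 qed
 fix \<epsilon> :: real assume "\<epsilon> > 0"
 then obtain r where r: "r > 0" "\<forall>w. norm (w - z) < r \<longrightarrow> ((w - z) \<bullet> n < - \<epsilon> * norm (w - z) \<longrightarrow> w \<in> S) \<and>
    ((w - z) \<bullet> n > \<epsilon> * norm (w - z) \<longrightarrow> w \<notin> S)" using n unfolding is_outer_normal_def by blast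
 have "w \<in> S' \<longleftrightarrow> w \<in> S" if w: "norm (w - z) < min r e" for w
 proof -
  have "w \<in> ball z e" using w by (simp add: dist_norm norm_minus_commute)
  then show ?thesis using eq by blast
 qed
 then show "\<exists>r>0. \<forall>w. norm (w - z) < r \<longrightarrow> ((w - z) \<bullet> n < - \<epsilon> * norm (w - z) \<longrightarrow> w \<in> S') \<and>
    ((w - z) \<bullet> n > \<epsilon> * norm (w - z) \<longrightarrow> w \<notin> S')" using r e by (intro exI[of _ "min r e"]) auto
qed


lemma cross2_zero_parallel:
 assumes "cross2 u v = 0"
 shows "(u \<bullet> n) *\<^sub>R v = (v \<bullet> n) *\<^sub>R u"
proof -
 obtain u1 u2 v1 v2 n1 n2 where e: "u = (u1, u2)" "v = (v1, v2)" "n = (n1, n2)" by (metis surj_pair)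
 have "u1 * v2 = u2 * v1" using assms unfolding cross2_def e by simp
 then show ?thesis unfolding e by (simp add: algebra_simps)
qed

context star_domain
begin

text \<open>Otherwise z would lie strictly between w and a point of the closure, hence in T.\<close>

lemma opposite_cone_outside:
 assumes z: "z \<in> frontier T" and w: "w \<in> ball x0 \<rho>" and t: "t > 0"
 shows "z + t *\<^sub>R (z - w) \<notin> closure T"
proof
 assume a: "z + t *\<^sub>R (z - w) \<in> closure T"
 have "w + (1 / (1 + t)) *\<^sub>R ((z + t *\<^sub>R (z - w)) - w) = w + (1 / (1 + t)) *\<^sub>R ((1 + t) *\<^sub>R (z - w))"
  by (simp add: algebra_simps)
 also have "\<dots> = z" using t by simp
 finally have "z \<in> T" using open_segment_subset[OF w a, of "1 / (1 + t)"] t by simp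
 then show False using z open_T by (auto simp: frontier_def interior_open)
qed

text \<open>If the tangent met the ball at g s + \<tau> G, then curve points close to g s would lie
  on segments from points w' of the ball to g s, hence in T and not on its frontier.\<close>

lemma tangent_misses_ball:
 assumes fr: "\<And>t. \<bar>t - s\<bar> < d \<Longrightarrow> g t \<in> frontier T" and d: "d > 0"
  and der: "(g has_vector_derivative G) (at s)" and G: "G \<noteq> 0"
 shows "g s + \<tau> *\<^sub>R G \<notin> ball x0 \<rho>"
proof
 assume w: "g s + \<tau> *\<^sub>R G \<in> ball x0 \<rho>"
 have z: "g s \<in> frontier T" using fr[of s] d by simp
 have clT: "g s \<in> closure T" using z by (simp add: frontier_def)
 have "\<tau> \<noteq> 0" using w z ball_subset open_T by (auto simp: frontier_def interior_open)
 obtain e where e: "e > 0" "ball (g s + \<tau> *\<^sub>R G) e \<subseteq> ball x0 \<rho>" using openE[OF open_ball w] by blast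
 \<comment> \<open>When the end point on the tangent is corrected to w', the remainder R of the
   tangent approximation is magnified by \<tau> / h. This \<eta> keeps the correction at most e /
   2.\<close>
 define \<eta> where "\<eta> = e / (2 * \<bar>\<tau>\<bar>)"
 have eta: "\<eta> > 0" unfolding \<eta>_def using e \<open>\<tau> \<noteq> 0\<close> by simp
 have "(g has_derivative (\<lambda>h. h *\<^sub>R G)) (at s)" using der unfolding has_vector_derivative_def .
 then obtain k where k: "k > 0" "\<And>y. norm (y - s) < k \<Longrightarrow> norm (g y - g s - (y - s) *\<^sub>R G) \<le> \<eta> * norm (y - s)"
  using eta unfolding has_derivative_at_alt by blast
 define m0 where "m0 = min (min (k / 2) (d / 2)) (\<bar>\<tau>\<bar> / 2)"
 \<comment> \<open>The sign of \<tau> and the bound by |\<tau>| place h / \<tau> strictly between 0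
   and 1, so that g (s + h) falls on the open segment.\<close>
 define h where "h = sgn \<tau> * m0"
 have m: "m0 > 0" "m0 < k" "m0 < d" "m0 < \<bar>\<tau>\<bar>" unfolding m0_def using k d \<open>\<tau> \<noteq> 0\<close> by auto
 then have h: "\<bar>h\<bar> < k" "\<bar>h\<bar> < d" "\<bar>h\<bar> < \<bar>\<tau>\<bar>" "h \<noteq> 0" unfolding h_def using \<open>\<tau> \<noteq> 0\<close> by (auto simp: abs_mult sgn_zero_iff)
 have ht: "0 < h / \<tau>" unfolding h_def using m \<open>\<tau> \<noteq> 0\<close> by (cases "\<tau> > 0") (auto simp: sgn_if divide_less_0_iff)
 have "h / \<tau> < 1" using h(3) \<open>\<tau> \<noteq> 0\<close> by (cases "\<tau> > 0") (auto simp: divide_less_eq)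
 define R where "R = g (s + h) - g s - h *\<^sub>R G"
 have R: "norm R \<le> \<eta> * \<bar>h\<bar>" using k(2)[of "s + h"] h unfolding R_def by simp
 define w' where "w' = g s + \<tau> *\<^sub>R G + (\<tau> / h) *\<^sub>R R"
 have "norm ((\<tau> / h) *\<^sub>R R) \<le> \<bar>\<tau> / h\<bar> * (\<eta> * \<bar>h\<bar>)" unfolding norm_scaleR by (rule mult_left_mono[OF R]) simp
 also have "\<dots> = e / 2" unfolding \<eta>_def using h \<open>\<tau> \<noteq> 0\<close> by simp
 finally have nR: "norm ((\<tau> / h) *\<^sub>R R) \<le> e / 2" .
 have "dist (g s + \<tau> *\<^sub>R G) w' = norm ((\<tau> / h) *\<^sub>R R)"
  unfolding w'_def dist_norm by (metis add_diff_cancel_left' norm_minus_commute)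
 then have "w' \<in> ball (g s + \<tau> *\<^sub>R G) e" unfolding mem_ball using nR e(1) by linarith
 then have "w' \<in> ball x0 \<rho>" using e(2) by blast
 moreover have "g (s + h) = w' + (1 - h / \<tau>) *\<^sub>R (g s - w')"
 proof -
  have "w' + (1 - h / \<tau>) *\<^sub>R (g s - w') = g s + (h / \<tau>) *\<^sub>R (w' - g s)" by (simp add: algebra_simps)
  also have "\<dots> = g s + (h *\<^sub>R G + R)" unfolding w'_def using h \<open>\<tau> \<noteq> 0\<close> by (simp add: scaleR_add_right)
  also have "\<dots> = g (s + h)" unfolding R_def by simp
  finally show ?thesis ..
 qed
 ultimately have "g (s + h) \<in> T" using open_segment_subset[OF _ clT, of w' "1 - h / \<tau>"] ht \<open>h / \<tau> < 1\<close> by simp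
 then show False using fr[of "s + h"] h open_T by (auto simp: frontier_def interior_open)
qed

text \<open>Intermediate value theorem for \<open>cross2 (g t - x) (y - x)\<close>, which vanishes
  where the curve meets the line through x and y. The crossing has |t - s| at most a fixed multiple
  of |y - g s|, and this makes the deviation of g t from the tangent small relative to |y - g
  s|.\<close>

lemma ray_crosses_curve:
 assumes cont: "continuous_on {s - d..s + d} g" and d: "d > 0"
  and der: "(g has_vector_derivative G) (at s)" and G: "cross2 G (g s - x) \<noteq> 0" and eta: "\<eta> > 0"
 obtains r where "r > 0" "\<And>y. norm (y - g s) < r \<Longrightarrow> y \<noteq> g s \<Longrightarrow>
   \<exists>t. \<bar>t - s\<bar> < d \<and> cross2 (g t - x) (y - x) = 0 \<and> norm (g t - g s - (t - s) *\<^sub>R G) \<le> \<eta> * norm (y - g s)"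
proof -
 define b where "b = g s - x"
 define \<kappa> where "\<kappa> = \<bar>cross2 G b\<bar>"
 have kp: "\<kappa> > 0" using G unfolding \<kappa>_def b_def by simp
 define M where "M = norm b + 1"
 have M: "M \<ge> 1" "norm b \<le> M" unfolding M_def by auto
 \<comment> \<open>At t = s + C \<Delta> and t = s - C \<Delta> the leading term has size C \<Delta>
   \<kappa>. With this C, and with the first bound in \<eta>' below, each of the three error terms
   is at most a quarter of it, so the signs at the two ends are opposite. The second bound in
   \<eta>' serves the final estimate.\<close>
 define C where "C = 4 * M / \<kappa>"
 have C: "C > 0" unfolding C_def using M kp by simp
 have "C * \<kappa> = 4 * M" unfolding C_def using kp by simp
 then have MD: "M * t = C * \<kappa> * t / 4" for t by simp
 define \<eta>' where "\<eta>' = min (\<kappa> / (4 * M)) (\<eta> / C)"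
 have e': "\<eta>' > 0" "\<eta>' \<le> \<kappa> / (4 * M)" "\<eta>' \<le> \<eta> / C" unfolding \<eta>'_def using kp M C eta by auto
 have eM: "\<eta>' * M \<le> \<kappa> / 4" using e'(2) M by (simp add: field_simps)
 have eC: "\<eta>' * C \<le> \<eta>" using e'(3) C by (simp add: field_simps)
 have "(g has_derivative (\<lambda>h. h *\<^sub>R G)) (at s)" using der unfolding has_vector_derivative_def .
 then obtain k where k: "k > 0" "\<And>y. norm (y - s) < k \<Longrightarrow> norm (g y - g s - (y - s) *\<^sub>R G) \<le> \<eta>' * norm (y - s)"
  using e'(1) unfolding has_derivative_at_alt by blast
 define r where "r = min (min (k / (2 * C)) (d / (2 * C))) (min 1 (\<kappa> / (4 * (norm G + 1))))"
 have nG: "norm G + 1 > 0" using norm_ge_zero[of G] by linarith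
 have r: "r > 0" "r \<le> k / (2 * C)" "r \<le> d / (2 * C)" "r \<le> 1" "r \<le> \<kappa> / (4 * (norm G + 1))"
  unfolding r_def using k d C kp nG by auto
 have "\<exists>t. \<bar>t - s\<bar> < d \<and> cross2 (g t - x) (y - x) = 0 \<and> norm (g t - g s - (t - s) *\<^sub>R G) \<le> \<eta> * norm (y - g s)"
  if y: "norm (y - g s) < r" "y \<noteq> g s" for y
 proof -
  define \<Delta> where "\<Delta> = norm (y - g s)"
  have D: "\<Delta> > 0" "\<Delta> < r" unfolding \<Delta>_def using y by auto
  have CD: "C * \<Delta> < k" "C * \<Delta> < d"
  proof -
   have "C * \<Delta> < C * r" using D C by simp
   also have "\<dots> \<le> k / 2" using r(2) C by (simp add: field_simps)
   finally show "C * \<Delta> < k" using k by simp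
   have "C * \<Delta> < C * r" using D C by simp
   also have "\<dots> \<le> d / 2" using r(3) C by (simp add: field_simps)
   finally show "C * \<Delta> < d" using d by simp
  qed
  define \<psi> where "\<psi> t = cross2 (g t - x) (y - x)" for t
  have est: "\<bar>\<psi> (s + h) - h * cross2 G b\<bar> < C * \<Delta> * \<kappa>" if h: "\<bar>h\<bar> = C * \<Delta>" for h
  proof -
   define R where "R = g (s + h) - g s - h *\<^sub>R G"
   have R: "norm R \<le> \<eta>' * (C * \<Delta>)" using k(2)[of "s + h"] h CD unfolding R_def by simp
   have gR: "g (s + h) - x = b + h *\<^sub>R G + R" unfolding R_def b_def by simp
   have yx: "y - x = b + (y - g s)" unfolding b_def by simp
   have "\<psi> (s + h) - h * cross2 G b = cross2 b (y - g s) + h * cross2 G (y - g s) + cross2 R (y - x)"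
    unfolding \<psi>_def gR unfolding yx by (simp add: cross2_def algebra_simps)
   also have "\<bar>\<dots>\<bar> \<le> \<bar>cross2 b (y - g s)\<bar> + \<bar>h\<bar> * \<bar>cross2 G (y - g s)\<bar> + \<bar>cross2 R (y - x)\<bar>"
    using abs_triangle_ineq[of "cross2 b (y - g s) + h * cross2 G (y - g s)" "cross2 R (y - x)"]
     abs_triangle_ineq[of "cross2 b (y - g s)" "h * cross2 G (y - g s)"] by (simp add: abs_mult)
   also have "\<dots> \<le> M * \<Delta> + (C * \<Delta>) * (\<kappa> / 4) + (\<eta>' * (C * \<Delta>)) * M"
   proof (intro add_mono mult_mono)
    show "\<bar>cross2 b (y - g s)\<bar> \<le> M * \<Delta>"
     using order_trans[OF abs_cross2_le mult_right_mono[OF M(2)]] unfolding \<Delta>_def by simp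
    have "\<bar>cross2 G (y - g s)\<bar> \<le> norm G * \<Delta>" unfolding \<Delta>_def by (rule abs_cross2_le)
    also have "\<dots> \<le> (norm G + 1) * r" using D by (intro mult_mono) auto
    also have "\<dots> \<le> \<kappa> / 4" using r(5) nG by (simp add: field_simps)
    finally show "\<bar>cross2 G (y - g s)\<bar> \<le> \<kappa> / 4" .
    have "norm (y - x) \<le> norm b + \<Delta>" unfolding yx \<Delta>_def by (rule norm_triangle_ineq)
    then have nyx: "norm (y - x) \<le> M" using D r(4) unfolding M_def by linarith
    have "\<bar>cross2 R (y - x)\<bar> \<le> norm R * norm (y - x)" by (rule abs_cross2_le)
    also have "\<dots> \<le> (\<eta>' * (C * \<Delta>)) * M" using R nyx M D C e' by (intro mult_mono) auto
    finally show "\<bar>cross2 R (y - x)\<bar> \<le> \<eta>' * (C * \<Delta>) * M" .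
   qed (use h C D kp in auto)
   also have "\<dots> = C * \<kappa> * \<Delta> / 4 + C * \<kappa> * \<Delta> / 4 + (\<eta>' * M) * (C * \<Delta>)" unfolding MD by (simp add: algebra_simps)
   also have "\<dots> \<le> C * \<kappa> * \<Delta> / 4 + C * \<kappa> * \<Delta> / 4 + (\<kappa> / 4) * (C * \<Delta>)"
    using eM C D by (intro add_left_mono mult_right_mono) auto
   also have "\<dots> = 3 / 4 * (C * \<Delta> * \<kappa>)" by (simp add: algebra_simps)
   also have "\<dots> < C * \<Delta> * \<kappa>" using C D kp by simp
   finally show ?thesis .
  qed
  have cont\<psi>: "continuous_on {s - C * \<Delta>..s + C * \<Delta>} \<psi>"
  proof -
   have "continuous_on {s - C * \<Delta>..s + C * \<Delta>} g" by (rule continuous_on_subset[OF cont]) (use CD in auto)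
   then show ?thesis unfolding \<psi>_def cross2_def by (intro continuous_intros)
  qed
  have "\<exists>t\<ge>s - C * \<Delta>. t \<le> s + C * \<Delta> \<and> \<psi> t = 0"
  proof (cases "cross2 G b > 0")
   case True
   then have "\<psi> (s - C * \<Delta>) \<le> 0" "0 \<le> \<psi> (s + C * \<Delta>)"
    using est[of "C * \<Delta>"] est[of "- (C * \<Delta>)"] C D unfolding \<kappa>_def by (auto simp: abs_less_iff)
   then show ?thesis using IVT'[OF _ _ _ cont\<psi>, of 0] C D by auto
  next
   case False
   then have "\<psi> (s + C * \<Delta>) \<le> 0" "0 \<le> \<psi> (s - C * \<Delta>)"
    using est[of "C * \<Delta>"] est[of "- (C * \<Delta>)"] C D unfolding \<kappa>_def by (auto simp: abs_less_iff)
   then show ?thesis using IVT2'[OF _ _ _ cont\<psi>, of 0] C D by auto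
  qed
  then obtain t where t: "\<bar>t - s\<bar> \<le> C * \<Delta>" "\<psi> t = 0" by (auto simp: abs_le_iff) (metis add.commute diff_le_eq)
  have "norm (g t - g s - (t - s) *\<^sub>R G) \<le> \<eta>' * \<bar>t - s\<bar>" using k(2)[of t] t CD by simp
  also have "\<dots> \<le> \<eta>' * (C * \<Delta>)" using t e' by (intro mult_left_mono) auto
  also have "\<dots> \<le> \<eta> * \<Delta>" using mult_right_mono[OF eC, of \<Delta>] D by (simp add: mult.assoc)
  finally show ?thesis using t CD unfolding \<psi>_def \<Delta>_def by (intro exI[of _ t]) auto
 qed
 then show ?thesis using that[OF r(1)] by blast
qed

text \<open>The line from x0 through a point y near z meets the curve at some g t close to the
  tangent, and by star shape y belongs to T if it lies before g t on this line and not if it lies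
  beyond. Which case occurs is read off from the normal components of y - x0 and g t - x0.\<close>

lemma outer_normal_star:
 assumes fr: "\<And>t. \<bar>t - s\<bar> \<le> d \<Longrightarrow> g t \<in> frontier T" and d: "d > 0"
  and cont: "continuous_on {s - d..s + d} g"
  and der: "(g has_vector_derivative G) (at s)" and G: "G \<noteq> 0"
 obtains n where "is_outer_normal T (g s) n" "n \<bullet> G = 0" "\<And>w. w \<in> ball x0 \<rho> \<Longrightarrow> 0 < (g s - w) \<bullet> n"
proof -
 define z where "z = g s"
 have z: "z \<in> frontier T" unfolding z_def using fr[of s] d by simp
 have miss: "z + \<tau> *\<^sub>R G \<notin> ball x0 \<rho>" for \<tau>
  unfolding z_def by (rule tangent_misses_ball[OF _ d der G]) (use fr in simp)
 define \<mu> where "\<mu> = (1 / norm G) *\<^sub>R (- snd G, fst G)"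
 define n where "n = (if (z - x0) \<bullet> \<mu> > 0 then \<mu> else - \<mu>)"
 have "norm (- snd G, fst G) = norm G" by (cases G) (simp add: norm_Pair add.commute)
 then have nmu: "norm \<mu> = 1" unfolding \<mu>_def norm_scaleR using G by simp
 have muG: "\<mu> \<bullet> G = 0" unfolding \<mu>_def by (cases G) simp
 have nn: "norm n = 1" "n \<bullet> G = 0" unfolding n_def using nmu muG by auto
 have nz: "(z - w) \<bullet> n \<noteq> 0" if w: "w \<in> ball x0 \<rho>" for w
 proof
  assume "(z - w) \<bullet> n = 0"
  then have "cross2 G (z - w) = 0" using abs_cross2_normal[OF nn, of "z - w"] by simp
  from cross2_zero_parallel[OF this, of G]
  have e: "(G \<bullet> G) *\<^sub>R (z - w) = ((z - w) \<bullet> G) *\<^sub>R G" .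
  have "z - w = (1 / (G \<bullet> G)) *\<^sub>R ((G \<bullet> G) *\<^sub>R (z - w))" using G by simp
  also have "\<dots> = (((z - w) \<bullet> G) / (G \<bullet> G)) *\<^sub>R G" unfolding e by simp
  finally have "w = z + (- (((z - w) \<bullet> G) / (G \<bullet> G))) *\<^sub>R G" by (simp add: algebra_simps)
  then show False using miss w by metis
 qed
 have x0b: "x0 \<in> ball x0 \<rho>" using rho_pos by simp
 have pos0: "(z - x0) \<bullet> n > 0" using nz[OF x0b] unfolding n_def by (auto split: if_splits)
 have pos: "(z - w) \<bullet> n > 0" if w: "w \<in> ball x0 \<rho>" for w
 proof (rule ccontr)
  assume neg: "\<not> (z - w) \<bullet> n > 0"
  \<comment> \<open>If w were not on the inner side of the tangent, the segment from x0 to w would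
    cross the tangent inside the ball; l is the parameter of the crossing.\<close>
  define l where "l = (z - x0) \<bullet> n / ((z - x0) \<bullet> n - (z - w) \<bullet> n)"
  have l: "0 \<le> l" "l \<le> 1" unfolding l_def using pos0 neg by (auto simp: field_simps)
  have "x0 + l *\<^sub>R (w - x0) \<in> ball x0 \<rho>"
  proof -
   have "norm (l *\<^sub>R (w - x0)) \<le> 1 * norm (w - x0)" unfolding norm_scaleR using l by (intro mult_right_mono) auto
   then show ?thesis using w by (simp add: dist_norm norm_minus_commute)
  qed
  moreover have "(z - (x0 + l *\<^sub>R (w - x0))) \<bullet> n = (z - x0) \<bullet> n - l * ((z - x0) \<bullet> n - (z - w) \<bullet> n)"
   by (simp add: inner_diff_left inner_add_left algebra_simps)
  then have "(z - (x0 + l *\<^sub>R (w - x0))) \<bullet> n = 0" unfolding l_def using pos0 neg by simp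
  ultimately show False using nz by blast
 qed
 have cr: "cross2 G (g s - x0) \<noteq> 0" using abs_cross2_normal[OF nn, of "z - x0"] pos0 G unfolding z_def by auto
 have "is_outer_normal T z n" unfolding is_outer_normal_def
 proof (intro conjI allI impI z nn(1))
  fix \<epsilon> :: real assume eps: "\<epsilon> > 0"
  define \<eta> where "\<eta> = min (\<epsilon> / 2) (1 / 2)"
  have eta: "\<eta> > 0" "\<eta> < \<epsilon>" "\<eta> \<le> 1 / 2" unfolding \<eta>_def using eps by auto
  obtain r where r: "r > 0" "\<And>y. norm (y - g s) < r \<Longrightarrow> y \<noteq> g s \<Longrightarrow>
    \<exists>t. \<bar>t - s\<bar> < d \<and> cross2 (g t - x0) (y - x0) = 0 \<and> norm (g t - g s - (t - s) *\<^sub>R G) \<le> \<eta> * norm (y - g s)"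
   by (rule ray_crosses_curve[OF cont d der cr eta(1)]) blast
  \<comment> \<open>The second bound keeps y and g t on the same side of x0 as z, so that \<alpha>
    and \<beta> are positive.\<close>
  define r' where "r' = min r ((z - x0) \<bullet> n)"
  have "(y \<in> T \<or> \<not> (y - z) \<bullet> n < - \<epsilon> * norm (y - z)) \<and> (y \<notin> T \<or> \<not> (y - z) \<bullet> n > \<epsilon> * norm (y - z))"
   if y: "norm (y - z) < r'" for y
  proof (cases "y = z")
   case False
   obtain t where t: "\<bar>t - s\<bar> < d" "cross2 (g t - x0) (y - x0) = 0" "norm (g t - g s - (t - s) *\<^sub>R G) \<le> \<eta> * norm (y - z)"
    using r(2)[of y] y False unfolding z_def r'_def by auto
   have gt: "g t \<in> frontier T" using fr[of t] t by simp
   define \<alpha> where "\<alpha> = (g t - x0) \<bullet> n"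
   define \<beta> where "\<beta> = (y - x0) \<bullet> n"
   have "(g t - z) \<bullet> n = (g t - g s - (t - s) *\<^sub>R G) \<bullet> n" unfolding z_def using nn(2)
    by (simp add: inner_diff_left inner_commute[of G n])
   then have gn: "\<bar>(g t - z) \<bullet> n\<bar> \<le> \<eta> * norm (y - z)"
    using Cauchy_Schwarz_ineq2[of "g t - g s - (t - s) *\<^sub>R G" n] t(3) nn(1) by simp
   have yn: "\<bar>(y - z) \<bullet> n\<bar> \<le> norm (y - z)" using Cauchy_Schwarz_ineq2[of "y - z" n] nn(1) by simp
   have a: "\<alpha> = (z - x0) \<bullet> n + (g t - z) \<bullet> n" and b: "\<beta> = (z - x0) \<bullet> n + (y - z) \<bullet> n"
    unfolding \<alpha>_def \<beta>_def by (simp_all add: inner_diff_left)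
   have "\<eta> * norm (y - z) \<le> 1 * norm (y - z)" using eta by (intro mult_right_mono) auto
   then have ab: "\<alpha> > 0" "\<beta> > 0" using a b gn yn y unfolding r'_def by auto
   have par: "\<alpha> *\<^sub>R (y - x0) = \<beta> *\<^sub>R (g t - x0)" unfolding \<alpha>_def \<beta>_def by (rule cross2_zero_parallel[OF t(2)])
   have yv: "y = x0 + (\<beta> / \<alpha>) *\<^sub>R (g t - x0)"
   proof -
    have "y - x0 = (1 / \<alpha>) *\<^sub>R (\<alpha> *\<^sub>R (y - x0))" using ab by simp
    also have "\<dots> = (\<beta> / \<alpha>) *\<^sub>R (g t - x0)" unfolding par by simp
    finally show ?thesis by (simp add: algebra_simps)
   qed
   have lt: "\<eta> * norm (y - z) < \<epsilon> * norm (y - z)" using eta False by simp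
   have 1: "y \<in> T" if "(y - z) \<bullet> n < - \<epsilon> * norm (y - z)"
   proof -
    have "\<beta> < \<alpha>" using a b gn lt that by auto
    then have "\<beta> / \<alpha> < 1" "0 \<le> \<beta> / \<alpha>" using ab by auto
    moreover have "g t \<in> closure T" using gt by (simp add: frontier_def)
    ultimately show ?thesis unfolding yv using open_segment_subset[OF x0b] by blast
   qed
   have 2: "y \<notin> T" if "(y - z) \<bullet> n > \<epsilon> * norm (y - z)"
   proof -
    have "\<beta> > \<alpha>" using a b gn lt that by auto
    then have t0: "\<beta> / \<alpha> - 1 > 0" using ab by simp
    have "y = g t + (\<beta> / \<alpha> - 1) *\<^sub>R (g t - x0)" using yv by (simp add: algebra_simps)
    then show ?thesis using opposite_cone_outside[OF gt x0b t0] closure_subset by auto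
   qed
   show ?thesis using 1 2 by blast
  qed auto
  moreover have "r' > 0" unfolding r'_def using r(1) pos0 by simp
  ultimately show "\<exists>r>0. \<forall>w. norm (w - z) < r \<longrightarrow> ((w - z) \<bullet> n < - \<epsilon> * norm (w - z) \<longrightarrow> w \<in> T) \<and>
    ((w - z) \<bullet> n > \<epsilon> * norm (w - z) \<longrightarrow> w \<notin> T)" by blast
 qed
 then show ?thesis using that nn(2) pos unfolding z_def by blast
qed

end

section \<open>Traces on Lipschitz curves\<close>

text \<open>Outer normals exist only at almost every point of a curve, hence the traces that occur in
 the forms agree with bounded measurable functions only up to null sets of parameters.\<close>

definition trace_bounded :: "(real \<Rightarrow> pt) \<Rightarrow> real set \<Rightarrow> (pt \<Rightarrow> real) \<Rightarrow> bool" where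
 "trace_bounded g S \<phi> \<longleftrightarrow> (\<exists>\<psi> B. \<psi> \<in> borel_measurable lebesgue \<and> (\<forall>s. \<bar>\<psi> s\<bar> \<le> B) \<and>
   (AE s in lebesgue. s \<in> S \<longrightarrow> velocity g s \<noteq> 0 \<longrightarrow> \<phi> (g s) = \<psi> s))"

lemma trace_boundedI:
 assumes "\<psi> \<in> borel_measurable lebesgue" "\<And>s. \<bar>\<psi> s\<bar> \<le> B"
  "AE_curve g S (\<lambda>s. \<phi> (g s) = \<psi> s)"
 shows "trace_bounded g S \<phi>" using assms unfolding trace_bounded_def by blast

lemma trace_bounded_const: "trace_bounded g S (\<lambda>_. c)"
 by (rule trace_boundedI[of "\<lambda>_. c" "\<bar>c\<bar>"]) auto

lemma trace_bounded_add:
 assumes "trace_bounded g S \<phi>" "trace_bounded g S \<psi>"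
 shows "trace_bounded g S (\<lambda>z. \<phi> z + \<psi> z)"
proof -
 obtain p A where p: "p \<in> borel_measurable lebesgue" "\<And>s. \<bar>p s\<bar> \<le> A"
  "AE_curve g S (\<lambda>s. \<phi> (g s) = p s)" using assms(1) unfolding trace_bounded_def by blast
 obtain q B where q: "q \<in> borel_measurable lebesgue" "\<And>s. \<bar>q s\<bar> \<le> B"
  "AE_curve g S (\<lambda>s. \<psi> (g s) = q s)" using assms(2) unfolding trace_bounded_def by blast
 show ?thesis
 proof (rule trace_boundedI)
  show "(\<lambda>s. p s + q s) \<in> borel_measurable lebesgue" using p(1) q(1) by simp
  show "\<bar>p s + q s\<bar> \<le> A + B" for s using p(2)[of s] q(2)[of s] by linarith
  show "AE_curve g S (\<lambda>s. \<phi> (g s) + \<psi> (g s) = p s + q s)" using p(3) q(3) by eventually_elim simp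
 qed
qed

lemma trace_bounded_mult:
 assumes "trace_bounded g S \<phi>" "trace_bounded g S \<psi>"
 shows "trace_bounded g S (\<lambda>z. \<phi> z * \<psi> z)"
proof -
 obtain p A where p: "p \<in> borel_measurable lebesgue" "\<And>s. \<bar>p s\<bar> \<le> A"
  "AE_curve g S (\<lambda>s. \<phi> (g s) = p s)" using assms(1) unfolding trace_bounded_def by blast
 obtain q B where q: "q \<in> borel_measurable lebesgue" "\<And>s. \<bar>q s\<bar> \<le> B"
  "AE_curve g S (\<lambda>s. \<psi> (g s) = q s)" using assms(2) unfolding trace_bounded_def by blast
 show ?thesis
 proof (rule trace_boundedI)
  show "(\<lambda>s. p s * q s) \<in> borel_measurable lebesgue" using p(1) q(1) by simp
  show "\<bar>p s * q s\<bar> \<le> A * B" for s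
   unfolding abs_mult using p(2)[of s] q(2)[of s] abs_ge_zero[of "p s"] by (intro mult_mono) linarith+
  show "AE_curve g S (\<lambda>s. \<phi> (g s) * \<psi> (g s) = p s * q s)" using p(3) q(3) by eventually_elim simp
 qed
qed

lemma trace_bounded_diff:
 assumes "trace_bounded g S \<phi>" "trace_bounded g S \<psi>"
 shows "trace_bounded g S (\<lambda>z. \<phi> z - \<psi> z)"
 using trace_bounded_add[OF assms(1) trace_bounded_mult[OF trace_bounded_const[of g S "-1"] assms(2)]] by simp

lemma trace_bounded_power2:
 assumes "trace_bounded g S \<phi>" shows "trace_bounded g S (\<lambda>z. (\<phi> z)\<^sup>2)"
 unfolding power2_eq_square by (rule trace_bounded_mult[OF assms assms])

lemma trace_bounded_cong_AE:
 assumes "trace_bounded g S \<phi>"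
  and "AE_curve g S (\<lambda>s. \<psi> (g s) = \<phi> (g s))"
 shows "trace_bounded g S \<psi>"
proof -
 obtain p A where p: "p \<in> borel_measurable lebesgue" "\<And>s. \<bar>p s\<bar> \<le> A"
  "AE_curve g S (\<lambda>s. \<phi> (g s) = p s)" using assms(1) unfolding trace_bounded_def by blast
 show ?thesis by (rule trace_boundedI[OF p(1,2)]) (use p(3) assms(2) in eventually_elim, simp)
qed

lemma trace_bounded_continuous:
 assumes g: "L-lipschitz_on {0..1} g" and S: "S \<in> sets borel" "S \<subseteq> {0..1}"
  and C: "compact C" "g ` S \<subseteq> C" and \<phi>: "continuous_on C \<phi>"
 shows "trace_bounded g S \<phi>"
proof -
 obtain B where B: "B > 0" "\<And>z. z \<in> C \<Longrightarrow> \<bar>\<phi> z\<bar> \<le> B"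
  using compact_imp_bounded[OF compact_continuous_image[OF \<phi> C(1)]] unfolding bounded_pos by auto
 have gS: "g s \<in> C" if "s \<in> S" for s using C(2) that by blast
 have "continuous_on S (\<lambda>s. \<phi> (g s))"
  by (rule continuous_on_compose2[OF \<phi> continuous_on_subset[OF lipschitz_on_continuous_on[OF g] S(2)] C(2)])
 then have m: "(\<lambda>s. indicator S s *\<^sub>R \<phi> (g s)) \<in> borel_measurable borel"
  using S(1) by (intro borel_measurable_continuous_on_indicator)
 show ?thesis
 proof (rule trace_boundedI)
  show "(\<lambda>s. indicator S s *\<^sub>R \<phi> (g s)) \<in> borel_measurable lebesgue" using m by (intro measurable_completion) simp
  show "\<bar>indicator S s *\<^sub>R \<phi> (g s)\<bar> \<le> B" for s using B gS by (cases "s \<in> S") (auto simp: less_imp_le)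
  show "AE_curve g S (\<lambda>s. \<phi> (g s) = indicator S s *\<^sub>R \<phi> (g s))" by (auto simp: indicator_def)
 qed
qed

lemma lipschitz_curve_derivative_AE:
 fixes g :: "real \<Rightarrow> pt"
 assumes g: "L-lipschitz_on {0..1} g"
 obtains G where "G \<in> borel_measurable lebesgue" "\<And>s. norm (G s) \<le> L"
  "AE s in lebesgue. s \<in> {0..1} \<longrightarrow> 0 < s \<and> s < 1 \<and> (g has_vector_derivative G s) (at s)"
proof -
 obtain D G where D: "D \<subseteq> {0<..<1}" "negligible ({0..1} - D)"
  and G: "G \<in> borel_measurable borel" "\<And>s. norm (G s) \<le> L" "\<And>s. s \<in> D \<Longrightarrow> (g has_vector_derivative G s) (at s)"
  by (rule lipschitz_curve_derivative[OF g]) blast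
 have "AE s in lebesgue. s \<in> {0..1} \<longrightarrow> 0 < s \<and> s < 1 \<and> (g has_vector_derivative G s) (at s)"
  by (rule AE_I'[of "{0..1} - D"]) (use D G(3) in \<open>auto simp: negligible_iff_null_sets\<close>)
 moreover have "G \<in> borel_measurable lebesgue" using G(1) by (intro measurable_completion) simp
 ultimately show ?thesis using that G(2) by blast
qed

lemma trace_bounded_integrable:
 assumes g: "L-lipschitz_on {0..1} g" and S: "S \<in> sets borel" "S \<subseteq> {0..1}"
  and \<phi>: "trace_bounded g S \<phi>"
 shows "set_integrable lebesgue S (\<lambda>s. \<phi> (g s) * norm (velocity g s))"
proof -
 obtain G where G: "G \<in> borel_measurable lebesgue" "\<And>s. norm (G s) \<le> L"
  "AE s in lebesgue. s \<in> {0..1} \<longrightarrow> 0 < s \<and> s < 1 \<and> (g has_vector_derivative G s) (at s)"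
  by (rule lipschitz_curve_derivative_AE[OF g]) blast
 obtain p A where p: "p \<in> borel_measurable lebesgue" "\<And>s. \<bar>p s\<bar> \<le> A"
  "AE_curve g S (\<lambda>s. \<phi> (g s) = p s)" using \<phi> unfolding trace_bounded_def by blast
 have Sl: "S \<in> sets lebesgue" using S(1) by (rule sets_completionI_sets[of _ lborel, simplified])
 have fin: "emeasure lebesgue S < \<infinity>" using emeasure_mono[OF S(2), of lebesgue] by (simp add: le_less_trans)
 have i: "integrable lebesgue (\<lambda>s. indicator S s *\<^sub>R (p s * norm (G s)))"
 proof (rule Bochner_Integration.integrable_bound[where f = "\<lambda>s. indicator S s *\<^sub>R (A * L)"])
  show "integrable lebesgue (\<lambda>s. indicator S s *\<^sub>R (A * L))"
   using Sl fin by (intro integrable_scaleR_left integrable_real_indicator) auto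
  show "(\<lambda>s. indicator S s *\<^sub>R (p s * norm (G s))) \<in> borel_measurable lebesgue" using Sl p(1) G(1) by simp
  have "\<bar>p s\<bar> * norm (G s) \<le> \<bar>A * L\<bar>" for s
  proof -
   have "\<bar>p s\<bar> * norm (G s) \<le> A * L" using p(2)[of s] G(2)[of s] abs_ge_zero[of "p s"]
    by (intro mult_mono) (auto simp del: abs_ge_zero)
   then show ?thesis by linarith
  qed
  then show "AE s in lebesgue. norm (indicator S s *\<^sub>R (p s * norm (G s))) \<le> norm (indicator S s *\<^sub>R (A * L))"
   by (intro AE_I2) (auto simp: abs_mult indicator_def)
 qed
 have AE: "AE s in lebesgue. indicator S s *\<^sub>R (p s * norm (G s)) = indicator S s *\<^sub>R (\<phi> (g s) * norm (velocity g s))"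
  using G(3) p(3)
 proof eventually_elim
  fix s assume a: "s \<in> {0..1} \<longrightarrow> 0 < s \<and> s < 1 \<and> (g has_vector_derivative G s) (at s)"
   "s \<in> S \<longrightarrow> velocity g s \<noteq> 0 \<longrightarrow> \<phi> (g s) = p s"
  show "indicator S s *\<^sub>R (p s * norm (G s)) = indicator S s *\<^sub>R (\<phi> (g s) * norm (velocity g s))"
  proof (cases "s \<in> S")
   case True
   then have "velocity g s = G s" using a(1) S(2) vector_derivative_at by auto
   then show ?thesis using a(2) True by auto
  qed simp
 qed
 have m: "(\<lambda>s. indicator S s *\<^sub>R (\<phi> (g s) * norm (velocity g s))) \<in> borel_measurable lebesgue"
  by (rule borel_measurable_AE[OF borel_measurable_integrable[OF i] AE])
 show ?thesis unfolding set_integrable_def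
  using i integrable_cong_AE[OF borel_measurable_integrable[OF i] m AE] by simp
qed

text \<open>The normal is expressed by position and velocity alone. As \<open>outer_normal\<close>
  is a definite description, this formula is the source of its measurability.\<close>

lemma unit_normal_formula:
 fixes n G b :: pt
 assumes n: "norm n = 1" "n \<bullet> G = 0" "0 < b \<bullet> n" and G: "G \<noteq> 0"
 shows "n = sgn (b \<bullet> (- snd G, fst G)) *\<^sub>R ((1 / norm G) *\<^sub>R (- snd G, fst G))"
proof -
 define \<mu> where "\<mu> = (- snd G, fst G)"
 obtain n1 n2 G1 G2 where e: "n = (n1, n2)" "G = (G1, G2)" by (metis surj_pair)
 have 1: "n1\<^sup>2 + n2\<^sup>2 = 1" "n1 * G1 + n2 * G2 = 0" using n unfolding e by (auto simp: norm_Pair)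
 define k where "k = n2 * G1 - n1 * G2"
 have mu: "\<mu> = k *\<^sub>R n" unfolding \<mu>_def k_def e using 1 by simp algebra
 have "norm \<mu> = norm G" unfolding \<mu>_def e by (simp add: norm_Pair add.commute)
 then have k: "\<bar>k\<bar> = norm G" unfolding mu using n by simp
 have "sgn (b \<bullet> \<mu>) = sgn k" unfolding mu using n(3) by (simp add: sgn_mult)
 then have "sgn (b \<bullet> \<mu>) *\<^sub>R ((1 / norm G) *\<^sub>R \<mu>) = (sgn k * k / \<bar>k\<bar>) *\<^sub>R n" unfolding mu k[symmetric] by simp
 also have "sgn k * k / \<bar>k\<bar> = 1" using k G by (auto simp: sgn_if)
 finally show ?thesis unfolding \<mu>_def by simp
qed

lemma trace_bounded_normal:
 assumes g: "L-lipschitz_on {0..1} g" and S: "S \<in> sets borel" "S \<subseteq> {0..1}"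
  and N: "AE_curve g S (\<lambda>s. norm (N (g s)) = 1 \<and> N (g s) \<bullet> velocity g s = 0 \<and> 0 < (g s - x) \<bullet> N (g s))"
 shows "trace_bounded g S (\<lambda>z. e \<bullet> N z)"
proof -
 obtain G where G: "G \<in> borel_measurable lebesgue" "\<And>s. norm (G s) \<le> L"
  "AE s in lebesgue. s \<in> {0..1} \<longrightarrow> 0 < s \<and> s < 1 \<and> (g has_vector_derivative G s) (at s)"
  by (rule lipschitz_curve_derivative_AE[OF g]) blast
 define \<psi> where "\<psi> s = indicator S s *\<^sub>R (e \<bullet> (sgn ((g s - x) \<bullet> (- snd (G s), fst (G s))) *\<^sub>R ((1 / norm (G s)) *\<^sub>R (- snd (G s), fst (G s)))))" for s
 have f1: "(fst :: pt \<Rightarrow> real) \<in> borel_measurable borel" "(snd :: pt \<Rightarrow> real) \<in> borel_measurable borel"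
  by (auto intro!: borel_measurable_continuous_onI continuous_intros)
 define gS where "gS s = indicator S s *\<^sub>R g s" for s
 have gm: "gS \<in> borel_measurable lebesgue"
 proof -
  have "gS \<in> borel_measurable borel" unfolding gS_def
   using continuous_on_subset[OF lipschitz_on_continuous_on[OF g] S(2)] S(1)
   by (intro borel_measurable_continuous_on_indicator)
  then show ?thesis by (intro measurable_completion) simp
 qed
 have Sl: "S \<in> sets lebesgue" using S(1) by (rule sets_completionI_sets[of _ lborel, simplified])
 have "\<psi> s = indicator S s * (sgn ((fst (gS s) - fst x) * (- snd (G s)) + (snd (gS s) - snd x) * fst (G s)) *
   (1 / norm (G s)) * (fst e * (- snd (G s)) + snd e * fst (G s)))" for s
  unfolding \<psi>_def gS_def inner_scaleR_right by (cases "s \<in> S") (simp_all add: inner_prod_def)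
 moreover have "(\<lambda>s. indicator S s * (sgn ((fst (gS s) - fst x) * (- snd (G s)) + (snd (gS s) - snd x) * fst (G s)) *
   (1 / norm (G s)) * (fst e * (- snd (G s)) + snd e * fst (G s)))) \<in> borel_measurable lebesgue"
 proof -
  note m [measurable] = Sl measurable_compose[OF gm f1(1)] measurable_compose[OF gm f1(2)] measurable_compose[OF G(1) f1(1)]
   measurable_compose[OF G(1) f1(2)] G(1)
  show ?thesis by measurable
 qed
 ultimately have pm: "\<psi> \<in> borel_measurable lebesgue" by presburger
 \<comment> \<open>At v = 0 the convention 1 / 0 = 0 makes the vector zero, so the bound holds for
   all v.\<close>
 have "norm (sgn a *\<^sub>R ((1 / norm v) *\<^sub>R (- snd v, fst v))) \<le> 1" for a :: real and v :: pt
 proof -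
  have "norm (- snd v, fst v) = norm v" by (cases v) (simp add: norm_Pair add.commute)
  then have "norm (sgn a *\<^sub>R ((1 / norm v) *\<^sub>R (- snd v, fst v))) = \<bar>sgn a\<bar> * (1 / norm v * norm v)"
   unfolding norm_scaleR by simp
  also have "\<dots> \<le> 1" by (simp add: abs_sgn_eq)
  finally show ?thesis .
 qed
 then have "\<bar>e \<bullet> (sgn a *\<^sub>R ((1 / norm v) *\<^sub>R (- snd v, fst v)))\<bar> \<le> norm e * 1" for a :: real and v :: pt
  by (meson Cauchy_Schwarz_ineq2 mult_left_mono norm_ge_zero order_trans)
 then have pb: "\<bar>\<psi> s\<bar> \<le> norm e" for s unfolding \<psi>_def by (cases "s \<in> S") simp_all
 show ?thesis
 proof (rule trace_boundedI[OF pm pb])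
  show "AE_curve g S (\<lambda>s. e \<bullet> N (g s) = \<psi> s)" using N G(3)
  proof (eventually_elim, intro impI)
   fix s assume a: "s \<in> S \<longrightarrow> velocity g s \<noteq> 0 \<longrightarrow>
    norm (N (g s)) = 1 \<and> N (g s) \<bullet> velocity g s = 0 \<and> 0 < (g s - x) \<bullet> N (g s)"
    "s \<in> {0..1} \<longrightarrow> 0 < s \<and> s < 1 \<and> (g has_vector_derivative G s) (at s)"
    and s: "s \<in> S" "velocity g s \<noteq> 0"
   have v: "velocity g s = G s" using a(2) s(1) S(2) vector_derivative_at by auto
   have "N (g s) = sgn ((g s - x) \<bullet> (- snd (G s), fst (G s))) *\<^sub>R ((1 / norm (G s)) *\<^sub>R (- snd (G s), fst (G s)))"
    by (rule unit_normal_formula) (use a(1) s v in auto)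
   then show "e \<bullet> N (g s) = \<psi> s" unfolding \<psi>_def using s by simp
  qed
 qed
qed

section \<open>The boundary of the domain\<close>

declare Gam.simps [simp del] Gam_arc.simps(2,3) [simp del]

locale tricomi =
 fixes D :: tricomi_data
 assumes dom: "tricomi_domain D"
begin

abbreviation "\<Omega> \<equiv> region D"
abbreviation "K \<equiv> coefK D"
abbreviation "yc \<equiv> y_crit D"
text \<open>\<open>k\<close> is |dx/dy| along both characteristics, and \<open>J y\<close> is the
  horizontal distance they cover between the heights 0 and y.\<close>

definition "k t = sqrt (- K t)"
definition "J y = integral {y..0} k"

lemma domain_facts:
 shows open_region: "open \<Omega>" and connected_region: "connected \<Omega>" and bounded_region: "bounded \<Omega>"
  and region_nonempty: "\<Omega> \<noteq> {}" and cont_K: "continuous_on (snd ` closure \<Omega>) K"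
  and C1_K: "K C1_differentiable_on (snd ` \<Omega>)"
  and K_sign: "\<And>y. y \<in> snd ` closure \<Omega> \<Longrightarrow> y \<noteq> 0 \<Longrightarrow> K y * y > 0"
  and deriv_K_pos: "\<And>y. y \<in> snd ` \<Omega> \<Longrightarrow> deriv K y > 0"
  and frontier_region: "frontier \<Omega> = Gam D Upper \<union> Gam D CharLeft \<union> Gam D CharRight"
  and yc_neg: "yc < 0" and J_yc: "J yc = 1"
  and arc_upper: "arc (upper_arc D)" and lip_upper: "\<exists>L. L-lipschitz_on {0..1} (upper_arc D)"
  and upper_start: "upper_arc D 0 = (1, 0)" and upper_finish: "upper_arc D 1 = (- 1, 0)"
  and Gam_Upper: "Gam D Upper = upper_arc D ` {0<..<1}"
 using dom unfolding tricomi_domain_def Let_def J_def k_def pathstart_def pathfinish_def by auto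

lemma Gam_CharLeft_iff: "(x, y) \<in> Gam D CharLeft \<longleftrightarrow> yc \<le> y \<and> y \<le> 0 \<and> x = - 1 + J y"
 and Gam_CharRight_iff: "(x, y) \<in> Gam D CharRight \<longleftrightarrow> yc \<le> y \<and> y \<le> 0 \<and> x = 1 - J y"
 unfolding J_def k_def by (auto simp: Gam.simps)

lemma arc_CharLeft: "Gam_arc D CharLeft s = (- 1 + J (s * yc), s * yc)"
 and arc_CharRight: "Gam_arc D CharRight s = (1 - J (s * yc), s * yc)"
 unfolding J_def k_def by (auto simp: Gam_arc.simps)

text \<open>The hypotheses on K concern heights that occur in the closure of the domain; the left
  characteristic passes through all heights from yc to 0.\<close>

lemma lower_range: "{yc..0} \<subseteq> snd ` closure \<Omega>"
proof
 fix y assume "y \<in> {yc..0}"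
 then have "(- 1 + J y, y) \<in> frontier \<Omega>" unfolding frontier_region using Gam_CharLeft_iff by auto
 then show "y \<in> snd ` closure \<Omega>" by (auto simp: frontier_def image_iff intro!: bexI[of _ "(- 1 + J y, y)"])
qed

lemma cont_k: "continuous_on {yc..0} k"
 unfolding k_def by (intro continuous_intros continuous_on_subset[OF cont_K lower_range])

lemma k_pos: "0 < k y" if "yc \<le> y" "y < 0" for y
 using K_sign[of y] lower_range that unfolding k_def by (auto simp: subset_iff zero_less_mult_iff)

lemma k_sq: "(k y)\<^sup>2 = - K y" if "yc \<le> y" "y < 0" for y
 using K_sign[of y] lower_range that unfolding k_def by (auto simp: subset_iff zero_less_mult_iff)

text \<open>The sign of K is not prescribed at height 0, so the value there is reached by
  continuity.\<close>

lemma k_nonneg: "0 \<le> k y" if "yc \<le> y" "y \<le> 0" for y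
proof (cases "y = 0")
 case True
 show ?thesis
 proof (rule continuous_ge_on_closure[where f = k and S = "{yc..<0}"])
  show "continuous_on (closure {yc..<0}) k" using cont_k yc_neg by simp
  show "y \<in> closure {yc..<0}" using True yc_neg by simp
 qed (use k_pos in \<open>auto intro: less_imp_le\<close>)
qed (use k_pos that in \<open>auto intro: less_imp_le\<close>)

lemma k_bound: obtains B where "B > 0" "\<And>y. yc \<le> y \<Longrightarrow> y \<le> 0 \<Longrightarrow> k y \<le> B"
 using compact_imp_bounded[OF compact_continuous_image[OF cont_k compact_Icc]] unfolding bounded_pos by force

lemma k_integrable: "yc \<le> a \<Longrightarrow> b \<le> 0 \<Longrightarrow> k integrable_on {a..b}"
 by (intro integrable_continuous_real continuous_on_subset[OF cont_k]) auto

lemma J_diff: "J y - J y' = integral {y..y'} k" if "yc \<le> y" "y \<le> y'" "y' \<le> 0"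
 unfolding J_def using Henstock_Kurzweil_Integration.integral_combine[of y y' 0 k] k_integrable[of y 0] that by simp

lemma J_0: "J 0 = 0" unfolding J_def by simp

lemma J_antimono: "J y' \<le> J y" if "yc \<le> y" "y \<le> y'" "y' \<le> 0"
proof -
 have "0 \<le> integral {y..y'} k" using that by (intro integral_nonneg k_integrable) (auto intro: k_nonneg)
 then show ?thesis using J_diff[OF that] by simp
qed

lemma J_deriv: "(J has_real_derivative - k y) (at y)" if "yc < y" "y < 0"
proof -
 have 1: "((\<lambda>u. integral {u..0} k) has_vector_derivative - k y) (at y within {yc..0})"
  using integral_has_vector_derivative'[OF cont_k, of y] that by simp
 have "at y within {yc..0} = at y" using that by (intro at_within_interior) (simp add: interior_atLeastAtMost_real)
 then show ?thesis using 1 unfolding J_def[abs_def] has_real_derivative_iff_has_vector_derivative by simp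
qed

text \<open>The integrand is positive at yc. Strictness is what makes the two characteristics meet
  at their lower end only.\<close>

lemma J_lt_1: "J y < 1" if y: "yc < y" "y \<le> 0"
proof -
 have "0 < integral {yc..y} k"
 proof (rule ccontr)
  assume "\<not> 0 < integral {yc..y} k"
  moreover have "0 \<le> integral {yc..y} k" using y by (intro integral_nonneg k_integrable) (auto intro: k_nonneg)
  ultimately have z: "integral {yc..y} k = 0" by simp
  have "continuous_on {yc..y} k" by (rule continuous_on_subset[OF cont_k]) (use y in auto)
  then have "k yc = 0" using integral_eq_0_iff[of yc y k] z y k_nonneg by (auto simp: subset_iff)
  then show False using k_pos[of yc] yc_neg by simp
 qed
 then show ?thesis using J_diff[of yc y] J_yc y by simp
qed

lemma J_range: "0 \<le> J y" "J y \<le> 1" if "yc \<le> y" "y \<le> 0"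
 using J_antimono[of y 0] J_antimono[of yc y] J_0 J_yc that yc_neg by auto

lemma J_lipschitz:
 assumes B: "B > 0" "\<And>y. yc \<le> y \<Longrightarrow> y \<le> 0 \<Longrightarrow> k y \<le> B" and y: "yc \<le> y" "y \<le> 0" "yc \<le> y'" "y' \<le> 0"
 shows "\<bar>J y - J y'\<bar> \<le> B * \<bar>y - y'\<bar>"
proof -
 have *: "\<bar>J u - J v\<bar> \<le> B * \<bar>u - v\<bar>" if "yc \<le> u" "u \<le> v" "v \<le> 0" for u v
 proof -
  have "integral {u..v} k \<le> integral {u..v} (\<lambda>_. B)" by (rule integral_le[OF k_integrable]) (use that B(2) in auto)
  then have "J u - J v \<le> B * (v - u)" using J_diff[OF that] that by (simp add: mult.commute)
  then show ?thesis using J_antimono[OF that] that by auto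
 qed
 show ?thesis using *[of y y'] *[of y' y] y by (cases "y \<le> y'") (auto simp: abs_minus_commute)
qed

lemma scaled_range: "s \<in> {0..1} \<Longrightarrow> yc \<le> s * yc \<and> s * yc \<le> 0"
 using yc_neg by (auto simp: mult_le_0_iff)

section \<open>The boundary arcs and the closed curve that they form\<close>

lemma Gam_arc_lipschitz: "\<exists>L. L-lipschitz_on {0..1} (Gam_arc D j)"
proof (cases j)
 case Upper
 then show ?thesis using lip_upper by (simp add: lipschitz_on_def)
next
 case CharLeft
 obtain B where B: "B > 0" "\<And>y. yc \<le> y \<Longrightarrow> y \<le> 0 \<Longrightarrow> k y \<le> B" by (rule k_bound) blast
 have "(B * \<bar>yc\<bar> + \<bar>yc\<bar>)-lipschitz_on {0..1} (Gam_arc D CharLeft)"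
 proof (rule lipschitz_onI)
  fix s t :: real assume st: "s \<in> {0..1}" "t \<in> {0..1}"
  have "dist (Gam_arc D CharLeft s) (Gam_arc D CharLeft t) \<le> \<bar>J (s * yc) - J (t * yc)\<bar> + \<bar>s * yc - t * yc\<bar>"
   unfolding arc_CharLeft dist_prod_def by (rule order_trans[OF sqrt_sum_squares_le_sum_abs]) (simp add: dist_real_def)
  also have "\<dots> \<le> B * \<bar>s * yc - t * yc\<bar> + \<bar>s * yc - t * yc\<bar>"
   using J_lipschitz[OF B] scaled_range st by (intro add_mono) auto
  also have "\<bar>s * yc - t * yc\<bar> = \<bar>yc\<bar> * dist s t"
   unfolding dist_real_def left_diff_distrib[symmetric] abs_mult by simp
  finally show "dist (Gam_arc D CharLeft s) (Gam_arc D CharLeft t) \<le> (B * \<bar>yc\<bar> + \<bar>yc\<bar>) * dist s t"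
   by (simp add: algebra_simps)
 qed (use B in simp)
 then show ?thesis using CharLeft by blast
next
 case CharRight
 obtain B where B: "B > 0" "\<And>y. yc \<le> y \<Longrightarrow> y \<le> 0 \<Longrightarrow> k y \<le> B" by (rule k_bound) blast
 have "(B * \<bar>yc\<bar> + \<bar>yc\<bar>)-lipschitz_on {0..1} (Gam_arc D CharRight)"
 proof (rule lipschitz_onI)
  fix s t :: real assume st: "s \<in> {0..1}" "t \<in> {0..1}"
  have "dist (Gam_arc D CharRight s) (Gam_arc D CharRight t) \<le> \<bar>J (s * yc) - J (t * yc)\<bar> + \<bar>s * yc - t * yc\<bar>"
   unfolding arc_CharRight dist_prod_def
   by (rule order_trans[OF sqrt_sum_squares_le_sum_abs]) (simp add: dist_real_def abs_minus_commute)
  also have "\<dots> \<le> B * \<bar>s * yc - t * yc\<bar> + \<bar>s * yc - t * yc\<bar>"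
   using J_lipschitz[OF B] scaled_range st by (intro add_mono) auto
  also have "\<bar>s * yc - t * yc\<bar> = \<bar>yc\<bar> * dist s t"
   unfolding dist_real_def left_diff_distrib[symmetric] abs_mult by simp
  finally show "dist (Gam_arc D CharRight s) (Gam_arc D CharRight t) \<le> (B * \<bar>yc\<bar> + \<bar>yc\<bar>) * dist s t"
   by (simp add: algebra_simps)
 qed (use B in simp)
 then show ?thesis using CharRight by blast
qed

lemma Gam_arc_inj: "inj_on (Gam_arc D j) {0..1}"
proof (cases j)
 case Upper
 then show ?thesis using arc_upper unfolding arc_def inj_on_def by auto
qed (use yc_neg in \<open>auto simp: inj_on_def arc_CharLeft arc_CharRight\<close>)

lemma Gam_arc_continuous: "continuous_on {0..1} (Gam_arc D j)"
 using Gam_arc_lipschitz lipschitz_on_continuous_on by blast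

lemma Gam_char_image:
 "Gam D CharLeft = Gam_arc D CharLeft ` {0..1}" "Gam D CharRight = Gam_arc D CharRight ` {0..1}"
proof -
 have *: "y / yc \<in> {0..1}" "y / yc * yc = y" if "yc \<le> y" "y \<le> 0" for y
  using that yc_neg by (auto simp: divide_nonpos_neg divide_le_eq)
 show "Gam D CharLeft = Gam_arc D CharLeft ` {0..1}"
 proof (intro set_eqI iffI; clarsimp)
  fix x y assume a: "(x, y) \<in> Gam D CharLeft"
  then have y: "yc \<le> y" "y \<le> 0" "x = - 1 + J y" using Gam_CharLeft_iff by auto
  show "(x, y) \<in> Gam_arc D CharLeft ` {0..1}"
   by (rule image_eqI[of _ _ "y / yc"]) (use y *[OF y(1,2)] in \<open>auto simp: arc_CharLeft\<close>)
 next
  fix s :: real assume "0 \<le> s" "s \<le> 1"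
  then show "Gam_arc D CharLeft s \<in> Gam D CharLeft"
   unfolding arc_CharLeft Gam_CharLeft_iff using scaled_range[of s] by auto
 qed
 show "Gam D CharRight = Gam_arc D CharRight ` {0..1}"
 proof (intro set_eqI iffI; clarsimp)
  fix x y assume a: "(x, y) \<in> Gam D CharRight"
  then have y: "yc \<le> y" "y \<le> 0" "x = 1 - J y" using Gam_CharRight_iff by auto
  show "(x, y) \<in> Gam_arc D CharRight ` {0..1}"
   by (rule image_eqI[of _ _ "y / yc"]) (use y *[OF y(1,2)] in \<open>auto simp: arc_CharRight\<close>)
 next
  fix s :: real assume "0 \<le> s" "s \<le> 1"
  then show "Gam_arc D CharRight s \<in> Gam D CharRight"
   unfolding arc_CharRight Gam_CharRight_iff using scaled_range[of s] by auto
 qed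
qed

lemma Gam_subset_image: "Gam D j \<subseteq> Gam_arc D j ` {0..1}"
 using Gam_char_image Gam_Upper by (cases j) auto

lemma Gam_subset_frontier: "Gam D j \<subseteq> frontier \<Omega>"
 using frontier_region by (cases j) auto

lemma Gam_arc_frontier: "Gam_arc D j ` {0..1} \<subseteq> frontier \<Omega>"
proof (cases j)
 case Upper
 have "{0..1} = {0<..<1} \<union> {0, 1::real}" by auto
 then have "Gam_arc D Upper ` {0..1} = Gam D Upper \<union> {(1, 0), (- 1, 0)}"
  using Gam_Upper upper_start upper_finish by auto
 moreover have "(- 1, 0) \<in> Gam D CharLeft" "(1, 0) \<in> Gam D CharRight"
  unfolding Gam_CharLeft_iff Gam_CharRight_iff using yc_neg J_0 by auto
 ultimately show ?thesis using Upper frontier_region by auto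
qed (use Gam_char_image Gam_subset_frontier in auto)

lemma Gam_snd: "z \<in> Gam D Upper \<Longrightarrow> snd z > 0" "z \<in> Gam D CharLeft \<Longrightarrow> snd z \<le> 0" "z \<in> Gam D CharRight \<Longrightarrow> snd z \<le> 0"
 by (auto simp: Gam.simps)

lemma Gam_char_Int: "Gam D CharLeft \<inter> Gam D CharRight \<subseteq> {(0, yc)}"
proof
 fix z assume z: "z \<in> Gam D CharLeft \<inter> Gam D CharRight"
 obtain x y where xy: "z = (x, y)" by (cases z)
 have y: "yc \<le> y" "y \<le> 0" "x = - 1 + J y" "x = 1 - J y"
  using z unfolding xy using Gam_CharLeft_iff Gam_CharRight_iff by auto
 then have "J y = 1" by simp
 then have "y = yc" using J_lt_1[of y] y by fastforce
 then show "z \<in> {(0, yc)}" using xy y J_yc by simp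
qed

lemma Gam_Int_finite: "j \<noteq> j' \<Longrightarrow> finite (Gam D j \<inter> Gam D j')"
proof -
 have U: "Gam D Upper \<inter> Gam D CharLeft = {}" "Gam D Upper \<inter> Gam D CharRight = {}" using Gam_snd by force+
 have C: "finite (Gam D CharLeft \<inter> Gam D CharRight)" using Gam_char_Int finite_subset by blast
 assume "j \<noteq> j'"
 then show ?thesis using U C by (cases j; cases j') (auto simp: Int_commute)
qed

lemma Gam_arc_deriv:
 assumes s: "0 < s" "s < 1"
 shows "(Gam_arc D CharLeft has_vector_derivative yc *\<^sub>R (- k (s * yc), 1)) (at s)"
  "(Gam_arc D CharRight has_vector_derivative yc *\<^sub>R (k (s * yc), 1)) (at s)"
proof -
 have y: "yc < s * yc" "s * yc < 0" using s yc_neg by (auto simp: mult_less_0_iff)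
 have "((\<lambda>s. J (s * yc)) has_real_derivative (- k (s * yc)) * yc) (at s)"
  by (rule DERIV_chain2[where f = J and g = "\<lambda>s. s * yc", OF J_deriv[OF y]]) (auto intro!: derivative_eq_intros)
 then have Jd: "((\<lambda>s. J (s * yc)) has_vector_derivative (- k (s * yc)) * yc) (at s)"
  by (simp add: has_real_derivative_iff_has_vector_derivative)
 have id: "((\<lambda>s. s * yc) has_vector_derivative yc) (at s)" by (auto intro!: derivative_eq_intros)
 have "((\<lambda>s. (- 1 + J (s * yc), s * yc)) has_vector_derivative (0 + (- k (s * yc)) * yc, yc)) (at s)"
  by (intro has_vector_derivative_Pair has_vector_derivative_add has_vector_derivative_const Jd id)
 then show "(Gam_arc D CharLeft has_vector_derivative yc *\<^sub>R (- k (s * yc), 1)) (at s)"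
  unfolding arc_CharLeft[abs_def] by (simp add: mult.commute)
 have "((\<lambda>s. (1 - J (s * yc), s * yc)) has_vector_derivative (0 - (- k (s * yc)) * yc, yc)) (at s)"
  by (intro has_vector_derivative_Pair has_vector_derivative_diff has_vector_derivative_const Jd id)
 then show "(Gam_arc D CharRight has_vector_derivative yc *\<^sub>R (k (s * yc), 1)) (at s)"
  unfolding arc_CharRight[abs_def] by (simp add: mult.commute)
qed

text \<open>A point of the domain to the right would lie on a horizontal ray leaving the bounded
  domain, so the ray would meet the frontier. At negative heights the frontier consists of the two
  characteristic points only, and neither is further right. This later fixes the sign of the normal
  on \<open>CharRight\<close>.\<close>

lemma right_of_CharRight_outside:
 assumes z: "(x, y) \<in> Gam D CharRight" and y: "y < 0" and t: "t > 0"
 shows "(x + t, y) \<notin> \<Omega>"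
proof
 assume a: "(x + t, y) \<in> \<Omega>"
 define S where "S = (\<lambda>\<tau>. (x + \<tau>, y)) ` {t..}"
 have "connected S" unfolding S_def by (intro connected_continuous_image continuous_intros connected_Ici)
 moreover have "S \<inter> \<Omega> \<noteq> {}" using a unfolding S_def by auto
 moreover have "S - \<Omega> \<noteq> {}"
 proof
  assume "S - \<Omega> = {}"
  then have "bounded S" using bounded_region bounded_subset by blast
  then obtain B where B: "\<And>z. z \<in> S \<Longrightarrow> norm z \<le> B" unfolding bounded_iff by blast
  define \<tau> where "\<tau> = max t (\<bar>B\<bar> + \<bar>x\<bar> + 1)"
  have "(x + \<tau>, y) \<in> S" unfolding S_def \<tau>_def by auto
  then have "\<bar>x + \<tau>\<bar> \<le> B" using B dist_fst_le[of "(x + \<tau>, y)" 0] by (force simp: dist_norm)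
  then show False unfolding \<tau>_def by linarith
 qed
 ultimately have "S \<inter> frontier \<Omega> \<noteq> {}" by (rule connected_Int_frontier)
 then obtain \<tau> where tau: "\<tau> \<ge> t" "(x + \<tau>, y) \<in> frontier \<Omega>" unfolding S_def by auto
 have yy: "yc \<le> y" "y \<le> 0" "x = 1 - J y" using z Gam_CharRight_iff by auto
 have "(x + \<tau>, y) \<notin> Gam D Upper" using Gam_snd(1) y by force
 then have "x + \<tau> = - 1 + J y \<or> x + \<tau> = 1 - J y"
  using tau(2) unfolding frontier_region Un_iff Gam_CharLeft_iff Gam_CharRight_iff by blast
 then show False using yy tau t J_range[OF yy(1,2)] by auto
qed

text \<open>\<open>Upper\<close> runs from (1, 0) to (-1, 0), the left characteristic goes on to (0,
  yc), and the reversed right one returns to (1, 0).\<close>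

lemma boundary_loop: obtains c where "simple_path c" "pathfinish c = pathstart c" "path_image c = frontier \<Omega>"
proof -
 let ?l = "Gam_arc D CharLeft" and ?r = "reversepath (Gam_arc D CharRight)" and ?u = "upper_arc D"
 have al: "arc ?l" unfolding arc_def path_def using Gam_arc_inj Gam_arc_continuous by blast
 have "arc (Gam_arc D CharRight)" unfolding arc_def path_def using Gam_arc_inj Gam_arc_continuous by blast
 then have ar: "arc ?r" by (rule arc_reversepath)
 have il: "path_image ?l = Gam D CharLeft" unfolding path_image_def Gam_char_image ..
 have ir: "path_image ?r = Gam D CharRight" unfolding path_image_reversepath unfolding path_image_def Gam_char_image ..
 have ends: "pathstart ?l = (- 1, 0)" "pathfinish ?l = (0, yc)" "pathstart ?r = (0, yc)" "pathfinish ?r = (1, 0)"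
  unfolding pathstart_reversepath pathfinish_reversepath
  unfolding pathstart_def pathfinish_def arc_CharLeft arc_CharRight using J_0 J_yc by auto
 have alr: "arc (?l +++ ?r)" by (rule arc_join[OF al ar]) (use ends il ir Gam_char_Int in auto)
 have ilr: "path_image (?l +++ ?r) = Gam D CharLeft \<union> Gam D CharRight"
  using ends il ir by (subst path_image_join) auto
 have eq: "{0..1} = {0<..<1} \<union> {0, 1::real}" by auto
 have iu: "path_image ?u = Gam D Upper \<union> {(1, 0), (- 1, 0)}"
  unfolding path_image_def Gam_Upper eq using upper_start upper_finish by auto
 have pts: "(- 1, 0) \<in> Gam D CharLeft" "(1, 0) \<in> Gam D CharRight"
  unfolding Gam_CharLeft_iff Gam_CharRight_iff using yc_neg J_0 by auto
 have disj: "Gam D Upper \<inter> (Gam D CharLeft \<union> Gam D CharRight) = {}" using Gam_snd by force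
 have eu: "pathstart ?u = (1, 0)" "pathfinish ?u = (- 1, 0)"
  unfolding pathstart_def pathfinish_def using upper_start upper_finish by auto
 have elr: "pathstart (?l +++ ?r) = (- 1, 0)" "pathfinish (?l +++ ?r) = (1, 0)" using ends by auto
 show ?thesis
 proof
  show "simple_path (?u +++ (?l +++ ?r))"
   by (rule simple_path_join_loop[OF arc_upper alr]) (use eu elr iu ilr disj in auto)
  show "pathfinish (?u +++ (?l +++ ?r)) = pathstart (?u +++ (?l +++ ?r))" using eu elr by simp
  show "path_image (?u +++ (?l +++ ?r)) = frontier \<Omega>"
   using eu elr pts by (subst path_image_join) (auto simp: iu ilr frontier_region)
 qed
qed

text \<open>If a ball around a boundary point were covered by the closure of the domain, then removing
 the part of the boundary inside the ball would leave an arc whose complement splits into two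
 open sets, although arcs do not separate the plane.\<close>

lemma ball_not_in_closure:
 assumes z: "z \<in> frontier \<Omega>" and e: "e > 0"
 shows "\<not> ball z e \<subseteq> closure \<Omega>"
proof
 assume sub: "ball z e \<subseteq> closure \<Omega>"
 obtain c where c: "simple_path c" "pathfinish c = pathstart c" "path_image c = frontier \<Omega>" by (rule boundary_loop)
 have "z \<in> c ` {0..1}" using z c(3) unfolding path_image_def by simp
 then obtain t where t: "t \<in> {0..1}" "z = c t" by blast
 \<comment> \<open>The loop is made to start and end at z, so that cutting off both ends of the
   parameter interval removes the part near z and leaves an arc A.\<close>
 define d where "d = shiftpath t c"
 have d: "simple_path d" unfolding d_def using simple_path_shiftpath[OF c(1,2)] t by auto
 have di: "path_image d = frontier \<Omega>" unfolding d_def using path_image_shiftpath[OF _ c(2)] t c(3) by simp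
 have d01: "d 0 = z" "d 1 = z" using t c(2) unfolding d_def shiftpath_def pathstart_def pathfinish_def by auto
 have cd: "continuous_on {0..1} d" using d simple_path_imp_path path_def by blast
 obtain r where r: "r > 0" "\<And>s. s \<in> {0..1} \<Longrightarrow> \<bar>s - 0\<bar> < r \<Longrightarrow> dist (d s) z < e"
  using cd e unfolding continuous_on_iff by (metis atLeastAtMost_iff d01(1) dist_real_def order_refl zero_le_one)
 obtain r' where r': "r' > 0" "\<And>s. s \<in> {0..1} \<Longrightarrow> \<bar>s - 1\<bar> < r' \<Longrightarrow> dist (d s) z < e"
  using cd e unfolding continuous_on_iff by (metis atLeastAtMost_iff d01(2) dist_real_def order_refl zero_le_one)
 define \<epsilon> where "\<epsilon> = min (1 / 4) (min (r / 2) (r' / 2))"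
 have eps: "\<epsilon> > 0" "\<epsilon> \<le> 1 / 4" "\<epsilon> < r" "\<epsilon> < r'" unfolding \<epsilon>_def using r r' by auto
 define A where "A = path_image (subpath \<epsilon> (1 - \<epsilon>) d)"
 have "arc (subpath \<epsilon> (1 - \<epsilon>) d)" using arc_simple_path_subpath_interior[OF d, of \<epsilon> "1 - \<epsilon>"] eps by auto
 then have conn: "connected (- A)" and comp: "compact A"
  unfolding A_def by (auto intro!: connected_arc_complement compact_path_image arc_imp_path)
 have Aim: "A = d ` {\<epsilon>..1 - \<epsilon>}" unfolding A_def path_image_subpath using eps by auto
 have Asub: "A \<subseteq> frontier \<Omega>" unfolding Aim di[symmetric] path_image_def using eps by auto
 have cover: "frontier \<Omega> \<subseteq> A \<union> ball z e"
 proof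
  fix w assume "w \<in> frontier \<Omega>"
  then obtain s where s: "s \<in> {0..1}" "w = d s" unfolding di[symmetric] path_image_def by auto
  show "w \<in> A \<union> ball z e"
  proof (cases "s \<in> {\<epsilon>..1 - \<epsilon>}")
   case False
   then have "\<bar>s - 0\<bar> < r \<or> \<bar>s - 1\<bar> < r'" using s eps by auto
   then show ?thesis using r(2)[OF s(1)] r'(2)[OF s(1)] s(2) by (auto simp: dist_commute)
  qed (use s Aim in auto)
 qed
 \<comment> \<open>W is open by this description and relatively closed in the complement of A by the
   identity proved next. As that complement is connected, W is all of it and hence
   unbounded.\<close>
 define W where "W = \<Omega> \<union> (ball z e - A)"
 have \<Omega>A: "\<Omega> \<inter> A = {}" using Asub open_region by (auto simp: frontier_def interior_open)
 have W: "W = - A \<inter> closure \<Omega>"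
 proof
  show "W \<subseteq> - A \<inter> closure \<Omega>" unfolding W_def using \<Omega>A sub closure_subset by blast
  show "- A \<inter> closure \<Omega> \<subseteq> W"
  proof
   fix w assume w: "w \<in> - A \<inter> closure \<Omega>"
   show "w \<in> W"
   proof (cases "w \<in> \<Omega>")
    case False
    then have "w \<in> frontier \<Omega>" using w open_region by (auto simp: frontier_def interior_open)
    then show ?thesis using cover w unfolding W_def by blast
   qed (simp add: W_def)
  qed
 qed
 have "open W" unfolding W_def using open_region comp by (intro open_Un open_Diff compact_imp_closed) auto
 then have "openin (top_of_set (- A)) W" using W by (auto simp: openin_open_eq comp compact_imp_closed open_Compl)
 moreover have "closedin (top_of_set (- A)) W" unfolding W by (simp add: closedin_closed_Int)
 ultimately have "W = {} \<or> W = - A" using conn unfolding connected_clopen by blast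
 moreover have "W \<noteq> {}" unfolding W_def using region_nonempty by blast
 ultimately have "- A \<subseteq> closure \<Omega>" using W by auto
 then have "bounded (- A)" using bounded_region bounded_closure bounded_subset by blast
 then have "bounded (- A \<union> A)" using comp compact_imp_bounded bounded_Un by blast
 then show False using not_bounded_UNIV[where 'a = pt] by (simp add: Un_commute)
qed

end

section \<open>Meshes\<close>

lemma frontier_local:
 fixes S S' U :: "pt set"
 assumes "open U" "S \<inter> U = S' \<inter> U" "y \<in> U" "y \<in> frontier S"
 shows "y \<in> frontier S'" unfolding frontier_straddle mem_Collect_eq
proof (intro allI impI)
 obtain e where e: "e > 0" "ball y e \<subseteq> U" using openE[OF assms(1,3)] by blast
 fix d :: real assume "d > 0"
 then have "min d e > 0" using e by simp
 then have "(\<exists>x\<in>S. dist y x < min d e) \<and> (\<exists>x. x \<notin> S \<and> dist y x < min d e)"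
  using assms(4) unfolding frontier_straddle by blast
 then obtain u v where uv: "u \<in> S" "dist y u < min d e" "v \<notin> S" "dist y v < min d e" by blast
 then have "u \<in> U" "v \<in> U" using e by auto
 then have "u \<in> S'" "v \<notin> S'" using uv assms(2) by blast+
 then show "(\<exists>x\<in>S'. dist y x < d) \<and> (\<exists>x. x \<notin> S' \<and> dist y x < d)" using uv
  by (intro conjI bexI[of _ u] exI[of _ v]) auto
qed

lemma unit_perp_cases:
 fixes n n' u :: pt
 assumes "norm n = 1" "norm n' = 1" "n \<bullet> u = 0" "n' \<bullet> u = 0" "u \<noteq> 0"
 shows "n' = n \<or> n' = - n"
proof -
 obtain n1 n2 m1 m2 u1 u2 where e: "n = (n1, n2)" "n' = (m1, m2)" "u = (u1, u2)" by (metis surj_pair)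
 have 1: "n1 * u1 + n2 * u2 = 0" "m1 * u1 + m2 * u2 = 0" "u1 \<noteq> 0 \<or> u2 \<noteq> 0" using assms(3-5) unfolding e by (auto simp: zero_prod_def)
 have "u1 * (n1 * m2 - n2 * m1) = 0" "u2 * (n1 * m2 - n2 * m1) = 0" using 1 by algebra+
 then have "cross2 n n' = 0" using 1(3) unfolding cross2_def e by auto
 from cross2_zero_parallel[OF this, of n] have p: "n' = (n' \<bullet> n) *\<^sub>R n" using assms(1) by (simp add: dot_square_norm)
 then have "\<bar>n' \<bullet> n\<bar> * norm n = norm n'" by (metis norm_scaleR)
 then have "n' \<bullet> n = 1 \<or> n' \<bullet> n = - 1" using assms(1,2) by auto
 then show ?thesis using p by (metis scaleR_minus1_left scaleR_one)
qed

context star_domain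
begin

text \<open>Elements have no slits or punctures: behind a frontier point the ray from the centre
  leaves the closure at once.\<close>

lemma interior_closure_eq: "interior (closure T) = T"
proof
 show "interior (closure T) \<subseteq> T"
 proof
  fix y assume y: "y \<in> interior (closure T)"
  show "y \<in> T"
  proof (rule ccontr)
   assume "y \<notin> T"
   then have fr: "y \<in> frontier T" using y interior_subset open_T by (auto simp: frontier_def interior_open)
   have x0b: "x0 \<in> ball x0 \<rho>" using rho_pos by simp
   have "y \<noteq> x0" using \<open>y \<notin> T\<close> x0b ball_subset by blast
   obtain e where e: "e > 0" "ball y e \<subseteq> closure T" using y by (meson mem_interior)
   define t where "t = e / (2 * norm (y - x0))"
   have "t > 0" unfolding t_def using e \<open>y \<noteq> x0\<close> by simp
   have "norm (t *\<^sub>R (y - x0)) = e / 2" unfolding t_def norm_scaleR using e \<open>y \<noteq> x0\<close> by simp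
   then have "dist y (y + t *\<^sub>R (y - x0)) < e" using e(1) unfolding dist_norm by (subst norm_minus_commute) simp
   then show False using opposite_cone_outside[OF fr x0b \<open>t > 0\<close>] e(2) by auto
  qed
 qed
 show "T \<subseteq> interior (closure T)" by (rule interior_maximal[OF closure_subset open_T])
qed

lemma segment_normal:
 assumes sub: "closed_segment a b \<subseteq> frontier T" and ab: "a \<noteq> b" and s: "0 < s" "s < 1"
 obtains n where "is_outer_normal T (linepath a b s) n" "n \<bullet> (b - a) = 0"
  "\<And>w. w \<in> ball x0 \<rho> \<Longrightarrow> 0 < (linepath a b s - w) \<bullet> n"
proof -
 define d where "d = min s (1 - s)"
 have d: "d > 0" unfolding d_def using s by simp
 have fr: "linepath a b t \<in> frontier T" if "\<bar>t - s\<bar> \<le> d" for t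
 proof -
  have "t \<in> {0..1}" using that unfolding d_def by auto
  then show ?thesis using sub linepath_in_path by auto
 qed
 have "(linepath a b has_vector_derivative (b - a)) (at s)"
  using has_vector_derivative_linepath_within[of a b s UNIV] by simp
 from outer_normal_star[OF fr d _ this] ab that show ?thesis by (auto intro: continuous_on_linepath)
qed

text \<open>\<open>is_outer_normal\<close> yields only cones narrower than a half plane; a straight
  boundary yields the full half disc. A point w on the inner side is projected from x0 to a point q
  w of the segment, and w lies strictly before q w on this ray.\<close>

lemma half_disc:
 assumes sub: "closed_segment a b \<subseteq> closure T" and s: "0 < s" "s < 1" and ab: "a \<noteq> b"
  and n: "norm n = 1" "n \<bullet> (b - a) = 0" "0 < (linepath a b s - x0) \<bullet> n"
 shows "\<exists>e>0. \<forall>w. dist (linepath a b s) w < e \<longrightarrow> (w - linepath a b s) \<bullet> n < 0 \<longrightarrow> w \<in> T"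
proof -
 define z where "z = linepath a b s"
 define u where "u = b - a"
 define c where "c = (z - x0) \<bullet> n"
 have c: "c > 0" using n unfolding c_def z_def by simp
 \<comment> \<open>\<open>t w\<close> tells which fraction of the way from x0 to the line of the
   segment is reached at w, \<open>q w\<close> is the central projection, and \<open>l w\<close> the
   position of \<open>q w\<close> along the segment relative to z.\<close>
 define t where "t w = ((w - x0) \<bullet> n) / c" for w
 define q where "q w = x0 + (1 / t w) *\<^sub>R (w - x0)" for w
 define l where "l w = ((q w - z) \<bullet> u) / (u \<bullet> u)" for w
 have tz: "t z = 1" unfolding t_def c_def[symmetric] using c by simp
 have "isCont t z" unfolding t_def using c by (intro continuous_intros) auto
 moreover have "isCont q z" unfolding q_def using tz by (intro continuous_intros calculation) auto
 then have "isCont l z" unfolding l_def using ab by (intro continuous_intros) (auto simp: u_def)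
 ultimately have "\<forall>\<^sub>F w in nhds z. t w > 0" "\<forall>\<^sub>F w in nhds z. \<bar>l w\<bar> < min s (1 - s)"
 proof -
  assume ct: "isCont t z" and cl: "isCont l z"
  show "\<forall>\<^sub>F w in nhds z. t w > 0"
   using ct tz unfolding isCont_def tendsto_at_iff_tendsto_nhds by (intro order_tendstoD(1)[of t 1]) auto
  have "l z = 0" unfolding l_def q_def tz by simp
  then have "(l \<longlongrightarrow> 0) (nhds z)" using cl unfolding isCont_def tendsto_at_iff_tendsto_nhds by simp
  then have "((\<lambda>w. \<bar>l w\<bar>) \<longlongrightarrow> 0) (nhds z)" by (rule tendsto_rabs_zero)
  then show "\<forall>\<^sub>F w in nhds z. \<bar>l w\<bar> < min s (1 - s)" by (rule order_tendstoD(2)) (use s in simp)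
 qed
 then have "\<forall>\<^sub>F w in nhds z. t w > 0 \<and> \<bar>l w\<bar> < min s (1 - s)" by eventually_elim simp
 then obtain e where e: "e > 0" "\<And>w. dist w z < e \<Longrightarrow> t w > 0 \<and> \<bar>l w\<bar> < min s (1 - s)"
  unfolding eventually_nhds_metric by blast
 have "w \<in> T" if w: "dist z w < e" "(w - z) \<bullet> n < 0" for w
 proof -
  have tl: "t w > 0" "\<bar>l w\<bar> < min s (1 - s)" using e(2)[of w] w by (auto simp: dist_commute)
  have "(w - x0) \<bullet> n < c" using w unfolding c_def by (simp add: inner_diff_left)
  then have t1: "t w < 1" unfolding t_def using c by simp
  have "(q w - z) \<bullet> n = (1 / t w) * ((w - x0) \<bullet> n) - c" unfolding q_def c_def by (simp add: inner_diff_left inner_add_left)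
  also have "(w - x0) \<bullet> n = t w * c" unfolding t_def using c by simp
  finally have "(q w - z) \<bullet> n = 0" using tl by simp
  then have "cross2 u (q w - z) = 0" using abs_cross2_normal[of n u "q w - z"] n unfolding u_def by simp
  from cross2_zero_parallel[OF this, of u]
  have e1: "(u \<bullet> u) *\<^sub>R (q w - z) = ((q w - z) \<bullet> u) *\<^sub>R u" .
  have uu: "u \<bullet> u \<noteq> 0" using ab unfolding u_def by simp
  have "q w - z = (1 / (u \<bullet> u)) *\<^sub>R ((u \<bullet> u) *\<^sub>R (q w - z))" using uu by simp
  also have "\<dots> = l w *\<^sub>R u" unfolding e1 l_def by simp
  finally have "q w = linepath a b (s + l w)" unfolding z_def linepath_def u_def by (simp add: algebra_simps)
  moreover have "s + l w \<in> {0..1}" using tl by auto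
  ultimately have "q w \<in> closed_segment a b" using linepath_in_path by metis
  then have "q w \<in> closure T" using sub by (rule subsetD[rotated])
  then have "x0 + t w *\<^sub>R (q w - x0) \<in> T" using open_segment_subset[of x0 "q w" "t w"] tl t1 rho_pos by simp
  then show ?thesis unfolding q_def using tl by simp
 qed
 then show ?thesis using e(1) unfolding z_def by blast
qed

end

text \<open>The choice of end points repeats the one inside \<open>segment_integral\<close>, so that
  both refer to the same parametrisation.\<close>

definition segment_path :: "pt set \<Rightarrow> real \<Rightarrow> pt" where
 "segment_path F = (case SOME (a, b). F = closed_segment a b of (a, b) \<Rightarrow> linepath a b)"

lemma segment_path:
 assumes "segment_set F"
 obtains a b where "a \<noteq> b" "F = closed_segment a b" "segment_path F = linepath a b"
proof -
 obtain a0 b0 where ab0: "a0 \<noteq> b0" "F = closed_segment a0 b0" using assms unfolding segment_set_def by blast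
 obtain a b where ab: "(SOME (a, b). F = closed_segment a b) = (a, b)" by (metis surj_pair)
 have "case SOME (a, b). F = closed_segment a b of (a, b) \<Rightarrow> F = closed_segment a b"
  by (rule someI[of "\<lambda>(a, b). F = closed_segment a b" "(a0, b0)"]) (use ab0 in simp)
 then have F: "F = closed_segment a b" unfolding ab by simp
 moreover have "a \<noteq> b"
 proof
  assume "a = b"
  then have "a0 \<in> {a}" "b0 \<in> {a}" using ab0 F ends_in_segment by auto
  then show False using ab0 by simp
 qed
 moreover have "segment_path F = linepath a b" unfolding segment_path_def ab by simp
 ultimately show ?thesis using that by blast
qed

lemma segment_integral_eq: "segment_integral F \<phi> = curve_integral (segment_path F) F \<phi>"
 unfolding segment_integral_def segment_path_def by (simp add: Let_def split: prod.split)

lemma UNIV_boundary_part: "(UNIV :: boundary_part set) = {Upper, CharLeft, CharRight}"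
 using boundary_part.exhaust by auto

section \<open>Incidence of elements, facets and boundary\<close>

locale tricomi_mesh = tricomi +
 fixes \<T> :: "pt set set"
 assumes mesh: "is_mesh D \<T>" and star_element: "\<And>T. T \<in> \<T> \<Longrightarrow> \<exists>x \<rho>. star_domain T x \<rho>"
begin

text \<open>\<open>\<F>\<close> is the set of interior facets of the mesh, called \<open>F\<^sub>h\<^sup>I\<close> in the paper.\<close>

abbreviation "\<F> \<equiv> interior_facets \<T>"
abbreviation "elem_facets \<equiv> elem_interior_facets \<T>"
abbreviation "sides \<equiv> facet_elems \<T>"

lemma mesh_facts:
 shows finite_mesh: "finite \<T>" and open_element: "\<And>T. T \<in> \<T> \<Longrightarrow> open T"
  and element_nonempty: "\<And>T. T \<in> \<T> \<Longrightarrow> T \<noteq> {}" and element_subset: "\<And>T. T \<in> \<T> \<Longrightarrow> T \<subseteq> \<Omega>"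
  and elements_disjoint: "\<And>T T'. T \<in> \<T> \<Longrightarrow> T' \<in> \<T> \<Longrightarrow> T \<noteq> T' \<Longrightarrow> T \<inter> T' = {}"
  and elements_cover: "\<Omega> \<subseteq> (\<Union>T\<in>\<T>. closure T)"
  and elements_meet: "\<And>T T'. T \<in> \<T> \<Longrightarrow> T' \<in> \<T> \<Longrightarrow> T \<noteq> T' \<Longrightarrow> frontier T \<inter> frontier T' = {} \<or>
    (\<exists>z. frontier T \<inter> frontier T' = {z}) \<or> segment_set (frontier T \<inter> frontier T')"
 using mesh unfolding is_mesh_def by auto

lemma closure_element_subset: "T \<in> \<T> \<Longrightarrow> closure T \<subseteq> closure \<Omega>"
 using element_subset closure_mono by blast

lemma frontier_element_subset: "T \<in> \<T> \<Longrightarrow> frontier T \<subseteq> closure \<Omega>"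
 using closure_element_subset by (auto simp: frontier_def)

lemma closure_cover: "closure \<Omega> \<subseteq> (\<Union>T\<in>\<T>. closure T)"
 by (rule closure_minimal[OF elements_cover]) (use finite_mesh in auto)

lemma frontier_other:
 assumes "T \<in> \<T>" "T' \<in> \<T>" "T \<noteq> T'" "z \<in> frontier T" "z \<in> closure T'"
 shows "z \<in> frontier T'"
proof -
 have "z \<notin> T'"
 proof
  assume "z \<in> T'"
  moreover have "z \<in> closure T" using assms by (simp add: frontier_def)
  ultimately have "T' \<inter> T \<noteq> {}" using open_Int_closure_eq_empty[OF open_element[OF assms(2)], of T] by blast
  then show False using elements_disjoint assms by blast
 qed
 then show ?thesis using assms open_element by (auto simp: frontier_def interior_open)
qed

text \<open>Both normals are perpendicular to the facet. Were they equal, points just behind the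
  facet would lie in both elements, which are disjoint. So they are opposite, and the two half discs
  together with the segment fill a disc.\<close>

lemma facet_point:
 assumes T: "T \<in> \<T>" "T' \<in> \<T>" "T \<noteq> T'" and F: "frontier T \<inter> frontier T' = closed_segment a b" "a \<noteq> b"
  and s: "0 < s" "s < 1"
 obtains n where "is_outer_normal T (linepath a b s) n" "is_outer_normal T' (linepath a b s) (- n)"
  "\<exists>e>0. ball (linepath a b s) e \<subseteq> T \<union> T' \<union> closed_segment a b"
proof -
 define z where "z = linepath a b s"
 obtain x \<rho> where st: "star_domain T x \<rho>" using star_element T by blast
 obtain x' \<rho>' where st': "star_domain T' x' \<rho>'" using star_element T by blast
 have sub: "closed_segment a b \<subseteq> frontier T" "closed_segment a b \<subseteq> frontier T'" using F by auto
 obtain n where n: "is_outer_normal T z n" "n \<bullet> (b - a) = 0" "\<And>w. w \<in> ball x \<rho> \<Longrightarrow> 0 < (z - w) \<bullet> n"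
  using star_domain.segment_normal[OF st sub(1) F(2) s] unfolding z_def by blast
 obtain n' where n': "is_outer_normal T' z n'" "n' \<bullet> (b - a) = 0" "\<And>w. w \<in> ball x' \<rho>' \<Longrightarrow> 0 < (z - w) \<bullet> n'"
  using star_domain.segment_normal[OF st' sub(2) F(2) s] unfolding z_def by blast
 have u: "norm n = 1" "norm n' = 1" using n n' unfolding is_outer_normal_def by auto
 have "n' \<noteq> n"
 proof
  assume eq: "n' = n"
  obtain r where r: "r > 0" "\<And>w. norm (w - z) < r \<Longrightarrow> (w - z) \<bullet> n < - (1/2) * norm (w - z) \<Longrightarrow> w \<in> T"
   using n(1) unfolding is_outer_normal_def by (metis half_gt_zero_iff zero_less_one)
  obtain r' where r': "r' > 0" "\<And>w. norm (w - z) < r' \<Longrightarrow> (w - z) \<bullet> n < - (1/2) * norm (w - z) \<Longrightarrow> w \<in> T'"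
   using n'(1) unfolding is_outer_normal_def eq by (metis half_gt_zero_iff zero_less_one)
  define w where "w = z - (min r r' / 2) *\<^sub>R n"
  have "norm (w - z) = min r r' / 2" "(w - z) \<bullet> n = - (min r r' / 2)"
   unfolding w_def using r r' u by (auto simp: dot_square_norm)
  then have "w \<in> T" "w \<in> T'" using r r' by (auto intro!: r(2) r'(2))
  then show False using elements_disjoint T by blast
 qed
 then have neq: "n' = - n" using unit_perp_cases[OF u n(2) n'(2)] F(2) by auto
 obtain e where e: "e > 0" "\<And>w. dist z w < e \<Longrightarrow> (w - z) \<bullet> n < 0 \<Longrightarrow> w \<in> T"
  using star_domain.half_disc[OF st _ s F(2) u(1) n(2)] sub(1) n(3) star_domain.rho_pos[OF st]
  unfolding z_def by (auto simp: frontier_def)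
 obtain e' where e': "e' > 0" "\<And>w. dist z w < e' \<Longrightarrow> (w - z) \<bullet> n' < 0 \<Longrightarrow> w \<in> T'"
  using star_domain.half_disc[OF st' _ s F(2) u(2) n'(2)] sub(2) n'(3) star_domain.rho_pos[OF st']
  unfolding z_def by (auto simp: frontier_def)
 \<comment> \<open>The last bound keeps the points of the disc that lie on the line through a and b
   inside the segment.\<close>
 define d where "d = min (min e e') (min s (1 - s) * norm (b - a))"
 have d: "d > 0" "d \<le> e" "d \<le> e'" "d \<le> min s (1 - s) * norm (b - a)" unfolding d_def using e e' s F by auto
 have "w \<in> T \<union> T' \<union> closed_segment a b" if w: "w \<in> ball z d" for w
 proof -
  consider "(w - z) \<bullet> n < 0" | "(w - z) \<bullet> n' < 0" | "(w - z) \<bullet> n = 0" unfolding neq by fastforce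
  then show ?thesis
  proof cases
   case 1
   then show ?thesis using e(2)[of w] w d by auto
  next
   case 2
   then show ?thesis using e'(2)[of w] w d by auto
  next
   case 3
   define u where "u = b - a"
   have uu: "u \<bullet> u \<noteq> 0" using F(2) unfolding u_def by simp
   have "cross2 u (w - z) = 0" using abs_cross2_normal[of n u "w - z"] n(2) u(1) 3 unfolding u_def
    using n(1) by (simp add: is_outer_normal_def)
   from cross2_zero_parallel[OF this, of u]
   have e1: "(u \<bullet> u) *\<^sub>R (w - z) = ((w - z) \<bullet> u) *\<^sub>R u" .
   define l where "l = ((w - z) \<bullet> u) / (u \<bullet> u)"
   have "w - z = (1 / (u \<bullet> u)) *\<^sub>R ((u \<bullet> u) *\<^sub>R (w - z))" using uu by simp
   also have "\<dots> = l *\<^sub>R u" unfolding e1 l_def by simp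
   finally have wl: "w - z = l *\<^sub>R u" .
   then have "norm (w - z) = \<bar>l\<bar> * norm u" by simp
   moreover have "norm (w - z) < d" using w by (simp add: dist_norm norm_minus_commute)
   ultimately have "\<bar>l\<bar> * norm u < min s (1 - s) * norm u" using d(4) unfolding u_def by linarith
   then have "\<bar>l\<bar> < min s (1 - s)" by (simp add: mult_less_cancel_right)
   then have "s + l \<in> {0..1}" by auto
   moreover have "w = linepath a b (s + l)" using wl unfolding z_def linepath_def u_def by (simp add: algebra_simps)
   ultimately show ?thesis using linepath_in_path by blast
  qed
 qed
 then have "\<exists>e>0. ball z e \<subseteq> T \<union> T' \<union> closed_segment a b" using d(1) by blast
 then show ?thesis using that[of n] n(1) n'(1) unfolding neq z_def by blast
qed

text \<open>A third element would meet the disc of \<open>facet_point\<close> only inside the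
  segment, which has empty interior.\<close>

lemma facet_point_elements:
 assumes T: "T \<in> \<T>" "T' \<in> \<T>" "T \<noteq> T'" and F: "frontier T \<inter> frontier T' = closed_segment a b" "a \<noteq> b"
  and s: "0 < s" "s < 1" and T'': "T'' \<in> \<T>" "linepath a b s \<in> closure T''"
 shows "T'' = T \<or> T'' = T'"
proof (rule ccontr)
 assume ne: "\<not> (T'' = T \<or> T'' = T')"
 obtain e where e: "e > 0" "ball (linepath a b s) e \<subseteq> T \<union> T' \<union> closed_segment a b"
  using facet_point[OF T F s] by metis
 have "ball (linepath a b s) e \<inter> T'' \<subseteq> closed_segment a b"
  using e(2) elements_disjoint[OF T(1) T''(1)] elements_disjoint[OF T(2) T''(1)] ne by blast
 then have "ball (linepath a b s) e \<inter> T'' \<subseteq> interior (closed_segment a b)"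
  using open_element[OF T''(1)] by (intro interior_maximal) auto
 then have "ball (linepath a b s) e \<inter> T'' = {}" by (simp add: interior_closed_segment_ge2)
 then have "ball (linepath a b s) e \<inter> closure T'' = {}" using open_Int_closure_eq_empty[of "ball (linepath a b s) e" T''] by simp
 then show False using T''(2) e(1) by (metis IntI centre_in_ball empty_iff)
qed

text \<open>The disc of \<open>facet_point\<close> lies in the closure of the domain, which
  \<open>ball_not_in_closure\<close> excludes at boundary points. So the domain is not slit along a
  facet.\<close>

lemma facet_point_interior:
 assumes T: "T \<in> \<T>" "T' \<in> \<T>" "T \<noteq> T'" and F: "frontier T \<inter> frontier T' = closed_segment a b" "a \<noteq> b"
  and s: "0 < s" "s < 1"
 shows "linepath a b s \<in> \<Omega>"
proof (rule ccontr)
 assume n: "linepath a b s \<notin> \<Omega>"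
 obtain e where e: "e > 0" "ball (linepath a b s) e \<subseteq> T \<union> T' \<union> closed_segment a b"
  using facet_point[OF T F s] by metis
 have "closed_segment a b \<subseteq> frontier T" using F by auto
 then have "ball (linepath a b s) e \<subseteq> closure \<Omega>"
  using e(2) frontier_element_subset[OF T(1)] element_subset T closure_subset by blast
 moreover have "linepath a b s \<in> frontier \<Omega>"
  using n calculation e(1) open_region by (auto simp: frontier_def interior_open)
 ultimately show False using ball_not_in_closure e(1) by blast
qed

text \<open>The exceptional points of the mesh: isolated contacts of two elements and end points of
  common segments. There are finitely many, hence they do not matter for integrals along
  curves.\<close>

definition "corners = (\<Union>T\<in>\<T>. \<Union>T'\<in>\<T> - {T}. {z \<in> frontier T \<inter> frontier T'.
  \<not> (\<exists>a b s. a \<noteq> b \<and> 0 < s \<and> s < 1 \<and> frontier T \<inter> frontier T' = closed_segment a b \<and> z = linepath a b s)})"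

lemma finite_corners: "finite corners"
 unfolding corners_def
proof (intro finite_UN_I finite_mesh finite_Diff)
 fix T T' assume T: "T \<in> \<T>" "T' \<in> \<T> - {T}"
 let ?C = "{z \<in> frontier T \<inter> frontier T'.
  \<not> (\<exists>a b s. a \<noteq> b \<and> 0 < s \<and> s < 1 \<and> frontier T \<inter> frontier T' = closed_segment a b \<and> z = linepath a b s)}"
 consider "frontier T \<inter> frontier T' = {}" | z where "frontier T \<inter> frontier T' = {z}"
  | a b where "a \<noteq> b" "frontier T \<inter> frontier T' = closed_segment a b"
  using elements_meet[of T T'] T unfolding segment_set_def by blast
 then show "finite ?C"
 proof cases
  case 3
  have "?C \<subseteq> {a, b}"
  proof
   fix z assume z: "z \<in> ?C"
   then have "z \<in> closed_segment a b" using 3 by auto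
   then obtain s where s: "0 \<le> s" "s \<le> 1" "z = linepath a b s" unfolding in_segment linepath_def by auto
   then have "\<not> (0 < s \<and> s < 1)" using z 3 by blast
   then have "s = 0 \<or> s = 1" using s by auto
   then show "z \<in> {a, b}" using s by (auto simp: linepath_0' linepath_1')
  qed
  then show ?thesis using finite_subset by blast
 qed auto
qed

lemma shared_point:
 assumes T: "T \<in> \<T>" "T' \<in> \<T>" "T \<noteq> T'" and z: "z \<in> frontier T" "z \<in> frontier T'" "z \<notin> corners"
 obtains a b s where "a \<noteq> b" "frontier T \<inter> frontier T' = closed_segment a b" "0 < s" "s < 1" "z = linepath a b s"
 using assms unfolding corners_def by blast

text \<open>Away from the corners a second element at z would share with T a segment having z in its
  relative interior, against \<open>facet_point_interior\<close>. So near z the closure of T alone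
  covers the domain, and \<open>interior_closure_eq\<close> removes the closure.\<close>

lemma boundary_point:
 assumes T: "T \<in> \<T>" and z: "z \<in> frontier T" "z \<in> frontier \<Omega>" "z \<notin> corners"
 shows "T' \<in> \<T> \<Longrightarrow> z \<in> closure T' \<Longrightarrow> T' = T"
  and "\<exists>e>0. T \<inter> ball z e = \<Omega> \<inter> ball z e"
proof -
 have other: "z \<notin> closure T'" if T': "T' \<in> \<T>" "T \<noteq> T'" for T'
 proof
  assume "z \<in> closure T'"
  then have "z \<in> frontier T'" using frontier_other[OF T T'(1,2) z(1)] by simp
  then obtain a b s where "a \<noteq> b" "frontier T \<inter> frontier T' = closed_segment a b" "0 < s" "s < 1" "z = linepath a b s"
   using shared_point[OF T T' z(1) _ z(3)] by blast
  then have "z \<in> \<Omega>" using facet_point_interior[OF T T'] by blast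
  then show False using z(2) open_region by (auto simp: frontier_def interior_open)
 qed
 then show "T' \<in> \<T> \<Longrightarrow> z \<in> closure T' \<Longrightarrow> T' = T" by blast
 have "closed (\<Union>T'\<in>\<T> - {T}. closure T')" using finite_mesh by auto
 moreover have "z \<notin> (\<Union>T'\<in>\<T> - {T}. closure T')" using other by blast
 ultimately obtain e where e: "e > 0" "ball z e \<subseteq> - (\<Union>T'\<in>\<T> - {T}. closure T')" by (metis Compl_iff open_Compl openE)
 have "\<Omega> \<inter> ball z e \<subseteq> closure T" using e(2) elements_cover by blast
 then have "\<Omega> \<inter> ball z e \<subseteq> interior (closure T)" using open_region by (intro interior_maximal) auto
 moreover obtain x \<rho> where "star_domain T x \<rho>" using star_element T by blast
 ultimately have "\<Omega> \<inter> ball z e \<subseteq> T" using star_domain.interior_closure_eq by metis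
 then show "\<exists>e>0. T \<inter> ball z e = \<Omega> \<inter> ball z e" using e(1) element_subset[OF T] by blast
qed

text \<open>At a frontier point of T inside the domain another element must be present: otherwise
  the closure of T would be a neighbourhood of the point.\<close>

lemma frontier_cover:
 assumes T: "T \<in> \<T>"
 shows "frontier T \<subseteq> frontier \<Omega> \<union> \<Union>(elem_facets T) \<union> corners"
proof
 fix z assume z: "z \<in> frontier T"
 show "z \<in> frontier \<Omega> \<union> \<Union>(elem_facets T) \<union> corners"
 proof (cases "z \<in> \<Omega> \<and> z \<notin> corners")
  case False
  then show ?thesis using z frontier_element_subset[OF T] open_region by (auto simp: frontier_def interior_open)
 next
  case True
  have "\<exists>T'\<in>\<T> - {T}. z \<in> closure T'"
  proof (rule ccontr)
   assume "\<not> (\<exists>T'\<in>\<T> - {T}. z \<in> closure T')"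
   then have "z \<in> \<Omega> - (\<Union>T'\<in>\<T> - {T}. closure T')" using True by blast
   moreover have "open (\<Omega> - (\<Union>T'\<in>\<T> - {T}. closure T'))" using finite_mesh open_region by (intro open_Diff) auto
   moreover have "\<Omega> - (\<Union>T'\<in>\<T> - {T}. closure T') \<subseteq> closure T" using elements_cover by blast
   ultimately have "z \<in> interior (closure T)" by (meson interior_maximal subsetD)
   moreover obtain x \<rho> where "star_domain T x \<rho>" using star_element T by blast
   ultimately have "z \<in> T" using star_domain.interior_closure_eq by metis
   then show False using z open_element[OF T] by (auto simp: frontier_def interior_open)
  qed
  then obtain T' where T': "T' \<in> \<T>" "T \<noteq> T'" "z \<in> closure T'" by blast
  have z': "z \<in> frontier T'" using frontier_other[OF T T'(1,2) z T'(3)] .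
  have nc: "z \<notin> corners" using True by simp
  obtain a b s where ab: "a \<noteq> b" "frontier T \<inter> frontier T' = closed_segment a b" "0 < s" "s < 1" "z = linepath a b s"
   by (rule shared_point[OF T T'(1,2) z z' nc])
  from ab(1,2) have "segment_set (frontier T \<inter> frontier T')" unfolding segment_set_def by (intro exI conjI)
  then have "frontier T \<inter> frontier T' \<in> elem_facets T"
   unfolding elem_interior_facets_def mem_Collect_eq using T'(1,2) by (intro conjI bexI[of _ T'] refl)
  then show ?thesis using z z' by blast
 qed
qed

end

lemma is_outer_normal_norm: "is_outer_normal S z n \<Longrightarrow> norm n = 1"
 unfolding is_outer_normal_def by blast

context tricomi_mesh
begin

section \<open>The divergence theorem on elements\<close>

definition boundary_piece :: "pt set \<Rightarrow> boundary_part \<Rightarrow> pt set" where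
 "boundary_piece T j = frontier T \<inter> Gam D j"

text \<open>The pieces of an element boundary are indexed by a sum type: \<open>Inl F\<close> for an
  interior facet, \<open>Inr j\<close> for the contact with the boundary part j. All three j occur
  for every element; contacts without length contribute zero.\<close>

definition piece_path :: "pt set + boundary_part \<Rightarrow> real \<Rightarrow> pt" where
 "piece_path = case_sum segment_path (Gam_arc D)"

definition piece_image :: "pt set \<Rightarrow> pt set + boundary_part \<Rightarrow> pt set" where
 "piece_image T = case_sum (\<lambda>F. F) (boundary_piece T)"

definition piece_set :: "pt set \<Rightarrow> pt set + boundary_part \<Rightarrow> real set" where
 "piece_set T i = {s \<in> {0..1}. piece_path i s \<in> piece_image T i}"

definition pieces :: "pt set \<Rightarrow> (pt set + boundary_part) set" where
 "pieces T = Inl ` elem_facets T \<union> Inr ` UNIV"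

lemma piece_simps [simp]:
 "piece_path (Inl F) = segment_path F" "piece_path (Inr j) = Gam_arc D j"
 "piece_image T (Inl F) = F" "piece_image T (Inr j) = boundary_piece T j"
 unfolding piece_path_def piece_image_def by auto

lemma curve_integral_piece:
 "curve_integral (piece_path i) (piece_image T i) \<phi> =
   (LINT s:piece_set T i|lebesgue. \<phi> (piece_path i s) * norm (velocity (piece_path i) s))"
 unfolding curve_integral_def piece_set_def ..

lemma elem_facetE:
 assumes "T \<in> \<T>" "F \<in> elem_facets T"
 obtains T' a b where "T' \<in> \<T>" "T \<noteq> T'" "F = frontier T \<inter> frontier T'" "F = closed_segment a b" "a \<noteq> b"
  "segment_path F = linepath a b"
proof -
 obtain T' where T': "T' \<in> \<T>" "T \<noteq> T'" "F = frontier T \<inter> frontier T'" and F: "segment_set F"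
  using assms(2) unfolding elem_interior_facets_def by auto
 obtain a b where "a \<noteq> b" "F = closed_segment a b" "segment_path F = linepath a b" by (rule segment_path[OF F])
 then show ?thesis using that T' by blast
qed

lemma finite_elem_facets: "T \<in> \<T> \<Longrightarrow> finite (elem_facets T)"
proof -
 assume "T \<in> \<T>"
 have "elem_facets T \<subseteq> (\<lambda>T'. frontier T \<inter> frontier T') ` \<T>" unfolding elem_interior_facets_def by auto
 then show ?thesis using finite_mesh finite_surj by blast
qed

lemma finite_pieces: "T \<in> \<T> \<Longrightarrow> finite (pieces T)"
 unfolding pieces_def using finite_elem_facets by (simp add: UNIV_boundary_part)

lemma piece_cases:
 assumes "i \<in> pieces T"
 obtains F where "i = Inl F" "F \<in> elem_facets T" | j where "i = Inr j" using assms unfolding pieces_def by auto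

lemma piece_lipschitz:
 assumes "T \<in> \<T>" "i \<in> pieces T" shows "\<exists>L. L-lipschitz_on {0..1} (piece_path i)" using assms(2)
proof (cases rule: piece_cases)
 case (1 F)
 obtain T' a b where "segment_path F = linepath a b" by (rule elem_facetE[OF assms(1) 1(2)])
 moreover have "(norm (b - a))-lipschitz_on {0..1} (linepath a b)"
 proof (rule lipschitz_onI)
  fix s t :: real
  have "linepath a b s - linepath a b t = (s - t) *\<^sub>R (b - a)" unfolding linepath_def by (simp add: algebra_simps)
  then show "dist (linepath a b s) (linepath a b t) \<le> norm (b - a) * dist s t"
   unfolding dist_norm by (simp add: mult.commute)
 qed simp
 ultimately show ?thesis using 1 by auto
qed (use Gam_arc_lipschitz in simp)

lemma piece_inj:
 assumes "T \<in> \<T>" "i \<in> pieces T" shows "inj_on (piece_path i) {0..1}" using assms(2)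
proof (cases rule: piece_cases)
 case (1 F)
 obtain T' a b where "a \<noteq> b" "segment_path F = linepath a b" by (rule elem_facetE[OF assms(1) 1(2)])
 then show ?thesis using inj_on_linepath 1 by auto
qed (use Gam_arc_inj in simp)

lemma piece_set_subset: "piece_set T i \<subseteq> {0..1}" unfolding piece_set_def by auto

lemma piece_set_facet:
 assumes "T \<in> \<T>" "F \<in> elem_facets T" shows "piece_set T (Inl F) = {0..1}"
proof -
 obtain T' a b where F: "F = closed_segment a b" "segment_path F = linepath a b" by (rule elem_facetE[OF assms])
 then have "segment_path F s \<in> F" if "s \<in> {0..1}" for s using linepath_in_path that by metis
 then show ?thesis unfolding piece_set_def by auto
qed

lemma piece_image_eq:
 assumes "T \<in> \<T>" "i \<in> pieces T" shows "piece_path i ` piece_set T i = piece_image T i" using assms(2)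
proof (cases rule: piece_cases)
 case (1 F)
 obtain T' a b where F: "F = closed_segment a b" "segment_path F = linepath a b" by (rule elem_facetE[OF assms(1) 1(2)])
 then have "segment_path F ` {0..1} = F" using linepath_image_01 by metis
 then show ?thesis using 1 piece_set_facet[OF assms(1) 1(2)] by simp
next
 case (2 j)
 have "boundary_piece T j \<subseteq> Gam_arc D j ` {0..1}" using Gam_subset_image[of j] unfolding boundary_piece_def by blast
 then have "Gam_arc D j ` {s \<in> {0..1}. Gam_arc D j s \<in> boundary_piece T j} = boundary_piece T j" by blast
 then show ?thesis unfolding 2 piece_set_def piece_simps .
qed

lemma piece_image_subset:
 assumes "T \<in> \<T>" "i \<in> pieces T" shows "piece_image T i \<subseteq> frontier T" using assms(2)
proof (cases rule: piece_cases)
 case (1 F)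
 then show ?thesis using elem_facetE[OF assms(1) 1(2)] by (metis Int_lower1 piece_simps(3))
qed (auto simp: boundary_piece_def)

lemma piece_set_borel:
 assumes "T \<in> \<T>" "i \<in> pieces T" shows "piece_set T i \<in> sets borel" using assms(2)
proof (cases rule: piece_cases)
 case (1 F)
 show ?thesis unfolding 1 piece_set_facet[OF assms(1) 1(2)] by simp
next
 case (2 j)
 have c: "closed ({0..1} \<inter> Gam_arc D j -` frontier T)"
  by (rule continuous_closed_preimage[OF Gam_arc_continuous]) auto
 \<comment> \<open>\<open>Gam D Upper\<close> omits its end points, so its parameters form the open
   interval.\<close>
 have cases: "piece_set T i = ({0..1} \<inter> Gam_arc D j -` frontier T) \<inter> (if j = Upper then {0<..<1} else {0..1})"
 proof (cases j)
  case Upper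
  have "s \<in> {0<..<1} \<longleftrightarrow> Gam_arc D Upper s \<in> Gam D Upper" if s: "s \<in> {0..1}" for s
  proof
   assume a: "Gam_arc D Upper s \<in> Gam D Upper"
   then have "s \<noteq> 0" "s \<noteq> 1" using upper_start upper_finish Gam_snd(1) by fastforce+
   then show "s \<in> {0<..<1}" using s by auto
  qed (simp add: Gam_Upper)
  moreover have "{0<..<1} \<subseteq> {0..1::real}" by auto
  ultimately show ?thesis unfolding 2 piece_set_def Upper piece_simps boundary_piece_def if_True simp_thms by blast
 qed (use Gam_char_image in \<open>auto simp: piece_set_def boundary_piece_def 2\<close>)
 have "(if j = Upper then {0<..<1} else {0..1::real}) \<in> sets borel" by simp
 then show ?thesis unfolding cases using borel_closed[OF c] by (rule sets.Int[rotated])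
qed

lemma AE_avoid_finite:
 fixes g :: "real \<Rightarrow> 'b"
 assumes "inj_on g {0..1}" "finite C"
 shows "AE s in lebesgue. s \<in> {0..1} \<longrightarrow> g s \<notin> C"
proof -
 have "finite (g -` C \<inter> {0..1})" by (rule finite_vimage_IntI[OF assms(2,1)])
 then have "negligible (g -` C \<inter> {0..1})" by (rule negligible_finite)
 then show ?thesis by (intro AE_I'[of "g -` C \<inter> {0..1}"]) (auto simp: negligible_iff_null_sets)
qed

lemma piece_cover:
 assumes T: "T \<in> \<T>"
 shows "finite (frontier T - (\<Union>i\<in>pieces T. piece_path i ` piece_set T i))"
proof -
 have "frontier T - (\<Union>i\<in>pieces T. piece_path i ` piece_set T i) \<subseteq> corners"
 proof
  fix z assume z: "z \<in> frontier T - (\<Union>i\<in>pieces T. piece_path i ` piece_set T i)"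
  then have n: "z \<notin> piece_image T i" if "i \<in> pieces T" for i using piece_image_eq[OF T that] that by blast
  have "z \<notin> F" if "F \<in> elem_facets T" for F using n[of "Inl F"] that unfolding pieces_def by auto
  moreover have "z \<notin> Gam D j" for j using n[of "Inr j"] z unfolding pieces_def by (auto simp: boundary_piece_def)
  ultimately have "z \<notin> frontier \<Omega>" "z \<notin> \<Union>(elem_facets T)" unfolding frontier_region by blast+
  then show "z \<in> corners" using frontier_cover[OF T] z by blast
 qed
 then show ?thesis using finite_corners finite_subset by blast
qed

lemma facet_corner_or_interior:
 assumes T: "T \<in> \<T>" and F: "F \<in> elem_facets T" and z: "z \<in> F" "z \<notin> corners"
 shows "z \<in> \<Omega>" "\<And>T''. T'' \<in> \<T> \<Longrightarrow> z \<in> closure T'' \<Longrightarrow> F = frontier T \<inter> frontier T'' \<or> T'' = T"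
proof -
 obtain T' where T': "T' \<in> \<T>" "T \<noteq> T'" "F = frontier T \<inter> frontier T'" by (rule elem_facetE[OF T F])
 obtain a b s where s: "a \<noteq> b" "frontier T \<inter> frontier T' = closed_segment a b" "0 < s" "s < 1" "z = linepath a b s"
  using shared_point[OF T T'(1,2), of z] z T'(3) by blast
 show "z \<in> \<Omega>" unfolding s(5) by (rule facet_point_interior[OF T T'(1,2) s(2,1,3,4)])
 fix T'' assume "T'' \<in> \<T>" "z \<in> closure T''"
 then have "T'' = T \<or> T'' = T'" using facet_point_elements[OF T T'(1,2) s(2,1,3,4)] s(5) by blast
 then show "F = frontier T \<inter> frontier T'' \<or> T'' = T" using T'(3) by blast
qed

text \<open>Two facets of T with a common point off the corners have the same second neighbour and
  so coincide. A facet and a boundary part can meet only in corners, since the other points of a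
  facet lie inside the domain.\<close>

lemma piece_disjoint:
 assumes T: "T \<in> \<T>" and i: "i \<in> pieces T" "i' \<in> pieces T" "i \<noteq> i'"
 shows "finite (piece_path i ` piece_set T i \<inter> piece_path i' ` piece_set T i')"
proof -
 have FF: "F \<inter> F' \<subseteq> corners" if F: "F \<in> elem_facets T" "F' \<in> elem_facets T" "F \<noteq> F'" for F F'
 proof
  fix z assume z: "z \<in> F \<inter> F'"
  show "z \<in> corners"
  proof (rule ccontr)
   assume nc: "z \<notin> corners"
   obtain T'' where T'': "T'' \<in> \<T>" "T \<noteq> T''" "F' = frontier T \<inter> frontier T''" by (rule elem_facetE[OF T F(2)])
   have "z \<in> closure T''" using z T'' by (auto simp: frontier_def)
   then show False using facet_corner_or_interior(2)[OF T F(1) _ nc T''(1)] z T'' F(3) by blast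
  qed
 qed
 have FG: "F \<inter> boundary_piece T j \<subseteq> corners" if F: "F \<in> elem_facets T" for F j
 proof
  fix z assume z: "z \<in> F \<inter> boundary_piece T j"
  show "z \<in> corners"
  proof (rule ccontr)
   assume nc: "z \<notin> corners"
   have "z \<in> \<Omega>" using facet_corner_or_interior(1)[OF T F _ nc] z by blast
   moreover have "z \<in> frontier \<Omega>" using z Gam_subset_frontier unfolding boundary_piece_def by blast
   ultimately show False using open_region by (auto simp: frontier_def interior_open)
  qed
 qed
 have "finite (piece_image T i \<inter> piece_image T i')"
 proof (cases i)
  case i1: (Inl F)
  then have F: "F \<in> elem_facets T" using i unfolding pieces_def by auto
  show ?thesis
  proof (cases i')
   case (Inl F')
   then have "F' \<in> elem_facets T" "F \<noteq> F'" using i i1 unfolding pieces_def by auto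
   then have "F \<inter> F' \<subseteq> corners" by (rule FF[OF F])
   then have "finite (F \<inter> F')" using finite_corners finite_subset by blast
   then show ?thesis using i1 Inl by simp
  next
   case (Inr j)
   have "finite (F \<inter> boundary_piece T j)" using FG[OF F] finite_corners finite_subset by blast
   then show ?thesis using i1 Inr by simp
  qed
 next
  case i1: (Inr j)
  show ?thesis
  proof (cases i')
   case (Inl F')
   then have "F' \<in> elem_facets T" using i unfolding pieces_def by auto
   then have "finite (F' \<inter> boundary_piece T j)" using FG[of F' j] finite_corners finite_subset by blast
   then show ?thesis using i1 Inl by (simp add: Int_commute)
  next
   case (Inr j')
   then have "finite (Gam D j \<inter> Gam D j')" using i(3) i1 by (intro Gam_Int_finite) auto
   then show ?thesis unfolding i1 Inr piece_simps boundary_piece_def by (rule rev_finite_subset) auto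
  qed
 qed
 then show ?thesis unfolding piece_image_eq[OF T i(1)] piece_image_eq[OF T i(2)] .
qed

text \<open>On a boundary part, T coincides with the domain near almost every point. Hence a whole
  stretch of the boundary arc belongs to the frontier of T, \<open>outer_normal_star\<close>
  applies, and the normal it yields is also that of the domain.\<close>

lemma piece_normal:
 assumes st: "star_domain T x \<rho>" and T: "T \<in> \<T>" and i: "i \<in> pieces T"
 shows "AE_curve (piece_path i) (piece_set T i) (\<lambda>s. is_outer_normal T (piece_path i s) (outer_normal T (piece_path i s)) \<and>
   outer_normal T (piece_path i s) \<bullet> velocity (piece_path i) s = 0 \<and>
   (\<forall>w\<in>ball x \<rho>. 0 < (piece_path i s - w) \<bullet> outer_normal T (piece_path i s)) \<and>
   (\<forall>j. i = Inr j \<longrightarrow> is_outer_normal \<Omega> (piece_path i s) (outer_normal T (piece_path i s))))" using i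
proof (cases rule: piece_cases)
 case (1 F)
 obtain T' a b where F: "F = frontier T \<inter> frontier T'" "F = closed_segment a b" "a \<noteq> b" "segment_path F = linepath a b"
  by (rule elem_facetE[OF T 1(2)])
 have sub: "closed_segment a b \<subseteq> frontier T" using F by auto
 have "AE s in lebesgue. s \<in> {0..1} \<longrightarrow> (\<lambda>s. s) s \<notin> {0, 1 :: real}" by (rule AE_avoid_finite) auto
 then show ?thesis
 proof (eventually_elim, intro impI)
  fix s assume s: "s \<in> {0..1} \<longrightarrow> s \<notin> {0, 1 :: real}" "s \<in> piece_set T i" "velocity (piece_path i) s \<noteq> 0"
  then have s01: "0 < s" "s < 1" using piece_set_subset[of T i] by auto
  obtain n where n: "is_outer_normal T (linepath a b s) n" "n \<bullet> (b - a) = 0"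
    "\<And>w. w \<in> ball x \<rho> \<Longrightarrow> 0 < (linepath a b s - w) \<bullet> n" by (rule star_domain.segment_normal[OF st sub F(3) s01]) blast
  have on: "outer_normal T (linepath a b s) = n" using outer_normal_eq[OF n(1)] .
  have vd: "velocity (linepath a b) s = b - a" by simp
  show "is_outer_normal T (piece_path i s) (outer_normal T (piece_path i s)) \<and>
   outer_normal T (piece_path i s) \<bullet> velocity (piece_path i) s = 0 \<and>
   (\<forall>w\<in>ball x \<rho>. 0 < (piece_path i s - w) \<bullet> outer_normal T (piece_path i s)) \<and>
   (\<forall>j. i = Inr j \<longrightarrow> is_outer_normal \<Omega> (piece_path i s) (outer_normal T (piece_path i s)))"
   unfolding 1(1) piece_simps F(4) on vd using n by auto
 qed
next
 case (2 j)
 obtain L where L: "L-lipschitz_on {0..1} (Gam_arc D j)" using Gam_arc_lipschitz by blast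
 obtain G where G: "AE s in lebesgue. s \<in> {0..1} \<longrightarrow> 0 < s \<and> s < 1 \<and> (Gam_arc D j has_vector_derivative G s) (at s)"
  by (rule lipschitz_curve_derivative_AE[OF L])
 show ?thesis using G AE_avoid_finite[OF Gam_arc_inj[of j] finite_corners]
 proof (eventually_elim, intro impI)
  fix s assume a: "s \<in> {0..1} \<longrightarrow> 0 < s \<and> s < 1 \<and> (Gam_arc D j has_vector_derivative G s) (at s)"
   "s \<in> {0..1} \<longrightarrow> Gam_arc D j s \<notin> corners" "s \<in> piece_set T i" "velocity (piece_path i) s \<noteq> 0"
  have sI: "s \<in> {0..1}" and z: "Gam_arc D j s \<in> frontier T" "Gam_arc D j s \<in> frontier \<Omega>"
   using a(3) Gam_subset_frontier[of j] unfolding piece_set_def 2 piece_simps boundary_piece_def by auto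
  have s: "0 < s" "s < 1" and der: "(Gam_arc D j has_vector_derivative G s) (at s)" using a(1) sI by auto
  have vd: "velocity (Gam_arc D j) s = G s" using vector_derivative_at[OF der] .
  then have G0: "G s \<noteq> 0" using a(4) unfolding 2 piece_simps by simp
  define z where "z = Gam_arc D j s"
  obtain e where e: "e > 0" "T \<inter> ball z e = \<Omega> \<inter> ball z e"
   using boundary_point(2)[OF T z] a(2) sI unfolding z_def by blast
  obtain d where d: "d > 0" "\<And>t. t \<in> {0..1} \<Longrightarrow> \<bar>t - s\<bar> < d \<Longrightarrow> dist (Gam_arc D j t) z < e"
   using Gam_arc_continuous[of j] e(1) sI unfolding continuous_on_iff z_def dist_real_def by blast
  define d' where "d' = min (d / 2) (min s (1 - s))"
  have d': "d' > 0" "d' < d" "d' \<le> s" "d' \<le> 1 - s" unfolding d'_def using d s by auto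
  have fr: "Gam_arc D j t \<in> frontier T" if t: "\<bar>t - s\<bar> \<le> d'" for t
  proof -
   have tI: "t \<in> {0..1}" using t d' by auto
   then have "Gam_arc D j t \<in> frontier \<Omega>" using Gam_arc_frontier by blast
   moreover have "Gam_arc D j t \<in> ball z e" using d(2)[OF tI] t d' by (simp add: dist_commute)
   ultimately show ?thesis using frontier_local[of "ball z e" \<Omega> T] e(2) by auto
  qed
  have cont: "continuous_on {s - d'..s + d'} (Gam_arc D j)"
   by (rule continuous_on_subset[OF Gam_arc_continuous]) (use d' in auto)
  have "\<exists>n. is_outer_normal T z n \<and> n \<bullet> G s = 0 \<and> (\<forall>w\<in>ball x \<rho>. 0 < (z - w) \<bullet> n)" unfolding z_def
  proof (rule star_domain.outer_normal_star[OF st fr d'(1) cont der G0])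
   fix n assume "is_outer_normal T (Gam_arc D j s) n" "n \<bullet> G s = 0"
    "\<And>w. w \<in> ball x \<rho> \<Longrightarrow> 0 < (Gam_arc D j s - w) \<bullet> n"
   then show "\<exists>n. is_outer_normal T (Gam_arc D j s) n \<and> n \<bullet> G s = 0 \<and> (\<forall>w\<in>ball x \<rho>. 0 < (Gam_arc D j s - w) \<bullet> n)"
    by blast
  qed
  then obtain n where n: "is_outer_normal T z n" "n \<bullet> G s = 0" "\<And>w. w \<in> ball x \<rho> \<Longrightarrow> 0 < (z - w) \<bullet> n" by blast
  have on: "outer_normal T z = n" using outer_normal_eq[OF n(1)] .
  have n\<Omega>: "is_outer_normal \<Omega> z n" by (rule is_outer_normal_local[OF e n(1)])
  show "is_outer_normal T (piece_path i s) (outer_normal T (piece_path i s)) \<and>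
   outer_normal T (piece_path i s) \<bullet> velocity (piece_path i) s = 0 \<and>
   (\<forall>w\<in>ball x \<rho>. 0 < (piece_path i s - w) \<bullet> outer_normal T (piece_path i s)) \<and>
   (\<forall>j. i = Inr j \<longrightarrow> is_outer_normal \<Omega> (piece_path i s) (outer_normal T (piece_path i s)))"
   unfolding 2 piece_simps z_def[symmetric] on vd using n n\<Omega> by auto
 qed
qed

theorem element_divergence:
 fixes \<phi> \<phi>1 \<phi>2 :: "pt \<Rightarrow> real"
 assumes T: "T \<in> \<T>" and cont: "continuous_on (closure T) \<phi>"
  and der: "\<And>z. z \<in> T \<Longrightarrow> (\<phi> has_derivative (\<lambda>h. fst h * \<phi>1 z + snd h * \<phi>2 z)) (at z)"
  and c1: "continuous_on T \<phi>1" and c2: "continuous_on T \<phi>2"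
  and i1: "set_integrable lebesgue T \<phi>1" and i2: "set_integrable lebesgue T \<phi>2"
 shows "(LINT z:T|lebesgue. e \<bullet> (\<phi>1 z, \<phi>2 z)) =
  (\<Sum>i\<in>pieces T. curve_integral (piece_path i) (piece_image T i) (\<lambda>z. \<phi> z * (e \<bullet> outer_normal T z)))"
proof -
 obtain x \<rho> where st: "star_domain T x \<rho>" using star_element[OF T] by blast
 have "\<forall>i\<in>pieces T. \<exists>L. L-lipschitz_on {0..1} (piece_path i)" using piece_lipschitz[OF T] by blast
 then obtain L where L: "\<And>i. i \<in> pieces T \<Longrightarrow> (L i)-lipschitz_on {0..1} (piece_path i)" by metis
 show ?thesis unfolding curve_integral_piece
 proof (rule star_domain.star_divergence[OF st cont der c1 c2 i1 i2 finite_pieces[OF T] L])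
  show "AE_curve (piece_path i) (piece_set T i) (\<lambda>s. norm (outer_normal T (piece_path i s)) = 1 \<and> outer_normal T (piece_path i s) \<bullet> velocity (piece_path i) s = 0 \<and>
    (\<forall>w\<in>ball x \<rho>. 0 < (piece_path i s - w) \<bullet> outer_normal T (piece_path i s)))" if "i \<in> pieces T" for i
   using piece_normal[OF st T that] by eventually_elim (use is_outer_normal_norm in blast)
 qed (use piece_set_borel[OF T] piece_set_subset piece_inj[OF T] piece_image_eq[OF T] piece_image_subset[OF T]
   piece_cover[OF T] piece_disjoint[OF T] inj_on_subset[OF piece_inj[OF T] piece_set_subset] in \<open>auto\<close>)
qed

lemma piece_trace_normal:
 assumes T: "T \<in> \<T>" and i: "i \<in> pieces T"
 shows "trace_bounded (piece_path i) (piece_set T i) (\<lambda>z. e \<bullet> outer_normal T z)"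
proof -
 obtain x \<rho> where st: "star_domain T x \<rho>" using star_element[OF T] by blast
 obtain L where L: "L-lipschitz_on {0..1} (piece_path i)" using piece_lipschitz[OF T i] by blast
 show ?thesis
 proof -
  have xb: "x \<in> ball x \<rho>" using star_domain.rho_pos[OF st] by simp
  show ?thesis
 proof (rule trace_bounded_normal[OF L piece_set_borel[OF T i] piece_set_subset, where x = x])
  show "AE_curve (piece_path i) (piece_set T i) (\<lambda>s. norm (outer_normal T (piece_path i s)) = 1 \<and> outer_normal T (piece_path i s) \<bullet> velocity (piece_path i) s = 0 \<and>
    0 < (piece_path i s - x) \<bullet> outer_normal T (piece_path i s))"
   using piece_normal[OF st T i] by eventually_elim (use xb is_outer_normal_norm in blast)
 qed
 qed
qed

lemma piece_trace_continuous:
 assumes T: "T \<in> \<T>" and i: "i \<in> pieces T" and \<phi>: "continuous_on (closure \<Omega>) \<phi>"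
 shows "trace_bounded (piece_path i) (piece_set T i) \<phi>"
proof -
 obtain L where L: "L-lipschitz_on {0..1} (piece_path i)" using piece_lipschitz[OF T i] by blast
 show ?thesis
 proof (rule trace_bounded_continuous[OF L piece_set_borel[OF T i] piece_set_subset _ _ \<phi>])
  show "compact (closure \<Omega>)" using bounded_region by (simp add: compact_closure)
  show "piece_path i ` piece_set T i \<subseteq> closure \<Omega>"
   using piece_image_eq[OF T i] piece_image_subset[OF T i] frontier_element_subset[OF T] by auto
 qed
qed

lemma piece_trace_integrable:
 assumes T: "T \<in> \<T>" and i: "i \<in> pieces T" and \<phi>: "trace_bounded (piece_path i) (piece_set T i) \<phi>"
 shows "set_integrable lebesgue (piece_set T i) (\<lambda>s. \<phi> (piece_path i s) * norm (velocity (piece_path i) s))"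
 using piece_lipschitz[OF T i] trace_bounded_integrable[OF _ piece_set_borel[OF T i] piece_set_subset \<phi>] by blast

end

section \<open>Integrability of the derivatives of the coefficients\<close>

text \<open>f + M is nonnegative and has a continuous antiderivative up to the end points, hence a
  finite integral; for a nonnegative function this is absolute integrability.\<close>

lemma deriv_bounded_below_absolutely_integrable:
 fixes F f :: "real \<Rightarrow> real"
 assumes cont: "continuous_on {a..m} F" and am: "a \<le> m"
  and der: "\<And>x. a < x \<Longrightarrow> x < m \<Longrightarrow> (F has_real_derivative f x) (at x)"
  and low: "\<And>x. a < x \<Longrightarrow> x < m \<Longrightarrow> - M \<le> f x"
 shows "f absolutely_integrable_on {a<..<m}"
proof -
 have "((\<lambda>x. f x + M) has_integral ((F m + M * m) - (F a + M * a))) {a..m}"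
 proof (rule fundamental_theorem_of_calculus_interior[OF am])
  show "continuous_on {a..m} (\<lambda>x. F x + M * x)" by (intro continuous_intros cont)
  fix x assume "x \<in> {a<..<m}"
  then have "((\<lambda>x. F x + M * x) has_real_derivative f x + M) (at x)"
   using der[of x] by (auto intro!: derivative_eq_intros)
  then show "((\<lambda>x. F x + M * x) has_vector_derivative f x + M) (at x)"
   by (simp add: has_real_derivative_iff_has_vector_derivative)
 qed
 then have "(\<lambda>x. f x + M) integrable_on {a<..<m}" unfolding integrable_on_def has_integral_Icc_iff_Ioo by blast
 then have 1: "(\<lambda>x. f x + M) absolutely_integrable_on {a<..<m}"
  by (rule nonnegative_absolutely_integrable_1) (use low in force)
 have "(\<lambda>x. M) absolutely_integrable_on {a<..<m}" using absolutely_integrable_on_const[of "{a<..<m}" M] by simp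
 from set_integral_diff(1)[OF 1 this] show ?thesis by simp
qed

lemma absolutely_integrable_affine:
 fixes f :: "real \<Rightarrow> real"
 assumes k: "k \<noteq> 0" and S: "S \<in> sets lebesgue"
 shows "f absolutely_integrable_on (\<lambda>t. a + k * t) ` S \<longleftrightarrow> (\<lambda>t. f (a + k * t)) absolutely_integrable_on S"
proof -
 have "f absolutely_integrable_on (\<lambda>t. a + k * t) ` S \<longleftrightarrow> (\<lambda>x. \<bar>k\<bar> * f (a + k * x)) absolutely_integrable_on S"
  by (rule absolutely_integrable_change_of_variables_1'[OF S])
    (use k in \<open>auto intro!: derivative_eq_intros inj_onI\<close>)
 also have "\<dots> \<longleftrightarrow> (\<lambda>t. f (a + k * t)) absolutely_integrable_on S"
  using k by (simp add: set_integrable_def integrable_mult_right_iff mult.left_commute[of _ "\<bar>k\<bar>"])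
 finally show ?thesis .
qed

lemma affine_image_Ioo:
 fixes k :: real
 shows "k > 0 \<Longrightarrow> (\<lambda>t. a + k * t) ` {u<..<v} = {a + k * u<..<a + k * v}"
  and "k < 0 \<Longrightarrow> (\<lambda>t. a + k * t) ` {u<..<v} = {a + k * v<..<a + k * u}"
proof -
 assume k: "k > 0"
 show "(\<lambda>t. a + k * t) ` {u<..<v} = {a + k * u<..<a + k * v}"
 proof (intro set_eqI iffI)
  fix y assume "y \<in> {a + k * u<..<a + k * v}"
  then show "y \<in> (\<lambda>t. a + k * t) ` {u<..<v}"
   using k by (intro image_eqI[of _ _ "(y - a) / k"]) (auto simp: field_simps)
 qed (use k in auto)
next
 assume k: "k < 0"
 show "(\<lambda>t. a + k * t) ` {u<..<v} = {a + k * v<..<a + k * u}"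
 proof (intro set_eqI iffI)
  fix y assume "y \<in> {a + k * v<..<a + k * u}"
  then show "y \<in> (\<lambda>t. a + k * t) ` {u<..<v}"
   using k by (intro image_eqI[of _ _ "(y - a) / k"]) (auto simp: field_simps)
 qed (use k in auto)
qed

lemma absolutely_integrable_continuous_Icc_subset:
 fixes f :: "real \<Rightarrow> real"
 assumes "continuous_on {a..m} f"
 shows "f absolutely_integrable_on {a..m}" using absolutely_integrable_continuous_real[OF assms] .

lemma absolutely_integrable_interval_ends:
 fixes f :: "real \<Rightarrow> real"
 assumes cont: "continuous_on {l<..<r} f"
  and e1: "t > 0" "f absolutely_integrable_on {l<..<l + t}"
  and e2: "t' > 0" "f absolutely_integrable_on {r - t'<..<r}"
 shows "f absolutely_integrable_on {l<..<r}"
proof -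
 have "f absolutely_integrable_on {l + t / 2..r - t' / 2}"
  by (intro absolutely_integrable_continuous_Icc_subset continuous_on_subset[OF cont]) (use e1 e2 in auto)
 then have "f absolutely_integrable_on ({l<..<l + t} \<union> {l + t / 2..r - t' / 2}) \<union> {r - t'<..<r}"
  by (intro absolutely_integrable_Un e1(2) e2(2))
 then show ?thesis by (rule set_integrable_subset) (use e1(1) e2(1) in auto)
qed

text \<open>Scaling by \<open>q > 1\<close> contracts integrals: \<open>\<integral> |f (q t)| dt = q\<^sup>-\<^sup>1 \<integral> |f|\<close>, so the hypothesis bounds the
 integral of \<open>|f|\<close> away from \<open>0\<close> uniformly.\<close>

lemma scaling_absolutely_integrable:
 fixes f k :: "real \<Rightarrow> real"
 assumes cont: "continuous_on {0<..q * \<tau>} f" and q: "q > 1" and \<tau>: "\<tau> > 0"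
  and k: "k absolutely_integrable_on {0<..<\<tau>}"
  and bound: "\<And>t. 0 < t \<Longrightarrow> t < \<tau> \<Longrightarrow> \<bar>f t\<bar> \<le> \<bar>f (q * t)\<bar> + \<bar>k t\<bar>"
 shows "f absolutely_integrable_on {0<..<\<tau>}"
proof -
 have q\<tau>: "\<tau> < q * \<tau>" using q \<tau> by simp
 have ci: "(\<lambda>t. \<bar>f t\<bar>) integrable_on {u..v}" if "0 < u" "v \<le> q * \<tau>" for u v
  by (intro integrable_continuous_real continuous_intros continuous_on_subset[OF cont]) (use that in auto)
 have ka: "(\<lambda>t. \<bar>k t\<bar>) integrable_on {0<..<\<tau>}" using k by (simp add: absolutely_integrable_on_def)
 then have ki: "(\<lambda>t. \<bar>k t\<bar>) integrable_on {0..\<tau>}" unfolding integrable_on_def has_integral_Icc_iff_Ioo .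
 define C where "C = integral {0..\<tau>} (\<lambda>t. \<bar>k t\<bar>)"
 define C' where "C' = integral {\<tau>..q * \<tau>} (\<lambda>t. \<bar>f t\<bar>)"
 \<comment> \<open>A is the solution I of I = (I + C') / q + C.\<close>
 define A where "A = (C' / q + C) * (q / (q - 1))"
 have C'0: "C' \<ge> 0" unfolding C'_def by (intro integral_nonneg ci) (use q\<tau> \<tau> in auto)
 have C0: "C \<ge> 0" unfolding C_def by (intro integral_nonneg ki) auto
 have est: "integral {\<epsilon>..\<tau>} (\<lambda>t. \<bar>f t\<bar>) \<le> A" if e: "0 < \<epsilon>" "\<epsilon> \<le> \<tau>" for \<epsilon>
 proof -
  define I where "I = integral {\<epsilon>..\<tau>} (\<lambda>t. \<bar>f t\<bar>)"
  have ki': "(\<lambda>t. \<bar>k t\<bar>) integrable_on {\<epsilon>..\<tau>}" by (rule integrable_on_subinterval[OF ki]) (use e in auto)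
  have fq: "((\<lambda>t. \<bar>f (q * t)\<bar>) has_integral (1 / q) * integral {q * \<epsilon>..q * \<tau>} (\<lambda>t. \<bar>f t\<bar>)) {\<epsilon>..\<tau>}"
  proof -
   have "((\<lambda>t. \<bar>f t\<bar>) has_integral integral {q * \<epsilon>..q * \<tau>} (\<lambda>t. \<bar>f t\<bar>)) (cbox (q * \<epsilon>) (q * \<tau>))"
    using ci[of "q * \<epsilon>" "q * \<tau>"] q e by (simp add: integrable_integral)
   from has_integral_affinity[OF this, of q 0] q
   have "((\<lambda>t. \<bar>f (q * t)\<bar>) has_integral (1 / q) * integral {q * \<epsilon>..q * \<tau>} (\<lambda>t. \<bar>f t\<bar>)) ((\<lambda>x. (1 / q) *\<^sub>R x) ` cbox (q * \<epsilon>) (q * \<tau>))"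
    by simp
   moreover have "(\<lambda>x. (1 / q) *\<^sub>R x) ` cbox (q * \<epsilon>) (q * \<tau>) = {\<epsilon>..\<tau>}"
   proof -
    have "(\<lambda>x. (1 / q) *\<^sub>R x) ` {q * \<epsilon>..q * \<tau>} = {\<epsilon>..\<tau>}"
    proof (intro set_eqI iffI)
     fix y assume "y \<in> {\<epsilon>..\<tau>}"
     then show "y \<in> (\<lambda>x. (1 / q) *\<^sub>R x) ` {q * \<epsilon>..q * \<tau>}" using q by (intro image_eqI[of _ _ "q * y"]) auto
    qed (use q in \<open>auto simp: field_simps\<close>)
    then show ?thesis by simp
   qed
   ultimately show ?thesis by simp
  qed
  have Iq: "integral {q * \<epsilon>..q * \<tau>} (\<lambda>t. \<bar>f t\<bar>) \<le> I + C'"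
  proof -
   have "\<epsilon> \<le> q * \<epsilon>" using q e by simp
   then have "integral {q * \<epsilon>..q * \<tau>} (\<lambda>t. \<bar>f t\<bar>) \<le> integral {\<epsilon>..q * \<tau>} (\<lambda>t. \<bar>f t\<bar>)"
    by (intro integral_subset_le ci) (use q e in auto)
   also have "\<dots> = I + C'" unfolding I_def C'_def
    using Henstock_Kurzweil_Integration.integral_combine[of \<epsilon> \<tau> "q * \<tau>" "\<lambda>t. \<bar>f t\<bar>"] ci[of \<epsilon> "q * \<tau>"] e q\<tau> by simp
   finally show ?thesis .
  qed
  have "I \<le> integral {\<epsilon>..\<tau>} (\<lambda>t. \<bar>f (q * t)\<bar> + \<bar>k t\<bar>)"
  proof -
   have fk: "(\<lambda>t. \<bar>f (q * t)\<bar> + \<bar>k t\<bar>) integrable_on {\<epsilon>..\<tau>}"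
    using fq ki' by (intro integrable_add) (auto simp: integrable_on_def)
   have "integral {\<epsilon><..<\<tau>} (\<lambda>t. \<bar>f t\<bar>) \<le> integral {\<epsilon><..<\<tau>} (\<lambda>t. \<bar>f (q * t)\<bar> + \<bar>k t\<bar>)" using ci[of \<epsilon> \<tau>] fk e q\<tau> bound
    by (intro integral_le) (auto simp: integrable_on_def has_integral_Icc_iff_Ioo)
   then show ?thesis unfolding I_def by (simp add: integral_open_interval_real)
  qed
  also have "\<dots> = (1 / q) * integral {q * \<epsilon>..q * \<tau>} (\<lambda>t. \<bar>f t\<bar>) + integral {\<epsilon>..\<tau>} (\<lambda>t. \<bar>k t\<bar>)"
   using fq ki' by (subst Henstock_Kurzweil_Integration.integral_add) (auto simp: integrable_on_def integral_unique)
  also have "\<dots> \<le> (1 / q) * (I + C') + C"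
  proof (intro add_mono mult_left_mono Iq)
   show "integral {\<epsilon>..\<tau>} (\<lambda>t. \<bar>k t\<bar>) \<le> C" unfolding C_def by (intro integral_subset_le ki ki') (use e in auto)
  qed (use q in auto)
  finally have "I * (1 - 1 / q) \<le> C' / q + C" by (simp add: algebra_simps add_divide_distrib)
  moreover have "1 - 1 / q = (q - 1) / q" using q by (simp add: field_simps)
  ultimately have "I * ((q - 1) / q) \<le> C' / q + C" by simp
  then have "I * ((q - 1) / q) * (q / (q - 1)) \<le> A" unfolding A_def using q by (intro mult_right_mono) auto
  then show ?thesis unfolding I_def using q by simp
 qed
 \<comment> \<open>Truncations of |f| away from 0; they increase to |f| and their integrals are at
   most A.\<close>
 define g where "g n t = (if t \<in> {\<tau> / (real n + 1)..\<tau>} then \<bar>f t\<bar> else 0)" for n t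
 have en: "0 < \<tau> / (real n + 1)" "\<tau> / (real n + 1) \<le> \<tau>" for n using \<tau> by (auto simp: field_simps)
 have gi: "(g n has_integral integral {\<tau> / (real n + 1)..\<tau>} (\<lambda>t. \<bar>f t\<bar>)) {0<..\<tau>}" for n
  unfolding g_def using en[of n] q\<tau> ci[of "\<tau> / (real n + 1)" \<tau>]
  by (subst has_integral_restrict) (auto intro: less_le_trans simp: integrable_integral)
 have "(\<lambda>t. \<bar>f t\<bar>) integrable_on {0<..\<tau>} \<and>
   (\<lambda>n. integral {0<..\<tau>} (g n)) \<longlonglongrightarrow> integral {0<..\<tau>} (\<lambda>t. \<bar>f t\<bar>)"
 proof (rule monotone_convergence_increasing)
  show "g n integrable_on {0<..\<tau>}" for n using gi by blast
  show "g n t \<le> g (Suc n) t" if "t \<in> {0<..\<tau>}" for n t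
  proof -
   have "\<tau> / (real (Suc n) + 1) \<le> \<tau> / (real n + 1)" using \<tau> by (intro divide_left_mono) auto
   then show ?thesis unfolding g_def by auto
  qed
  show "(\<lambda>n. g n t) \<longlonglongrightarrow> \<bar>f t\<bar>" if t: "t \<in> {0<..\<tau>}" for t
  proof -
   obtain N where N: "\<tau> / t < real N" using reals_Archimedean2 by blast
   have "\<forall>\<^sub>F n in sequentially. g n t = \<bar>f t\<bar>" using eventually_ge_at_top[of N]
   proof eventually_elim
    fix n assume "N \<le> n"
    then have "\<tau> / t < real n + 1" using N by linarith
    then have "\<tau> / (real n + 1) \<le> t" using t by (simp add: field_simps)
    then show "g n t = \<bar>f t\<bar>" unfolding g_def using t by auto
   qed
   then show ?thesis by (rule tendsto_eventually)
  qed
  show "bounded (range (\<lambda>n. integral {0<..\<tau>} (g n)))"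
  proof (rule boundedI)
   fix x assume "x \<in> range (\<lambda>n. integral {0<..\<tau>} (g n))"
   then obtain n where x: "x = integral {\<tau> / (real n + 1)..\<tau>} (\<lambda>t. \<bar>f t\<bar>)" using integral_unique[OF gi] by auto
   have "0 \<le> x" unfolding x by (intro integral_nonneg ci) (use en q\<tau> in auto)
   then show "norm x \<le> A" using est[OF en] unfolding x by simp
  qed
 qed
 then have fi: "(\<lambda>t. \<bar>f t\<bar>) integrable_on {0<..\<tau>}" by blast
 have "f absolutely_integrable_on {0<..\<tau>}"
 proof (rule measurable_bounded_by_integrable_imp_absolutely_integrable[OF _ _ fi])
  have "{0<..\<tau>} \<subseteq> {0<..q * \<tau>}"
  proof
   fix x assume "x \<in> {0<..\<tau>}"
   then have x: "0 < x" "x \<le> \<tau>" by auto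
   have "x \<le> q * \<tau>" using x(2) q\<tau> by linarith
   then show "x \<in> {0<..q * \<tau>}" using x(1) by simp
  qed
  then have "continuous_on {0<..\<tau>} f" by (rule continuous_on_subset[OF cont])
  then show "f \<in> borel_measurable (lebesgue_on {0<..\<tau>})" by (rule continuous_imp_measurable_on_sets_lebesgue) auto
 qed auto
 then show ?thesis by (rule set_integrable_subset) auto
qed

lemma open_connected_bounded_real:
 fixes A :: "real set"
 assumes "open A" "connected A" "bounded A" "A \<noteq> {}"
 shows "A = {Inf A<..<Sup A}"
proof
 have bd: "bdd_below A" "bdd_above A" using assms(3) bounded_imp_bdd_below bounded_imp_bdd_above by auto
 show "A \<subseteq> {Inf A<..<Sup A}"
 proof
  fix x assume x: "x \<in> A"
  obtain e where e: "e > 0" "ball x e \<subseteq> A" using openE[OF assms(1) x] by blast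
  have "x - e / 2 \<in> A" "x + e / 2 \<in> A" using e by (auto intro!: subsetD[OF e(2)] simp: dist_real_def)
  then show "x \<in> {Inf A<..<Sup A}" using e(1) cInf_lower[OF _ bd(1)] cSup_upper[OF _ bd(2)] by fastforce
 qed
 show "{Inf A<..<Sup A} \<subseteq> A"
 proof
  fix x assume x: "x \<in> {Inf A<..<Sup A}"
  then obtain u v where "u \<in> A" "u < x" "v \<in> A" "x < v"
   using cInf_less_iff[OF assms(4) bd(1)] less_cSup_iff[OF assms(4) bd(2)] by auto
  then show "x \<in> A" using assms(2) unfolding is_interval_connected_1[symmetric] is_interval_1 by (meson less_imp_le)
 qed
qed

lemma C1_real_facts:
 fixes f :: "real \<Rightarrow> real"
 assumes "f C1_differentiable_on S"
 shows "\<And>x. x \<in> S \<Longrightarrow> (f has_real_derivative deriv f x) (at x)" "continuous_on S (deriv f)"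
proof -
 obtain f' where f': "\<And>x. x \<in> S \<Longrightarrow> (f has_vector_derivative f' x) (at x)" "continuous_on S f'"
  using assms unfolding C1_differentiable_on_def by blast
 have d: "(f has_real_derivative f' x) (at x)" if "x \<in> S" for x
  using f'(1)[OF that] by (simp add: has_real_derivative_iff_has_vector_derivative)
 have eq: "deriv f x = f' x" if "x \<in> S" for x by (rule DERIV_imp_deriv[OF d[OF that]])
 show "\<And>x. x \<in> S \<Longrightarrow> (f has_real_derivative deriv f x) (at x)" using d eq by simp
 show "continuous_on S (deriv f)" using f'(2) eq by (simp cong: continuous_on_cong)
qed

lemma absolutely_integrable_product:
 fixes f :: "real \<Rightarrow> real"
 assumes f: "f absolutely_integrable_on A" and A: "open A" and cont: "continuous_on A f" and B: "open B" "bounded B"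
 shows "(\<lambda>z. f (fst z)) absolutely_integrable_on A \<times> B" "(\<lambda>z. f (snd z)) absolutely_integrable_on B \<times> A"
proof -
 define F where "F x = indicator A x *\<^sub>R f x" for x
 define G where "G y = (indicator B y :: real)" for y
 have Fm: "F \<in> borel_measurable borel" unfolding F_def using A cont by (intro borel_measurable_continuous_on_indicator) auto
 have Gm: "G \<in> borel_measurable borel" unfolding G_def using B by simp
 have "integrable lebesgue F" using f unfolding set_integrable_def F_def .
 then have Fi: "integrable lborel F" using Fm by (simp add: integrable_completion)
 have "emeasure lborel B < \<infinity>" using B(2) by (rule emeasure_bounded_finite)
 then have Gi: "integrable lborel G" unfolding G_def using B(1) by (intro integrable_real_indicator) auto
 have m1: "(\<lambda>z. F (fst z) * G (snd z)) \<in> borel_measurable (lborel \<Otimes>\<^sub>M lborel)"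
  using measurable_compose[OF measurable_fst, of F borel borel] measurable_compose[OF measurable_snd, of G borel borel] Fm Gm
  by (intro borel_measurable_times) (auto intro!: measurable_compose[OF measurable_fst] measurable_compose[OF measurable_snd])
 have m2: "(\<lambda>z. G (fst z) * F (snd z)) \<in> borel_measurable (lborel \<Otimes>\<^sub>M lborel)" using Fm Gm
  by (intro borel_measurable_times) (auto intro!: measurable_compose[OF measurable_fst] measurable_compose[OF measurable_snd])
 have "integrable (lborel \<Otimes>\<^sub>M lborel) (\<lambda>z. F (fst z) * G (snd z))"
 proof (rule lborel_pair.Fubini_integrable[OF m1])
  show "integrable lborel (\<lambda>x. LINT y|lborel. norm (F (fst (x, y)) * G (snd (x, y))))"
   using Fi by (simp add: abs_mult)
 qed (use Gi in simp)
 then have "integrable lborel (\<lambda>z. F (fst z) * G (snd z))" unfolding lborel_prod .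
 then have "integrable lebesgue (\<lambda>z. F (fst z) * G (snd z))" using m1 unfolding lborel_prod by (simp add: integrable_completion)
 moreover have "F (fst z) * G (snd z) = indicator (A \<times> B) z *\<^sub>R f (fst z)" for z
  unfolding F_def G_def by (cases z) (auto simp: indicator_def)
 ultimately show "(\<lambda>z. f (fst z)) absolutely_integrable_on A \<times> B" unfolding set_integrable_def by simp
 have "integrable (lborel \<Otimes>\<^sub>M lborel) (\<lambda>z. G (fst z) * F (snd z))"
 proof (rule lborel_pair.Fubini_integrable[OF m2])
  show "integrable lborel (\<lambda>x. LINT y|lborel. norm (G (fst (x, y)) * F (snd (x, y))))"
   using Gi by (simp add: abs_mult)
 qed (use Fi in simp)
 then have "integrable lborel (\<lambda>z. G (fst z) * F (snd z))" unfolding lborel_prod .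
 then have "integrable lebesgue (\<lambda>z. G (fst z) * F (snd z))" using m2 unfolding lborel_prod by (simp add: integrable_completion)
 moreover have "G (fst z) * F (snd z) = indicator (B \<times> A) z *\<^sub>R f (snd z)" for z
  unfolding F_def G_def by (cases z) (auto simp: indicator_def)
 ultimately show "(\<lambda>z. f (snd z)) absolutely_integrable_on B \<times> A" unfolding set_integrable_def by simp
qed

lemma continuous_Icc_abs_bound:
 fixes f :: "real \<Rightarrow> real"
 assumes "continuous_on {u..v} f" shows "\<exists>M. \<forall>y\<in>{u..v}. \<bar>f y\<bar> \<le> M"
 using compact_imp_bounded[OF compact_continuous_image[OF assms compact_Icc]] unfolding bounded_iff by auto

section \<open>Coordinate ranges and one-dimensional bounds for the coefficients\<close>

locale tricomi_multiplier = tricomi_mesh +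
 fixes b c :: "real \<Rightarrow> real" and \<delta> :: real
 assumes multiplier: "admissible_multiplier D b c \<delta>"
begin

lemma multiplier_facts:
 shows cont_b: "continuous_on (fst ` closure \<Omega>) b" and C1_b: "b C1_differentiable_on (fst ` \<Omega>)"
  and cont_c: "continuous_on (snd ` closure \<Omega>) c" and C1_c: "c C1_differentiable_on (snd ` \<Omega>)"
  and delta_pos: "\<delta> > 0"
  and mult_1: "\<And>x y. (x, y) \<in> \<Omega> \<Longrightarrow> - K y * deriv b x + deriv (\<lambda>t. K t * c t) y \<ge> \<delta>"
  and mult_2: "\<And>x y. (x, y) \<in> \<Omega> \<Longrightarrow> deriv b x - deriv c y \<ge> \<delta>"
  and mult_right: "\<And>x y. (x, y) \<in> Gam D CharRight \<Longrightarrow> b x + c y * sqrt (- K y) \<le> 0"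
  and mult_upper: "\<And>x y n. (x, y) \<in> Gam D Upper \<Longrightarrow> is_outer_normal \<Omega> (x, y) n \<Longrightarrow> (b x, c y) \<bullet> n \<ge> 0"
 using multiplier unfolding admissible_multiplier_def Let_def by fast+

definition "xl = Inf (fst ` \<Omega>)" definition "xr = Sup (fst ` \<Omega>)"
definition "yl = Inf (snd ` \<Omega>)" definition "yr = Sup (snd ` \<Omega>)"

lemma fst_region: "fst ` \<Omega> = {xl<..<xr}"
 unfolding xl_def xr_def by (rule open_connected_bounded_real[OF open_image_fst[OF open_region]
   connected_continuous_image[OF continuous_on_fst[OF continuous_on_id] connected_region, unfolded id_def] bounded_fst[OF bounded_region]])
  (use region_nonempty in simp)

lemma snd_region: "snd ` \<Omega> = {yl<..<yr}"
 unfolding yl_def yr_def by (rule open_connected_bounded_real[OF open_image_snd[OF open_region]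
   connected_continuous_image[OF continuous_on_snd[OF continuous_on_id] connected_region, unfolded id_def] bounded_snd[OF bounded_region]])
  (use region_nonempty in simp)

lemma range_lt: "xl < xr" "yl < yr"
 using fst_region snd_region region_nonempty by (metis greaterThanLessThan_empty_iff image_is_empty linorder_not_less)+

lemma fst_closure: "fst ` closure \<Omega> = {xl..xr}"
proof
 have "fst ` closure \<Omega> \<subseteq> closure (fst ` \<Omega>)"
  by (rule image_closure_subset) (auto intro: continuous_intros closure_subset[THEN subsetD])
 then show "fst ` closure \<Omega> \<subseteq> {xl..xr}" unfolding fst_region using range_lt by simp
 have "compact (fst ` closure \<Omega>)"
  using bounded_region by (intro compact_continuous_image continuous_intros) (simp add: compact_closure)
 then have "closure (fst ` \<Omega>) \<subseteq> fst ` closure \<Omega>"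
  by (intro closure_minimal image_mono closure_subset compact_imp_closed)
 then show "{xl..xr} \<subseteq> fst ` closure \<Omega>" unfolding fst_region using range_lt by simp
qed

lemma snd_closure: "snd ` closure \<Omega> = {yl..yr}"
proof
 have "snd ` closure \<Omega> \<subseteq> closure (snd ` \<Omega>)"
  by (rule image_closure_subset) (auto intro: continuous_intros closure_subset[THEN subsetD])
 then show "snd ` closure \<Omega> \<subseteq> {yl..yr}" unfolding snd_region using range_lt by simp
 have "compact (snd ` closure \<Omega>)"
  using bounded_region by (intro compact_continuous_image continuous_intros) (simp add: compact_closure)
 then have "closure (snd ` \<Omega>) \<subseteq> snd ` closure \<Omega>"
  by (intro closure_minimal image_mono closure_subset compact_imp_closed)
 then show "{yl..yr} \<subseteq> snd ` closure \<Omega>" unfolding snd_region using range_lt by simp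
qed

lemma in_ranges: assumes "(x, y) \<in> \<Omega>" shows "xl < x" "x < xr" "yl < y" "y < yr"
 using imageI[OF assms, of fst] imageI[OF assms, of snd] unfolding fst_region snd_region by auto

lemma in_ranges_closure: assumes "(x, y) \<in> closure \<Omega>" shows "xl \<le> x" "x \<le> xr" "yl \<le> y" "y \<le> yr"
 using imageI[OF assms, of fst] imageI[OF assms, of snd] unfolding fst_closure snd_closure by auto

lemma corner_points: "(- 1, 0) \<in> closure \<Omega>" "(1, 0) \<in> closure \<Omega>" "(0, yc) \<in> closure \<Omega>"
proof -
 have "(- 1, 0) \<in> Gam D CharLeft" "(1, 0) \<in> Gam D CharRight" "(0, yc) \<in> Gam D CharLeft"
  unfolding Gam_CharLeft_iff Gam_CharRight_iff using yc_neg J_0 J_yc by auto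
 then show "(- 1, 0) \<in> closure \<Omega>" "(1, 0) \<in> closure \<Omega>" "(0, yc) \<in> closure \<Omega>"
  using Gam_subset_frontier by (auto simp: frontier_def)
qed

lemma zero_in_x_range: "xl < 0" "0 < xr"
 using in_ranges_closure(1)[OF corner_points(1)] in_ranges_closure(2)[OF corner_points(2)] by auto

text \<open>A point of lowest height is a boundary point of negative height, hence on a
  characteristic, and the characteristics end at (0, yc).\<close>

lemma bottom_point:
 assumes "(x, yl) \<in> closure \<Omega>" shows "yl = yc" "x = 0"
proof -
 have y: "yl \<le> yc" using in_ranges_closure(3)[OF corner_points(3)] .
 have "(x, yl) \<notin> \<Omega>" using in_ranges(3) by blast
 then have fr: "(x, yl) \<in> frontier \<Omega>" using assms open_region by (auto simp: frontier_def interior_open)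
 have "(x, yl) \<notin> Gam D Upper" using Gam_snd(1) y yc_neg by force
 then have c: "(x, yl) \<in> Gam D CharLeft \<or> (x, yl) \<in> Gam D CharRight" using fr frontier_region by blast
 then have "yc \<le> yl" unfolding Gam_CharLeft_iff Gam_CharRight_iff by blast
 then show "yl = yc" using y by simp
 then show "x = 0" using c J_yc unfolding Gam_CharLeft_iff Gam_CharRight_iff by auto
qed

lemma yl_eq: "yl = yc"
proof -
 have "yl \<in> snd ` closure \<Omega>" unfolding snd_closure using range_lt by simp
 then show ?thesis using bottom_point by (metis imageE prod.collapse)
qed

lemma yr_pos: "yr > 0"
proof -
 have "upper_arc D (1/2) \<in> Gam D Upper" unfolding Gam_Upper by auto
 then have "snd (upper_arc D (1/2)) > 0" "upper_arc D (1/2) \<in> closure \<Omega>"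
  using Gam_snd(1) Gam_subset_frontier[of Upper] by (auto simp: frontier_def)
 then show ?thesis using in_ranges_closure(4) by (metis less_le_trans prod.collapse)
qed

lemmas b_C1 = C1_real_facts[OF C1_b, unfolded fst_region]
lemmas c_C1 = C1_real_facts[OF C1_c, unfolded snd_region]
lemmas K_C1 = C1_real_facts[OF C1_K, unfolded snd_region]

lemma deriv_Kc: assumes "yl < y" "y < yr" shows "deriv (\<lambda>t. K t * c t) y = deriv K y * c y + K y * deriv c y"
 using c_C1(1)[of y] K_C1(1)[of y] assms by (intro DERIV_imp_deriv) (auto intro!: derivative_eq_intros)

lemma K_pos: "0 < K y" if "0 < y" "y \<le> yr"
proof -
 have "y \<in> snd ` closure \<Omega>" unfolding snd_closure yl_eq using that yc_neg by simp
 then show ?thesis using K_sign[of y] that by (simp add: zero_less_mult_iff)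
qed

lemma deriv_K_integrable: "deriv K absolutely_integrable_on {yl<..<yr}"
proof (rule deriv_bounded_below_absolutely_integrable[where M = 0 and F = K])
 show "continuous_on {yl..yr} K" using cont_K unfolding snd_closure .
qed (use range_lt K_C1(1) deriv_K_pos snd_region in \<open>auto intro: less_imp_le\<close>)

text \<open>The first multiplier inequality implies K (b' - c') \<le> K' c. Above a positive height
  y0 the function K is bounded away from 0, so b' - c' lies between 0 and a multiple of K', which is
  integrable.\<close>

lemma gap_bound:
 obtains M y0 where "0 \<le> M" "0 < y0" "y0 < yr"
  "\<And>x y. (x, y) \<in> \<Omega> \<Longrightarrow> y0 \<le> y \<Longrightarrow> 0 \<le> deriv b x - deriv c y \<and> deriv b x - deriv c y \<le> M * deriv K y"
proof -
 define y0 where "y0 = yr / 2"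
 have y0: "0 < y0" "y0 < yr" unfolding y0_def using yr_pos by auto
 obtain A where A: "A > 0" "\<And>y. y \<in> {yl..yr} \<Longrightarrow> \<bar>c y\<bar> \<le> A"
  using compact_imp_bounded[OF compact_continuous_image[OF cont_c[unfolded snd_closure] compact_Icc]]
  unfolding bounded_pos by auto
 define M where "M = A / K y0"
 have Ky0: "K y0 > 0" using K_pos[of y0] y0 by simp
 have bound: "0 \<le> deriv b x - deriv c y \<and> deriv b x - deriv c y \<le> M * deriv K y"
  if xy: "(x, y) \<in> \<Omega>" and y: "y0 \<le> y" for x y
 proof -
  have r: "yl < y" "y < yr" using in_ranges[OF xy] by auto
  have Kd: "deriv K y > 0" using deriv_K_pos[of y] r snd_region by auto
  have "K y0 \<le> K y"
  proof (cases "y0 = y")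
   case False
   have "K y0 < K y"
   proof (rule DERIV_pos_imp_increasing[of y0 y])
    fix t assume "y0 \<le> t" "t \<le> y"
    then have "t \<in> {yl<..<yr}" using r y0 yl_eq yc_neg by auto
    then show "\<exists>d. (K has_real_derivative d) (at t) \<and> d > 0" using K_C1(1) deriv_K_pos snd_region by auto
   qed (use y False in auto)
   then show ?thesis by simp
  qed simp
  then have Ky: "K y > 0" "K y0 \<le> K y" using Ky0 by auto
  have "\<delta> \<le> - K y * deriv b x + (deriv K y * c y + K y * deriv c y)" using mult_1[OF xy] deriv_Kc[OF r] by simp
  then have "K y * (deriv b x - deriv c y) \<le> deriv K y * c y" using delta_pos by (simp add: algebra_simps)
  also have "\<dots> \<le> deriv K y * A" using A(2)[of y] r Kd by (intro mult_left_mono) auto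
  finally have "deriv b x - deriv c y \<le> deriv K y * A / K y" using Ky by (simp add: field_simps)
  also have "\<dots> \<le> deriv K y * A / K y0" using Ky Ky0 Kd A by (intro divide_left_mono) auto
  finally show ?thesis using mult_2[OF xy] delta_pos unfolding M_def by (simp add: field_simps)
 qed
 have "0 \<le> M" unfolding M_def using A Ky0 by simp
 then show ?thesis using that[of M y0] y0 bound by blast
qed

text \<open>Every point of the closure belongs to the closure of an element, whose kernel ball
  supplies segments inside the domain that end at the point. Along them the multiplier inequalities
  relate b' and c' near the ends of the coordinate ranges.\<close>

lemma element_segment:
 assumes "z \<in> closure \<Omega>"
 obtains w \<rho> where "\<rho> > 0" "w \<in> \<Omega>" "\<And>v t. v \<in> ball w \<rho> \<Longrightarrow> 0 < t \<Longrightarrow> t < 1 \<Longrightarrow> z + t *\<^sub>R (v - z) \<in> \<Omega>"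
proof -
 obtain T where T: "T \<in> \<T>" "z \<in> closure T" using closure_cover assms by blast
 obtain w \<rho> where st: "star_domain T w \<rho>" using star_element[OF T(1)] by blast
 have "z + t *\<^sub>R (v - z) \<in> \<Omega>" if "v \<in> ball w \<rho>" "0 < t" "t < 1" for v t
 proof -
  have "v + (1 - t) *\<^sub>R (z - v) \<in> T" by (rule star_domain.open_segment_subset[OF st that(1) T(2)]) (use that in auto)
  moreover have "v + (1 - t) *\<^sub>R (z - v) = z + t *\<^sub>R (v - z)" by (simp add: algebra_simps)
  ultimately show ?thesis using element_subset[OF T(1)] by auto
 qed
 moreover have "w \<in> \<Omega>" using star_domain.rho_pos[OF st] star_domain.ball_subset[OF st] element_subset[OF T(1)]
  by (meson centre_in_ball subsetD)
 ultimately show ?thesis using that[of \<rho> w] star_domain.rho_pos[OF st] by blast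
qed

lemma convex_combination_bounds:
 fixes p q t :: real
 assumes "0 \<le> t" "t \<le> 1"
 shows "min p q \<le> p + t * (q - p)" "p + t * (q - p) \<le> max p q"
proof -
 have e: "p + t * (q - p) = (1 - t) * p + t * q" by (simp add: algebra_simps)
 have "(1 - t) * min p q + t * min p q \<le> (1 - t) * p + t * q" using assms by (intro add_mono mult_left_mono) auto
 then show "min p q \<le> p + t * (q - p)" unfolding e by (simp add: algebra_simps)
 have "(1 - t) * p + t * q \<le> (1 - t) * max p q + t * max p q" using assms by (intro add_mono mult_left_mono) auto
 then show "p + t * (q - p) \<le> max p q" unfolding e by (simp add: algebra_simps)
qed

lemma affine_deriv_absolutely_integrable:
 fixes F F' :: "real \<Rightarrow> real"
 assumes \<kappa>: "\<kappa> \<noteq> 0" and cont: "continuous_on {0..1} (\<lambda>t. F (a + \<kappa> * t))"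
  and F: "\<And>t. 0 < t \<Longrightarrow> t < 1 \<Longrightarrow> (F has_real_derivative F' (a + \<kappa> * t)) (at (a + \<kappa> * t))"
  and low: "\<And>t. 0 < t \<Longrightarrow> t < 1 \<Longrightarrow> - M \<le> F' (a + \<kappa> * t)"
 shows "(\<lambda>t. F' (a + \<kappa> * t)) absolutely_integrable_on {0<..<1}"
proof (rule deriv_bounded_below_absolutely_integrable[where F = "\<lambda>t. F (a + \<kappa> * t) / \<kappa>", OF _ _ _ low])
 show "continuous_on {0..1} (\<lambda>t. F (a + \<kappa> * t) / \<kappa>)" using \<kappa> by (intro continuous_intros cont) auto
 fix t :: real assume t: "0 < t" "t < 1"
 have "((\<lambda>t. F (a + \<kappa> * t)) has_real_derivative F' (a + \<kappa> * t) * \<kappa>) (at t)"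
  by (rule DERIV_chain2[where g = "\<lambda>t. a + \<kappa> * t", OF F[OF t]]) (auto intro!: derivative_eq_intros)
 from DERIV_cdivide[OF this, of \<kappa>]
 show "((\<lambda>t. F (a + \<kappa> * t) / \<kappa>) has_real_derivative F' (a + \<kappa> * t)) (at t)" using \<kappa> by simp
qed auto

lemma deriv_K_near_top:
 assumes \<theta>: "0 < \<theta>" and y0: "0 < y0" "y0 < yr"
 obtains \<tau> where "0 < \<tau>" "\<tau> \<le> 1 / 2" "\<forall>t<\<tau>. y0 \<le> yr - \<theta> * t"
  "{yr - \<theta> * \<tau><..<yr} = (\<lambda>t. yr + (- \<theta>) * t) ` {0<..<\<tau>}" "(\<lambda>t. deriv K (yr - \<theta> * t)) absolutely_integrable_on {0<..<\<tau>}"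
proof -
 define \<tau> where "\<tau> = min (1 / 2) ((yr - y0) / \<theta>)"
 have \<tau>: "0 < \<tau>" "\<tau> \<le> 1 / 2" "\<tau> \<le> (yr - y0) / \<theta>"
  using \<theta> y0 min.cobounded1[of "1 / 2" "(yr - y0) / \<theta>"] min.cobounded2[of "1 / 2" "(yr - y0) / \<theta>"]
  unfolding \<tau>_def by (auto simp del: min.cobounded1 min.cobounded2)
 have yge: "y0 \<le> yr - \<theta> * t" if "t \<le> \<tau>" for t
 proof -
  have "t \<le> (yr - y0) / \<theta>" using that \<tau> by simp
  then show ?thesis using \<theta> by (simp add: field_simps)
 qed
 have im: "{yr - \<theta> * \<tau><..<yr} = (\<lambda>t. yr + (- \<theta>) * t) ` {0<..<\<tau>}" using affine_image_Ioo(2)[of "- \<theta>" yr 0 \<tau>] \<theta> by simp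
 have "yl \<le> yr - \<theta> * \<tau>" using yge[OF order_refl] y0 yl_eq yc_neg by linarith
 then have "deriv K absolutely_integrable_on {yr - \<theta> * \<tau><..<yr}"
  by (intro set_integrable_subset[OF deriv_K_integrable]) auto
 then have "(\<lambda>t. deriv K (yr - \<theta> * t)) absolutely_integrable_on {0<..<\<tau>}"
  using absolutely_integrable_affine[of "- \<theta>" "{0<..<\<tau>}" yr "deriv K"] \<theta> unfolding im by simp
 then show ?thesis using that[OF \<tau>(1,2) _ im] yge by simp
qed

text \<open>A segment in the domain runs to a closure point (x0, y1). If y1 is below the top, c' is
  bounded along it and the second multiplier inequality bounds b' from below. If y1 is the top, c'
  may be unbounded as well; then two segments are compared at equal heights, where c' cancels. By
  \<open>gap_bound\<close> the values of b' at the abscissa offsets \<kappa> t and q \<kappa> t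
  differ by at most M K', and the scaling lemma applies.\<close>

lemma deriv_b_end:
 assumes x0: "x0 = xl \<or> x0 = xr"
 obtains \<kappa> \<tau> where "\<tau> > 0" "x0 = xl \<Longrightarrow> \<kappa> > 0" "x0 = xr \<Longrightarrow> \<kappa> < 0"
  "(\<lambda>t. deriv b (x0 + \<kappa> * t)) absolutely_integrable_on {0<..<\<tau>}"
proof -
 have "x0 \<in> fst ` closure \<Omega>" unfolding fst_closure using x0 range_lt by auto
 then obtain y1 where z: "(x0, y1) \<in> closure \<Omega>" by (metis imageE prod.collapse)
 obtain w \<rho> where \<rho>: "\<rho> > 0" "w \<in> \<Omega>"
  and seg: "\<And>v t. v \<in> ball w \<rho> \<Longrightarrow> 0 < t \<Longrightarrow> t < 1 \<Longrightarrow> (x0, y1) + t *\<^sub>R (v - (x0, y1)) \<in> \<Omega>"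
  by (rule element_segment[OF z]) blast
 obtain w1 w2 where w: "w = (w1, w2)" by (cases w)
 have wr: "xl < w1" "w1 < xr" "yl < w2" "w2 < yr" using in_ranges \<rho>(2) unfolding w by auto
 define \<kappa> where "\<kappa> = w1 - x0"
 have \<kappa>: "x0 = xl \<Longrightarrow> \<kappa> > 0" "x0 = xr \<Longrightarrow> \<kappa> < 0" "\<kappa> \<noteq> 0" unfolding \<kappa>_def using wr x0 by auto
 have in0: "(x0 + \<kappa> * t, y1 + t * (w2 - y1)) \<in> \<Omega>" if "0 < t" "t < 1" for t
  using seg[of w t] \<rho>(1) that unfolding w \<kappa>_def by (simp add: mult.commute)
 have y1r: "yl \<le> y1" "y1 \<le> yr" using in_ranges_closure[OF z] by auto
 \<comment> \<open>The lowest height occurs only at x = 0, strictly inside the range of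
   abscissae.\<close>
 have "y1 \<noteq> yl" using bottom_point(2)[of x0] z x0 zero_in_x_range by auto
 then consider "yl < y1" "y1 < yr" | "y1 = yr" using y1r by linarith
 then show ?thesis
 proof cases
  case 1
  have "continuous_on {min y1 w2..max y1 w2} (deriv c)" by (rule continuous_on_subset[OF c_C1(2)]) (use 1 wr in auto)
  then obtain M where M: "\<And>y. y \<in> {min y1 w2..max y1 w2} \<Longrightarrow> \<bar>deriv c y\<bar> \<le> M" using continuous_Icc_abs_bound by blast
  have "(\<lambda>t. deriv b (x0 + \<kappa> * t)) absolutely_integrable_on {0<..<1}"
  proof (rule affine_deriv_absolutely_integrable[OF \<kappa>(3)])
   have "x0 + \<kappa> * t \<in> {xl..xr}" if "t \<in> {0..1}" for t
    using convex_combination_bounds[of t x0 w1] that x0 wr unfolding \<kappa>_def by (auto simp: mult.commute)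
   then show "continuous_on {0..1} (\<lambda>t. b (x0 + \<kappa> * t))"
    by (intro continuous_intros continuous_on_compose2[OF cont_b[unfolded fst_closure]]) auto
   fix t :: real assume t: "0 < t" "t < 1"
   show "(b has_real_derivative deriv b (x0 + \<kappa> * t)) (at (x0 + \<kappa> * t))" using b_C1(1) in_ranges[OF in0[OF t]] by simp
   have "\<bar>deriv c (y1 + t * (w2 - y1))\<bar> \<le> M" using convex_combination_bounds[of t y1 w2] t by (intro M) auto
   then show "- M \<le> deriv b (x0 + \<kappa> * t)" using mult_2[OF in0[OF t]] delta_pos by linarith
  qed
  then show ?thesis using that[of 1 \<kappa>] \<kappa> by auto
 next
  case 2
  obtain M y0 where M: "0 \<le> M" "0 < y0" "y0 < yr"
   and gap: "\<And>x y. (x, y) \<in> \<Omega> \<Longrightarrow> y0 \<le> y \<Longrightarrow> 0 \<le> deriv b x - deriv c y \<and> deriv b x - deriv c y \<le> M * deriv K y"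
   by (rule gap_bound) blast
  define \<theta> where "\<theta> = yr - w2"
  have \<theta>: "\<theta> > 0" unfolding \<theta>_def using wr by simp
  \<comment> \<open>With this factor the point v below is w shifted by \<rho> / 2 away from x0: it
    stays in the kernel ball, and the segment to v passes the same heights with abscissa offsets
    multiplied by q.\<close>
  define q where "q = 1 + \<rho> / (2 * \<bar>\<kappa>\<bar>)"
  have q: "q > 1" unfolding q_def using \<rho>(1) \<kappa>(3) by simp
  define v where "v = (x0 + q * \<kappa>, w2)"
  have "fst v - w1 = \<rho> / 2 * sgn \<kappa>" unfolding v_def q_def \<kappa>_def using \<kappa>(3) unfolding \<kappa>_def
   by (auto simp: field_simps sgn_if abs_if)
  then have a: "w1 - (x0 + q * \<kappa>) = - (\<rho> / 2 * sgn \<kappa>)" unfolding v_def by simp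
  have "dist w v = \<rho> / 2" unfolding w v_def dist_prod_def fst_conv snd_conv dist_real_def a
   using \<rho>(1) \<kappa>(3) by (simp add: abs_mult abs_sgn_eq)
  then have vb: "v \<in> ball w \<rho>" using \<rho>(1) by simp
  have in1: "(x0 + \<kappa> * (q * t), y1 + t * (w2 - y1)) \<in> \<Omega>" if "0 < t" "t < 1" for t
   using seg[OF vb that] unfolding v_def by (simp add: algebra_simps)
  obtain \<tau> where \<tau>: "0 < \<tau>" "\<tau> \<le> 1 / 2" and yge': "\<forall>t<\<tau>. y0 \<le> yr - \<theta> * t"
   and "{yr - \<theta> * \<tau><..<yr} = (\<lambda>t. yr + (- \<theta>) * t) ` {0<..<\<tau>}"
   and Ki: "(\<lambda>t. deriv K (yr - \<theta> * t)) absolutely_integrable_on {0<..<\<tau>}" by (rule deriv_K_near_top[OF \<theta> M(2,3)])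
  note yge = yge'[rule_format]
  have yt: "y1 + t * (w2 - y1) = yr - \<theta> * t" for t unfolding 2 \<theta>_def by (simp add: algebra_simps)
  have "(\<lambda>t. deriv b (x0 + \<kappa> * t)) absolutely_integrable_on {0<..<\<tau>}"
  proof (rule scaling_absolutely_integrable[OF _ q \<tau>(1)])
   show "continuous_on {0<..q * \<tau>} (\<lambda>t. deriv b (x0 + \<kappa> * t))"
   proof (intro continuous_on_compose2[OF b_C1(2)] continuous_intros subsetI)
    fix x assume "x \<in> (\<lambda>t. x0 + \<kappa> * t) ` {0<..q * \<tau>}"
    then obtain t where t: "0 < t" "t \<le> q * \<tau>" "x = x0 + \<kappa> * t" by auto
    have "t / q \<le> \<tau>" using t(2) q by (simp add: divide_le_eq mult.commute)
    then have lt: "t / q < 1" using \<tau>(2) by linarith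
    have "0 < t / q" using t q by simp
    from in_ranges[OF in1[OF this lt]] show "x \<in> {xl<..<xr}" using q t(3) by simp
   qed
   show "(\<lambda>t. M * deriv K (yr - \<theta> * t)) absolutely_integrable_on {0<..<\<tau>}"
    using Ki by (rule set_integrable_mult_right)
   fix t assume t: "0 < t" "t < \<tau>"
   have t1: "t < 1" using t \<tau> by simp
   have "(x0 + \<kappa> * t, yr - \<theta> * t) \<in> \<Omega>" "(x0 + \<kappa> * (q * t), yr - \<theta> * t) \<in> \<Omega>"
    using in0[OF t(1) t1] in1[OF t(1) t1] unfolding yt by auto
   from gap[OF this(1) yge[OF t(2)]] gap[OF this(2) yge[OF t(2)]]
   show "\<bar>deriv b (x0 + \<kappa> * t)\<bar> \<le> \<bar>deriv b (x0 + \<kappa> * (q * t))\<bar> + \<bar>M * deriv K (yr - \<theta> * t)\<bar>" by linarith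
  qed
  then show ?thesis using that[OF \<tau>(1) \<kappa>(1,2)] by blast
 qed
qed

lemma deriv_b_integrable: "deriv b absolutely_integrable_on {xl<..<xr}"
proof -
 obtain k t where k: "t > 0" "k > 0" "(\<lambda>s. deriv b (xl + k * s)) absolutely_integrable_on {0<..<t}"
  by (rule deriv_b_end[of xl]) (use range_lt in auto)
 have 1: "deriv b absolutely_integrable_on {xl<..<xl + k * t}"
  using k absolutely_integrable_affine[of k "{0<..<t}" xl "deriv b"] affine_image_Ioo(1)[of k xl 0 t] by simp
 obtain k' t' where k': "t' > 0" "k' < 0" "(\<lambda>s. deriv b (xr + k' * s)) absolutely_integrable_on {0<..<t'}"
  by (rule deriv_b_end[of xr]) (use range_lt in auto)
 have 2: "deriv b absolutely_integrable_on {xr - (- k' * t')<..<xr}"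
  using k' absolutely_integrable_affine[of k' "{0<..<t'}" xr "deriv b"] affine_image_Ioo(2)[of k' xr 0 t'] by simp
 show ?thesis
  by (rule absolutely_integrable_interval_ends[OF b_C1(2) _ 1 _ 2]) (use k k' in \<open>auto simp: mult_neg_pos\<close>)
qed

text \<open>A segment ending at (0, yc) has its abscissae in a compact part of the open range, where
  b' is bounded. The second multiplier inequality then bounds -c' from below.\<close>

lemma deriv_c_lower: obtains k where "k > 0" "deriv c absolutely_integrable_on {yl<..<yl + k}"
proof -
 obtain w \<rho> where \<rho>: "\<rho> > 0" "w \<in> \<Omega>"
  and seg: "\<And>v t. v \<in> ball w \<rho> \<Longrightarrow> 0 < t \<Longrightarrow> t < 1 \<Longrightarrow> (0, yc) + t *\<^sub>R (v - (0, yc)) \<in> \<Omega>"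
  by (rule element_segment[OF corner_points(3)]) blast
 obtain w1 w2 where w: "w = (w1, w2)" by (cases w)
 have wr: "xl < w1" "w1 < xr" "yl < w2" "w2 < yr" using in_ranges \<rho>(2) unfolding w by auto
 define \<kappa> where "\<kappa> = w2 - yc"
 have \<kappa>: "\<kappa> > 0" unfolding \<kappa>_def using wr yl_eq by auto
 have in0: "(0 + t * (w1 - 0), yc + \<kappa> * t) \<in> \<Omega>" if "0 < t" "t < 1" for t
  using seg[of w t] \<rho>(1) that unfolding w \<kappa>_def by (simp add: mult.commute)
 have "continuous_on {min 0 w1..max 0 w1} (deriv b)"
  by (rule continuous_on_subset[OF b_C1(2)]) (use zero_in_x_range wr in auto)
 then obtain M where M: "\<And>y. y \<in> {min 0 w1..max 0 w1} \<Longrightarrow> \<bar>deriv b y\<bar> \<le> M" using continuous_Icc_abs_bound by blast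
 have "(\<lambda>t. - deriv c (yc + \<kappa> * t)) absolutely_integrable_on {0<..<1}"
 proof (rule affine_deriv_absolutely_integrable[where F = "\<lambda>y. - c y"])
  have "yc + \<kappa> * t \<in> {yl..yr}" if "t \<in> {0..1}" for t
   using convex_combination_bounds[of t yc w2] that wr yl_eq unfolding \<kappa>_def by (auto simp: mult.commute)
  then show "continuous_on {0..1} (\<lambda>t. - c (yc + \<kappa> * t))"
   by (intro continuous_intros continuous_on_compose2[OF cont_c[unfolded snd_closure]]) auto
  fix t :: real assume t: "0 < t" "t < 1"
  show "((\<lambda>y. - c y) has_real_derivative - deriv c (yc + \<kappa> * t)) (at (yc + \<kappa> * t))"
   using DERIV_minus[OF c_C1(1)] in_ranges[OF in0[OF t]] by simp
  have "\<bar>deriv b (0 + t * (w1 - 0))\<bar> \<le> M" using convex_combination_bounds[of t 0 w1] t by (intro M) auto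
  then show "- M \<le> - deriv c (yc + \<kappa> * t)" using mult_2[OF in0[OF t]] delta_pos by linarith
 qed (use \<kappa> in simp)
 then have "(\<lambda>t. deriv c (yc + \<kappa> * t)) absolutely_integrable_on {0<..<1}"
  using set_integrable_mult_right[of "- 1" lebesgue "{0<..<1}" "\<lambda>t. - deriv c (yc + \<kappa> * t)"] by simp
 then have "deriv c absolutely_integrable_on {yl<..<yl + \<kappa>}"
  using \<kappa> absolutely_integrable_affine[of \<kappa> "{0<..<1}" yc "deriv c"] affine_image_Ioo(1)[of \<kappa> yc 0 1] yl_eq by simp
 then show ?thesis using that[OF \<kappa>] by blast
qed

text \<open>Near the top |c'| \<le> |b'| + M K' by \<open>gap_bound\<close>, and b' is already known
  to be integrable.\<close>

lemma deriv_c_upper: obtains k where "k > 0" "deriv c absolutely_integrable_on {yr - k<..<yr}"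
proof -
 have "yr \<in> snd ` closure \<Omega>" unfolding snd_closure using range_lt by auto
 then obtain x1 where z: "(x1, yr) \<in> closure \<Omega>" by (metis imageE prod.collapse)
 obtain w \<rho> where \<rho>: "\<rho> > 0" "w \<in> \<Omega>"
  and seg: "\<And>v t. v \<in> ball w \<rho> \<Longrightarrow> 0 < t \<Longrightarrow> t < 1 \<Longrightarrow> (x1, yr) + t *\<^sub>R (v - (x1, yr)) \<in> \<Omega>"
  by (rule element_segment[OF z]) blast
 obtain M y0 where M: "0 \<le> M" "0 < y0" "y0 < yr"
  and gap: "\<And>x y. (x, y) \<in> \<Omega> \<Longrightarrow> y0 \<le> y \<Longrightarrow> 0 \<le> deriv b x - deriv c y \<and> deriv b x - deriv c y \<le> M * deriv K y"
  by (rule gap_bound) blast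
 \<comment> \<open>If w lies directly below the end point, it is shifted sideways, so that the
   abscissa varies along the segment and the integrability of b' in x can be carried over to the
   segment parameter.\<close>
 define v where "v = (if fst w = x1 then w + (\<rho> / 2, 0) else w)"
 have vb: "v \<in> ball w \<rho>" using \<rho>(1) unfolding v_def by (auto simp: dist_norm norm_Pair)
 define \<kappa> where "\<kappa> = fst v - x1"
 have \<kappa>: "\<kappa> \<noteq> 0" using \<rho>(1) unfolding \<kappa>_def v_def by auto
 define \<theta> where "\<theta> = yr - snd v"
 have "snd v = snd w" unfolding v_def by auto
 then have \<theta>: "\<theta> > 0" using in_ranges[of "fst w" "snd w"] \<rho>(2) unfolding \<theta>_def by simp
 have in0: "(x1 + \<kappa> * t, yr - \<theta> * t) \<in> \<Omega>" if "0 < t" "t < 1" for t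
 proof -
  have "(x1, yr) + t *\<^sub>R (v - (x1, yr)) = (x1 + \<kappa> * t, yr - \<theta> * t)"
   unfolding \<kappa>_def \<theta>_def by (cases v) (simp add: algebra_simps)
  then show ?thesis using seg[OF vb that] by simp
 qed
 obtain \<tau> where \<tau>: "0 < \<tau>" "\<tau> \<le> 1 / 2" and yge': "\<forall>t<\<tau>. y0 \<le> yr - \<theta> * t"
  and im: "{yr - \<theta> * \<tau><..<yr} = (\<lambda>t. yr + (- \<theta>) * t) ` {0<..<\<tau>}"
  and Ki: "(\<lambda>t. deriv K (yr - \<theta> * t)) absolutely_integrable_on {0<..<\<tau>}" by (rule deriv_K_near_top[OF \<theta> M(2,3)])
 note yge = yge'[rule_format]
 have "deriv b absolutely_integrable_on (\<lambda>t. x1 + \<kappa> * t) ` {0<..<\<tau>}"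
 proof (rule set_integrable_subset[OF deriv_b_integrable])
  show "(\<lambda>t. x1 + \<kappa> * t) ` {0<..<\<tau>} \<in> sets lebesgue" using affine_image_Ioo[of \<kappa> x1 0 \<tau>] \<kappa> by (cases "\<kappa> > 0") auto
  show "(\<lambda>t. x1 + \<kappa> * t) ` {0<..<\<tau>} \<subseteq> {xl<..<xr}"
  proof
   fix x assume "x \<in> (\<lambda>t. x1 + \<kappa> * t) ` {0<..<\<tau>}"
   then obtain t where "0 < t" "t < 1" "x = x1 + \<kappa> * t" using \<tau> by auto
   then show "x \<in> {xl<..<xr}" using in_ranges[OF in0] by auto
  qed
 qed
 then have Bi: "(\<lambda>t. deriv b (x1 + \<kappa> * t)) absolutely_integrable_on {0<..<\<tau>}"
  using absolutely_integrable_affine[OF \<kappa>, of "{0<..<\<tau>}"] by simp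
 have "(\<lambda>t. deriv c (yr - \<theta> * t)) absolutely_integrable_on {0<..<\<tau>}"
 proof (rule measurable_bounded_by_integrable_imp_absolutely_integrable
   [where g = "\<lambda>t. \<bar>deriv b (x1 + \<kappa> * t)\<bar> + M * \<bar>deriv K (yr - \<theta> * t)\<bar>"])
  have "continuous_on {0<..<\<tau>} (\<lambda>t. deriv c (yr - \<theta> * t))"
  proof (intro continuous_on_compose2[OF c_C1(2)] continuous_intros subsetI)
   fix y assume "y \<in> (\<lambda>t. yr - \<theta> * t) ` {0<..<\<tau>}"
   then obtain t where "0 < t" "t < 1" "y = yr - \<theta> * t" using \<tau> by auto
   then show "y \<in> {yl<..<yr}" using in_ranges[OF in0] by auto
  qed
  then show "(\<lambda>t. deriv c (yr - \<theta> * t)) \<in> borel_measurable (lebesgue_on {0<..<\<tau>})"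
   by (rule continuous_imp_measurable_on_sets_lebesgue) auto
  show "(\<lambda>t. \<bar>deriv b (x1 + \<kappa> * t)\<bar> + M * \<bar>deriv K (yr - \<theta> * t)\<bar>) integrable_on {0<..<\<tau>}"
   using Bi Ki unfolding absolutely_integrable_on_def by (intro integrable_add integrable_on_mult_right) auto
  fix t assume "t \<in> {0<..<\<tau>}"
  then have t: "0 < t" "t < \<tau>" "t < 1" using \<tau> by auto
  from gap[OF in0[OF t(1,3)] yge[OF t(2)]]
  have "\<bar>deriv c (yr - \<theta> * t)\<bar> \<le> \<bar>deriv b (x1 + \<kappa> * t)\<bar> + M * deriv K (yr - \<theta> * t)" by linarith
  also have "\<dots> \<le> \<bar>deriv b (x1 + \<kappa> * t)\<bar> + M * \<bar>deriv K (yr - \<theta> * t)\<bar>"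
   using M(1) by (intro add_left_mono mult_left_mono) auto
  finally show "norm (deriv c (yr - \<theta> * t)) \<le> \<bar>deriv b (x1 + \<kappa> * t)\<bar> + M * \<bar>deriv K (yr - \<theta> * t)\<bar>" by simp
 qed simp
 then have "deriv c absolutely_integrable_on {yr - \<theta> * \<tau><..<yr}"
  using absolutely_integrable_affine[of "- \<theta>" "{0<..<\<tau>}" yr "deriv c"] \<theta> unfolding im by simp
 then show ?thesis using that[of "\<theta> * \<tau>"] \<theta> \<tau> by simp
qed

lemma deriv_c_integrable: "deriv c absolutely_integrable_on {yl<..<yr}"
proof -
 obtain k where k: "k > 0" "deriv c absolutely_integrable_on {yl<..<yl + k}" by (rule deriv_c_lower)
 obtain k' where k': "k' > 0" "deriv c absolutely_integrable_on {yr - k'<..<yr}" by (rule deriv_c_upper)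
 show ?thesis by (rule absolutely_integrable_interval_ends[OF c_C1(2) k k'])
qed

lemma element_box: "T \<in> \<T> \<Longrightarrow> T \<subseteq> {xl<..<xr} \<times> {yl<..<yr}"
 using element_subset[of T] in_ranges by fastforce

lemma coefficient_derivs_integrable:
 assumes T: "T \<in> \<T>"
 shows "set_integrable lebesgue T (\<lambda>z. deriv b (fst z))" "set_integrable lebesgue T (\<lambda>z. deriv c (snd z))"
  "set_integrable lebesgue T (\<lambda>z. deriv K (snd z))"
proof -
 have Tl: "T \<in> sets lebesgue" using open_element[OF T] by simp
 show "set_integrable lebesgue T (\<lambda>z. deriv b (fst z))"
  by (rule set_integrable_subset[OF absolutely_integrable_product(1)[OF deriv_b_integrable _ b_C1(2)] Tl element_box[OF T]]) auto
 show "set_integrable lebesgue T (\<lambda>z. deriv c (snd z))"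
  by (rule set_integrable_subset[OF absolutely_integrable_product(2)[OF deriv_c_integrable _ c_C1(2)] Tl element_box[OF T]]) auto
 show "set_integrable lebesgue T (\<lambda>z. deriv K (snd z))"
  by (rule set_integrable_subset[OF absolutely_integrable_product(2)[OF deriv_K_integrable _ K_C1(2)] Tl element_box[OF T]]) auto
qed

end

section \<open>Polynomials\<close>

lemma poly_space_zero: "(\<lambda>_. 0) \<in> poly_space p"
 unfolding poly_space_def by (auto intro!: exI[of _ "\<lambda>_ _. 0"])

lemma poly_space_add:
 assumes "q \<in> poly_space p" "r \<in> poly_space p" shows "(\<lambda>z. q z + r z) \<in> poly_space p"
proof -
 obtain a where a: "q = (\<lambda>(x, y). \<Sum>i\<le>p. \<Sum>j\<le>p - i. a i j * x ^ i * y ^ j)" using assms(1) unfolding poly_space_def by blast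
 obtain a' where a': "r = (\<lambda>(x, y). \<Sum>i\<le>p. \<Sum>j\<le>p - i. a' i j * x ^ i * y ^ j)" using assms(2) unfolding poly_space_def by blast
 have "(\<lambda>z. q z + r z) = (\<lambda>(x, y). \<Sum>i\<le>p. \<Sum>j\<le>p - i. (a i j + a' i j) * x ^ i * y ^ j)"
  unfolding a a' by (auto simp: algebra_simps sum.distrib)
 then show ?thesis unfolding poly_space_def by (auto intro!: exI[of _ "\<lambda>i j. a i j + a' i j"])
qed

lemma poly_space_monomial:
 fixes k :: real
 assumes "i + j \<le> p" shows "(\<lambda>z. k * (fst z ^ i * snd z ^ j)) \<in> poly_space p"
proof -
 define a where "a i' j' = (if i' = i then if j' = j then k else 0 else 0)" for i' j'
 have 1: "(\<Sum>j'\<le>p - i'. a i' j' * x ^ i' * y ^ j') = (if i' = i then k * x ^ i * y ^ j else 0)" for i' x y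
 proof (cases "i' = i")
  case True
  have "(\<Sum>j'\<le>p - i. a i j' * x ^ i * y ^ j') = (\<Sum>j'\<le>p - i. if j' = j then k * x ^ i * y ^ j else 0)"
   unfolding a_def by (rule sum.cong) auto
  also have "\<dots> = k * x ^ i * y ^ j" using assms by (subst sum.delta) auto
  finally show ?thesis using True by simp
 qed (simp add: a_def)
 have "(\<Sum>i'\<le>p. \<Sum>j'\<le>p - i'. a i' j' * x ^ i' * y ^ j') = k * (x ^ i * y ^ j)" for x y
  unfolding 1 using assms by (subst sum.delta) (auto simp: mult.assoc)
 then have "(\<lambda>z. k * (fst z ^ i * snd z ^ j)) = (\<lambda>(x, y). \<Sum>i\<le>p. \<Sum>j\<le>p - i. a i j * x ^ i * y ^ j)" by auto
 then show ?thesis unfolding poly_space_def by blast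
qed

lemma poly_space_sum:
 assumes "finite I" "\<And>i. i \<in> I \<Longrightarrow> f i \<in> poly_space p" shows "(\<lambda>z. \<Sum>i\<in>I. f i z) \<in> poly_space p"
 using assms by (induction I rule: finite_induct) (auto intro: poly_space_zero poly_space_add)

lemma partials_eq:
 assumes "(q has_derivative (\<lambda>h. fst h * A + snd h * B)) (at z)"
 shows "dx q z = A" "dy q z = B"
proof -
 have q: "(q has_derivative (\<lambda>h. fst h * A + snd h * B)) (at (fst z, snd z))" using assms by simp
 have 1: "((\<lambda>s. (s, snd z)) has_derivative (\<lambda>h. (h, 0))) (at (fst z))" by (auto intro!: derivative_eq_intros)
 have "((\<lambda>s. q (s, snd z)) has_derivative (\<lambda>h. fst (h, 0 :: real) * A + snd (h, 0 :: real) * B)) (at (fst z))"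
  by (rule has_derivative_compose[OF 1]) (use q in simp)
 then have "((\<lambda>s. q (s, snd z)) has_real_derivative A) (at (fst z))"
  unfolding has_field_derivative_def by (rule has_derivative_eq_rhs) (auto simp: mult.commute)
 then show "dx q z = A" unfolding dx_def by (rule DERIV_imp_deriv)
 have 2: "((\<lambda>s. (fst z, s)) has_derivative (\<lambda>h. (0, h))) (at (snd z))" by (auto intro!: derivative_eq_intros)
 have "((\<lambda>s. q (fst z, s)) has_derivative (\<lambda>h. fst (0 :: real, h) * A + snd (0 :: real, h) * B)) (at (snd z))"
  by (rule has_derivative_compose[OF 2]) (use q in simp)
 then have "((\<lambda>s. q (fst z, s)) has_real_derivative B) (at (snd z))"
  unfolding has_field_derivative_def by (rule has_derivative_eq_rhs) (auto simp: mult.commute)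
 then show "dy q z = B" unfolding dy_def by (rule DERIV_imp_deriv)
qed

lemma poly_space_derivatives:
 assumes q: "q \<in> poly_space p"
 shows "(q has_derivative (\<lambda>h. fst h * dx q z + snd h * dy q z)) (at z)"
  and "dx q \<in> poly_space p" and "dy q \<in> poly_space p" and "dx (dy q) z = dy (dx q) z"
proof -
 obtain a where "q = (\<lambda>(x, y). \<Sum>i\<le>p. \<Sum>j\<le>p - i. a i j * x ^ i * y ^ j)" using q unfolding poly_space_def by blast
 then have q': "q = (\<lambda>z. \<Sum>i\<le>p. \<Sum>j\<le>p - i. a i j * (fst z ^ i * snd z ^ j))" by (auto simp: mult.assoc)
 have fd: "((\<lambda>z::pt. fst z ^ n) has_derivative (\<lambda>h. real n * (fst h * fst z ^ (n - 1)))) (at z)" for n z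
  by (auto intro!: derivative_eq_intros simp: algebra_simps)
 have sd: "((\<lambda>z::pt. snd z ^ n) has_derivative (\<lambda>h. real n * (snd h * snd z ^ (n - 1)))) (at z)" for n z
  by (auto intro!: derivative_eq_intros simp: algebra_simps)
 \<comment> \<open>With general exponents m and n one formula serves q and its first derivatives,
   whose exponents are truncated differences. Where the truncation bites, the coefficient contains a
   factor 0.\<close>
 have gen: "((\<lambda>z::pt. \<Sum>i\<le>p. \<Sum>j\<le>p - i. e i j * (fst z ^ m i * snd z ^ n j)) has_derivative
   (\<lambda>h. fst h * (\<Sum>i\<le>p. \<Sum>j\<le>p - i. (e i j * real (m i)) * (fst z ^ (m i - 1) * snd z ^ n j)) +
     snd h * (\<Sum>i\<le>p. \<Sum>j\<le>p - i. (e i j * real (n j)) * (fst z ^ m i * snd z ^ (n j - 1))))) (at z)" for e m n z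
 proof -
  have "((\<lambda>z::pt. \<Sum>i\<le>p. \<Sum>j\<le>p - i. e i j * (fst z ^ m i * snd z ^ n j)) has_derivative
   (\<lambda>h. \<Sum>i\<le>p. \<Sum>j\<le>p - i. e i j * (fst z ^ m i * (real (n j) * (snd h * snd z ^ (n j - 1))) +
     (real (m i) * (fst h * fst z ^ (m i - 1))) * snd z ^ n j))) (at z)"
   by (intro has_derivative_sum has_derivative_mult_right has_derivative_mult fd sd)
  then show ?thesis
   by (rule has_derivative_eq_rhs) (auto simp: sum_distrib_left sum.distrib[symmetric] algebra_simps intro!: sum.cong)
 qed
 have 1: "dx q = (\<lambda>z. \<Sum>i\<le>p. \<Sum>j\<le>p - i. (a i j * real i) * (fst z ^ (i - 1) * snd z ^ j))"
  and 2: "dy q = (\<lambda>z. \<Sum>i\<le>p. \<Sum>j\<le>p - i. (a i j * real j) * (fst z ^ i * snd z ^ (j - 1)))"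
  using partials_eq[OF gen[of a "\<lambda>i. i" "\<lambda>j. j"]] unfolding q' by blast+
 show "(q has_derivative (\<lambda>h. fst h * dx q z + snd h * dy q z)) (at z)"
  unfolding 1 2 unfolding q' using gen[of a "\<lambda>i. i" "\<lambda>j. j"] .
 show "dx q \<in> poly_space p" unfolding 1 by (intro poly_space_sum poly_space_monomial) auto
 show "dy q \<in> poly_space p" unfolding 2 by (intro poly_space_sum poly_space_monomial) auto
 have "dx (dy q) z = (\<Sum>i\<le>p. \<Sum>j\<le>p - i. (a i j * real j * real i) * (fst z ^ (i - 1) * snd z ^ (j - 1)))"
  unfolding 2 using partials_eq(1)[OF gen[of "\<lambda>i j. a i j * real j" "\<lambda>i. i" "\<lambda>j. j - 1"]] .
 moreover have "dy (dx q) z = (\<Sum>i\<le>p. \<Sum>j\<le>p - i. (a i j * real i * real j) * (fst z ^ (i - 1) * snd z ^ (j - 1)))"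
  unfolding 1 using partials_eq(2)[OF gen[of "\<lambda>i j. a i j * real i" "\<lambda>i. i - 1" "\<lambda>j. j"]] .
 ultimately show "dx (dy q) z = dy (dx q) z" by (simp add: mult.commute mult.left_commute)
qed

lemma poly_space_continuous: "q \<in> poly_space p \<Longrightarrow> continuous_on S q"
 by (intro continuous_at_imp_continuous_on ballI) (meson poly_space_derivatives(1) has_derivative_continuous)

lemma poly_space_partials_add:
 assumes "q \<in> poly_space p" "r \<in> poly_space p"
 shows "dx (\<lambda>z. q z + r z) z = dx q z + dx r z" "dy (\<lambda>z. q z + r z) z = dy q z + dy r z"
proof -
 have "((\<lambda>z. q z + r z) has_derivative (\<lambda>h. fst h * (dx q z + dx r z) + snd h * (dy q z + dy r z))) (at z)"
  using has_derivative_add[OF poly_space_derivatives(1)[OF assms(1), of z] poly_space_derivatives(1)[OF assms(2), of z]]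
  by (rule has_derivative_eq_rhs) (auto simp: algebra_simps)
 from partials_eq[OF this] show "dx (\<lambda>z. q z + r z) z = dx q z + dx r z" "dy (\<lambda>z. q z + r z) z = dy q z + dy r z" .
qed

lemma poly_space_partials_cmult:
 assumes "q \<in> poly_space p"
 shows "dx (\<lambda>z. k * q z) z = k * dx q z" "dy (\<lambda>z. k * q z) z = k * dy q z"
proof -
 have "((\<lambda>z. k * q z) has_derivative (\<lambda>h. fst h * (k * dx q z) + snd h * (k * dy q z))) (at z)"
  using has_derivative_mult_right[OF poly_space_derivatives(1)[OF assms, of z], of k]
  by (rule has_derivative_eq_rhs) (auto simp: algebra_simps)
 from partials_eq[OF this] show "dx (\<lambda>z. k * q z) z = k * dx q z" "dy (\<lambda>z. k * q z) z = k * dy q z" .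
qed

section \<open>The energy identity on an element\<close>

lemma half_sum_bound:
 fixes G W A B r s S :: real
 assumes "G - W = 1 / 2 * (A + B)" "r \<le> A" "s \<le> B" "S = 1 / 2 * (r + s)"
 shows "S + W \<le> G" using assms by simp

context tricomi_mesh
begin

abbreviation "PI T i \<equiv> curve_integral (piece_path i) (piece_image T i)"
abbreviation "TB T i \<equiv> trace_bounded (piece_path i) (piece_set T i)"

lemma PI_add:
 assumes T: "T \<in> \<T>" and i: "i \<in> pieces T" and "TB T i \<phi>" "TB T i \<psi>"
 shows "PI T i (\<lambda>z. \<phi> z + \<psi> z) = PI T i \<phi> + PI T i \<psi>"
 using set_integral_add(2)[OF piece_trace_integrable[OF T i assms(3)] piece_trace_integrable[OF T i assms(4)]]
 unfolding curve_integral_piece by (simp add: distrib_right)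

lemma PI_cmult: "PI T i (\<lambda>z. r * \<phi> z) = r * PI T i \<phi>"
 unfolding curve_integral_piece by (simp add: mult.assoc)

lemma PI_mono:
 assumes T: "T \<in> \<T>" and i: "i \<in> pieces T" and tb: "TB T i \<phi>" "TB T i \<psi>"
  and le: "AE_curve (piece_path i) (piece_set T i) (\<lambda>s. \<phi> (piece_path i s) \<le> \<psi> (piece_path i s))"
 shows "PI T i \<phi> \<le> PI T i \<psi>" unfolding curve_integral_piece set_lebesgue_integral_def
proof (rule integral_mono_AE)
 show "AE s in lebesgue. indicator (piece_set T i) s *\<^sub>R (\<phi> (piece_path i s) * norm (velocity (piece_path i) s))
   \<le> indicator (piece_set T i) s *\<^sub>R (\<psi> (piece_path i s) * norm (velocity (piece_path i) s))" using le
 proof eventually_elim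
  fix s assume "s \<in> piece_set T i \<longrightarrow> velocity (piece_path i) s \<noteq> 0 \<longrightarrow> \<phi> (piece_path i s) \<le> \<psi> (piece_path i s)"
  then show "indicator (piece_set T i) s *\<^sub>R (\<phi> (piece_path i s) * norm (velocity (piece_path i) s))
   \<le> indicator (piece_set T i) s *\<^sub>R (\<psi> (piece_path i s) * norm (velocity (piece_path i) s))"
   by (cases "s \<in> piece_set T i"; cases "velocity (piece_path i) s = 0") (auto intro: mult_right_mono)
 qed
qed (use piece_trace_integrable[OF T i tb(1)] piece_trace_integrable[OF T i tb(2)] in \<open>auto simp: set_integrable_def\<close>)

lemma PI_nonneg:
 assumes T: "T \<in> \<T>" and i: "i \<in> pieces T" and tb: "TB T i \<phi>" and "\<And>z. 0 \<le> \<phi> z"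
 shows "0 \<le> PI T i \<phi>"
 using PI_mono[OF T i trace_bounded_const[of _ _ 0] tb] assms(4) PI_cmult[where T = T and i = i and r = 0 and \<phi> = \<phi>] by simp

lemma PI_cong_AE:
 assumes T: "T \<in> \<T>" and i: "i \<in> pieces T" and tb: "TB T i \<phi>"
  and eq: "AE_curve (piece_path i) (piece_set T i) (\<lambda>s. \<psi> (piece_path i s) = \<phi> (piece_path i s))"
 shows "PI T i \<psi> = PI T i \<phi>"
proof (rule antisym)
 have tb': "TB T i \<psi>" by (rule trace_bounded_cong_AE[OF tb eq])
 show "PI T i \<psi> \<le> PI T i \<phi>" by (rule PI_mono[OF T i tb' tb]) (use eq in eventually_elim, simp)
 show "PI T i \<phi> \<le> PI T i \<psi>" by (rule PI_mono[OF T i tb tb']) (use eq in eventually_elim, simp)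
qed

end

context tricomi_multiplier
begin

lemma continuous_coefficients:
 "continuous_on (closure \<Omega>) (\<lambda>z. b (fst z))" "continuous_on (closure \<Omega>) (\<lambda>z. c (snd z))"
 "continuous_on (closure \<Omega>) (\<lambda>z. K (snd z))"
 by (auto intro!: continuous_on_compose2[OF cont_b] continuous_on_compose2[OF cont_c] continuous_on_compose2[OF cont_K] continuous_intros)

lemma coefficient_derivatives:
 assumes z: "z \<in> \<Omega>"
 shows "((\<lambda>z. b (fst z)) has_derivative (\<lambda>h. fst h * deriv b (fst z) + snd h * 0)) (at z)"
  "((\<lambda>z. c (snd z)) has_derivative (\<lambda>h. fst h * 0 + snd h * deriv c (snd z))) (at z)"
  "((\<lambda>z. K (snd z)) has_derivative (\<lambda>h. fst h * 0 + snd h * deriv K (snd z))) (at z)"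
proof -
 have r: "xl < fst z" "fst z < xr" "yl < snd z" "snd z < yr" using in_ranges[of "fst z" "snd z"] z by auto
 have f: "(fst has_derivative fst) (at z)" and s: "(snd has_derivative snd) (at z)" by (auto intro!: derivative_eq_intros)
 have "((\<lambda>z. b (fst z)) has_derivative (\<lambda>h. deriv b (fst z) * fst h)) (at z)"
  by (rule has_derivative_compose[OF f]) (use b_C1(1)[of "fst z"] r in \<open>simp add: has_field_derivative_def\<close>)
 then show "((\<lambda>z. b (fst z)) has_derivative (\<lambda>h. fst h * deriv b (fst z) + snd h * 0)) (at z)" by (simp add: mult.commute)
 have "((\<lambda>z. c (snd z)) has_derivative (\<lambda>h. deriv c (snd z) * snd h)) (at z)"
  by (rule has_derivative_compose[OF s]) (use c_C1(1)[of "snd z"] r in \<open>simp add: has_field_derivative_def\<close>)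
 then show "((\<lambda>z. c (snd z)) has_derivative (\<lambda>h. fst h * 0 + snd h * deriv c (snd z))) (at z)" by (simp add: mult.commute)
 have "((\<lambda>z. K (snd z)) has_derivative (\<lambda>h. deriv K (snd z) * snd h)) (at z)"
  by (rule has_derivative_compose[OF s]) (use K_C1(1)[of "snd z"] r in \<open>simp add: has_field_derivative_def\<close>)
 then show "((\<lambda>z. K (snd z)) has_derivative (\<lambda>h. fst h * 0 + snd h * deriv K (snd z))) (at z)" by (simp add: mult.commute)
qed

lemma continuous_coefficient_derivs:
 "continuous_on \<Omega> (\<lambda>z. deriv b (fst z))" "continuous_on \<Omega> (\<lambda>z. deriv c (snd z))" "continuous_on \<Omega> (\<lambda>z. deriv K (snd z))"
 using fst_region snd_region
 by (auto intro!: continuous_on_compose2[OF b_C1(2)] continuous_on_compose2[OF c_C1(2)] continuous_on_compose2[OF K_C1(2)] continuous_intros)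

lemma has_partials_mult:
 fixes f g :: "pt \<Rightarrow> real"
 assumes "(f has_derivative (\<lambda>h. fst h * f1 + snd h * f2)) (at z)" "(g has_derivative (\<lambda>h. fst h * g1 + snd h * g2)) (at z)"
 shows "((\<lambda>z. f z * g z) has_derivative (\<lambda>h. fst h * (f1 * g z + f z * g1) + snd h * (f2 * g z + f z * g2))) (at z)"
 using has_derivative_mult[OF assms] by (rule has_derivative_eq_rhs) (auto simp: algebra_simps)

lemma has_partials_add:
 fixes f g :: "pt \<Rightarrow> real"
 assumes "(f has_derivative (\<lambda>h. fst h * f1 + snd h * f2)) (at z)" "(g has_derivative (\<lambda>h. fst h * g1 + snd h * g2)) (at z)"
 shows "((\<lambda>z. f z + g z) has_derivative (\<lambda>h. fst h * (f1 + g1) + snd h * (f2 + g2))) (at z)"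
 using has_derivative_add[OF assms] by (rule has_derivative_eq_rhs) (auto simp: algebra_simps)

lemma grad_Mop:
 assumes v: "v \<in> poly_space p" and z: "z \<in> \<Omega>"
 shows "grad (Mop b c v) z =
  (deriv b (fst z) * dx v z + b (fst z) * dx (dx v) z + c (snd z) * dx (dy v) z,
   b (fst z) * dy (dx v) z + deriv c (snd z) * dy v z + c (snd z) * dy (dy v) z)"
proof -
 note d = poly_space_derivatives[OF v]
 have "(Mop b c v has_derivative (\<lambda>h. fst h * ((deriv b (fst z) * dx v z + b (fst z) * dx (dx v) z) + (0 * dy v z + c (snd z) * dx (dy v) z)) +
   snd h * ((0 * dx v z + b (fst z) * dy (dx v) z) + (deriv c (snd z) * dy v z + c (snd z) * dy (dy v) z)))) (at z)"
  unfolding Mop_def[abs_def]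
  by (intro has_partials_add has_partials_mult coefficient_derivatives[OF z] poly_space_derivatives(1)[OF d(2)] poly_space_derivatives(1)[OF d(3)])
 from partials_eq[OF this] show ?thesis unfolding grad_def by (simp add: algebra_simps)
qed

lemma element_continuous_integrable:
 assumes T: "T \<in> \<T>" and \<phi>: "continuous_on (closure \<Omega>) \<phi>"
 shows "set_integrable lebesgue T (\<phi> :: pt \<Rightarrow> real)"
 by (rule set_integrable_continuous_closure[OF open_element[OF T] _ continuous_on_subset[OF \<phi> closure_element_subset[OF T]]])
   (rule bounded_subset[OF bounded_region element_subset[OF T]])

lemma element_mult_integrable:
 assumes T: "T \<in> \<T>" and \<phi>: "continuous_on (closure \<Omega>) (\<phi> :: pt \<Rightarrow> real)" and \<psi>: "set_integrable lebesgue T \<psi>"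
 shows "set_integrable lebesgue T (\<lambda>z. \<phi> z * \<psi> z)"
proof -
 have "compact (closure \<Omega>)" using bounded_region by (simp add: compact_closure)
 then obtain B where B: "\<And>z. z \<in> closure \<Omega> \<Longrightarrow> \<bar>\<phi> z\<bar> \<le> B"
  using compact_imp_bounded[OF compact_continuous_image[OF \<phi>]] unfolding bounded_iff by auto
 have sub: "T \<subseteq> closure \<Omega>" using element_subset[OF T] closure_subset by blast
 show ?thesis
  by (rule set_integrable_mult_bounded[OF \<psi> set_borel_measurable_continuous_open[OF open_element[OF T] continuous_on_subset[OF \<phi> sub]]])
    (use B sub in blast)
qed

text \<open>Only b' and c' may be unbounded. They occur linearly, with factors continuous on the
  closure of the domain.\<close>

lemma weak_integrand_integrable:
 assumes T: "T \<in> \<T>" and u: "u \<in> poly_space p" and v: "v \<in> poly_space p"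
 shows "set_integrable lebesgue T (\<lambda>z. Wgrad D u z \<bullet> grad (Mop b c v) z)"
proof -
 note du = poly_space_derivatives[OF u] and dv = poly_space_derivatives[OF v]
 note ddv = poly_space_derivatives[OF dv(2)] poly_space_derivatives[OF dv(3)]
 note cont = poly_space_continuous[OF du(2)] poly_space_continuous[OF du(3)] poly_space_continuous[OF dv(2)] poly_space_continuous[OF dv(3)]
   poly_space_continuous[OF ddv(2)] poly_space_continuous[OF ddv(3)] poly_space_continuous[OF ddv(6)] poly_space_continuous[OF ddv(7)]
 have "set_integrable lebesgue T (\<lambda>z. (K (snd z) * dx u z * dx v z) * deriv b (fst z) + (dy u z * dy v z) * deriv c (snd z) +
   (K (snd z) * dx u z * (b (fst z) * dx (dx v) z + c (snd z) * dx (dy v) z) + dy u z * (b (fst z) * dy (dx v) z + c (snd z) * dy (dy v) z)))"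
  by (intro set_integral_add element_mult_integrable[OF T] coefficient_derivs_integrable[OF T] element_continuous_integrable[OF T]
    continuous_intros continuous_coefficients cont)
 moreover have "(K (snd z) * dx u z * dx v z) * deriv b (fst z) + (dy u z * dy v z) * deriv c (snd z) +
   (K (snd z) * dx u z * (b (fst z) * dx (dx v) z + c (snd z) * dx (dy v) z) + dy u z * (b (fst z) * dy (dx v) z + c (snd z) * dy (dy v) z))
   = Wgrad D u z \<bullet> grad (Mop b c v) z" if "z \<in> T" for z
  using grad_Mop[OF v, of z] element_subset[OF T] that unfolding Wgrad_def by (auto simp: algebra_simps)
 ultimately show ?thesis by (subst set_integrable_cong[OF refl]) auto
qed

text \<open>The quadratic form W grad v . grad v. It is indefinite, since K changes sign.\<close>

definition wnorm :: "(pt \<Rightarrow> real) \<Rightarrow> pt \<Rightarrow> real" where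
 "wnorm v z = K (snd z) * (dx v z)\<^sup>2 + (dy v z)\<^sup>2"

text \<open>Pointwise, -W grad v . grad (Mv) is half of (-K b' + (K c)') v_x^2 + (b' - c') v_y^2
  minus half of the divergence of m times \<open>wnorm v\<close>; here the mixed second derivatives
  of v cancel by symmetry. The multiplier inequalities bound the first part below by \<delta> / 2
  |grad v|^2.\<close>

theorem element_energy:
 assumes T: "T \<in> \<T>" and v: "v \<in> poly_space p"
 shows "\<delta> / 2 * (LINT z:T|lebesgue. (dx v z)\<^sup>2 + (dy v z)\<^sup>2)
   - 1 / 2 * (\<Sum>i\<in>pieces T. PI T i (\<lambda>z. ((b (fst z), c (snd z)) \<bullet> outer_normal T z) * wnorm v z))
  \<le> - (LINT z:T|lebesgue. Wgrad D v z \<bullet> grad (Mop b c v) z)"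
proof -
 note dv = poly_space_derivatives[OF v]
 note ddv = poly_space_derivatives[OF dv(2)] poly_space_derivatives[OF dv(3)]
 note cont = poly_space_continuous[OF dv(2)] poly_space_continuous[OF dv(3)]
   poly_space_continuous[OF ddv(2)] poly_space_continuous[OF ddv(3)] poly_space_continuous[OF ddv(6)] poly_space_continuous[OF ddv(7)]
 have T\<Omega>: "T \<subseteq> \<Omega>" using element_subset[OF T] .
 have Tc: "T \<subseteq> closure \<Omega>" using T\<Omega> closure_subset by blast
 define N1 where "N1 z = 2 * K (snd z) * dx v z * dx (dx v) z + 2 * dy v z * dx (dy v) z" for z
 define N2c where "N2c z = 2 * K (snd z) * dx v z * dy (dx v) z + 2 * dy v z * dy (dy v) z" for z
 \<comment> \<open>The y-derivative of \<open>wnorm v\<close>, split into a part that is continuous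
   up to the boundary and a multiple of K', which is merely integrable.\<close>
 define N2 where "N2 z = (dx v z)\<^sup>2 * deriv K (snd z) + N2c z" for z
 have cN: "continuous_on (closure \<Omega>) (wnorm v)" "continuous_on (closure \<Omega>) N1" "continuous_on (closure \<Omega>) N2c"
  unfolding wnorm_def[abs_def] N1_def[abs_def] N2c_def[abs_def] by (intro continuous_intros continuous_coefficients cont)+
 have dN: "(wnorm v has_derivative (\<lambda>h. fst h * N1 z + snd h * N2 z)) (at z)" if z: "z \<in> T" for z
 proof -
  have "z \<in> \<Omega>" using z T\<Omega> by blast
  then have "((\<lambda>z. K (snd z) * (dx v z * dx v z) + dy v z * dy v z) has_derivative
   (\<lambda>h. fst h * ((0 * (dx v z * dx v z) + K (snd z) * (dx (dx v) z * dx v z + dx v z * dx (dx v) z)) + (dx (dy v) z * dy v z + dy v z * dx (dy v) z)) +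
    snd h * ((deriv K (snd z) * (dx v z * dx v z) + K (snd z) * (dy (dx v) z * dx v z + dx v z * dy (dx v) z)) + (dy (dy v) z * dy v z + dy v z * dy (dy v) z)))) (at z)"
   by (intro has_partials_add has_partials_mult coefficient_derivatives(3) ddv(1) ddv(5))
  then have "((\<lambda>z. K (snd z) * (dx v z * dx v z) + dy v z * dy v z) has_derivative (\<lambda>h. fst h * N1 z + snd h * N2 z)) (at z)"
   by (rule has_derivative_eq_rhs) (auto simp: N1_def N2_def N2c_def algebra_simps power2_eq_square)
  then show ?thesis unfolding wnorm_def[abs_def] power2_eq_square .
 qed
 have iN2: "set_integrable lebesgue T N2" unfolding N2_def[abs_def]
  by (intro set_integral_add element_mult_integrable[OF T] coefficient_derivs_integrable[OF T] element_continuous_integrable[OF T] cN continuous_intros cont)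
 have cK': "continuous_on T N2" unfolding N2_def[abs_def]
  by (intro continuous_intros cont continuous_on_subset[OF cN(3) Tc] continuous_on_subset[OF continuous_coefficient_derivs(3) T\<Omega>])
 have sub: "closure T \<subseteq> closure \<Omega>" using closure_element_subset[OF T] .
 \<comment> \<open>The divergence theorem is used for a scalar and a fixed direction, so the field m
   times \<open>wnorm v\<close> is treated one component at a time.\<close>
 have G1: "(LINT z:T|lebesgue. (1, 0) \<bullet> (deriv b (fst z) * wnorm v z + b (fst z) * N1 z, 0 * wnorm v z + b (fst z) * N2 z)) =
  (\<Sum>i\<in>pieces T. PI T i (\<lambda>z. (b (fst z) * wnorm v z) * ((1, 0) \<bullet> outer_normal T z)))"
 proof (rule element_divergence[OF T])
  show "continuous_on (closure T) (\<lambda>z. b (fst z) * wnorm v z)"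
   by (rule continuous_on_subset[OF _ sub]) (intro continuous_intros continuous_coefficients cN)
  show "((\<lambda>z. b (fst z) * wnorm v z) has_derivative (\<lambda>h. fst h * (deriv b (fst z) * wnorm v z + b (fst z) * N1 z) + snd h * (0 * wnorm v z + b (fst z) * N2 z))) (at z)"
   if "z \<in> T" for z using that T\<Omega> by (intro has_partials_mult coefficient_derivatives dN) auto
  show "continuous_on T (\<lambda>z. deriv b (fst z) * wnorm v z + b (fst z) * N1 z)"
   by (intro continuous_intros continuous_on_subset[OF continuous_coefficient_derivs(1) T\<Omega>] continuous_on_subset[OF cN(1) Tc] continuous_on_subset[OF cN(2) Tc] continuous_on_subset[OF continuous_coefficients(1) Tc])
  show "continuous_on T (\<lambda>z. 0 * wnorm v z + b (fst z) * N2 z)"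
   by (intro continuous_intros cK' continuous_on_subset[OF cN(1) Tc] continuous_on_subset[OF continuous_coefficients(1) Tc])
  have "set_integrable lebesgue T (\<lambda>z. wnorm v z * deriv b (fst z) + b (fst z) * N1 z)"
   by (intro set_integral_add element_mult_integrable[OF T] coefficient_derivs_integrable[OF T] element_continuous_integrable[OF T] cN continuous_coefficients)
  then show "set_integrable lebesgue T (\<lambda>z. deriv b (fst z) * wnorm v z + b (fst z) * N1 z)" by (simp add: mult.commute)
  have "set_integrable lebesgue T (\<lambda>z. b (fst z) * N2 z)"
   by (intro element_mult_integrable[OF T] iN2 continuous_coefficients)
  then show "set_integrable lebesgue T (\<lambda>z. 0 * wnorm v z + b (fst z) * N2 z)" by simp
 qed
 have G2: "(LINT z:T|lebesgue. (0, 1) \<bullet> (0 * wnorm v z + c (snd z) * N1 z, deriv c (snd z) * wnorm v z + c (snd z) * N2 z)) =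
  (\<Sum>i\<in>pieces T. PI T i (\<lambda>z. (c (snd z) * wnorm v z) * ((0, 1) \<bullet> outer_normal T z)))"
 proof (rule element_divergence[OF T])
  show "continuous_on (closure T) (\<lambda>z. c (snd z) * wnorm v z)"
   by (rule continuous_on_subset[OF _ sub]) (intro continuous_intros continuous_coefficients cN)
  show "((\<lambda>z. c (snd z) * wnorm v z) has_derivative (\<lambda>h. fst h * (0 * wnorm v z + c (snd z) * N1 z) + snd h * (deriv c (snd z) * wnorm v z + c (snd z) * N2 z))) (at z)"
   if "z \<in> T" for z using that T\<Omega> by (intro has_partials_mult coefficient_derivatives dN) auto
  show "continuous_on T (\<lambda>z. 0 * wnorm v z + c (snd z) * N1 z)"
   by (intro continuous_intros continuous_on_subset[OF cN(1) Tc] continuous_on_subset[OF cN(2) Tc] continuous_on_subset[OF continuous_coefficients(2) Tc])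
  show "continuous_on T (\<lambda>z. deriv c (snd z) * wnorm v z + c (snd z) * N2 z)"
   by (intro continuous_intros cK' continuous_on_subset[OF continuous_coefficient_derivs(2) T\<Omega>] continuous_on_subset[OF cN(1) Tc] continuous_on_subset[OF continuous_coefficients(2) Tc])
  have "set_integrable lebesgue T (\<lambda>z. c (snd z) * N1 z)"
   by (intro element_continuous_integrable[OF T] continuous_intros cN continuous_coefficients)
  then show "set_integrable lebesgue T (\<lambda>z. 0 * wnorm v z + c (snd z) * N1 z)" by simp
  have "set_integrable lebesgue T (\<lambda>z. wnorm v z * deriv c (snd z) + c (snd z) * N2 z)"
   by (intro set_integral_add element_mult_integrable[OF T] coefficient_derivs_integrable[OF T] iN2 cN continuous_coefficients)
  then show "set_integrable lebesgue T (\<lambda>z. deriv c (snd z) * wnorm v z + c (snd z) * N2 z)" by (simp add: mult.commute)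
 qed
 define g1 where "g1 z = wnorm v z * deriv b (fst z) + b (fst z) * N1 z" for z
 define g2 where "g2 z = wnorm v z * deriv c (snd z) + c (snd z) * N2 z" for z
 have ig1: "set_integrable lebesgue T g1" unfolding g1_def[abs_def]
  by (intro set_integral_add element_mult_integrable[OF T] coefficient_derivs_integrable[OF T] element_continuous_integrable[OF T] cN continuous_coefficients)
 have ig2: "set_integrable lebesgue T g2" unfolding g2_def[abs_def]
  by (intro set_integral_add element_mult_integrable[OF T] coefficient_derivs_integrable[OF T] iN2 cN continuous_coefficients)
 have bd: "(\<Sum>i\<in>pieces T. PI T i (\<lambda>z. ((b (fst z), c (snd z)) \<bullet> outer_normal T z) * wnorm v z)) =
  (LINT z:T|lebesgue. g1 z) + (LINT z:T|lebesgue. g2 z)"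
 proof -
  have "PI T i (\<lambda>z. ((b (fst z), c (snd z)) \<bullet> outer_normal T z) * wnorm v z) =
   PI T i (\<lambda>z. (b (fst z) * wnorm v z) * ((1, 0) \<bullet> outer_normal T z)) + PI T i (\<lambda>z. (c (snd z) * wnorm v z) * ((0, 1) \<bullet> outer_normal T z))"
   if i: "i \<in> pieces T" for i
  proof -
   have "TB T i (\<lambda>z. (b (fst z) * wnorm v z) * ((1, 0) \<bullet> outer_normal T z))" "TB T i (\<lambda>z. (c (snd z) * wnorm v z) * ((0, 1) \<bullet> outer_normal T z))"
    by (intro trace_bounded_mult piece_trace_normal[OF T i] piece_trace_continuous[OF T i] continuous_coefficients cN)+
   from PI_add[OF T i this] show ?thesis by (simp add: inner_prod_def algebra_simps)
  qed
  then have "(\<Sum>i\<in>pieces T. PI T i (\<lambda>z. ((b (fst z), c (snd z)) \<bullet> outer_normal T z) * wnorm v z)) =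
   (\<Sum>i\<in>pieces T. PI T i (\<lambda>z. (b (fst z) * wnorm v z) * ((1, 0) \<bullet> outer_normal T z))) +
   (\<Sum>i\<in>pieces T. PI T i (\<lambda>z. (c (snd z) * wnorm v z) * ((0, 1) \<bullet> outer_normal T z)))" by (simp add: sum.distrib)
  also have "\<dots> = (LINT z:T|lebesgue. g1 z) + (LINT z:T|lebesgue. g2 z)"
   unfolding G1[symmetric] G2[symmetric] g1_def g2_def by (simp add: mult.commute)
  finally show ?thesis .
 qed
 have ip: "set_integrable lebesgue T (\<lambda>z. (dx v z)\<^sup>2 + (dy v z)\<^sup>2)"
  by (intro element_continuous_integrable[OF T] continuous_intros cont)
 have iw: "set_integrable lebesgue T (\<lambda>z. Wgrad D v z \<bullet> grad (Mop b c v) z)" by (rule weak_integrand_integrable[OF T v v])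
 have point: "\<delta> / 2 * ((dx v z)\<^sup>2 + (dy v z)\<^sup>2) + Wgrad D v z \<bullet> grad (Mop b c v) z \<le> 1 / 2 * (g1 z + g2 z)" if z: "z \<in> T" for z
 proof -
  obtain x y where xy: "z = (x, y)" by (cases z)
  have z\<Omega>: "(x, y) \<in> \<Omega>" using z T\<Omega> xy by auto
  have r: "yl < y" "y < yr" using in_ranges[OF z\<Omega>] by auto
  have m1: "\<delta> \<le> - K y * deriv b x + (deriv K y * c y + K y * deriv c y)" using mult_1[OF z\<Omega>] deriv_Kc[OF r] by simp
  have m2: "\<delta> \<le> deriv b x - deriv c y" using mult_2[OF z\<Omega>] .
  have "1 / 2 * (g1 z + g2 z) - Wgrad D v z \<bullet> grad (Mop b c v) z =
   1 / 2 * ((- K y * deriv b x + (deriv K y * c y + K y * deriv c y)) * (dx v z)\<^sup>2 + (deriv b x - deriv c y) * (dy v z)\<^sup>2)"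
   unfolding g1_def g2_def N1_def N2_def N2c_def wnorm_def grad_Mop[OF v z\<Omega>[folded xy]] Wgrad_def dv(4)
   by (simp add: xy) algebra
  moreover have "(- K y * deriv b x + (deriv K y * c y + K y * deriv c y)) * (dx v z)\<^sup>2 \<ge> \<delta> * (dx v z)\<^sup>2"
   "(deriv b x - deriv c y) * (dy v z)\<^sup>2 \<ge> \<delta> * (dy v z)\<^sup>2" using m1 m2 by (auto intro: mult_right_mono)
  moreover have "\<delta> / 2 * ((dx v z)\<^sup>2 + (dy v z)\<^sup>2) = 1 / 2 * (\<delta> * (dx v z)\<^sup>2 + \<delta> * (dy v z)\<^sup>2)" by (simp add: algebra_simps)
  ultimately show ?thesis by (rule half_sum_bound)
 qed
 have "(LINT z:T|lebesgue. \<delta> / 2 * ((dx v z)\<^sup>2 + (dy v z)\<^sup>2) + Wgrad D v z \<bullet> grad (Mop b c v) z) \<le> (LINT z:T|lebesgue. 1 / 2 * (g1 z + g2 z))"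
  by (rule set_integral_mono[OF _ _ point]) (use ip iw ig1 ig2 in \<open>auto intro!: set_integral_add set_integrable_mult_right\<close>)
 moreover have "(LINT z:T|lebesgue. \<delta> / 2 * ((dx v z)\<^sup>2 + (dy v z)\<^sup>2) + Wgrad D v z \<bullet> grad (Mop b c v) z) =
   \<delta> / 2 * (LINT z:T|lebesgue. (dx v z)\<^sup>2 + (dy v z)\<^sup>2) + (LINT z:T|lebesgue. Wgrad D v z \<bullet> grad (Mop b c v) z)"
  using ip iw by (subst set_integral_add) auto
 moreover have "(LINT z:T|lebesgue. 1 / 2 * (g1 z + g2 z)) = 1 / 2 * ((LINT z:T|lebesgue. g1 z) + (LINT z:T|lebesgue. g2 z))"
  using set_integral_add(2)[OF ig1 ig2] by simp
 ultimately show ?thesis unfolding bd by linarith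
qed

end

section \<open>Sums over facets\<close>

context tricomi_mesh
begin

lemma finite_parts: "finite (P :: boundary_part set)"
 by (rule finite_subset[OF subset_UNIV]) (simp add: UNIV_boundary_part)

lemma curve_integral_finite:
 assumes "inj_on \<gamma> {0..1}" "finite (F \<inter> \<gamma> ` {0..1})"
 shows "curve_integral \<gamma> F \<phi> = 0"
proof -
 have "AE s in lebesgue. s \<in> {0..1} \<longrightarrow> \<gamma> s \<notin> F \<inter> \<gamma> ` {0..1}" by (rule AE_avoid_finite[OF assms])
 then have "AE s in lebesgue. indicator {s \<in> {0..1}. \<gamma> s \<in> F} s *\<^sub>R (\<phi> (\<gamma> s) * norm (velocity \<gamma> s)) = 0"
  by eventually_elim (auto simp: indicator_def)
 then show ?thesis unfolding curve_integral_def set_lebesgue_integral_def by (rule integral_eq_zero_AE)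
qed

definition has_length :: "pt set \<Rightarrow> boundary_part \<Rightarrow> bool" where
 "has_length T j \<longleftrightarrow> curve_integral (Gam_arc D j) (boundary_piece T j) (\<lambda>_. 1) > 0"

lemma Inr_piece: "Inr j \<in> pieces T" unfolding pieces_def by auto

lemma Inl_piece: "F \<in> elem_facets T \<Longrightarrow> Inl F \<in> pieces T" unfolding pieces_def by auto

text \<open>Zero length means that the speed vanishes almost everywhere on the piece, and the speed
  is a factor of every curve integral.\<close>

lemma curve_integral_no_length:
 assumes T: "T \<in> \<T>" and n: "\<not> has_length T j" shows "PI T (Inr j) \<phi> = 0"
proof -
 define f where "f s = indicator (piece_set T (Inr j)) s *\<^sub>R (1 * norm (velocity (Gam_arc D j) s))" for s
 have i: "integrable lebesgue f"
  using piece_trace_integrable[OF T Inr_piece trace_bounded_const[of _ _ 1], of j] unfolding set_integrable_def f_def piece_simps .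
 have pos: "AE s in lebesgue. 0 \<le> f s" by (auto simp: f_def)
 have "integral\<^sup>L lebesgue f \<le> 0" using n unfolding has_length_def f_def
  using curve_integral_piece[where i = "Inr j" and T = T and \<phi> = "\<lambda>_. 1"] by (simp add: set_lebesgue_integral_def)
 moreover have "0 \<le> integral\<^sup>L lebesgue f" by (rule integral_nonneg_AE[OF pos])
 ultimately have "AE s in lebesgue. f s = 0" using integral_nonneg_eq_0_iff_AE[OF i pos] by simp
 then have "AE s in lebesgue. indicator (piece_set T (Inr j)) s *\<^sub>R (\<phi> (Gam_arc D j s) * norm (velocity (Gam_arc D j) s)) = 0"
  by eventually_elim (auto simp: f_def indicator_def split: if_splits)
 then show ?thesis unfolding curve_integral_piece unfolding set_lebesgue_integral_def piece_simps by (rule integral_eq_zero_AE)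
qed

lemma infinite_boundary_piece:
 assumes "has_length T j" shows "infinite (boundary_piece T j)"
proof
 assume "finite (boundary_piece T j)"
 then have "curve_integral (Gam_arc D j) (boundary_piece T j) (\<lambda>_. 1) = 0"
  by (intro curve_integral_finite Gam_arc_inj) auto
 then show False using assms unfolding has_length_def by simp
qed

text \<open>\<open>boundary_integral\<close> adds the integrals over all three arcs, but the other
  two meet the piece in finitely many points.\<close>

lemma boundary_integral_piece:
 assumes T: "T \<in> \<T>" shows "boundary_integral D (boundary_piece T j) \<phi> = PI T (Inr j) \<phi>"
proof -
 have z: "curve_integral (Gam_arc D j') (boundary_piece T j) \<phi> = 0" if "j' \<noteq> j" for j'
 proof (rule curve_integral_finite[OF Gam_arc_inj])
  have "{0..1} = {0<..<1} \<union> {0, 1 :: real}" by auto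
  then have U: "Gam_arc D Upper ` {0..1} = Gam D Upper \<union> {(1, 0), (- 1, 0)}"
   using Gam_Upper upper_start upper_finish by auto
  have "Gam_arc D j' ` {0..1} \<subseteq> Gam D j' \<union> {(1, 0), (- 1, 0)}" using Gam_char_image U by (cases j') auto
  then have "boundary_piece T j \<inter> Gam_arc D j' ` {0..1} \<subseteq> (Gam D j' \<inter> Gam D j) \<union> {(1, 0), (- 1, 0)}"
   unfolding boundary_piece_def by auto
  then show "finite (boundary_piece T j \<inter> Gam_arc D j' ` {0..1})" using Gam_Int_finite[OF that] finite_subset by blast
 qed
 have "boundary_integral D (boundary_piece T j) \<phi> = (\<Sum>j'\<in>UNIV. if j' = j then curve_integral (Gam_arc D j) (boundary_piece T j) \<phi> else 0)"
  unfolding boundary_integral_def UNIV_boundary_part by (intro sum.cong refl) (use z in auto)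
 also have "\<dots> = curve_integral (Gam_arc D j) (boundary_piece T j) \<phi>" by (subst sum.delta) (auto simp: finite_parts)
 finally show ?thesis by simp
qed

lemma boundary_facets_eq: "boundary_facets D \<S> j = (\<lambda>T. boundary_piece T j) ` {T \<in> \<S>. has_length T j}"
 unfolding boundary_facets_def has_length_def boundary_piece_def by auto

text \<open>A piece of positive length is infinite, so it contains a point off the corners, and such
  a point belongs to one element only. This gives meaning to the description in
  \<open>boundary_elem\<close>.\<close>

lemma boundary_piece_unique:
 assumes "T \<in> \<T>" "T' \<in> \<T>" "has_length T j" "boundary_piece T j = boundary_piece T' j'"
 shows "T' = T" "j' = j"
proof -
 have inf: "infinite (boundary_piece T j)" by (rule infinite_boundary_piece[OF assms(3)])
 have "\<not> boundary_piece T j \<subseteq> corners" by (meson finite_subset inf finite_corners)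
 then obtain z where z: "z \<in> boundary_piece T j" "z \<notin> corners" by blast
 then have "z \<in> frontier T" "z \<in> frontier \<Omega>" "z \<in> closure T'"
  using Gam_subset_frontier assms(4) unfolding boundary_piece_def by (auto simp: frontier_def)
 then show "T' = T" using boundary_point(1)[OF assms(1) _ _ z(2)] assms(2) by blast
 show "j' = j"
 proof (rule ccontr)
  assume "j' \<noteq> j"
  then have "finite (Gam D j' \<inter> Gam D j)" by (rule Gam_Int_finite)
  moreover have "boundary_piece T j \<subseteq> Gam D j' \<inter> Gam D j" using assms(4) unfolding boundary_piece_def by auto
  ultimately show False by (meson finite_subset inf)
 qed
qed

lemma elem_boundary_facets_eq: "elem_boundary_facets D T = boundary_piece T ` {j. has_length T j}"
 unfolding elem_boundary_facets_def boundary_facets_eq by auto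

lemma boundary_elem_eq:
 assumes T: "T \<in> \<T>" "has_length T j" shows "boundary_elem D \<T> (boundary_piece T j) = T"
 unfolding boundary_elem_def elem_boundary_facets_eq
proof (rule the_equality)
 show "T \<in> \<T> \<and> boundary_piece T j \<in> boundary_piece T ` {j. has_length T j}" using T by auto
 fix T' assume "T' \<in> \<T> \<and> boundary_piece T j \<in> boundary_piece T' ` {j. has_length T' j}"
 then show "T' = T" using boundary_piece_unique(1)[OF T(1) _ T(2)] by auto
qed

text \<open>Facets are sets, but those of positive length correspond one to one to pairs of an
  element and a boundary part. Pairs without length add only zeros, so the sum may run over all
  pairs.\<close>

lemma sum_boundary_facets:
 fixes w :: "pt set \<Rightarrow> real"
 shows "(\<Sum>F\<in>(\<Union>j\<in>P. boundary_facets D \<T> j). w F * boundary_integral D F (\<lambda>z. \<Phi> (boundary_elem D \<T> F) z)) =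
  (\<Sum>T\<in>\<T>. \<Sum>j\<in>P. w (boundary_piece T j) * PI T (Inr j) (\<Phi> T))"
proof -
 let ?h = "\<lambda>F. w F * boundary_integral D F (\<lambda>z. \<Phi> (boundary_elem D \<T> F) z)"
 define X where "X = {(T, j). T \<in> \<T> \<and> j \<in> P \<and> has_length T j}"
 have eq: "(\<Union>j\<in>P. boundary_facets D \<T> j) = (\<lambda>(T, j). boundary_piece T j) ` X"
  unfolding X_def boundary_facets_eq by auto
 have inj: "inj_on (\<lambda>(T, j). boundary_piece T j) X" unfolding X_def inj_on_def using boundary_piece_unique by auto
 have "(\<Sum>F\<in>(\<Union>j\<in>P. boundary_facets D \<T> j). ?h F) = (\<Sum>(T, j)\<in>X. ?h (boundary_piece T j))"
  unfolding eq by (subst sum.reindex[OF inj]) (auto intro!: sum.cong)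
 also have "\<dots> = (\<Sum>(T, j)\<in>X. w (boundary_piece T j) * PI T (Inr j) (\<Phi> T))"
  by (rule sum.cong) (auto simp: X_def boundary_elem_eq boundary_integral_piece simp del: piece_simps)
 also have "\<dots> = (\<Sum>(T, j)\<in>\<T> \<times> P. w (boundary_piece T j) * PI T (Inr j) (\<Phi> T))"
 proof (rule sum.mono_neutral_left)
  show "\<forall>x\<in>\<T> \<times> P - X. (case x of (T, j) \<Rightarrow> w (boundary_piece T j) * PI T (Inr j) (\<Phi> T)) = 0"
  proof
   fix x assume "x \<in> \<T> \<times> P - X"
   then obtain T j where "x = (T, j)" "T \<in> \<T>" "\<not> has_length T j" unfolding X_def by auto
   then show "(case x of (T, j) \<Rightarrow> w (boundary_piece T j) * PI T (Inr j) (\<Phi> T)) = 0"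
    using curve_integral_no_length[of T j "\<Phi> T"] by (simp del: piece_simps)
  qed
 qed (use finite_mesh finite_parts in \<open>auto simp: X_def\<close>)
 also have "\<dots> = (\<Sum>T\<in>\<T>. \<Sum>j\<in>P. w (boundary_piece T j) * PI T (Inr j) (\<Phi> T))" by (rule sum.cartesian_product[symmetric])
 finally show ?thesis .
qed

lemma segment_integral_piece: "segment_integral F \<phi> = PI T (Inl F) \<phi>"
 unfolding segment_integral_eq by simp

lemma elem_boundary_integral_eq:
 assumes T: "T \<in> \<T>" shows "elem_boundary_integral D \<T> T \<phi> = (\<Sum>i\<in>pieces T. PI T i \<phi>)"
proof -
 have "(\<Sum>F\<in>elem_boundary_facets D T. boundary_integral D F \<phi>) = (\<Sum>j\<in>{j. has_length T j}. PI T (Inr j) \<phi>)"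
  unfolding elem_boundary_facets_eq
  by (subst sum.reindex) (use boundary_piece_unique[OF T T] boundary_integral_piece[OF T] in \<open>auto simp: inj_on_def simp del: piece_simps\<close>)
 also have "\<dots> = (\<Sum>j\<in>UNIV. PI T (Inr j) \<phi>)"
  by (rule sum.mono_neutral_left) (use curve_integral_no_length[OF T] finite_parts in \<open>auto simp del: piece_simps\<close>)
 finally have 1: "(\<Sum>F\<in>elem_boundary_facets D T. boundary_integral D F \<phi>) = (\<Sum>j\<in>UNIV. PI T (Inr j) \<phi>)" .
 have "(\<Sum>i\<in>pieces T. PI T i \<phi>) = (\<Sum>i\<in>Inl ` elem_facets T. PI T i \<phi>) + (\<Sum>i\<in>Inr ` UNIV. PI T i \<phi>)"
  unfolding pieces_def using finite_elem_facets[OF T] finite_parts by (intro sum.union_disjoint) auto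
 also have "\<dots> = (\<Sum>F\<in>elem_facets T. PI T (Inl F) \<phi>) + (\<Sum>j\<in>UNIV. PI T (Inr j) \<phi>)"
  by (simp add: sum.reindex o_def del: piece_simps)
 finally show ?thesis unfolding elem_boundary_integral_def 1 segment_integral_piece[where T = T] by simp
qed

lemma sum_pieces:
 assumes T: "T \<in> \<T>"
 shows "(\<Sum>i\<in>pieces T. f i) = (\<Sum>F\<in>elem_facets T. f (Inl F)) + (\<Sum>j\<in>UNIV. f (Inr j))"
proof -
 have "(\<Sum>i\<in>pieces T. f i) = (\<Sum>i\<in>Inl ` elem_facets T. f i) + (\<Sum>i\<in>Inr ` UNIV. f i)"
  unfolding pieces_def using finite_elem_facets[OF T] finite_parts by (intro sum.union_disjoint) auto
 then show ?thesis by (simp add: sum.reindex o_def)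
qed

lemma interior_facets_eq: "\<F> = (\<Union>T\<in>\<T>. elem_facets T)"
 unfolding interior_facets_def elem_interior_facets_def by auto

lemma finite_interior_facets: "finite (\<F>)"
 unfolding interior_facets_eq using finite_mesh finite_elem_facets by auto

lemma sum_interior_facets:
 "(\<Sum>T\<in>\<T>. \<Sum>F\<in>elem_facets T. X T F) = (\<Sum>F\<in>\<F>. \<Sum>T\<in>sides F. X T F)"
proof -
 have 1: "elem_facets T = {F \<in> \<F>. F \<in> elem_facets T}" if "T \<in> \<T>" for T using that interior_facets_eq by auto
 have "(\<Sum>T\<in>\<T>. \<Sum>F\<in>elem_facets T. X T F) = (\<Sum>T\<in>\<T>. \<Sum>F\<in>{F \<in> \<F>. F \<in> elem_facets T}. X T F)"
  using 1 by (intro sum.cong) auto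
 also have "\<dots> = (\<Sum>F\<in>\<F>. \<Sum>T\<in>{T \<in> \<T>. F \<in> elem_facets T}. X T F)"
  by (rule sum.swap_restrict[OF finite_mesh finite_interior_facets])
 finally show ?thesis unfolding facet_elems_def .
qed

abbreviation "opposite_normals T T' z \<equiv> norm (outer_normal T z) = 1 \<and> outer_normal T' z = - outer_normal T z"

text \<open>The midpoint of F lies in the closure of no third element, so \<open>sides F\<close> has
  exactly two members.\<close>

lemma interior_facet_neighbours:
 assumes "F \<in> \<F>"
 obtains T T' where "T \<in> \<T>" "T' \<in> \<T>" "T \<noteq> T'" "sides F = {T, T'}"
  "F \<in> elem_facets T" "F \<in> elem_facets T'" "F = frontier T \<inter> frontier T'"
  "AE s in lebesgue. s \<in> {0..1} \<longrightarrow> opposite_normals T T' (segment_path F s)"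
proof -
 obtain T T' where T: "T \<in> \<T>" "T' \<in> \<T>" "T \<noteq> T'" "F = frontier T \<inter> frontier T'" and seg: "segment_set F"
  using assms unfolding interior_facets_def by auto
 obtain a b where ab: "a \<noteq> b" "F = closed_segment a b" "segment_path F = linepath a b" by (rule segment_path[OF seg])
 have Fab: "frontier T \<inter> frontier T' = closed_segment a b" using T(4) ab(2) by simp
 have e: "F \<in> elem_facets T" "F \<in> elem_facets T'" unfolding elem_interior_facets_def using T seg by blast+
 have fe: "sides F = {T, T'}"
 proof
  show "sides F \<subseteq> {T, T'}"
  proof
   fix T'' assume "T'' \<in> sides F"
   then have T'': "T'' \<in> \<T>" "F \<subseteq> frontier T''" unfolding facet_elems_def elem_interior_facets_def by auto
   have "linepath a b (1/2) \<in> closed_segment a b" by (rule linepath_in_path) simp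
   then have "linepath a b (1/2) \<in> closure T''" using T''(2) ab(2) by (auto simp: frontier_def)
   then show "T'' \<in> {T, T'}" using facet_point_elements[OF T(1-3) Fab ab(1) _ _ T''(1), of "1/2"] by auto
  qed
  show "{T, T'} \<subseteq> sides F" unfolding facet_elems_def using e T by auto
 qed
 have "AE s in lebesgue. s \<in> {0..1} \<longrightarrow> (\<lambda>s. s) s \<notin> {0, 1 :: real}" by (rule AE_avoid_finite) auto
 then have "AE s in lebesgue. s \<in> {0..1} \<longrightarrow> opposite_normals T T' (segment_path F s)"
 proof (eventually_elim, intro impI)
  fix s assume s: "s \<in> {0..1} \<longrightarrow> s \<notin> {0, 1 :: real}" "s \<in> {0..1}"
  then have s01: "0 < s" "s < 1" by auto
  obtain n where n: "is_outer_normal T (linepath a b s) n" "is_outer_normal T' (linepath a b s) (- n)"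
   by (rule facet_point[OF T(1-3) Fab ab(1) s01]) blast
  show "opposite_normals T T' (segment_path F s)"
   unfolding ab(3) outer_normal_eq[OF n(1)] outer_normal_eq[OF n(2)] using is_outer_normal_norm[OF n(1)] by simp
 qed
 then show ?thesis using that[OF T(1-3) fe e T(4)] by blast
qed

lemma facet_elemsD: "T \<in> sides F \<Longrightarrow> T \<in> \<T> \<and> F \<in> elem_facets T"
 unfolding facet_elems_def by auto

abbreviation "region_normal T j s \<equiv> outer_normal \<Omega> (Gam_arc D j s) = outer_normal T (Gam_arc D j s) \<and>
 is_outer_normal \<Omega> (Gam_arc D j s) (outer_normal \<Omega> (Gam_arc D j s)) \<and> outer_normal \<Omega> (Gam_arc D j s) \<bullet> velocity (Gam_arc D j) s = 0"

lemma region_normal_AE: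
 assumes T: "T \<in> \<T>"
 shows "AE_curve (Gam_arc D j) (piece_set T (Inr j)) (\<lambda>s. region_normal T j s)"
proof -
 obtain x \<rho> where st: "star_domain T x \<rho>" using star_element[OF T] by blast
 show ?thesis using piece_normal[OF st T Inr_piece[of j]] unfolding piece_simps
 proof (eventually_elim, intro impI)
  fix s assume a: "s \<in> piece_set T (Inr j) \<longrightarrow> velocity (Gam_arc D j) s \<noteq> 0 \<longrightarrow>
    is_outer_normal T (Gam_arc D j s) (outer_normal T (Gam_arc D j s)) \<and>
    outer_normal T (Gam_arc D j s) \<bullet> velocity (Gam_arc D j) s = 0 \<and>
    (\<forall>w\<in>ball x \<rho>. 0 < (Gam_arc D j s - w) \<bullet> outer_normal T (Gam_arc D j s)) \<and>
    (\<forall>ja. Inr j = Inr ja \<longrightarrow> is_outer_normal \<Omega> (Gam_arc D j s) (outer_normal T (Gam_arc D j s)))"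
   and s: "s \<in> piece_set T (Inr j)" "velocity (Gam_arc D j) s \<noteq> 0"
  have n: "is_outer_normal \<Omega> (Gam_arc D j s) (outer_normal T (Gam_arc D j s))"
   "outer_normal T (Gam_arc D j s) \<bullet> velocity (Gam_arc D j) s = 0" using a s by blast+
  show "region_normal T j s" unfolding outer_normal_eq[OF n(1)] using n by blast
 qed
qed

lemma region_trace_normal:
 assumes T: "T \<in> \<T>"
 shows "TB T (Inr j) (\<lambda>z. e \<bullet> outer_normal \<Omega> z)"
 by (rule trace_bounded_cong_AE[OF piece_trace_normal[OF T Inr_piece[of j T], of e]])
   (use region_normal_AE[OF T, of j] in \<open>unfold piece_simps, eventually_elim, simp\<close>)

text \<open>The elements touch the left characteristic everywhere. If no contact had positive
  length, its velocity would vanish almost everywhere, but that is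
  \<open>yc *\<^sub>R (- k y, 1)\<close>, which is never zero. Such a facet fixes the last free
  constant in the coercivity proof.\<close>

lemma exists_CharLeft_facet: "\<exists>T\<in>\<T>. has_length T CharLeft"
proof (rule ccontr)
 assume n: "\<not> (\<exists>T\<in>\<T>. has_length T CharLeft)"
 have "AE s in lebesgue. \<forall>T\<in>\<T>. s \<in> piece_set T (Inr CharLeft) \<longrightarrow> velocity (Gam_arc D CharLeft) s = 0"
 proof (rule AE_finite_allI[OF finite_mesh])
  fix T assume T: "T \<in> \<T>"
  define f where "f s = indicator (piece_set T (Inr CharLeft)) s *\<^sub>R (1 * norm (velocity (Gam_arc D CharLeft) s))" for s
  have i: "integrable lebesgue f"
   using piece_trace_integrable[OF T Inr_piece trace_bounded_const[of _ _ 1], of CharLeft] unfolding set_integrable_def f_def piece_simps .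
  have "integral\<^sup>L lebesgue f = 0" using curve_integral_no_length[OF T, of CharLeft "\<lambda>_. 1"] n T
   unfolding curve_integral_piece unfolding set_lebesgue_integral_def piece_simps f_def by auto
  then have "AE s in lebesgue. f s = 0" using integral_nonneg_eq_0_iff_AE[OF i] by (simp add: f_def)
  then show "AE s in lebesgue. s \<in> piece_set T (Inr CharLeft) \<longrightarrow> velocity (Gam_arc D CharLeft) s = 0"
   by eventually_elim (auto simp: f_def indicator_def split: if_splits)
 qed
 then have ae: "AE s in lebesgue. s \<in> {0<..<1::real} \<longrightarrow> False"
 proof eventually_elim
  fix s assume a: "\<forall>T\<in>\<T>. s \<in> piece_set T (Inr CharLeft) \<longrightarrow> velocity (Gam_arc D CharLeft) s = 0"
  show "s \<in> {0<..<1} \<longrightarrow> False"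
  proof
   assume s: "s \<in> {0<..<1}"
   define z where "z = Gam_arc D CharLeft s"
   have z: "z \<in> Gam D CharLeft" unfolding Gam_char_image(1) z_def by (rule imageI) (use s in auto)
   then have fr: "z \<in> frontier \<Omega>" using Gam_subset_frontier by blast
   then obtain T where T: "T \<in> \<T>" "z \<in> closure T" using closure_cover by (auto simp: frontier_def)
   have "z \<notin> T" using fr element_subset[OF T(1)] open_region by (auto simp: frontier_def interior_open)
   then have "z \<in> frontier T" using T open_element by (auto simp: frontier_def interior_open)
   then have "s \<in> piece_set T (Inr CharLeft)" unfolding piece_set_def piece_simps boundary_piece_def
    using z s unfolding z_def by auto
   then have "velocity (Gam_arc D CharLeft) s = 0" using a T(1) by blast
   moreover have "velocity (Gam_arc D CharLeft) s = yc *\<^sub>R (- k (s * yc), 1)"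
    by (rule vector_derivative_at[OF Gam_arc_deriv(1)]) (use s in auto)
   ultimately show False using yc_neg by (simp add: zero_prod_def)
  qed
 qed
 have "{0<..<1::real} \<in> null_sets lebesgue" by (subst AE_iff_null_sets) (use ae in auto)
 then have "negligible {0<..<1::real}" by (simp add: negligible_iff_null_sets)
 then show False using open_not_negligible[of "{0<..<1::real}"] by simp
qed

text \<open>A finite set of points does not disconnect the domain, so crossing facets leads from any
 element to any other.\<close>

lemma mesh_connected:
 assumes eq: "\<And>F T T'. F \<in> \<F> \<Longrightarrow> sides F = {T, T'} \<Longrightarrow> f T = f T'"
  and T: "T \<in> \<T>" "T' \<in> \<T>"
 shows "f T = f T'"
proof (rule ccontr)
 assume ne: "f T \<noteq> f T'"
 define A where "A = (\<Union>S\<in>{S \<in> \<T>. f S = f T}. closure S)"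
 define B where "B = (\<Union>S\<in>{S \<in> \<T>. f S \<noteq> f T}. closure S)"
 have cl: "closed A" "closed B" unfolding A_def B_def using finite_mesh by auto
 have conn: "connected (\<Omega> - corners)"
  by (rule connected_open_delete_finite[OF open_region connected_region _ finite_corners]) simp
 have cov: "\<Omega> - corners \<subseteq> A \<union> B" using elements_cover unfolding A_def B_def by blast
 have ne1: "S \<inter> (\<Omega> - corners) \<noteq> {}" if S: "S \<in> \<T>" for S
 proof
  assume "S \<inter> (\<Omega> - corners) = {}"
  then have "S \<subseteq> corners" using element_subset[OF S] by blast
  then have "finite S" using finite_corners finite_subset by blast
  then show False using open_element[OF S] element_nonempty[OF S] finite_imp_not_open by blast
 qed
 have nA: "A \<inter> (\<Omega> - corners) \<noteq> {}" using ne1[OF T(1)] T(1) closure_subset unfolding A_def by blast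
 have nB: "B \<inter> (\<Omega> - corners) \<noteq> {}" using ne1[OF T(2)] T(2) ne closure_subset unfolding B_def by fastforce
 have "A \<inter> B \<inter> (\<Omega> - corners) \<noteq> {}"
 proof
  assume "A \<inter> B \<inter> (\<Omega> - corners) = {}"
  then show False using connected_closedD[OF conn _ cov cl(1) cl(2)] nA nB by blast
 qed
 then obtain z S S' where z: "z \<notin> corners" and S: "S \<in> \<T>" "f S = f T" "z \<in> closure S" and S': "S' \<in> \<T>" "f S' \<noteq> f T" "z \<in> closure S'"
  unfolding A_def B_def by blast
 have SS: "S \<noteq> S'" using S S' by auto
 have nS: "z \<notin> S"
 proof
  assume "z \<in> S"
  then have "S \<inter> S' \<noteq> {}" using S'(3) open_Int_closure_eq_empty[OF open_element[OF S(1)], of S'] by blast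
  then show False using elements_disjoint[OF S(1) S'(1) SS] by blast
 qed
 then have fS: "z \<in> frontier S" using S open_element by (auto simp: frontier_def interior_open)
 have fS': "z \<in> frontier S'" by (rule frontier_other[OF S(1) S'(1) SS fS S'(3)])
 obtain a b s where ab: "a \<noteq> b" "frontier S \<inter> frontier S' = closed_segment a b" "0 < s" "s < 1" "z = linepath a b s"
  by (rule shared_point[OF S(1) S'(1) SS fS fS' z])
 define F where "F = frontier S \<inter> frontier S'"
 have "segment_set F" unfolding segment_set_def F_def using ab(1,2) by (intro exI conjI)
 then have F: "F \<in> \<F>" "F \<in> elem_facets S" "F \<in> elem_facets S'"
  unfolding interior_facets_def elem_interior_facets_def F_def using S(1) S'(1) SS by blast+
 obtain U U' where U: "sides F = {U, U'}" by (rule interior_facet_neighbours[OF F(1)])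
 have "S \<in> sides F" "S' \<in> sides F" unfolding facet_elems_def using F S S' by auto
 then have "sides F = {S, S'}" using U SS by auto
 from eq[OF F(1) this] show False using S S' by simp
qed

end

section \<open>Solvability of coercive problems in finite dimension\<close>

definition linear_form :: "broken set \<Rightarrow> (broken \<Rightarrow> real) \<Rightarrow> bool" where
 "linear_form V f \<longleftrightarrow> (\<forall>u\<in>V. \<forall>v\<in>V. f (\<lambda>T z. u T z + v T z) = f u + f v) \<and>
   (\<forall>r. \<forall>v\<in>V. f (\<lambda>T z. r * v T z) = r * f v)"

definition bilinear_form :: "broken set \<Rightarrow> (broken \<Rightarrow> broken \<Rightarrow> real) \<Rightarrow> bool" where
 "bilinear_form V B \<longleftrightarrow> (\<forall>u\<in>V. linear_form V (B u)) \<and> (\<forall>v\<in>V. linear_form V (\<lambda>u. B u v))"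

lemma linear_form_add: "linear_form V f \<Longrightarrow> linear_form V g \<Longrightarrow> linear_form V (\<lambda>u. f u + g u)"
 unfolding linear_form_def by (auto simp: algebra_simps)

lemma linear_form_cmult: "linear_form V f \<Longrightarrow> linear_form V (\<lambda>u. k * f u)"
 unfolding linear_form_def by (auto simp: algebra_simps)

lemma linear_form_cmult_right: "linear_form V f \<Longrightarrow> linear_form V (\<lambda>u. f u * k)"
 unfolding linear_form_def by (auto simp: algebra_simps)

lemma linear_form_uminus: "linear_form V f \<Longrightarrow> linear_form V (\<lambda>u. - f u)"
 unfolding linear_form_def by auto

lemma linear_form_sum: "(\<And>i. i \<in> I \<Longrightarrow> linear_form V (f i)) \<Longrightarrow> linear_form V (\<lambda>u. \<Sum>i\<in>I. f i u)"
 unfolding linear_form_def by (auto simp: sum.distrib[symmetric] sum_distrib_left intro!: sum.cong)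

lemma linear_form_set_integral:
 assumes int: "\<And>u. u \<in> V \<Longrightarrow> set_integrable M S (f u)" and lin: "\<And>s. s \<in> S \<Longrightarrow> linear_form V (\<lambda>u. f u s)"
 shows "linear_form V (\<lambda>u. LINT s:S|M. f u s)" unfolding linear_form_def
proof (intro conjI ballI allI)
 fix u v assume uv: "u \<in> V" "v \<in> V"
 have "(LINT s:S|M. f (\<lambda>T z. u T z + v T z) s) = (LINT s:S|M. f u s + f v s)" unfolding set_lebesgue_integral_def
  by (intro Bochner_Integration.integral_cong refl) (use lin uv in \<open>auto simp: linear_form_def indicator_def\<close>)
 then show "(LINT s:S|M. f (\<lambda>T z. u T z + v T z) s) = (LINT s:S|M. f u s) + (LINT s:S|M. f v s)"
  using set_integral_add(2)[OF int[OF uv(1)] int[OF uv(2)]] by simp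
next
 fix k v assume v: "v \<in> V"
 have "(LINT s:S|M. f (\<lambda>T z. k * v T z) s) = (LINT s:S|M. k * f v s)" unfolding set_lebesgue_integral_def
  by (intro Bochner_Integration.integral_cong refl) (use lin v in \<open>auto simp: linear_form_def indicator_def\<close>)
 then show "(LINT s:S|M. f (\<lambda>T z. k * v T z) s) = k * (LINT s:S|M. f v s)" by simp
qed

lemma bilinear_form_add: "bilinear_form V f \<Longrightarrow> bilinear_form V g \<Longrightarrow> bilinear_form V (\<lambda>u v. f u v + g u v)"
 unfolding bilinear_form_def by (auto intro: linear_form_add)

lemma bilinear_form_cmult: "bilinear_form V f \<Longrightarrow> bilinear_form V (\<lambda>u v. k * f u v)"
 unfolding bilinear_form_def by (auto intro: linear_form_cmult)

lemma bilinear_form_uminus: "bilinear_form V f \<Longrightarrow> bilinear_form V (\<lambda>u v. - f u v)"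
 unfolding bilinear_form_def by (auto intro: linear_form_uminus)

lemma bilinear_form_sum: "(\<And>i. i \<in> I \<Longrightarrow> bilinear_form V (f i)) \<Longrightarrow> bilinear_form V (\<lambda>u v. \<Sum>i\<in>I. f i u v)"
 unfolding bilinear_form_def by (auto intro!: linear_form_sum)

lemma bilinear_form_mult: "linear_form V f \<Longrightarrow> linear_form V g \<Longrightarrow> bilinear_form V (\<lambda>u v. f u * g v)"
 unfolding bilinear_form_def by (auto intro: linear_form_cmult linear_form_cmult_right)

lemma bilinear_form_set_integral:
 assumes "\<And>u v. u \<in> V \<Longrightarrow> v \<in> V \<Longrightarrow> set_integrable M S (f u v)" "\<And>s. s \<in> S \<Longrightarrow> bilinear_form V (\<lambda>u v. f u v s)"
 shows "bilinear_form V (\<lambda>u v. LINT s:S|M. f u v s)"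
 using assms unfolding bilinear_form_def by (auto intro!: linear_form_set_integral)

lemma linear_form_diff:
 assumes V: "linear_subspace V" and f: "linear_form V f" and uv: "u \<in> V" "v \<in> V"
 shows "f (\<lambda>T z. u T z + k * v T z) = f u + k * f v"
proof -
 have "(\<lambda>T z. k * v T z) \<in> V" using V uv unfolding linear_subspace_def by blast
 then have "f (\<lambda>T z. u T z + k * v T z) = f u + f (\<lambda>T z. k * v T z)"
  using f uv(1) unfolding linear_form_def by (metis (no_types))
 also have "f (\<lambda>T z. k * v T z) = k * f v" using f uv(2) unfolding linear_form_def by blast
 finally show ?thesis .
qed

lemma linear_subspace_comb:
 assumes V: "linear_subspace V" and uv: "u \<in> V" "v \<in> V"
 shows "(\<lambda>T z. u T z + k * v T z) \<in> V"
proof -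
 have kv: "(\<lambda>T z. k * v T z) \<in> V" using V uv unfolding linear_subspace_def by blast
 have "\<forall>u\<in>V. \<forall>w\<in>V. (\<lambda>T z. u T z + w T z) \<in> V" using V unfolding linear_subspace_def by (elim conjE)
 from this[rule_format, OF uv(1) kv] show ?thesis .
qed

definition combinations :: "'i set \<Rightarrow> ('i \<Rightarrow> broken) \<Rightarrow> broken set" where
 "combinations I e = {v. \<exists>a. v = (\<lambda>T z. \<Sum>i\<in>I. a i * e i T z)}"

lemma combinationsI: "v = (\<lambda>T z. \<Sum>i\<in>I. a i * e i T z) \<Longrightarrow> v \<in> combinations I e"
 unfolding combinations_def mem_Collect_eq by (rule exI)

lemma combinationsE:
 assumes "v \<in> combinations I e" obtains a where "v = (\<lambda>T z. \<Sum>i\<in>I. a i * e i T z)"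
 using assms unfolding combinations_def mem_Collect_eq by (elim exE)

lemma combinations_comb:
 assumes "u \<in> combinations I e" "v \<in> combinations I e"
 shows "(\<lambda>T z. u T z + k * v T z) \<in> combinations I e"
proof -
 obtain a where a: "u = (\<lambda>T z. \<Sum>i\<in>I. a i * e i T z)" by (rule combinationsE[OF assms(1)])
 obtain a' where a': "v = (\<lambda>T z. \<Sum>i\<in>I. a' i * e i T z)" by (rule combinationsE[OF assms(2)])
 have "(\<lambda>T z. u T z + k * v T z) = (\<lambda>T z. \<Sum>i\<in>I. (a i + k * a' i) * e i T z)"
  unfolding a a' by (simp add: sum_distrib_left sum.distrib[symmetric] algebra_simps)
 then show ?thesis by (rule combinationsI)
qed

text \<open>Induction on the number of generators: if the space grows by one dimension, the new basis
 vector is made orthogonal to the old space in the first argument of the form.\<close>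

lemma coercive_solvable:
 assumes "finite I"
 shows "\<And>V L. linear_subspace V \<Longrightarrow> V \<subseteq> combinations I e \<Longrightarrow> bilinear_form V B \<Longrightarrow> linear_form V L \<Longrightarrow>
  (\<And>v. v \<in> V \<Longrightarrow> v \<noteq> (\<lambda>_ _. 0) \<Longrightarrow> B v v > 0) \<Longrightarrow> \<exists>u\<in>V. \<forall>v\<in>V. B u v = L v" using assms
proof (induction I rule: finite_induct)
 case empty
 have V0: "V = {\<lambda>_ _. 0}" using empty(1,2) unfolding combinations_def linear_subspace_def by auto
 have "L (\<lambda>_ _. 0) = 0" using linear_form_diff[OF empty(1,4), of "\<lambda>_ _. 0" "\<lambda>_ _. 0" 1] V0 by simp
 moreover have "linear_form V (B (\<lambda>_ _. 0))" using empty(3) V0 unfolding bilinear_form_def by auto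
 then have "B (\<lambda>_ _. 0) (\<lambda>_ _. 0) = 0"
  using linear_form_diff[OF empty(1), of "B (\<lambda>_ _. 0)" "\<lambda>_ _. 0" "\<lambda>_ _. 0" 1] V0 by simp
 ultimately show ?case unfolding V0 by simp
next
 case (insert i I)
 note V = insert.prems(1) and sub = insert.prems(2) and B = insert.prems(3) and L = insert.prems(4) and pos = insert.prems(5)
 have Bl: "linear_form V (B u)" if "u \<in> V" for u using B that unfolding bilinear_form_def by blast
 have Br: "linear_form V (\<lambda>u. B u v)" if "v \<in> V" for v using B that unfolding bilinear_form_def by blast
 define V0 where "V0 = V \<inter> combinations I e"
 have z: "(\<lambda>_ _. 0) \<in> combinations I e" unfolding combinations_def by (auto intro!: exI[of _ "\<lambda>_. 0"])
 have zV: "(\<lambda>_ _. 0) \<in> V" using V unfolding linear_subspace_def by blast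
 have V0: "linear_subspace V0" unfolding linear_subspace_def
 proof (intro conjI ballI allI)
  show "(\<lambda>T z. 0) \<in> V0" using z zV unfolding V0_def by blast
  fix u v assume uv: "u \<in> V0" "v \<in> V0"
  then show "(\<lambda>T z. u T z + v T z) \<in> V0"
   using linear_subspace_comb[OF V, of u v 1] combinations_comb[of u I e v 1] unfolding V0_def by auto
 next
  fix k v assume v: "v \<in> V0"
  then show "(\<lambda>T z. k * v T z) \<in> V0"
   using linear_subspace_comb[OF V zV, of v k] combinations_comb[OF z, of v k] unfolding V0_def by auto
 qed
 have restr: "linear_form V f \<Longrightarrow> linear_form V0 f" for f unfolding linear_form_def V0_def by auto
 have B0: "bilinear_form V0 B" using Bl Br restr unfolding bilinear_form_def V0_def by auto
 have IH: "\<exists>u\<in>V0. \<forall>v\<in>V0. B u v = f v" if "linear_form V f" for f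
  by (rule insert.IH[OF V0 _ B0 restr[OF that]]) (use pos in \<open>auto simp: V0_def\<close>)
 obtain u0 where u0: "u0 \<in> V0" "\<And>v. v \<in> V0 \<Longrightarrow> B u0 v = L v" using IH[OF L] by blast
 show ?case
 proof (cases "V \<subseteq> combinations I e")
  case True
  then have "V0 = V" unfolding V0_def by blast
  then show ?thesis using u0 by blast
 next
  case False
  then obtain w where w: "w \<in> V" "w \<notin> combinations I e" by blast
  obtain a where a: "w = (\<lambda>T z. \<Sum>j\<in>insert i I. a j * e j T z)" by (rule combinationsE[OF subsetD[OF sub w(1)]])
  have ai: "a i \<noteq> 0"
  proof
   assume "a i = 0"
   then have "w = (\<lambda>T z. \<Sum>j\<in>I. a j * e j T z)" unfolding a using insert.hyps by simp
   then have "w \<in> combinations I e" by (rule combinationsI)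
   then show False using w(2) by blast
  qed
  have decomp: "\<exists>t. (\<lambda>T z. v T z + t * w T z) \<in> V0" if v: "v \<in> V" for v
  proof -
   obtain d where d: "v = (\<lambda>T z. \<Sum>j\<in>insert i I. d j * e j T z)" by (rule combinationsE[OF subsetD[OF sub v]])
   \<comment> \<open>Chosen so that the coefficient of the new generator \<open>e i\<close>
     cancels.\<close>
   define t where "t = - (d i / a i)"
   have di: "d i + t * a i = 0" unfolding t_def using ai by simp
   have "(\<lambda>T z. v T z + t * w T z) = (\<lambda>T z. \<Sum>j\<in>I. (d j + t * a j) * e j T z)"
   proof (intro ext)
    fix T z
    have "v T z + t * w T z = (\<Sum>j\<in>insert i I. (d j + t * a j) * e j T z)"
     unfolding d a by (simp only: sum_distrib_left sum.distrib[symmetric]) (auto simp: algebra_simps intro!: sum.cong)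
    also have "\<dots> = (\<Sum>j\<in>I. (d j + t * a j) * e j T z)" using insert.hyps di by simp
    finally show "v T z + t * w T z = (\<Sum>j\<in>I. (d j + t * a j) * e j T z)" .
   qed
   then have "(\<lambda>T z. v T z + t * w T z) \<in> combinations I e" by (rule combinationsI)
   then have "(\<lambda>T z. v T z + t * w T z) \<in> V0" unfolding V0_def by (rule IntI[OF linear_subspace_comb[OF V v w(1)]])
   then show ?thesis by (rule exI)
  qed
  obtain w0 where w0: "w0 \<in> V0" "\<And>v. v \<in> V0 \<Longrightarrow> B w0 v = B w v" using IH[OF Bl[OF w(1)]] by blast
  define x where "x = (\<lambda>T z. w T z + (- 1) * w0 T z)"
  have w0V: "w0 \<in> V" "u0 \<in> V" using w0 u0 unfolding V0_def by auto
  have xV: "x \<in> V" unfolding x_def by (rule linear_subspace_comb[OF V w(1) w0V(1)])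
  have x0: "B x v = 0" if v: "v \<in> V0" for v
  proof -
   have vV: "v \<in> V" using v unfolding V0_def by blast
   show ?thesis unfolding x_def using linear_form_diff[OF V Br[OF vV] w(1) w0V(1), of "- 1"] w0(2)[OF v] by simp
  qed
  have "x \<noteq> (\<lambda>_ _. 0)"
  proof
   assume "x = (\<lambda>_ _. 0)"
   then have "x T z = 0" for T z by simp
   then have "w T z = w0 T z" for T z unfolding x_def by (simp add: eq_neg_iff_add_eq_0)
   then have "w = w0" by (intro ext)
   then show False using w w0(1) unfolding V0_def by blast
  qed
  then have Bx: "B x x > 0" using pos xV by blast
  \<comment> \<open>Adding a multiple of x to u0 does not disturb the equations on V0, because
    \<open>B x v = 0\<close> there. This multiple satisfies the one remaining equation, the one
    tested with x.\<close>
  define t where "t = (L x - B u0 x) / B x x"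
  define u where "u = (\<lambda>T z. u0 T z + t * x T z)"
  have uV: "u \<in> V" unfolding u_def by (rule linear_subspace_comb[OF V w0V(2) xV])
  have u1: "B u v = B u0 v + t * B x v" if "v \<in> V" for v
   unfolding u_def by (rule linear_form_diff[OF V Br[OF that] w0V(2) xV])
  have ux: "B u x = L x" using u1[OF xV] Bx unfolding t_def by simp
  have u00: "B u v = L v" if v: "v \<in> V0" for v using u1[of v] u0(2)[OF v] x0[OF v] v unfolding V0_def by auto
  have "B u v = L v" if v: "v \<in> V" for v
  proof -
   obtain s where s: "(\<lambda>T z. v T z + s * w T z) \<in> V0" by (rule exE[OF decomp[OF v]])
   define y where "y = (\<lambda>T z. v T z + s * x T z)"
   have "y = (\<lambda>T z. (v T z + s * w T z) + (- s) * w0 T z)" unfolding y_def x_def by (auto simp: algebra_simps)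
   then have yV0: "y \<in> V0" using linear_subspace_comb[OF V0 s w0(1), of "- s"] by simp
   have "B u y = B u v + s * B u x" unfolding y_def by (rule linear_form_diff[OF V Bl[OF uV] v xV])
   moreover have "L y = L v + s * L x" unfolding y_def by (rule linear_form_diff[OF V L v xV])
   ultimately show ?thesis using u00[OF yV0] ux by simp
  qed
  then show ?thesis using uV by blast
 qed
qed

lemma coercive_unique:
 assumes V: "linear_subspace V" and B: "bilinear_form V B"
  and pos: "\<And>v. v \<in> V \<Longrightarrow> v \<noteq> (\<lambda>_ _. 0) \<Longrightarrow> B v v > 0"
  and u: "u \<in> V" "\<And>v. v \<in> V \<Longrightarrow> B u v = L v" and u': "u' \<in> V" "\<And>v. v \<in> V \<Longrightarrow> B u' v = L v"
 shows "u = u'"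
proof -
 define x where "x = (\<lambda>T z. u T z + (- 1) * u' T z)"
 have xV: "x \<in> V" unfolding x_def by (rule linear_subspace_comb[OF V u(1) u'(1)])
 have "linear_form V (\<lambda>u. B u x)" using B xV unfolding bilinear_form_def by blast
 from linear_form_diff[OF V this u(1) u'(1), of "- 1"] have "B x x = 0"
  unfolding x_def[symmetric] using u(2)[OF xV] u'(2)[OF xV] by simp
 then have "x = (\<lambda>_ _. 0)" using pos[OF xV] by force
 then have "x T z = 0" for T z by simp
 then have "u T z = u' T z" for T z unfolding x_def by (simp add: eq_neg_iff_add_eq_0)
 then show ?thesis by (intro ext)
qed

lemma broken_poly_space_combinations:
 assumes "finite \<T>"
 shows "broken_poly_space p \<T> \<subseteq> combinations (\<T> \<times> {..p} \<times> {..p}) (\<lambda>(S, i, j) T z. if T = S then fst z ^ i * snd z ^ j else 0)"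
proof
 fix v assume v: "v \<in> broken_poly_space p \<T>"
 then have "\<forall>T\<in>\<T>. \<exists>a. v T = (\<lambda>(x, y). \<Sum>i\<le>p. \<Sum>j\<le>p - i. a i j * x ^ i * y ^ j)"
  unfolding broken_poly_space_def poly_space_def by blast
 from bchoice[OF this] obtain a where a': "\<forall>T\<in>\<T>. v T = (\<lambda>(x, y). \<Sum>i\<le>p. \<Sum>j\<le>p - i. a T i j * x ^ i * y ^ j)" by (rule exE)
 note a = bspec[OF a']
 \<comment> \<open>The generators range over the full square of exponents, so the coefficients above
   total degree p are set to zero.\<close>
 define d where "d = (\<lambda>(S, i, j). if j \<le> p - i then a S i j else 0)"
 have "v T z = (\<Sum>k\<in>\<T> \<times> {..p} \<times> {..p}. d k * (case k of (S, i, j) \<Rightarrow> \<lambda>T z. if T = S then fst z ^ i * snd z ^ j else 0) T z)" for T z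
 proof -
  have "(\<Sum>k\<in>\<T> \<times> {..p} \<times> {..p}. d k * (case k of (S, i, j) \<Rightarrow> \<lambda>T z. if T = S then fst z ^ i * snd z ^ j else 0) T z) =
   (\<Sum>S\<in>\<T>. \<Sum>i\<le>p. \<Sum>j\<le>p. d (S, i, j) * (if T = S then fst z ^ i * snd z ^ j else 0))"
   unfolding sum.cartesian_product by (intro sum.cong refl) (simp split: prod.split)
  also have "\<dots> = (\<Sum>S\<in>\<T>. if S = T then \<Sum>i\<le>p. \<Sum>j\<le>p. d (T, i, j) * (fst z ^ i * snd z ^ j) else 0)"
   by (intro sum.cong) auto
  also have "\<dots> = (if T \<in> \<T> then \<Sum>i\<le>p. \<Sum>j\<le>p. d (T, i, j) * (fst z ^ i * snd z ^ j) else 0)"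
   using assms by (simp add: sum.delta)
  also have "\<dots> = v T z"
  proof (cases "T \<in> \<T>")
   case True
   have "(\<Sum>j\<le>p. d (T, i, j) * (fst z ^ i * snd z ^ j)) = (\<Sum>j\<le>p - i. a T i j * fst z ^ i * snd z ^ j)" for i
   proof -
    have "(\<Sum>j\<le>p - i. a T i j * fst z ^ i * snd z ^ j) = (\<Sum>j\<le>p - i. d (T, i, j) * (fst z ^ i * snd z ^ j))"
     by (rule sum.cong) (auto simp: d_def mult.assoc)
    also have "\<dots> = (\<Sum>j\<le>p. d (T, i, j) * (fst z ^ i * snd z ^ j))" by (rule sum.mono_neutral_left) (auto simp: d_def)
    finally show ?thesis ..
   qed
   then show ?thesis using a[OF True] True by (simp add: case_prod_beta)
  next
   case False
   then have "v T = (\<lambda>_. 0)" using v unfolding broken_poly_space_def by blast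
   then show ?thesis using False by simp
  qed
  finally show ?thesis ..
 qed
 then have "v = (\<lambda>T z. \<Sum>k\<in>\<T> \<times> {..p} \<times> {..p}. d k * (case k of (S, i, j) \<Rightarrow> \<lambda>T z. if T = S then fst z ^ i * snd z ^ j else 0) T z)"
  by (intro ext)
 then show "v \<in> combinations (\<T> \<times> {..p} \<times> {..p}) (\<lambda>(S, i, j) T z. if T = S then fst z ^ i * snd z ^ j else 0)"
  by (rule combinationsI)
qed

section \<open>The forms as sums over the pieces of the elements\<close>

lemma trace_bounded_sum:
 assumes "\<And>i. i \<in> I \<Longrightarrow> trace_bounded g S (f i)"
 shows "trace_bounded g S (\<lambda>z. \<Sum>i\<in>I. f i z)" using assms
 by (induction I rule: infinite_finite_induct) (auto intro: trace_bounded_add trace_bounded_const[of g S 0])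

lemma trace_bounded_inner:
 fixes m n :: "pt \<Rightarrow> pt"
 assumes "trace_bounded g S (\<lambda>z. fst (m z))" "trace_bounded g S (\<lambda>z. snd (m z))" "\<And>e. trace_bounded g S (\<lambda>z. e \<bullet> n z)"
 shows "trace_bounded g S (\<lambda>z. m z \<bullet> n z)"
proof -
 have "(\<lambda>z. m z \<bullet> n z) = (\<lambda>z. fst (m z) * ((1, 0) \<bullet> n z) + snd (m z) * ((0, 1) \<bullet> n z))" by (simp add: inner_prod_def)
 then show ?thesis using assms by (auto intro!: trace_bounded_add trace_bounded_mult)
qed

lemma trace_bounded_normal_components:
 assumes "\<And>e. trace_bounded g S (\<lambda>z. e \<bullet> n z)"
 shows "trace_bounded g S (\<lambda>z. fst (n z :: pt))" "trace_bounded g S (\<lambda>z. snd (n z))"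
 using assms[of "(1, 0)"] assms[of "(0, 1)"] by (simp_all add: inner_prod_def)

lemma trace_bounded_mult_integrable:
 assumes S: "S \<in> sets borel" and \<phi>: "trace_bounded \<gamma> S \<phi>"
  and g: "set_integrable lebesgue S (\<lambda>s. g (\<gamma> s) * norm (velocity \<gamma> s))"
 shows "set_integrable lebesgue S (\<lambda>s. (g (\<gamma> s) * \<phi> (\<gamma> s)) * norm (velocity \<gamma> s))"
proof -
 obtain p A where p: "p \<in> borel_measurable lebesgue" "\<And>s. \<bar>p s\<bar> \<le> A"
  "AE_curve (\<gamma>) S (\<lambda>s. \<phi> (\<gamma> s) = p s)" using \<phi> unfolding trace_bounded_def by blast
 have Sl: "S \<in> sets lebesgue" using S by (rule sets_completionI_sets[of _ lborel, simplified])
 have "set_borel_measurable lebesgue S p" using p(1) Sl unfolding set_borel_measurable_def by simp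
 from set_integrable_mult_bounded[OF g this p(2)]
 have i: "integrable lebesgue (\<lambda>s. indicator S s *\<^sub>R (p s * (g (\<gamma> s) * norm (velocity \<gamma> s))))"
  unfolding set_integrable_def .
 have AE: "AE s in lebesgue. indicator S s *\<^sub>R (p s * (g (\<gamma> s) * norm (velocity \<gamma> s))) =
   indicator S s *\<^sub>R ((g (\<gamma> s) * \<phi> (\<gamma> s)) * norm (velocity \<gamma> s))"
  using p(3) by eventually_elim (auto simp: indicator_def)
 have m: "(\<lambda>s. indicator S s *\<^sub>R ((g (\<gamma> s) * \<phi> (\<gamma> s)) * norm (velocity \<gamma> s))) \<in> borel_measurable lebesgue"
  by (rule borel_measurable_AE[OF borel_measurable_integrable[OF i] AE])
 show ?thesis unfolding set_integrable_def
  using i integrable_cong_AE[OF borel_measurable_integrable[OF i] m AE] by simp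
qed

text \<open>By |f| \<le> 1 + f^2, square integrability with respect to the finite weight w implies
  integrability. Measurability is assumed of the product with w only, as in
  \<open>L2_on_curve\<close>.\<close>

lemma set_integrable_square_bound:
 fixes f w :: "'a \<Rightarrow> real"
 assumes S: "S \<in> sets M" "S \<subseteq> A" and w: "set_integrable M S w" "\<And>x. 0 \<le> w x"
  and f: "set_borel_measurable M A (\<lambda>x. f x * w x)" "set_integrable M A (\<lambda>x. (f x)\<^sup>2 * w x)"
 shows "set_integrable M S (\<lambda>x. f x * w x)"
proof -
 have f2: "set_integrable M S (\<lambda>x. (f x)\<^sup>2 * w x)" by (rule set_integrable_subset[OF f(2) S])
 have m: "set_borel_measurable M S (\<lambda>x. f x * w x)" by (rule set_borel_measurable_subset[OF f(1) S])
 have bound: "\<bar>f x * w x\<bar> \<le> w x + (f x)\<^sup>2 * w x" for x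
 proof -
  have "2 * \<bar>f x\<bar> \<le> 1 + (f x)\<^sup>2" using sum_squares_bound[of "\<bar>f x\<bar>" 1] by simp
  then have "\<bar>f x\<bar> \<le> 1 + (f x)\<^sup>2" by linarith
  then have "\<bar>f x\<bar> * w x \<le> (1 + (f x)\<^sup>2) * w x" by (rule mult_right_mono) (rule w(2))
  then show ?thesis using w(2)[of x] by (simp add: abs_mult algebra_simps)
 qed
 show ?thesis unfolding set_integrable_def
 proof (rule Bochner_Integration.integrable_bound)
  show "integrable M (\<lambda>x. indicator S x *\<^sub>R (w x + (f x)\<^sup>2 * w x))"
   using set_integral_add(1)[OF w(1) f2] unfolding set_integrable_def .
  show "(\<lambda>x. indicator S x *\<^sub>R (f x * w x)) \<in> borel_measurable M" using m unfolding set_borel_measurable_def .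
  show "AE x in M. norm (indicator S x *\<^sub>R (f x * w x)) \<le> norm (indicator S x *\<^sub>R (w x + (f x)\<^sup>2 * w x))"
  proof (rule AE_I2)
   fix x
   have "\<bar>f x * w x\<bar> \<le> \<bar>w x + (f x)\<^sup>2 * w x\<bar>" using bound[of x] by linarith
   then show "norm (indicator S x *\<^sub>R (f x * w x)) \<le> norm (indicator S x *\<^sub>R (w x + (f x)\<^sup>2 * w x))"
    by (simp add: indicator_def)
  qed
 qed
qed

locale tricomi_scheme = tricomi_multiplier +
 fixes p :: nat and V :: "broken set"
 assumes V_sub: "V \<subseteq> broken_poly_space p \<T>" and V_lin: "linear_subspace V"
begin

abbreviation "weak_form T u v \<equiv> (LINT z:T|lebesgue. Wgrad D (u T) z \<bullet> grad (Mop b c (v T)) z)"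
abbreviation "consistency F u v \<equiv> segment_integral F (\<lambda>z. avg \<T> F (\<lambda>T. Wgrad D (u T)) z \<bullet> jump \<T> F (\<lambda>T. Mop b c (v T)) z)"
abbreviation "jump_form F u v \<equiv> segment_integral F (\<lambda>z. jump \<T> F u z \<bullet> jump \<T> F v z)"
abbreviation "gradient_jump_form F u v \<equiv> segment_integral F (\<lambda>z. jump \<T> F (\<lambda>T. dx (u T)) z \<bullet> jump \<T> F (\<lambda>T. dx (v T)) z + jump \<T> F (\<lambda>T. dy (u T)) z \<bullet> jump \<T> F (\<lambda>T. dy (v T)) z)"
abbreviation "boundary_form T j u v \<equiv> PI T (Inr j) (\<lambda>z. (Wgrad D (u T) z \<bullet> outer_normal \<Omega> z) * Mop b c (v T) z)"
abbreviation "boundary_jump_form T j u v \<equiv> PI T (Inr j) (\<lambda>z. (u T z *\<^sub>R outer_normal \<Omega> z) \<bullet> (v T z *\<^sub>R outer_normal \<Omega> z))"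
abbreviation "tangential_form T j u v \<equiv> PI T (Inr j) (\<lambda>z. dtan D (u T) z * dtan D (v T) z)"

lemma V_poly: assumes "u \<in> V" shows "u T \<in> poly_space p"
proof (cases "T \<in> \<T>")
 case True
 then show ?thesis using assms V_sub unfolding broken_poly_space_def by blast
next
 case False
 then have "u T = (\<lambda>_. 0)" using assms V_sub unfolding broken_poly_space_def by blast
 then show ?thesis using poly_space_zero by simp
qed

lemma linear_value: "linear_form V (\<lambda>u. u T z)"
 unfolding linear_form_def by simp

lemma linear_dx: "linear_form V (\<lambda>u. dx (u T) z)"
 unfolding linear_form_def
 by (intro conjI ballI allI poly_space_partials_add(1)[OF V_poly V_poly] poly_space_partials_cmult(1)[OF V_poly])

lemma linear_dy: "linear_form V (\<lambda>u. dy (u T) z)"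
 unfolding linear_form_def
 by (intro conjI ballI allI poly_space_partials_add(2)[OF V_poly V_poly] poly_space_partials_cmult(2)[OF V_poly])

text \<open>Differentiation formulas hold for polynomials only, so linearity is carried over from
  expressions that agree with the given one on V.\<close>

lemma linear_form_V_cong:
 assumes g: "linear_form V g" and eq: "\<And>u. u \<in> V \<Longrightarrow> f u = g u"
 shows "linear_form V f"
proof -
 have add: "(\<lambda>T z. u T z + v T z) \<in> V" if "u \<in> V" "v \<in> V" for u v
  using linear_subspace_comb[OF V_lin that, of 1] by simp
 have mult: "(\<lambda>T z. k * v T z) \<in> V" if "v \<in> V" for k v
 proof -
  have "\<forall>k. \<forall>v\<in>V. (\<lambda>T z. k * v T z) \<in> V" using V_lin unfolding linear_subspace_def by (elim conjE)
  from this[rule_format, OF that] show ?thesis .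
 qed
 show ?thesis using g unfolding linear_form_def by (auto simp: eq add mult)
qed

lemma linear_Mop: "linear_form V (\<lambda>u. Mop b c (u T) z)"
 unfolding Mop_def by (intro linear_form_add linear_form_cmult linear_dx linear_dy)

lemma linear_Wgrad: "linear_form V (\<lambda>u. Wgrad D (u T) z \<bullet> e)"
 unfolding Wgrad_def inner_prod_def
 by (simp, intro linear_form_add linear_form_cmult_right linear_form_cmult linear_dx linear_dy)

lemma linear_dtan: "linear_form V (\<lambda>u. dtan D (u T) z)"
 unfolding dtan_def grad_def inner_prod_def
 by (simp, intro linear_form_add linear_form_diff linear_form_uminus linear_form_cmult_right linear_form_cmult linear_dx linear_dy)

lemma linear_second_derivatives:
 "linear_form V (\<lambda>u. dx (dx (u T)) z)" "linear_form V (\<lambda>u. dx (dy (u T)) z)"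
 "linear_form V (\<lambda>u. dy (dx (u T)) z)" "linear_form V (\<lambda>u. dy (dy (u T)) z)"
proof -
 have a: "dx (\<lambda>z. u T z + v T z) = (\<lambda>z. dx (u T) z + dx (v T) z)" "dy (\<lambda>z. u T z + v T z) = (\<lambda>z. dy (u T) z + dy (v T) z)"
  if "u \<in> V" "v \<in> V" for u v using poly_space_partials_add[OF V_poly[OF that(1)] V_poly[OF that(2)]] by blast+
 have m: "dx (\<lambda>z. k * u T z) = (\<lambda>z. k * dx (u T) z)" "dy (\<lambda>z. k * u T z) = (\<lambda>z. k * dy (u T) z)"
  if "u \<in> V" for u k using poly_space_partials_cmult[OF V_poly[OF that]] by blast+
 have d: "dx (u T) \<in> poly_space p" "dy (u T) \<in> poly_space p" if "u \<in> V" for u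
  using poly_space_derivatives(2,3)[OF V_poly[OF that]] by blast+
 show "linear_form V (\<lambda>u. dx (dx (u T)) z)" "linear_form V (\<lambda>u. dx (dy (u T)) z)"
  "linear_form V (\<lambda>u. dy (dx (u T)) z)" "linear_form V (\<lambda>u. dy (dy (u T)) z)" unfolding linear_form_def
  by (intro conjI ballI allI; simp only: a m, rule poly_space_partials_add[OF d(1) d(1)] poly_space_partials_add[OF d(2) d(2)]
    poly_space_partials_cmult[OF d(1)] poly_space_partials_cmult[OF d(2)]; assumption)+
qed

lemma bilinear_weak:
 assumes T: "T \<in> \<T>" and z: "z \<in> T"
 shows "bilinear_form V (\<lambda>u v. Wgrad D (u T) z \<bullet> grad (Mop b c (v T)) z)"
proof -
 have z\<Omega>: "z \<in> \<Omega>" using element_subset[OF T] z by blast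
 have "linear_form V (\<lambda>v. Wgrad D (u T) z \<bullet> grad (Mop b c (v T)) z)" if u: "u \<in> V" for u
 proof (rule linear_form_V_cong)
  show "linear_form V (\<lambda>v. K (snd z) * dx (u T) z * (deriv b (fst z) * dx (v T) z + b (fst z) * dx (dx (v T)) z + c (snd z) * dx (dy (v T)) z) +
   dy (u T) z * (b (fst z) * dy (dx (v T)) z + deriv c (snd z) * dy (v T) z + c (snd z) * dy (dy (v T)) z))"
   by (intro linear_form_add linear_form_cmult linear_dx linear_dy linear_second_derivatives)
  fix v assume "v \<in> V"
  from grad_Mop[OF V_poly[OF this] z\<Omega>]
  show "Wgrad D (u T) z \<bullet> grad (Mop b c (v T)) z = K (snd z) * dx (u T) z * (deriv b (fst z) * dx (v T) z + b (fst z) * dx (dx (v T)) z + c (snd z) * dx (dy (v T)) z) +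
   dy (u T) z * (b (fst z) * dy (dx (v T)) z + deriv c (snd z) * dy (v T) z + c (snd z) * dy (dy (v T)) z)"
   unfolding Wgrad_def by simp
 qed
 then show ?thesis unfolding bilinear_form_def using linear_Wgrad by blast
qed

lemma bilinear_form_PI:
 assumes T: "T \<in> \<T>" and i: "i \<in> pieces T"
  and tb: "\<And>u v. u \<in> V \<Longrightarrow> v \<in> V \<Longrightarrow> TB T i (\<Phi> u v)" and bil: "\<And>z. bilinear_form V (\<lambda>u v. \<Phi> u v z)"
 shows "bilinear_form V (\<lambda>u v. PI T i (\<Phi> u v))" unfolding curve_integral_piece
proof (rule bilinear_form_set_integral)
 show "set_integrable lebesgue (piece_set T i) (\<lambda>s. \<Phi> u v (piece_path i s) * norm (velocity (piece_path i) s))"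
  if "u \<in> V" "v \<in> V" for u v by (rule piece_trace_integrable[OF T i tb[OF that]])
 show "bilinear_form V (\<lambda>u v. \<Phi> u v (piece_path i s) * norm (velocity (piece_path i) s))" for s
  using bilinear_form_cmult[OF bil[of "piece_path i s"], of "norm (velocity (piece_path i) s)"]
  by (simp add: mult.commute)
qed

lemma poly_traces:
 assumes T: "T \<in> \<T>" and i: "i \<in> pieces T" and u: "u \<in> poly_space p"
 shows "TB T i u" "TB T i (dx u)" "TB T i (dy u)" "TB T i (\<lambda>z. fst (Wgrad D u z))" "TB T i (\<lambda>z. snd (Wgrad D u z))" "TB T i (Mop b c u)"
proof -
 have cont: "continuous_on (closure \<Omega>) u" "continuous_on (closure \<Omega>) (dx u)" "continuous_on (closure \<Omega>) (dy u)"
  using poly_space_continuous poly_space_derivatives(2,3)[OF u] u by blast+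
 show "TB T i u" "TB T i (dx u)" "TB T i (dy u)" by (intro piece_trace_continuous[OF T i] cont)+
 show "TB T i (\<lambda>z. fst (Wgrad D u z))" "TB T i (\<lambda>z. snd (Wgrad D u z))" "TB T i (Mop b c u)"
  unfolding Wgrad_def Mop_def[abs_def] fst_conv snd_conv
  by (intro piece_trace_continuous[OF T i] continuous_intros continuous_coefficients cont)+
qed

text \<open>The parameters of an interior facet fill [0, 1] from whichever neighbour it is
  seen.\<close>

lemma facet_trace:
 assumes "F \<in> \<F>" "S \<in> sides F" "S' \<in> sides F"
 shows "TB S (Inl F) \<phi> = TB S' (Inl F) \<phi>"
 using piece_set_facet[of S F] piece_set_facet[of S' F] facet_elemsD assms by simp

lemma facet_traces:
 assumes F: "F \<in> \<F>" and S: "S \<in> sides F" and T: "T \<in> sides F" and u: "u \<in> poly_space p"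
 shows "TB S (Inl F) (\<lambda>z. e \<bullet> outer_normal T z)" "TB S (Inl F) u" "TB S (Inl F) (dx u)" "TB S (Inl F) (dy u)"
  "TB S (Inl F) (\<lambda>z. fst (Wgrad D u z))" "TB S (Inl F) (\<lambda>z. snd (Wgrad D u z))" "TB S (Inl F) (Mop b c u)"
proof -
 have T': "T \<in> \<T>" "Inl F \<in> pieces T" using facet_elemsD[OF T] Inl_piece by auto
 show "TB S (Inl F) (\<lambda>z. e \<bullet> outer_normal T z)" "TB S (Inl F) u" "TB S (Inl F) (dx u)" "TB S (Inl F) (dy u)"
  "TB S (Inl F) (\<lambda>z. fst (Wgrad D u z))" "TB S (Inl F) (\<lambda>z. snd (Wgrad D u z))" "TB S (Inl F) (Mop b c u)"
  unfolding facet_trace[OF F S T] by (rule piece_trace_normal[OF T'] poly_traces[OF T' u])+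
qed

lemma jump_trace:
 assumes F: "F \<in> \<F>" and S: "S \<in> sides F"
  and \<phi>: "\<And>T. T \<in> sides F \<Longrightarrow> TB S (Inl F) (\<phi> T)"
 shows "TB S (Inl F) (\<lambda>z. e \<bullet> jump \<T> F \<phi> z)" unfolding jump_def inner_sum_right inner_scaleR_right
proof (rule trace_bounded_sum)
 fix T assume T: "T \<in> sides F"
 show "TB S (Inl F) (\<lambda>z. \<phi> T z * (e \<bullet> outer_normal T z))"
  by (rule trace_bounded_mult[OF \<phi>[OF T] facet_traces(1)[OF F S T poly_space_zero]])
qed

lemma jump_inner_trace:
 assumes F: "F \<in> \<F>" and S: "S \<in> sides F"
  and \<phi>: "\<And>T. T \<in> sides F \<Longrightarrow> TB S (Inl F) (\<phi> T)" and \<psi>: "\<And>T. T \<in> sides F \<Longrightarrow> TB S (Inl F) (\<psi> T)"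
 shows "TB S (Inl F) (\<lambda>z. jump \<T> F \<phi> z \<bullet> jump \<T> F \<psi> z)"
 by (rule trace_bounded_inner[OF trace_bounded_normal_components[OF jump_trace[OF F S \<phi>]] jump_trace[OF F S \<psi>]])

lemma bilinear_jump:
 assumes "\<And>T. linear_form V (\<lambda>u. \<phi> u T z)"
 shows "bilinear_form V (\<lambda>u v. jump \<T> F (\<phi> u) z \<bullet> jump \<T> F (\<phi> v) z)"
proof -
 have "(\<lambda>u v. jump \<T> F (\<phi> u) z \<bullet> jump \<T> F (\<phi> v) z) =
  (\<lambda>u v. \<Sum>S\<in>sides F. \<Sum>T\<in>sides F. (outer_normal S z \<bullet> outer_normal T z) * (\<phi> u S z * \<phi> v T z))"
  unfolding jump_def inner_sum_right inner_sum_left by (intro ext, subst sum.swap) (simp add: ac_simps)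
 then show ?thesis by (auto intro!: bilinear_form_sum bilinear_form_cmult bilinear_form_mult assms)
qed

lemma bilinear_segment_integral:
 assumes F: "F \<in> \<F>"
  and tb: "\<And>S u v. S \<in> sides F \<Longrightarrow> u \<in> V \<Longrightarrow> v \<in> V \<Longrightarrow> TB S (Inl F) (\<Phi> u v)"
  and bil: "\<And>z. bilinear_form V (\<lambda>u v. \<Phi> u v z)"
 shows "bilinear_form V (\<lambda>u v. segment_integral F (\<Phi> u v))"
proof -
 obtain T T' where T: "T \<in> \<T>" "sides F = {T, T'}" "F \<in> elem_facets T" by (rule interior_facet_neighbours[OF F])
 show ?thesis unfolding segment_integral_piece[of F _ T]
  by (rule bilinear_form_PI[OF T(1) Inl_piece[OF T(3)] tb bil]) (use T(2) in auto)
qed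

lemma A_h_eq:
 "A_h D b c \<T> u v = - (\<Sum>T\<in>\<T>. weak_form T u v)
   + (\<Sum>F\<in>\<F>. consistency F u v)
   + (\<Sum>T\<in>\<T>. \<Sum>j\<in>UNIV. boundary_form T j u v)"
proof -
 have e: "dirichlet_facets D \<T> \<union> boundary_facets D \<T> CharRight = (\<Union>j\<in>UNIV. boundary_facets D \<T> j)"
  unfolding dirichlet_facets_def UNIV_boundary_part by auto
 show ?thesis unfolding A_h_def e
  using sum_boundary_facets[of "\<lambda>_. 1" "\<lambda>T z. (Wgrad D (u T) z \<bullet> outer_normal \<Omega> z) * Mop b c (v T) z" UNIV] by (simp del: piece_simps)
qed

lemma dirichlet_facets_eq: "dirichlet_facets D \<T> = (\<Union>j\<in>{Upper, CharLeft}. boundary_facets D \<T> j)"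
 unfolding dirichlet_facets_def by auto

lemma A_J_eq:
 "A_J D \<T> p \<gamma>1 \<gamma>2 \<gamma>3 u v =
   (\<Sum>F\<in>\<F>. \<gamma>1 / diameter F ^ 3 * jump_form F u v)
   + (\<Sum>T\<in>\<T>. \<Sum>j\<in>{Upper, CharLeft}. \<gamma>1 / diameter (boundary_piece T j) ^ 3 *
     boundary_jump_form T j u v)
   + (\<Sum>F\<in>\<F>. \<gamma>2 * (real p)\<^sup>2 / diameter F * gradient_jump_form F u v)
   + (\<Sum>T\<in>\<T>. \<Sum>j\<in>{Upper, CharLeft}. \<gamma>3 * (real p)\<^sup>2 / diameter (boundary_piece T j) * tangential_form T j u v)"
 unfolding A_J_def dirichlet_facets_eq boundary_jump_def
 using sum_boundary_facets[of "\<lambda>F. \<gamma>1 / diameter F ^ 3" "\<lambda>T z. (u T z *\<^sub>R outer_normal \<Omega> z) \<bullet> (v T z *\<^sub>R outer_normal \<Omega> z)" "{Upper, CharLeft}"]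
  sum_boundary_facets[of "\<lambda>F. \<gamma>3 * (real p)\<^sup>2 / diameter F" "\<lambda>T z. dtan D (u T) z * dtan D (v T) z" "{Upper, CharLeft}"]
 by (simp only:)

lemma L_h_eq:
 "L_h D b c \<T> p \<gamma>1 \<gamma>3 f g gt v = (\<Sum>T\<in>\<T>. LINT z:T|lebesgue. f z * Mop b c (v T) z)
   + (\<Sum>T\<in>\<T>. \<Sum>j\<in>{Upper, CharLeft}. \<gamma>1 / diameter (boundary_piece T j) ^ 3 * PI T (Inr j) (\<lambda>z. g z * v T z))
   + (\<Sum>T\<in>\<T>. \<Sum>j\<in>{Upper, CharLeft}. \<gamma>3 * (real p)\<^sup>2 / diameter (boundary_piece T j) * PI T (Inr j) (\<lambda>z. gt z * dtan D (v T) z))"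
 unfolding L_h_def dirichlet_facets_eq
 using sum_boundary_facets[of "\<lambda>F. \<gamma>1 / diameter F ^ 3" "\<lambda>T z. g z * v T z" "{Upper, CharLeft}"]
  sum_boundary_facets[of "\<lambda>F. \<gamma>3 * (real p)\<^sup>2 / diameter F" "\<lambda>T z. gt z * dtan D (v T) z" "{Upper, CharLeft}"]
 by (simp only:)

lemma dtan_trace:
 assumes T: "T \<in> \<T>" and u: "u \<in> poly_space p"
 shows "TB T (Inr j) (dtan D u)"
proof -
 have "(\<lambda>z. dy u z * ((1, 0) \<bullet> outer_normal \<Omega> z) - dx u z * ((0, 1) \<bullet> outer_normal \<Omega> z)) = dtan D u"
  unfolding dtan_def grad_def tangent_of_def by (auto simp: inner_prod_def)
 moreover have "TB T (Inr j) (\<lambda>z. dy u z * ((1, 0) \<bullet> outer_normal \<Omega> z) - dx u z * ((0, 1) \<bullet> outer_normal \<Omega> z))"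
  by (intro trace_bounded_diff trace_bounded_mult poly_traces[OF T Inr_piece u] region_trace_normal[OF T])
 ultimately show ?thesis by simp
qed

lemma bilinear_weak_integral:
 assumes T: "T \<in> \<T>"
 shows "bilinear_form V (\<lambda>u v. weak_form T u v)"
proof (rule bilinear_form_set_integral)
 show "set_integrable lebesgue T (\<lambda>z. Wgrad D (u T) z \<bullet> grad (Mop b c (v T)) z)" if "u \<in> V" "v \<in> V" for u v
  by (rule weak_integrand_integrable[OF T V_poly[OF that(1)] V_poly[OF that(2)]])
 show "bilinear_form V (\<lambda>u v. Wgrad D (u T) z \<bullet> grad (Mop b c (v T)) z)" if "z \<in> T" for z
  by (rule bilinear_weak[OF T that])
qed

lemma inner_average_sum:
 fixes w n :: "'i \<Rightarrow> pt"
 shows "((1 / 2) *\<^sub>R (\<Sum>S\<in>A. w S)) \<bullet> (\<Sum>T\<in>A. m T *\<^sub>R n T) = (\<Sum>T\<in>A. \<Sum>S\<in>A. 1 / 2 * ((w S \<bullet> n T) * m T))"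
 by (simp add: inner_sum_right inner_sum_left sum_distrib_left sum_distrib_right mult.commute)

lemma consistency_trace:
 assumes F: "F \<in> \<F>" and S: "S \<in> sides F" and u: "u \<in> V" and v: "v \<in> V"
 shows "TB S (Inl F) (\<lambda>z. avg \<T> F (\<lambda>T. Wgrad D (u T)) z \<bullet> jump \<T> F (\<lambda>T. Mop b c (v T)) z)"
 unfolding avg_def jump_def inner_average_sum
proof (rule trace_bounded_sum, rule trace_bounded_sum)
 fix T R assume T: "T \<in> sides F" and R: "R \<in> sides F"
 note fu = facet_traces[OF F S R V_poly[OF u]] and fv = facet_traces[OF F S T V_poly[OF v]]
 show "TB S (Inl F) (\<lambda>z. 1 / 2 * ((Wgrad D (u R) z \<bullet> outer_normal T z) * Mop b c (v T) z))"
  by (rule trace_bounded_mult[OF trace_bounded_const trace_bounded_mult[OF trace_bounded_inner[OF fu(5,6) fv(1)] fv(7)]])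
qed

lemma bilinear_consistency:
 assumes F: "F \<in> \<F>" shows "bilinear_form V (\<lambda>u v. consistency F u v)"
proof (rule bilinear_segment_integral[OF F consistency_trace[OF F]])
 show "bilinear_form V (\<lambda>u v. avg \<T> F (\<lambda>T. Wgrad D (u T)) z \<bullet> jump \<T> F (\<lambda>T. Mop b c (v T)) z)" for z
  unfolding avg_def jump_def inner_average_sum
  by (rule bilinear_form_sum, rule bilinear_form_sum, rule bilinear_form_cmult, rule bilinear_form_mult[OF linear_Wgrad linear_Mop])
qed

lemma bilinear_boundary:
 assumes T: "T \<in> \<T>"
 shows "bilinear_form V (\<lambda>u v. boundary_form T j u v)"
proof (rule bilinear_form_PI[OF T Inr_piece _ bilinear_form_mult[OF linear_Wgrad linear_Mop]])
 fix u v assume u: "u \<in> V" and v: "v \<in> V"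
 note fu = poly_traces[OF T Inr_piece V_poly[OF u]] and fv = poly_traces[OF T Inr_piece V_poly[OF v]]
 show "TB T (Inr j) (\<lambda>z. (Wgrad D (u T) z \<bullet> outer_normal \<Omega> z) * Mop b c (v T) z)"
  by (rule trace_bounded_mult[OF trace_bounded_inner[OF fu(4,5) region_trace_normal[OF T]] fv(6)])
qed

lemma bilinear_jump_integral:
 assumes F: "F \<in> \<F>"
 shows "bilinear_form V (\<lambda>u v. jump_form F u v)"
proof (rule bilinear_segment_integral[OF F _ bilinear_jump[OF linear_value]])
 show "TB S (Inl F) (\<lambda>z. jump \<T> F u z \<bullet> jump \<T> F v z)" if S: "S \<in> sides F" and u: "u \<in> V" and v: "v \<in> V" for S u v
  by (rule jump_inner_trace[OF F S facet_traces(2)[OF F S _ V_poly[OF u]] facet_traces(2)[OF F S _ V_poly[OF v]]])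
qed

lemma gradient_jump_trace:
 assumes F: "F \<in> \<F>" and S: "S \<in> sides F" and u: "u \<in> V" and v: "v \<in> V"
 shows "TB S (Inl F) (\<lambda>z. jump \<T> F (\<lambda>T. dx (u T)) z \<bullet> jump \<T> F (\<lambda>T. dx (v T)) z + jump \<T> F (\<lambda>T. dy (u T)) z \<bullet> jump \<T> F (\<lambda>T. dy (v T)) z)"
 by (rule trace_bounded_add[OF
   jump_inner_trace[OF F S facet_traces(3)[OF F S _ V_poly[OF u]] facet_traces(3)[OF F S _ V_poly[OF v]]]
   jump_inner_trace[OF F S facet_traces(4)[OF F S _ V_poly[OF u]] facet_traces(4)[OF F S _ V_poly[OF v]]]])

lemma bilinear_gradient_jump_integral:
 assumes F: "F \<in> \<F>" shows "bilinear_form V (\<lambda>u v. gradient_jump_form F u v)"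
proof (rule bilinear_segment_integral[OF F gradient_jump_trace[OF F] bilinear_form_add[OF bilinear_jump bilinear_jump]])
 show "linear_form V (\<lambda>u. dx (u T) z)" "linear_form V (\<lambda>u. dy (u T) z)" for T z by (rule linear_dx linear_dy)+
qed

lemma bilinear_boundary_jump:
 assumes T: "T \<in> \<T>"
 shows "bilinear_form V (\<lambda>u v. boundary_jump_form T j u v)"
proof -
 have e: "(u T z *\<^sub>R outer_normal \<Omega> z) \<bullet> (v T z *\<^sub>R outer_normal \<Omega> z) = (outer_normal \<Omega> z \<bullet> outer_normal \<Omega> z) * (u T z * v T z)" for u v z
  by (simp only: inner_scaleR_left inner_scaleR_right ac_simps)
 note n = region_trace_normal[OF T]
 show ?thesis unfolding e
 proof (rule bilinear_form_PI[OF T Inr_piece _ bilinear_form_cmult[OF bilinear_form_mult[OF linear_value linear_value]]])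
  show "TB T (Inr j) (\<lambda>z. (outer_normal \<Omega> z \<bullet> outer_normal \<Omega> z) * (u T z * v T z))" if u: "u \<in> V" and v: "v \<in> V" for u v
   by (rule trace_bounded_mult[OF trace_bounded_inner[OF trace_bounded_normal_components[OF n] n]
      trace_bounded_mult[OF poly_traces(1)[OF T Inr_piece V_poly[OF u]] poly_traces(1)[OF T Inr_piece V_poly[OF v]]]])
 qed
qed

lemma bilinear_boundary_tangential:
 assumes T: "T \<in> \<T>"
 shows "bilinear_form V (\<lambda>u v. tangential_form T j u v)"
proof (rule bilinear_form_PI[OF T Inr_piece _ bilinear_form_mult[OF linear_dtan linear_dtan]])
 show "TB T (Inr j) (\<lambda>z. dtan D (u T) z * dtan D (v T) z)" if u: "u \<in> V" and v: "v \<in> V" for u v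
  by (rule trace_bounded_mult[OF dtan_trace[OF T V_poly[OF u]] dtan_trace[OF T V_poly[OF v]]])
qed

theorem bilinear_scheme: "bilinear_form V (\<lambda>u v. A_h D b c \<T> u v + A_J D \<T> p \<gamma>1 \<gamma>2 \<gamma>3 u v)"
 unfolding A_h_eq A_J_eq
 apply (rule bilinear_form_add)
  apply (rule bilinear_form_add)
  apply (rule bilinear_form_add)
   apply (rule bilinear_form_uminus)
   apply (rule bilinear_form_sum, erule bilinear_weak_integral)
  apply (rule bilinear_form_sum, erule bilinear_consistency)
  apply (rule bilinear_form_sum, rule bilinear_form_sum, erule bilinear_boundary)
 apply (rule bilinear_form_add)
  apply (rule bilinear_form_add)
  apply (rule bilinear_form_add)
   apply (rule bilinear_form_sum, rule bilinear_form_cmult, erule bilinear_jump_integral)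
  apply (rule bilinear_form_sum, rule bilinear_form_sum, rule bilinear_form_cmult, erule bilinear_boundary_jump)
  apply (rule bilinear_form_sum, rule bilinear_form_cmult, erule bilinear_gradient_jump_integral)
 apply (rule bilinear_form_sum, rule bilinear_form_sum, rule bilinear_form_cmult, erule bilinear_boundary_tangential)
 done

lemma boundary_datum_linear:
 assumes T: "T \<in> \<T>" and g: "L2_on_curve (Gam_arc D j) g"
  and tb: "\<And>v. v \<in> V \<Longrightarrow> TB T (Inr j) (\<phi> v)" and lin: "\<And>z. linear_form V (\<lambda>v. \<phi> v z)"
 shows "linear_form V (\<lambda>v. PI T (Inr j) (\<lambda>z. g z * \<phi> v z))"
proof -
 define S where "S = piece_set T (Inr j)"
 have S: "S \<in> sets borel" "S \<subseteq> {0..1}" unfolding S_def by (rule piece_set_borel[OF T Inr_piece] piece_set_subset)+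
 have Sl: "S \<in> sets lebesgue" using S(1) by (rule sets_completionI_sets[of _ lborel, simplified])
 have w: "set_integrable lebesgue S (\<lambda>s. norm (velocity (Gam_arc D j) s))"
  using piece_trace_integrable[OF T Inr_piece trace_bounded_const[of _ _ 1], of j] unfolding piece_simps S_def by simp
 have gi: "set_integrable lebesgue S (\<lambda>s. g (Gam_arc D j s) * norm (velocity (Gam_arc D j) s))"
  by (rule set_integrable_square_bound[where f = "\<lambda>s. g (Gam_arc D j s)", OF Sl S(2) w norm_ge_zero])
    (use g in \<open>unfold L2_on_curve_def, blast+\<close>)
 show ?thesis unfolding curve_integral_piece unfolding S_def[symmetric] piece_simps
 proof (rule linear_form_set_integral)
  show "set_integrable lebesgue S (\<lambda>s. g (Gam_arc D j s) * \<phi> v (Gam_arc D j s) * norm (velocity (Gam_arc D j) s))" if "v \<in> V" for v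
   by (rule trace_bounded_mult_integrable[OF S(1) _ gi]) (use tb[OF that] in \<open>unfold S_def piece_simps\<close>)
  show "linear_form V (\<lambda>v. g (Gam_arc D j s) * \<phi> v (Gam_arc D j s) * norm (velocity (Gam_arc D j) s))" for s
   by (intro linear_form_cmult_right linear_form_cmult lin)
 qed
qed

theorem linear_data:
 assumes f: "L2_on \<Omega> f" and g: "boundary_data D g gt"
 shows "linear_form V (L_h D b c \<T> p \<gamma>1 \<gamma>3 f g gt)"
proof -
 have poly: "u T \<in> poly_space p" if "u \<in> V" for u T using V_poly that .
 have gj: "L2_on_curve (Gam_arc D j) g" "L2_on_curve (Gam_arc D j) gt" if "j \<in> {Upper, CharLeft}" for j
  using g that unfolding boundary_data_def by blast+
 have 1: "linear_form V (\<lambda>v. LINT z:T|lebesgue. f z * Mop b c (v T) z)" if T: "T \<in> \<T>" for T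
 proof (rule linear_form_set_integral)
  have Tl: "T \<in> sets lebesgue" using open_element[OF T] by (simp add: borel_open sets_completionI_sets)
  have "set_integrable lebesgue T (\<lambda>z. f z * 1)"
   by (rule set_integrable_square_bound[OF Tl element_subset[OF T] element_continuous_integrable[OF T]])
     (use f in \<open>auto simp: L2_on_def\<close>)
  then have fi: "set_integrable lebesgue T f" by simp
  show "set_integrable lebesgue T (\<lambda>z. f z * Mop b c (v T) z)" if v: "v \<in> V" for v
  proof -
   have "continuous_on (closure \<Omega>) (dx (v T))" "continuous_on (closure \<Omega>) (dy (v T))"
    using poly_space_continuous poly_space_derivatives(2,3)[OF poly[OF v]] by blast+
   then have "continuous_on (closure \<Omega>) (Mop b c (v T))" unfolding Mop_def[abs_def]
    by (intro continuous_intros continuous_coefficients)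
   from element_mult_integrable[OF T this fi] show ?thesis by (simp add: mult.commute)
  qed
  show "linear_form V (\<lambda>v. f z * Mop b c (v T) z)" for z by (intro linear_form_cmult linear_Mop)
 qed
 have 2: "linear_form V (\<lambda>v. PI T (Inr j) (\<lambda>z. g z * v T z))" if T: "T \<in> \<T>" and j: "j \<in> {Upper, CharLeft}" for T j
  by (rule boundary_datum_linear[OF T gj(1)[OF j] poly_traces(1)[OF T Inr_piece poly] linear_value])
 have 3: "linear_form V (\<lambda>v. PI T (Inr j) (\<lambda>z. gt z * dtan D (v T) z))" if T: "T \<in> \<T>" and j: "j \<in> {Upper, CharLeft}" for T j
  by (rule boundary_datum_linear[OF T gj(2)[OF j] dtan_trace[OF T poly] linear_dtan])
 have "L_h D b c \<T> p \<gamma>1 \<gamma>3 f g gt = (\<lambda>v. (\<Sum>T\<in>\<T>. LINT z:T|lebesgue. f z * Mop b c (v T) z)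
   + (\<Sum>T\<in>\<T>. \<Sum>j\<in>{Upper, CharLeft}. \<gamma>1 / diameter (boundary_piece T j) ^ 3 * PI T (Inr j) (\<lambda>z. g z * v T z))
   + (\<Sum>T\<in>\<T>. \<Sum>j\<in>{Upper, CharLeft}. \<gamma>3 * (real p)\<^sup>2 / diameter (boundary_piece T j) * PI T (Inr j) (\<lambda>z. gt z * dtan D (v T) z)))"
  by (intro ext L_h_eq)
 moreover have "linear_form V \<dots>" by (intro linear_form_add linear_form_sum linear_form_cmult 1 2 3)
 ultimately show ?thesis by simp
qed

end

section \<open>Coercivity\<close>

text \<open>Young's inequality, from the square of 2 \<theta> R + P.\<close>

lemma product_lower_bound:
 fixes P R \<theta> :: real
 assumes t: "0 < \<theta>" and P: "P\<^sup>2 \<le> A" and R: "R\<^sup>2 \<le> B"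
 shows "- (A / (4 * \<theta>)) - \<theta> * B \<le> P * R"
proof -
 have "0 \<le> (2 * \<theta> * R + P)\<^sup>2 / (4 * \<theta>)" using t by simp
 also have "\<dots> = \<theta> * R\<^sup>2 + P * R + P\<^sup>2 / (4 * \<theta>)" using t by (simp add: field_simps power2_eq_square)
 finally have "0 \<le> \<theta> * R\<^sup>2 + P * R + P\<^sup>2 / (4 * \<theta>)" .
 moreover have "\<theta> * R\<^sup>2 \<le> \<theta> * B" using t R by simp
 moreover have "P\<^sup>2 / (4 * \<theta>) \<le> A / (4 * \<theta>)" using t P by (simp add: divide_right_mono)
 ultimately show ?thesis by linarith
qed

lemma cauchy_plane:
 fixes x y u v :: real
 shows "(x * u + y * v)\<^sup>2 \<le> (x\<^sup>2 + y\<^sup>2) * (u\<^sup>2 + v\<^sup>2)"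
proof -
 have "(x\<^sup>2 + y\<^sup>2) * (u\<^sup>2 + v\<^sup>2) - (x * u + y * v)\<^sup>2 = (x * v - y * u)\<^sup>2" by algebra
 then show ?thesis using zero_le_power2[of "x * v - y * u"] by linarith
qed

text \<open>The consistency term and the boundary terms of the two neighbours combine to the product
 of \<open>K c q1 - b q2\<close>, where \<open>q\<close> is the average of the gradients, and the tangential part of the
 jump of the gradient.\<close>

lemma facet_lower_bound:
 fixes \<kappa> b c n1 n2 a1 a2 e1 e2 \<beta> \<theta> :: real
 assumes n: "n1\<^sup>2 + n2\<^sup>2 = 1" and \<theta>: "0 < \<theta>" and \<beta>: "\<bar>\<kappa> * c\<bar> \<le> \<beta>" "\<bar>b\<bar> \<le> \<beta>"
 shows "- (\<beta>\<^sup>2 / (4 * \<theta>)) * (a1\<^sup>2 + a2\<^sup>2) - \<beta>\<^sup>2 / (4 * \<theta>) * (e1\<^sup>2 + e2\<^sup>2) \<le>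
  1 / 2 * ((\<kappa> * (a1 + e1) * n1 + (a2 + e2) * n2) * ((b * a1 + c * a2) - (b * e1 + c * e2)))
  - 1 / 2 * ((b * n1 + c * n2) * (\<kappa> * a1\<^sup>2 + a2\<^sup>2)) + 1 / 2 * ((b * n1 + c * n2) * (\<kappa> * e1\<^sup>2 + e2\<^sup>2))
  + \<theta> * ((a1 - e1)\<^sup>2 + (a2 - e2)\<^sup>2)" (is "_ \<le> ?X")
proof -
 define P where "P = (\<kappa> * c) * ((a1 + e1) / 2) + (- b) * ((a2 + e2) / 2)"
 define R where "R = n1 * (a2 - e2) + (- n2) * (a1 - e1)"
 have "(\<kappa> * c)\<^sup>2 \<le> \<beta>\<^sup>2" "b\<^sup>2 \<le> \<beta>\<^sup>2" using \<beta> by (auto simp: abs_le_square_iff[symmetric])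
 then have "(\<kappa> * c)\<^sup>2 + (- b)\<^sup>2 \<le> 2 * \<beta>\<^sup>2" by simp
 then have "((\<kappa> * c)\<^sup>2 + (- b)\<^sup>2) * (((a1 + e1) / 2)\<^sup>2 + ((a2 + e2) / 2)\<^sup>2) \<le> 2 * \<beta>\<^sup>2 * (((a1 + e1) / 2)\<^sup>2 + ((a2 + e2) / 2)\<^sup>2)"
  by (rule mult_right_mono) simp
 moreover have "2 * (((a1 + e1) / 2)\<^sup>2 + ((a2 + e2) / 2)\<^sup>2) \<le> (a1\<^sup>2 + a2\<^sup>2) + (e1\<^sup>2 + e2\<^sup>2)"
  using zero_le_power2[of "a1 - e1"] zero_le_power2[of "a2 - e2"] by (simp add: power2_eq_square field_simps)
 then have "\<beta>\<^sup>2 * (2 * (((a1 + e1) / 2)\<^sup>2 + ((a2 + e2) / 2)\<^sup>2)) \<le> \<beta>\<^sup>2 * ((a1\<^sup>2 + a2\<^sup>2) + (e1\<^sup>2 + e2\<^sup>2))"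
  by (rule mult_left_mono) simp
 ultimately have P: "P\<^sup>2 \<le> \<beta>\<^sup>2 * ((a1\<^sup>2 + a2\<^sup>2) + (e1\<^sup>2 + e2\<^sup>2))"
  using cauchy_plane[of "\<kappa> * c" "(a1 + e1) / 2" "- b" "(a2 + e2) / 2"] unfolding P_def by linarith
 have R: "R\<^sup>2 \<le> (a1 - e1)\<^sup>2 + (a2 - e2)\<^sup>2"
  using cauchy_plane[of n1 "a2 - e2" "- n2" "a1 - e1"] n unfolding R_def by simp
 \<comment> \<open>With q the average and d the jump of the gradient, the terms K b q1 d1 n1 and c
   q2 d2 n2 occur in both products with opposite signs and cancel. What remains has the tangential
   component R of d as a common factor.\<close>
 have e: "?X = P * R + \<theta> * ((a1 - e1)\<^sup>2 + (a2 - e2)\<^sup>2)"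
  unfolding P_def R_def by (simp add: field_simps power2_eq_square)
 have l: "- (\<beta>\<^sup>2 / (4 * \<theta>)) * (a1\<^sup>2 + a2\<^sup>2) - \<beta>\<^sup>2 / (4 * \<theta>) * (e1\<^sup>2 + e2\<^sup>2) = - (\<beta>\<^sup>2 * ((a1\<^sup>2 + a2\<^sup>2) + (e1\<^sup>2 + e2\<^sup>2)) / (4 * \<theta>))"
  by (simp add: add_divide_distrib distrib_left)
 show ?thesis unfolding e l using product_lower_bound[OF \<theta> P R] by simp
qed

text \<open>The quadratic form of the boundary terms is compared with its value at the normal part of the
 gradient, where it is nonnegative; the difference contains the tangential derivative as a factor.\<close>

lemma dirichlet_lower_bound:
 fixes \<kappa> b c n1 n2 a1 a2 \<beta> \<theta> :: real
 assumes n: "n1\<^sup>2 + n2\<^sup>2 = 1" and \<theta>: "0 < \<theta>"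
  and \<beta>: "\<bar>\<kappa> * b\<bar> \<le> \<beta>" "\<bar>b\<bar> \<le> \<beta>" "\<bar>\<kappa> * c\<bar> \<le> \<beta>" "\<bar>c\<bar> \<le> \<beta>"
  and pos: "0 \<le> (b * n1 + c * n2) * (\<kappa> * n1\<^sup>2 + n2\<^sup>2)"
 shows "- (4 * \<beta>\<^sup>2 / \<theta>) * (a1\<^sup>2 + a2\<^sup>2) \<le>
  (\<kappa> * a1 * n1 + a2 * n2) * (b * a1 + c * a2) - 1 / 2 * ((b * n1 + c * n2) * (\<kappa> * a1\<^sup>2 + a2\<^sup>2)) + \<theta> * (n1 * a2 - n2 * a1)\<^sup>2"
  (is "_ \<le> ?X + _")
proof -
 \<comment> \<open>N and t are the normal and tangential components of the gradient a. The m_ij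
   below are the entries of the symmetric matrix of the quadratic form \<open>?X\<close>, whose
   value at N n is the term with \<open>pos\<close>. The rest is (a - N n) . m (a + N n), with y = a
   + N n and a - N n equal to t times the rotated normal.\<close>
 define N t where "N = a1 * n1 + a2 * n2" and "t = n1 * a2 - n2 * a1"
 define m11 where "m11 = (\<kappa> * b * n1 - \<kappa> * c * n2) / 2"
 define m12 where "m12 = (\<kappa> * c * n1 + b * n2) / 2"
 define m22 where "m22 = (c * n2 - b * n1) / 2"
 define P1 P2 where "P1 = m11 * (- n2) + m12 * n1" and "P2 = m12 * (- n2) + m22 * n1"
 define y1 y2 where "y1 = a1 + N * n1" and "y2 = a2 + N * n2"
 have n': "n1 * n1 + n2 * n2 = 1" using n by (simp add: power2_eq_square)
 have d: "a1 - N * n1 = t * (- n2)" "a2 - N * n2 = t * n1" unfolding N_def t_def using n' by algebra+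
 have "?X = 1 / 2 * ((b * n1 + c * n2) * (\<kappa> * n1\<^sup>2 + n2\<^sup>2)) * N\<^sup>2
   + (a1 - N * n1) * (m11 * y1 + m12 * y2) + (a2 - N * n2) * (m12 * y1 + m22 * y2)"
  unfolding m11_def m12_def m22_def y1_def y2_def by (simp add: field_simps power2_eq_square)
 also have "\<dots> = 1 / 2 * ((b * n1 + c * n2) * (\<kappa> * n1\<^sup>2 + n2\<^sup>2)) * N\<^sup>2 + (P1 * y1 + P2 * y2) * t"
  unfolding d P1_def P2_def by (simp add: algebra_simps)
 finally have X: "(P1 * y1 + P2 * y2) * t \<le> ?X" using mult_nonneg_nonneg[OF pos zero_le_power2[of N]] by simp
 have n1: "\<bar>n1\<bar> \<le> 1" "\<bar>n2\<bar> \<le> 1"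
  using n zero_le_power2[of n1] zero_le_power2[of n2] unfolding abs_square_le_1[symmetric] by linarith+
 have h: "\<bar>x * n\<bar> \<le> \<beta>" if "\<bar>x\<bar> \<le> \<beta>" "\<bar>n\<bar> \<le> 1" for x n :: real using mult_mono[OF that] that by (simp add: abs_mult)
 have h2: "\<bar>(x - y) / 2\<bar> \<le> \<beta>" "\<bar>(x + y) / 2\<bar> \<le> \<beta>" if "\<bar>x\<bar> \<le> \<beta>" "\<bar>y\<bar> \<le> \<beta>" for x y :: real
  using that by (auto simp: abs_le_iff)
 have m: "\<bar>m11\<bar> \<le> \<beta>" "\<bar>m12\<bar> \<le> \<beta>" "\<bar>m22\<bar> \<le> \<beta>" unfolding m11_def m12_def m22_def
  by (rule h2(1)[OF h[OF \<beta>(1) n1(1)] h[OF \<beta>(3) n1(2)]] h2(2)[OF h[OF \<beta>(3) n1(1)] h[OF \<beta>(2) n1(2)]]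
    h2(1)[OF h[OF \<beta>(4) n1(2)] h[OF \<beta>(2) n1(1)]])+
 have m2: "m11\<^sup>2 \<le> \<beta>\<^sup>2" "m12\<^sup>2 \<le> \<beta>\<^sup>2" "m22\<^sup>2 \<le> \<beta>\<^sup>2" using m by (auto simp: abs_le_square_iff[symmetric])
 have "P1\<^sup>2 \<le> m11\<^sup>2 + m12\<^sup>2" "P2\<^sup>2 \<le> m12\<^sup>2 + m22\<^sup>2"
  using cauchy_plane[of m11 "- n2" m12 n1] cauchy_plane[of m12 "- n2" m22 n1] n unfolding P1_def P2_def
  by (simp_all add: add.commute)
 then have P: "P1\<^sup>2 + P2\<^sup>2 \<le> 4 * \<beta>\<^sup>2" using m2 by linarith
 have "y1\<^sup>2 + y2\<^sup>2 = (a1\<^sup>2 + a2\<^sup>2) + 3 * N\<^sup>2" unfolding y1_def y2_def N_def using n' by algebra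
 moreover have "N\<^sup>2 \<le> a1\<^sup>2 + a2\<^sup>2" using cauchy_plane[of a1 n1 a2 n2] n unfolding N_def by simp
 ultimately have y: "y1\<^sup>2 + y2\<^sup>2 \<le> 4 * (a1\<^sup>2 + a2\<^sup>2)" by (simp add: algebra_simps)
 \<comment> \<open>The two factors 4 multiply to 16 \<beta>^2 |a|^2, and Young's inequality divides
   by 4 \<theta>. This is where 4 \<beta>^2 / \<theta> comes from.\<close>
 have "(P1 * y1 + P2 * y2)\<^sup>2 \<le> (4 * \<beta>\<^sup>2) * (4 * (a1\<^sup>2 + a2\<^sup>2))"
  using cauchy_plane[of P1 y1 P2 y2] mult_mono[OF P y] by simp
 from product_lower_bound[OF \<theta> this order_refl, of t]
 have "- ((4 * \<beta>\<^sup>2) * (4 * (a1\<^sup>2 + a2\<^sup>2)) / (4 * \<theta>)) - \<theta> * t\<^sup>2 \<le> ?X" using X by linarith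
 moreover have "(4 * \<beta>\<^sup>2) * (4 * (a1\<^sup>2 + a2\<^sup>2)) / (4 * \<theta>) = (4 * \<beta>\<^sup>2 / \<theta>) * (a1\<^sup>2 + a2\<^sup>2)" by simp
 ultimately show ?thesis unfolding t_def by linarith
qed

text \<open>Along \<open>CharRight\<close> the quadratic form degenerates to a square, whose sign is prescribed by the
 multiplier.\<close>

lemma characteristic_nonneg:
 fixes \<kappa> b c n1 a1 a2 r :: real
 assumes "\<kappa> = - r\<^sup>2" "0 \<le> n1" "b + c * r \<le> 0"
 shows "0 \<le> (\<kappa> * a1 * n1 + a2 * (- r * n1)) * (b * a1 + c * a2) - 1 / 2 * ((b * n1 + c * (- r * n1)) * (\<kappa> * a1\<^sup>2 + a2\<^sup>2))"
  (is "_ \<le> ?X")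
proof -
 have "?X = 1 / 2 * (n1 * (- (b + c * r)) * (r * a1 + a2)\<^sup>2)"
  unfolding assms(1) by (simp add: field_simps power2_eq_square)
 moreover have "0 \<le> n1 * (- (b + c * r)) * (r * a1 + a2)\<^sup>2" using assms(2,3) by (intro mult_nonneg_nonneg) auto
 ultimately show ?thesis by (simp only: zero_le_mult_iff) simp
qed

locale tricomi_stable = tricomi_scheme +
 fixes \<beta> Ctr \<gamma>1 \<gamma>2 \<gamma>3 :: real
 assumes \<beta>: "\<And>z. z \<in> closure \<Omega> \<Longrightarrow> \<bar>K (snd z) * b (fst z)\<bar> \<le> \<beta>" "\<And>z. z \<in> closure \<Omega> \<Longrightarrow> \<bar>b (fst z)\<bar> \<le> \<beta>"
   "\<And>z. z \<in> closure \<Omega> \<Longrightarrow> \<bar>K (snd z) * c (snd z)\<bar> \<le> \<beta>" "\<And>z. z \<in> closure \<Omega> \<Longrightarrow> \<bar>c (snd z)\<bar> \<le> \<beta>"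
  and p_pos: "1 \<le> p"
  and trace: "\<And>T q. T \<in> \<T> \<Longrightarrow> q \<in> poly_space p \<Longrightarrow> sqrt (elem_boundary_integral D \<T> T (\<lambda>z. (q z)\<^sup>2))
     \<le> Ctr * real p * diameter T powr (- (1 / 2)) * sqrt (LINT z : T | lebesgue. (q z)\<^sup>2)"
  and penalties: "0 < \<gamma>1" "288 * \<beta>\<^sup>2 * Ctr\<^sup>2 / \<delta> < \<gamma>2" "288 * \<beta>\<^sup>2 * Ctr\<^sup>2 / \<delta> < \<gamma>3"
begin

definition "\<gamma> = min \<gamma>2 \<gamma>3"
text \<open>The price of the absorption per unit of the boundary integral of |grad v|^2: the
  constant 4 \<beta>^2 / \<theta> of \<open>dirichlet_lower_bound\<close> with \<theta> = \<gamma>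
  p^2 / diameter F, where the facet diameter is replaced by the larger diameter of T. The constant
  \<beta>^2 / (4 \<theta>) of interior facets is a sixteenth of 4 \<beta>^2 / \<theta>.\<close>

definition "\<kappa> T = 4 * \<beta>\<^sup>2 * diameter T / (\<gamma> * (real p)\<^sup>2)"
definition "gsq q z = (dx q z)\<^sup>2 + (dy q z)\<^sup>2"
definition "mn T z = (b (fst z), c (snd z)) \<bullet> outer_normal T z"

lemma gamma: "0 < \<gamma>" "\<gamma> \<le> \<gamma>2" "\<gamma> \<le> \<gamma>3" "288 * \<beta>\<^sup>2 * Ctr\<^sup>2 \<le> \<gamma> * \<delta>"
proof -
 have g: "288 * \<beta>\<^sup>2 * Ctr\<^sup>2 / \<delta> < \<gamma>" unfolding \<gamma>_def using penalties by simp
 have "0 \<le> 288 * \<beta>\<^sup>2 * Ctr\<^sup>2 / \<delta>" using delta_pos by simp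
 then show "0 < \<gamma>" using g by linarith
 show "\<gamma> \<le> \<gamma>2" "\<gamma> \<le> \<gamma>3" unfolding \<gamma>_def by auto
 show "288 * \<beta>\<^sup>2 * Ctr\<^sup>2 \<le> \<gamma> * \<delta>" using g delta_pos by (simp add: field_simps)
qed

lemma element_diameter: "T \<in> \<T> \<Longrightarrow> bounded T" "T \<in> \<T> \<Longrightarrow> 0 < diameter T"
proof -
 assume T: "T \<in> \<T>"
 show b: "bounded T" by (rule bounded_subset[OF bounded_region element_subset[OF T]])
 obtain x \<rho> where st: "star_domain T x \<rho>" using star_element[OF T] by blast
 interpret star_domain T x \<rho> by (rule st)
 have "x \<in> T" "x + (\<rho> / 2, 0) \<in> T" using ball_subset rho_pos by (auto intro!: subsetD[OF ball_subset] simp: dist_norm norm_Pair)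
 from diameter_bounded_bound[OF b this] show "0 < diameter T" using rho_pos by (simp add: dist_norm norm_Pair)
qed

lemma diameter_pos: "bounded S \<Longrightarrow> x \<in> S \<Longrightarrow> y \<in> S \<Longrightarrow> x \<noteq> y \<Longrightarrow> 0 < diameter (S :: pt set)"
 using diameter_bounded_bound by (metis dist_nz less_le_trans)

lemma facet_diameter:
 assumes "F \<in> \<F>" shows "0 < diameter F"
proof -
 obtain a b where ab: "a \<noteq> b" "F = closed_segment a b" using assms unfolding interior_facets_def segment_set_def by auto
 show ?thesis unfolding ab(2) by (rule diameter_pos[OF compact_imp_bounded[OF compact_segment] _ _ ab(1)]) auto
qed

lemma boundary_piece_diameter:
 assumes T: "T \<in> \<T>" and l: "has_length T j" shows "0 < diameter (boundary_piece T j)"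
proof -
 have inf: "infinite (boundary_piece T j)" by (rule infinite_boundary_piece[OF l])
 then obtain x where x: "x \<in> boundary_piece T j" using infinite_imp_nonempty by blast
 have "infinite (boundary_piece T j - {x})" using inf by simp
 then obtain y where y: "y \<in> boundary_piece T j" "x \<noteq> y" using infinite_imp_nonempty by blast
 have "boundary_piece T j \<subseteq> closure T" unfolding boundary_piece_def by (auto simp: frontier_def)
 from diameter_pos[OF bounded_subset[OF bounded_closure[OF element_diameter(1)[OF T]] this] x y] show ?thesis .
qed

lemma kappa_nonneg: "T \<in> \<T> \<Longrightarrow> 0 \<le> \<kappa> T"
 unfolding \<kappa>_def using element_diameter(2)[of T] gamma(1) by simp

lemma kappa_bound:
 assumes T: "T \<in> \<T>" and F: "F \<subseteq> closure T" "0 < diameter F" and g: "\<gamma> \<le> \<gamma>'"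
 shows "4 * \<beta>\<^sup>2 / (\<gamma>' * (real p)\<^sup>2 / diameter F) \<le> \<kappa> T" "\<beta>\<^sup>2 / (4 * (\<gamma>' * (real p)\<^sup>2 / diameter F)) \<le> \<kappa> T"
proof -
 have d: "diameter F \<le> diameter T"
  using diameter_subset[OF F(1) bounded_closure] element_diameter(1)[OF T] by (simp add: diameter_closure)
 have pp: "0 < (real p)\<^sup>2" using p_pos by simp
 have e: "4 * \<beta>\<^sup>2 / (\<gamma>' * (real p)\<^sup>2 / diameter F) = 4 * \<beta>\<^sup>2 * diameter F / (\<gamma>' * (real p)\<^sup>2)" by simp
 show 1: "4 * \<beta>\<^sup>2 / (\<gamma>' * (real p)\<^sup>2 / diameter F) \<le> \<kappa> T"
  unfolding e \<kappa>_def using d F(2) g gamma(1) pp by (intro frac_le mult_left_mono mult_right_mono) auto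
 have "\<beta>\<^sup>2 / (4 * (\<gamma>' * (real p)\<^sup>2 / diameter F)) = (4 * \<beta>\<^sup>2 / (\<gamma>' * (real p)\<^sup>2 / diameter F)) / 16" by simp
 also have "\<dots> \<le> 4 * \<beta>\<^sup>2 / (\<gamma>' * (real p)\<^sup>2 / diameter F)" using F(2) g gamma(1) pp by (simp add: field_simps)
 finally show "\<beta>\<^sup>2 / (4 * (\<gamma>' * (real p)\<^sup>2 / diameter F)) \<le> \<kappa> T" using 1 by linarith
qed

lemma piece_point: "T \<in> \<T> \<Longrightarrow> i \<in> pieces T \<Longrightarrow> s \<in> piece_set T i \<Longrightarrow> piece_path i s \<in> closure T \<inter> closure \<Omega>"
 using piece_image_eq[of T i] piece_image_subset[of T i] closure_element_subset[of T] by (auto simp: frontier_def)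

text \<open>Reduces an inequality between integrals to one that holds almost everywhere. The number
  of summands is that of an interior facet: two gradient terms on the left; consistency, two energy
  terms and a penalty on the right. Boundary pieces fill the free places with zeros.\<close>

lemma PI_combination:
 assumes T: "T \<in> \<T>" and i: "i \<in> pieces T"
  and tb: "TB T i e" "TB T i e'" "TB T i \<phi>" "TB T i \<phi>1" "TB T i \<phi>2" "TB T i \<psi>"
  and le: "AE_curve (piece_path i) (piece_set T i) (\<lambda>s. (\<lambda>z. r1 * e z + r2 * e' z) (piece_path i s) \<le> (\<lambda>z. \<phi> z + (r3 * \<phi>1 z + (r4 * \<phi>2 z + r5 * \<psi> z))) (piece_path i s))"
 shows "r1 * PI T i e + r2 * PI T i e' \<le> PI T i \<phi> + (r3 * PI T i \<phi>1 + (r4 * PI T i \<phi>2 + r5 * PI T i \<psi>))"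
proof -
 note c = trace_bounded_mult[OF trace_bounded_const]
 note t1 = trace_bounded_add[OF c[OF tb(5)] c[OF tb(6)], of r4 r5]
 note t2 = trace_bounded_add[OF c[OF tb(4)] t1, of r3]
 show ?thesis using PI_mono[OF T i trace_bounded_add[OF c[OF tb(1)] c[OF tb(2)]] trace_bounded_add[OF tb(3) t2] le]
  unfolding PI_add[OF T i c[OF tb(1)] c[OF tb(2)]] PI_add[OF T i tb(3) t2] PI_add[OF T i c[OF tb(4)] t1]
   PI_add[OF T i c[OF tb(5)] c[OF tb(6)]] PI_cmult .
qed

lemma gsq_trace: "T \<in> \<T> \<Longrightarrow> i \<in> pieces T \<Longrightarrow> q \<in> poly_space p \<Longrightarrow> TB T i (gsq q)"
 unfolding gsq_def[abs_def] by (intro trace_bounded_add trace_bounded_power2 poly_traces)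

lemma wnorm_trace:
 assumes "T \<in> \<T>" "i \<in> pieces T" "q \<in> poly_space p"
 shows "TB T i (\<lambda>z. mn T z * wnorm q z)"
proof (rule trace_bounded_mult)
 show "TB T i (mn T)" unfolding mn_def[abs_def]
  by (rule trace_bounded_inner[OF _ _ piece_trace_normal[OF assms(1,2)]])
    (simp, rule piece_trace_continuous[OF assms(1,2)], rule continuous_coefficients)+
 have "continuous_on (closure \<Omega>) (dx q)" "continuous_on (closure \<Omega>) (dy q)"
  using poly_space_continuous poly_space_derivatives(2,3)[OF assms(3)] by blast+
 then show "TB T i (wnorm q)" unfolding wnorm_def[abs_def]
  by (intro piece_trace_continuous[OF assms(1,2)] continuous_intros continuous_coefficients)
qed

lemma interior_facet_bound:
 assumes F: "F \<in> \<F>" and v: "v \<in> V"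
 shows "- (\<Sum>T\<in>sides F. \<kappa> T * PI T (Inl F) (gsq (v T))) \<le>
   consistency F v v
   - 1 / 2 * (\<Sum>T\<in>sides F. PI T (Inl F) (\<lambda>z. mn T z * wnorm (v T) z))
   + \<gamma>2 * (real p)\<^sup>2 / diameter F * gradient_jump_form F v v"
proof -
 obtain T T' where T: "T \<in> \<T>" "T' \<in> \<T>" "T \<noteq> T'" and fe: "sides F = {T, T'}"
  and e: "F \<in> elem_facets T" "F \<in> elem_facets T'" and FT: "F = frontier T \<inter> frontier T'"
  and nrm: "AE s in lebesgue. s \<in> {0..1} \<longrightarrow> opposite_normals T T' (segment_path F s)"
  by (rule interior_facet_neighbours[OF F])
 note i = Inl_piece[OF e(1)] and i' = Inl_piece[OF e(2)]
 have S: "T \<in> sides F" "T' \<in> sides F" using fe by auto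
 \<comment> \<open>\<open>PI T (Inl F)\<close> and \<open>PI T' (Inl F)\<close> are the same
   integral over F, so everything is computed from the side of T and only the bounds on traces are
   carried over from T'.\<close>
 note tb = facet_trace[OF F S]
 note dF = facet_diameter[OF F]
 define \<theta> where "\<theta> = \<gamma>2 * (real p)\<^sup>2 / diameter F"
 have \<theta>: "0 < \<theta>" unfolding \<theta>_def using gamma p_pos dF by simp
 have Fc: "F \<subseteq> closure T" "F \<subseteq> closure T'" using FT by (auto simp: frontier_def)
 have kb: "\<beta>\<^sup>2 / (4 * \<theta>) \<le> \<kappa> T" "\<beta>\<^sup>2 / (4 * \<theta>) \<le> \<kappa> T'"
  unfolding \<theta>_def by (rule kappa_bound(2)[OF T(1) Fc(1) dF gamma(2)] kappa_bound(2)[OF T(2) Fc(2) dF gamma(2)])+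
 define A where "A z = avg \<T> F (\<lambda>T. Wgrad D (v T)) z \<bullet> jump \<T> F (\<lambda>T. Mop b c (v T)) z" for z
 define J2 where "J2 z = jump \<T> F (\<lambda>T. dx (v T)) z \<bullet> jump \<T> F (\<lambda>T. dx (v T)) z
     + jump \<T> F (\<lambda>T. dy (v T)) z \<bullet> jump \<T> F (\<lambda>T. dy (v T)) z" for z
 have tA: "TB T (Inl F) A" unfolding A_def[abs_def] by (rule consistency_trace[OF F S(1) v v])
 have tJ: "TB T (Inl F) J2" unfolding J2_def[abs_def] by (rule gradient_jump_trace[OF F S(1) v v])
 have "- \<kappa> T * PI T (Inl F) (gsq (v T)) + - \<kappa> T' * PI T (Inl F) (gsq (v T')) \<le> PI T (Inl F) A
   + (- (1 / 2) * PI T (Inl F) (\<lambda>z. mn T z * wnorm (v T) z) + (- (1 / 2) * PI T (Inl F) (\<lambda>z. mn T' z * wnorm (v T') z) + \<theta> * PI T (Inl F) J2))"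
 proof (rule PI_combination[OF T(1) i gsq_trace[OF T(1) i V_poly[OF v]] _ tA wnorm_trace[OF T(1) i V_poly[OF v]] _ tJ])
  show "TB T (Inl F) (gsq (v T'))" "TB T (Inl F) (\<lambda>z. mn T' z * wnorm (v T') z)"
   unfolding tb by (rule gsq_trace[OF T(2) i' V_poly[OF v]] wnorm_trace[OF T(2) i' V_poly[OF v]])+
  show "AE_curve ((piece_path (Inl F))) (piece_set T (Inl F)) (\<lambda>s. (\<lambda>z. - \<kappa> T * gsq (v T) z + - \<kappa> T' * gsq (v T') z) (piece_path (Inl F) s) \<le>
    (\<lambda>z. A z + (- (1 / 2) * (mn T z * wnorm (v T) z) + (- (1 / 2) * (mn T' z * wnorm (v T') z) + \<theta> * J2 z))) (piece_path (Inl F) s))"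
   using nrm
  proof (eventually_elim, intro impI)
   fix s assume ns: "s \<in> {0..1} \<longrightarrow> opposite_normals T T' (segment_path F s)"
    and s: "s \<in> piece_set T (Inl F)"
   define z where "z = segment_path F s"
   obtain n1 n2 where n12: "outer_normal T z = (n1, n2)" by (metis surj_pair)
   have s01: "s \<in> {0..1}" using s piece_set_subset by blast
   have n: "n1\<^sup>2 + n2\<^sup>2 = 1" and n': "outer_normal T' z = (- n1, - n2)"
    using ns s01 unfolding z_def[symmetric] n12 by (auto simp: norm_Pair)
   have zc: "z \<in> closure \<Omega>" using piece_point[OF T(1) i s] unfolding z_def by simp
   define a1 a2 e1 e2 where "a1 = dx (v T) z" and "a2 = dy (v T) z" and "e1 = dx (v T') z" and "e2 = dy (v T') z"
   have 1: "A z = 1 / 2 * ((K (snd z) * (a1 + e1) * n1 + (a2 + e2) * n2) *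
     ((b (fst z) * a1 + c (snd z) * a2) - (b (fst z) * e1 + c (snd z) * e2)))"
    unfolding A_def avg_def jump_def fe using T(3)
    by (simp add: n12 n' Wgrad_def Mop_def a1_def a2_def e1_def e2_def algebra_simps)
   have 2: "J2 z = (a1 - e1)\<^sup>2 + (a2 - e2)\<^sup>2"
   proof -
    have "J2 z = ((a1 - e1)\<^sup>2 + (a2 - e2)\<^sup>2) * (n1\<^sup>2 + n2\<^sup>2)" unfolding J2_def jump_def fe using T(3)
     by (simp add: n12 n' a1_def a2_def e1_def e2_def algebra_simps power2_eq_square)
    then show ?thesis using n by simp
   qed
   have 3: "- \<kappa> T * gsq (v T) z \<le> - (\<beta>\<^sup>2 / (4 * \<theta>)) * (a1\<^sup>2 + a2\<^sup>2)"
    "- \<kappa> T' * gsq (v T') z \<le> - (\<beta>\<^sup>2 / (4 * \<theta>)) * (e1\<^sup>2 + e2\<^sup>2)"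
    unfolding gsq_def a1_def a2_def e1_def e2_def by (rule mult_right_mono; use kb in simp)+
   show "(\<lambda>z. - \<kappa> T * gsq (v T) z + - \<kappa> T' * gsq (v T') z) (piece_path (Inl F) s) \<le>
    (\<lambda>z. A z + (- (1 / 2) * (mn T z * wnorm (v T) z) + (- (1 / 2) * (mn T' z * wnorm (v T') z) + \<theta> * J2 z))) (piece_path (Inl F) s)"
    using facet_lower_bound[OF n \<theta> \<beta>(3)[OF zc] \<beta>(2)[OF zc], of a1 a2 e1 e2] 3
    unfolding piece_simps z_def[symmetric] 1 2 mn_def wnorm_def n12 n' a1_def[symmetric] a2_def[symmetric] e1_def[symmetric] e2_def[symmetric]
    by (simp add: algebra_simps)
  qed
 qed
 then show ?thesis
  unfolding fe segment_integral_piece[of F _ T] A_def[symmetric] J2_def[symmetric] \<theta>_def[symmetric] using T(3) by (simp add: add_divide_distrib)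
qed

abbreviation "normal_sign j z n1 n2 \<equiv> n1\<^sup>2 + n2\<^sup>2 = 1 \<and>
 (j \<noteq> CharRight \<longrightarrow> 0 \<le> (b (fst z) * n1 + c (snd z) * n2) * (K (snd z) * n1\<^sup>2 + n2\<^sup>2)) \<and>
 (j = CharRight \<longrightarrow> (\<exists>r\<ge>0. K (snd z) = - r\<^sup>2 \<and> 0 \<le> n1 \<and> n2 = - r * n1 \<and> b (fst z) + c (snd z) * r \<le> 0))"

text \<open>On \<open>Upper\<close> both K and m . n have the right sign. On \<open>CharLeft\<close>
  tangency forces n2 = k n1, so K n1^2 + n2^2 vanishes. On \<open>CharRight\<close> it forces n2 =
  -k n1, and the position of the domain fixes the sign of n1.\<close>

lemma boundary_normal:
 assumes T: "T \<in> \<T>"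
 shows "AE_curve (Gam_arc D j) (piece_set T (Inr j)) (\<lambda>s. (\<exists>n1 n2. outer_normal \<Omega> (Gam_arc D j s) = (n1, n2) \<and> outer_normal T (Gam_arc D j s) = (n1, n2) \<and> normal_sign j (Gam_arc D j s) n1 n2))"
proof -
 have "AE s in lebesgue. s \<in> {0..1} \<longrightarrow> (\<lambda>s. s) s \<notin> {0, 1 :: real}" by (rule AE_avoid_finite) auto
 then show ?thesis using region_normal_AE[OF T, of j]
 proof (eventually_elim, intro impI)
  fix s assume e: "s \<in> {0..1} \<longrightarrow> s \<notin> {0, 1 :: real}" and s: "s \<in> piece_set T (Inr j)" and dv: "velocity (Gam_arc D j) s \<noteq> 0"
   and nrm: "s \<in> piece_set T (Inr j) \<longrightarrow> velocity (Gam_arc D j) s \<noteq> 0 \<longrightarrow>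
   region_normal T j s"
  have s01: "0 < s" "s < 1" using e s piece_set_subset[of T "Inr j"] by auto
  obtain x y where xy: "Gam_arc D j s = (x, y)" by (metis surj_pair)
  obtain n1 n2 where n12: "outer_normal \<Omega> (x, y) = (n1, n2)" by (metis surj_pair)
  have nT: "outer_normal T (x, y) = (n1, n2)" and ion: "is_outer_normal \<Omega> (x, y) (n1, n2)"
   and perp: "(n1, n2) \<bullet> velocity (Gam_arc D j) s = 0" using nrm s dv unfolding xy n12 by auto
  have n: "n1\<^sup>2 + n2\<^sup>2 = 1" using is_outer_normal_norm[OF ion] by (simp add: norm_Pair)
  have G: "(x, y) \<in> Gam D j" using s unfolding piece_set_def piece_simps boundary_piece_def xy[symmetric] by auto
  have zc: "(x, y) \<in> closure \<Omega>" using G Gam_subset_frontier[of j] by (auto simp: frontier_def)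
  have ych: "y = s * yc" if "j \<noteq> Upper" using that xy by (cases j) (auto simp: arc_CharLeft arc_CharRight)
  have yr: "yc \<le> y" "y < 0" if "j \<noteq> Upper"
   using ych[OF that] yc_neg s01 mult_left_le_one_le[of "- yc" s] by (auto simp: mult_pos_neg)
  have 1: "0 \<le> (b x * n1 + c y * n2) * (K y * n1\<^sup>2 + n2\<^sup>2)" if j: "j \<noteq> CharRight"
  proof (cases j)
   case Upper
   have "y > 0" using Gam_snd(1) G Upper by force
   then have "0 < K y" using K_pos in_ranges_closure(4)[OF zc] by blast
   moreover have "0 \<le> b x * n1 + c y * n2" using mult_upper[OF _ ion] G Upper by simp
   ultimately show ?thesis by simp
  next
   case CharLeft
   then have yy: "yc \<le> y" "y < 0" using yr by auto
   have "velocity (Gam_arc D j) s = yc *\<^sub>R (- k y, 1)"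
    unfolding CharLeft ych[unfolded CharLeft, simplified] by (rule vector_derivative_at[OF Gam_arc_deriv(1)[OF s01]])
   then have "yc * (n2 - k y * n1) = 0" using perp by (simp add: algebra_simps)
   then have "n2 = k y * n1" using yc_neg by simp
   then have "K y * n1\<^sup>2 + n2\<^sup>2 = 0" using k_sq[OF yy] by (simp add: power_mult_distrib)
   then show ?thesis by simp
  qed (use j in simp)
  have 2: "\<exists>r\<ge>0. K y = - r\<^sup>2 \<and> 0 \<le> n1 \<and> n2 = - r * n1 \<and> b x + c y * r \<le> 0" if j: "j = CharRight"
  proof (intro exI[of _ "k y"] conjI)
   have yy: "yc \<le> y" "y < 0" using yr j by auto
   show "0 \<le> k y" using k_nonneg yy by simp
   show "K y = - (k y)\<^sup>2" using k_sq[OF yy] by simp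
   show "b x + c y * k y \<le> 0" using mult_right[of x y] G unfolding j k_def by simp
   have "velocity (Gam_arc D j) s = yc *\<^sub>R (k y, 1)"
    unfolding j ych[unfolded j, simplified] by (rule vector_derivative_at[OF Gam_arc_deriv(2)[OF s01]])
   then have "yc * (n2 + k y * n1) = 0" using perp by (simp add: algebra_simps)
   then show n2: "n2 = - k y * n1" using yc_neg by (simp add: eq_neg_iff_add_eq_0)
   \<comment> \<open>Tangency leaves the sign of the normal open. With n1 negative, points slightly
     to the right of the boundary point would belong to the domain.\<close>
   show "0 \<le> n1"
   proof (rule ccontr)
    assume "\<not> 0 \<le> n1"
    then have n1: "n1 < 0" by simp
    have "\<forall>\<epsilon>>0. \<exists>r>0. \<forall>w. norm (w - (x, y)) < r \<longrightarrow> ((w - (x, y)) \<bullet> (n1, n2) < - \<epsilon> * norm (w - (x, y)) \<longrightarrow> w \<in> \<Omega>)"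
     using ion unfolding is_outer_normal_def by blast
    from this[rule_format, of "- n1 / 2"] n1 obtain r where r: "r > 0"
     "\<And>w. norm (w - (x, y)) < r \<Longrightarrow> (w - (x, y)) \<bullet> (n1, n2) < - (- n1 / 2) * norm (w - (x, y)) \<Longrightarrow> w \<in> \<Omega>" by auto
    have "(x + r / 2, y) \<in> \<Omega>" by (rule r(2)) (use r(1) n1 in \<open>auto simp: norm_Pair mult_pos_neg\<close>)
    then show False using right_of_CharRight_outside[of x y "r / 2"] G yy r(1) unfolding j by simp
   qed
  qed
  show "\<exists>n1 n2. outer_normal \<Omega> (Gam_arc D j s) = (n1, n2) \<and> outer_normal T (Gam_arc D j s) = (n1, n2) \<and> normal_sign j (Gam_arc D j s) n1 n2"
   unfolding xy fst_conv snd_conv using n12 nT n 1 2 by blast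
 qed
qed

lemma boundary_piece_bound:
 assumes T: "T \<in> \<T>" and v: "v \<in> V"
 shows "- (\<kappa> T * PI T (Inr j) (gsq (v T))) \<le> boundary_form T j v v
   - 1 / 2 * PI T (Inr j) (\<lambda>z. mn T z * wnorm (v T) z)
   + (if j = CharRight then 0 else \<gamma>3 * (real p)\<^sup>2 / diameter (boundary_piece T j) * tangential_form T j v v)"
proof (cases "has_length T j")
 case False
 then show ?thesis by (simp add: curve_integral_no_length[OF T] del: piece_simps)
next
 case True
 have Fc: "boundary_piece T j \<subseteq> closure T" unfolding boundary_piece_def by (auto simp: frontier_def)
 note dF = boundary_piece_diameter[OF T True]
 define \<theta>0 where "\<theta>0 = \<gamma>3 * (real p)\<^sup>2 / diameter (boundary_piece T j)"
 have \<theta>0: "0 < \<theta>0" unfolding \<theta>0_def using gamma p_pos dF by simp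
 have kb: "4 * \<beta>\<^sup>2 / \<theta>0 \<le> \<kappa> T" unfolding \<theta>0_def by (rule kappa_bound(1)[OF T Fc dF gamma(3)])
 \<comment> \<open>No penalty acts on \<open>CharRight\<close>, where the boundary terms are
   nonnegative by themselves.\<close>
 define \<theta> where "\<theta> = (if j = CharRight then 0 else \<theta>0)"
 define A where "A z = (Wgrad D (v T) z \<bullet> outer_normal \<Omega> z) * Mop b c (v T) z" for z
 define J3 where "J3 z = dtan D (v T) z * dtan D (v T) z" for z
 note i = Inr_piece[of j T] and q = V_poly[OF v, of T]
 note tv = poly_traces[OF T i q]
 have tA: "TB T (Inr j) A" unfolding A_def[abs_def]
  by (rule trace_bounded_mult[OF trace_bounded_inner[OF tv(4,5) region_trace_normal[OF T]] tv(6)])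
 have tJ: "TB T (Inr j) J3" unfolding J3_def[abs_def] by (rule trace_bounded_mult[OF dtan_trace[OF T q] dtan_trace[OF T q]])
 have "- \<kappa> T * PI T (Inr j) (gsq (v T)) + 0 * PI T (Inr j) (\<lambda>_. 0) \<le> PI T (Inr j) A
   + (- (1 / 2) * PI T (Inr j) (\<lambda>z. mn T z * wnorm (v T) z) + (0 * PI T (Inr j) (\<lambda>_. 0) + \<theta> * PI T (Inr j) J3))"
 proof (rule PI_combination[OF T i gsq_trace[OF T i q] trace_bounded_const tA wnorm_trace[OF T i q] trace_bounded_const tJ])
  show "AE_curve ((piece_path (Inr j))) (piece_set T (Inr j)) (\<lambda>s. (\<lambda>z. - \<kappa> T * gsq (v T) z + 0 * 0) (piece_path (Inr j) s) \<le>
    (\<lambda>z. A z + (- (1 / 2) * (mn T z * wnorm (v T) z) + (0 * 0 + \<theta> * J3 z))) (piece_path (Inr j) s))"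
   using boundary_normal[OF T, of j] unfolding piece_simps
  proof (eventually_elim, intro impI)
   fix s assume bn: "s \<in> piece_set T (Inr j) \<longrightarrow> velocity (Gam_arc D j) s \<noteq> 0 \<longrightarrow>
   (\<exists>n1 n2. outer_normal \<Omega> (Gam_arc D j s) = (n1, n2) \<and> outer_normal T (Gam_arc D j s) = (n1, n2) \<and> normal_sign j (Gam_arc D j s) n1 n2)"
    and s: "s \<in> piece_set T (Inr j)" "velocity (Gam_arc D j) s \<noteq> 0"
   define z where "z = Gam_arc D j s"
   have zc: "z \<in> closure \<Omega>" using piece_point[OF T i s(1)] unfolding z_def by simp
   define a1 a2 where "a1 = dx (v T) z" and "a2 = dy (v T) z"
   obtain n1 n2 where n12: "outer_normal \<Omega> z = (n1, n2)" "outer_normal T z = (n1, n2)" and n: "n1\<^sup>2 + n2\<^sup>2 = 1"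
    and d: "j \<noteq> CharRight \<longrightarrow> 0 \<le> (b (fst z) * n1 + c (snd z) * n2) * (K (snd z) * n1\<^sup>2 + n2\<^sup>2)"
    and r: "j = CharRight \<longrightarrow> (\<exists>r\<ge>0. K (snd z) = - r\<^sup>2 \<and> 0 \<le> n1 \<and> n2 = - r * n1 \<and> b (fst z) + c (snd z) * r \<le> 0)"
    using bn s unfolding z_def[symmetric] by blast
   have eA: "A z = (K (snd z) * a1 * n1 + a2 * n2) * (b (fst z) * a1 + c (snd z) * a2)"
    unfolding A_def n12 Wgrad_def Mop_def a1_def a2_def by simp
   have eM: "mn T z * wnorm (v T) z = (b (fst z) * n1 + c (snd z) * n2) * (K (snd z) * a1\<^sup>2 + a2\<^sup>2)"
    unfolding mn_def wnorm_def n12 a1_def a2_def by simp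
   have eJ: "J3 z = (n1 * a2 - n2 * a1)\<^sup>2"
    unfolding J3_def dtan_def grad_def tangent_of_def n12 a1_def a2_def by (simp add: power2_eq_square algebra_simps)
   have eg: "gsq (v T) z = a1\<^sup>2 + a2\<^sup>2" unfolding gsq_def a1_def a2_def ..
   have "- \<kappa> T * gsq (v T) z \<le> A z - 1 / 2 * (mn T z * wnorm (v T) z) + \<theta> * J3 z"
   proof (cases "j = CharRight")
    case True
    obtain r where "K (snd z) = - r\<^sup>2" "0 \<le> n1" and n2: "n2 = - r * n1" and "b (fst z) + c (snd z) * r \<le> 0"
     using r True by blast
    from characteristic_nonneg[OF this(1,2,4), of a1 a2]
    have "0 \<le> A z - 1 / 2 * (mn T z * wnorm (v T) z)" unfolding eA eM n2 by simp
    moreover have "0 \<le> \<kappa> T * gsq (v T) z" unfolding eg using kappa_nonneg[OF T] by simp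
    ultimately show ?thesis unfolding \<theta>_def using True by simp
   next
    case False
    have "- \<kappa> T * gsq (v T) z \<le> - (4 * \<beta>\<^sup>2 / \<theta>0) * (a1\<^sup>2 + a2\<^sup>2)"
     unfolding eg by (rule mult_right_mono) (use kb in auto)
    also have "\<dots> \<le> A z - 1 / 2 * (mn T z * wnorm (v T) z) + \<theta>0 * J3 z"
     using dirichlet_lower_bound[OF n \<theta>0 \<beta>[OF zc] d[rule_format, OF False], of a1 a2] unfolding eA eM eJ .
    finally show ?thesis unfolding \<theta>_def using False by simp
   qed
   then show "(\<lambda>z. - \<kappa> T * gsq (v T) z + 0 * 0) (Gam_arc D j s) \<le>
    (\<lambda>z. A z + (- (1 / 2) * (mn T z * wnorm (v T) z) + (0 * 0 + \<theta> * J3 z))) (Gam_arc D j s)"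
    unfolding z_def[symmetric] by simp
  qed
 qed
 then show ?thesis unfolding A_def[symmetric] J3_def[symmetric] \<theta>_def \<theta>0_def by (simp split: if_splits del: piece_simps)
qed

end

section \<open>From almost everywhere to everywhere, and stability of the scheme\<close>

text \<open>The points where f leaves C form an open null set, which is empty.\<close>

lemma AE_open_closed:
 fixes f :: "pt \<Rightarrow> real"
 assumes S: "open S" and f: "continuous_on S f" and C: "closed C" and ae: "AE z in lebesgue. z \<in> S \<longrightarrow> f z \<in> C" and z: "z \<in> S"
 shows "f z \<in> C"
proof (rule ccontr)
 assume n: "f z \<notin> C"
 define A where "A = S \<inter> f -` (- C)"
 have A: "open A" unfolding A_def by (rule continuous_open_preimage[OF f S]) (use C in auto)
 have "A \<in> null_sets lebesgue"
  by (subst AE_iff_null_sets) (use A ae in \<open>auto simp: A_def borel_open sets_completionI_sets\<close>)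
 then have "negligible A" by (simp add: negligible_iff_null_sets)
 then show False using open_not_negligible[OF A] n z unfolding A_def by auto
qed

text \<open>By continuity an essential bound holds everywhere in the open set and then on its
  closure, where the boundary traces are taken.\<close>

lemma Linf_norm_bound:
 assumes S: "open S" "bounded S" and \<phi>: "continuous_on (closure S) \<phi>" and z: "z \<in> closure S"
 shows "\<bar>\<phi> z\<bar> \<le> Linf_norm S \<phi>" unfolding Linf_norm_def
proof (rule cInf_greatest)
 have "compact (closure S)" using S(2) by (simp add: compact_closure)
 then obtain B where B: "\<And>z. z \<in> closure S \<Longrightarrow> \<bar>\<phi> z\<bar> \<le> B"
  using compact_imp_bounded[OF compact_continuous_image[OF \<phi>]] unfolding bounded_iff by auto
 have "\<bar>\<phi> z\<bar> \<le> \<bar>B\<bar>" if "z \<in> S" for z using B[of z] that closure_subset by fastforce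
 then show "{C. 0 \<le> C \<and> (AE z in lebesgue. z \<in> S \<longrightarrow> \<bar>\<phi> z\<bar> \<le> C)} \<noteq> {}" by (auto intro!: exI[of _ "\<bar>B\<bar>"])
 fix C assume C: "C \<in> {C. 0 \<le> C \<and> (AE z in lebesgue. z \<in> S \<longrightarrow> \<bar>\<phi> z\<bar> \<le> C)}"
 have a: "continuous_on (closure S) (\<lambda>z. \<bar>\<phi> z\<bar>)" by (intro continuous_intros \<phi>)
 have "\<bar>\<phi> w\<bar> \<in> {..C}" if "w \<in> S" for w
  by (rule AE_open_closed[OF S(1) continuous_on_subset[OF a closure_subset] _ _ that]) (use C in auto)
 then show "\<bar>\<phi> z\<bar> \<le> C" using continuous_le_on_closure[OF a z] by auto
qed

text \<open>On the line from x through w the polynomial depends on one variable, and it has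
  infinitely many roots close to x.\<close>

lemma poly_space_eq_zero:
 assumes q: "q \<in> poly_space p" and S: "open S" "x \<in> S" and 0: "\<And>z. z \<in> S \<Longrightarrow> q z = 0"
 shows "q = (\<lambda>_. 0)"
proof
 fix w
 obtain a where a: "q = (\<lambda>(x, y). \<Sum>i\<le>p. \<Sum>j\<le>p - i. a i j * x ^ i * y ^ j)" using q unfolding poly_space_def by auto
 define P where "P = (\<Sum>i\<le>p. \<Sum>j\<le>p - i. [:a i j:] * [:fst x, fst w - fst x:] ^ i * [:snd x, snd w - snd x:] ^ j)"
 have P: "poly P t = q (x + t *\<^sub>R (w - x))" for t
  unfolding P_def a by (simp add: poly_sum case_prod_beta algebra_simps)
 obtain e where e: "0 < e" "ball x e \<subseteq> S" using S openE by blast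
 have "P = 0"
 proof (rule ccontr)
  assume "P \<noteq> 0"
  then have fin: "finite {t. poly P t = 0}" by (rule poly_roots_finite)
  define d where "d = e / (1 + norm (w - x))"
  have pos: "0 < 1 + norm (w - x)" by (simp add: add_pos_nonneg)
  have d: "0 < d" unfolding d_def using e pos by simp
  have "{0<..<d} \<subseteq> {t. poly P t = 0}"
  proof
   fix t assume t: "t \<in> {0<..<d}"
   have "t * norm (w - x) \<le> t * (1 + norm (w - x))" using t by simp
   also have "\<dots> < e" using t pos unfolding d_def by (simp add: field_simps)
   finally have "x + t *\<^sub>R (w - x) \<in> ball x e" using t by (simp add: dist_norm)
   then have "x + t *\<^sub>R (w - x) \<in> S" using e(2) by blast
   then show "t \<in> {t. poly P t = 0}" using 0 by (simp add: P)
  qed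
  then have "finite {0<..<d}" using fin finite_subset by blast
  then show False using d infinite_Ioo by blast
 qed
 then show "q w = 0" using P[of 1] by simp
qed

context tricomi_stable
begin

text \<open>The trace inequality is applied to both partial derivatives. The powers of p and of the
  diameter in it cancel against those in \<open>\<kappa> T\<close>.\<close>

lemma PI_gsq_bound:
 assumes T: "T \<in> \<T>" and q: "q \<in> poly_space p"
 shows "\<kappa> T * (\<Sum>i\<in>pieces T. PI T i (gsq q)) \<le> \<delta> / 4 * (LINT z:T|lebesgue. gsq q z)"
proof -
 define d where "d = diameter T"
 have d: "0 < d" unfolding d_def by (rule element_diameter(2)[OF T])
 have dq: "dx q \<in> poly_space p" "dy q \<in> poly_space p" using poly_space_derivatives(2,3)[OF q] by auto
 have sq: "set_integrable lebesgue T (\<lambda>z. (r z)\<^sup>2)" if "r \<in> poly_space p" for r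
  by (intro element_continuous_integrable[OF T] continuous_intros poly_space_continuous[OF that])
 have tb: "TB T i (\<lambda>z. (r z)\<^sup>2)" if "r \<in> poly_space p" "i \<in> pieces T" for r i
  by (rule trace_bounded_power2[OF poly_traces(1)[OF T that(2,1)]])
 define Y where "Y r = (LINT z:T|lebesgue. (r z :: real)\<^sup>2)" for r
 have Y0: "0 \<le> Y r" for r unfolding Y_def set_lebesgue_integral_def by (rule integral_nonneg_AE) (auto simp: indicator_def)
 define X where "X r = (\<Sum>i\<in>pieces T. PI T i (\<lambda>z. (r z)\<^sup>2))" for r
 have main: "X r \<le> Ctr\<^sup>2 * (real p)\<^sup>2 / d * Y r" if r: "r \<in> poly_space p" for r
 proof -
  have X0: "0 \<le> X r" unfolding X_def by (intro sum_nonneg PI_nonneg[OF T] tb[OF r]) auto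
  have dd: "(d powr (- (1 / 2)))\<^sup>2 = 1 / d"
   unfolding power2_eq_square powr_add[symmetric] using d by (simp add: powr_minus_divide)
  have "X r = (sqrt (X r))\<^sup>2" using X0 by simp
  also have "\<dots> \<le> (Ctr * real p * d powr (- (1 / 2)) * sqrt (Y r))\<^sup>2"
   using trace[OF T r] X0 unfolding elem_boundary_integral_eq[OF T] d_def[symmetric] X_def Y_def by (intro power_mono) auto
  also have "\<dots> = Ctr\<^sup>2 * (real p)\<^sup>2 / d * Y r" using Y0 by (simp add: power_mult_distrib dd)
  finally show ?thesis .
 qed
 have "(\<Sum>i\<in>pieces T. PI T i (gsq q)) = X (dx q) + X (dy q)" unfolding X_def gsq_def[abs_def] sum.distrib[symmetric]
  by (intro sum.cong refl PI_add[OF T] tb dq)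
 moreover have Z: "(LINT z:T|lebesgue. gsq q z) = Y (dx q) + Y (dy q)"
  unfolding gsq_def Y_def by (rule set_integral_add(2)[OF sq[OF dq(1)] sq[OF dq(2)]])
 ultimately have "(\<Sum>i\<in>pieces T. PI T i (gsq q)) \<le> Ctr\<^sup>2 * (real p)\<^sup>2 / d * (LINT z:T|lebesgue. gsq q z)"
  using main[OF dq(1)] main[OF dq(2)] by (simp add: distrib_left)
 then have "\<kappa> T * (\<Sum>i\<in>pieces T. PI T i (gsq q)) \<le> \<kappa> T * (Ctr\<^sup>2 * (real p)\<^sup>2 / d * (LINT z:T|lebesgue. gsq q z))"
  by (rule mult_left_mono) (rule kappa_nonneg[OF T])
 also have "\<dots> = 4 * \<beta>\<^sup>2 * Ctr\<^sup>2 / \<gamma> * (LINT z:T|lebesgue. gsq q z)"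
  unfolding \<kappa>_def d_def[symmetric] using d p_pos gamma(1) by (simp add: field_simps)
 also have "\<dots> \<le> \<delta> / 4 * (LINT z:T|lebesgue. gsq q z)"
 proof (rule mult_right_mono)
  have "0 \<le> \<beta>\<^sup>2 * Ctr\<^sup>2" by simp
  then have "16 * \<beta>\<^sup>2 * Ctr\<^sup>2 \<le> \<gamma> * \<delta>" using gamma(4) by linarith
  then show "4 * \<beta>\<^sup>2 * Ctr\<^sup>2 / \<gamma> \<le> \<delta> / 4" using gamma(1) by (simp add: field_simps)
  show "0 \<le> (LINT z:T|lebesgue. gsq q z)" unfolding Z using Y0 by simp
 qed
 finally show ?thesis .
qed

text \<open>The \<gamma>1 penalties are not spent on the absorption and are kept on the left. They
  control the constants on which the gradient term has no hold.\<close>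

theorem stability:
 assumes v: "v \<in> V"
 shows "\<delta> / 4 * (\<Sum>T\<in>\<T>. LINT z:T|lebesgue. gsq (v T) z)
   + (\<Sum>F\<in>\<F>. \<gamma>1 / diameter F ^ 3 * jump_form F v v)
   + (\<Sum>T\<in>\<T>. \<Sum>j\<in>{Upper, CharLeft}. \<gamma>1 / diameter (boundary_piece T j) ^ 3 *
     boundary_jump_form T j v v)
   \<le> A_h D b c \<T> v v + A_J D \<T> p \<gamma>1 \<gamma>2 \<gamma>3 v v" (is "_ + ?J1 + ?J2 \<le> _")
proof -
 define E where "E T = (LINT z:T|lebesgue. gsq (v T) z)" for T
 define W where "W T = (weak_form T v v)" for T
 define M where "M T i = PI T i (\<lambda>z. mn T z * wnorm (v T) z)" for T i
 define G where "G T i = PI T i (gsq (v T))" for T i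
 define S where "S F = consistency F v v" for F
 define R where "R T j = boundary_form T j v v" for T j
 define J3 where "J3 F = \<gamma>2 * (real p)\<^sup>2 / diameter F * gradient_jump_form F v v" for F
 define J4 where "J4 T j = \<gamma>3 * (real p)\<^sup>2 / diameter (boundary_piece T j) * tangential_form T j v v" for T j
 have split: "(\<Sum>T\<in>\<T>. \<Sum>i\<in>pieces T. f T i) = (\<Sum>F\<in>\<F>. \<Sum>T\<in>sides F. f T (Inl F)) + (\<Sum>T\<in>\<T>. \<Sum>j\<in>UNIV. f T (Inr j))"
  for f :: "pt set \<Rightarrow> pt set + boundary_part \<Rightarrow> real"
 proof -
  have "(\<Sum>T\<in>\<T>. \<Sum>i\<in>pieces T. f T i) = (\<Sum>T\<in>\<T>. (\<Sum>F\<in>elem_facets T. f T (Inl F)) + (\<Sum>j\<in>UNIV. f T (Inr j)))"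
   by (rule sum.cong[OF refl sum_pieces])
  then show ?thesis unfolding sum.distrib sum_interior_facets .
 qed
 have "(\<Sum>T\<in>\<T>. \<delta> / 2 * E T - 1 / 2 * (\<Sum>i\<in>pieces T. M T i)) \<le> (\<Sum>T\<in>\<T>. - W T)"
  by (rule sum_mono) (use element_energy[OF _ V_poly[OF v]] in \<open>simp add: E_def W_def M_def gsq_def mn_def\<close>)
 then have 1: "\<delta> / 2 * (\<Sum>T\<in>\<T>. E T) - 1 / 2 * (\<Sum>T\<in>\<T>. \<Sum>i\<in>pieces T. M T i) \<le> - (\<Sum>T\<in>\<T>. W T)"
  by (simp only: sum_subtractf sum_distrib_left sum_negf)
 have "(\<Sum>F\<in>\<F>. - (\<Sum>T\<in>sides F. \<kappa> T * G T (Inl F))) \<le>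
   (\<Sum>F\<in>\<F>. S F - 1 / 2 * (\<Sum>T\<in>sides F. M T (Inl F)) + J3 F)"
  unfolding G_def S_def M_def J3_def by (rule sum_mono) (rule interior_facet_bound[OF _ v])
 then have 2: "- (\<Sum>F\<in>\<F>. \<Sum>T\<in>sides F. \<kappa> T * G T (Inl F)) \<le>
   (\<Sum>F\<in>\<F>. S F) - 1 / 2 * (\<Sum>F\<in>\<F>. \<Sum>T\<in>sides F. M T (Inl F)) + (\<Sum>F\<in>\<F>. J3 F)"
  by (simp only: sum.distrib sum_subtractf sum_distrib_left sum_negf)
 have "(\<Sum>T\<in>\<T>. \<Sum>j\<in>UNIV. - (\<kappa> T * G T (Inr j))) \<le>
   (\<Sum>T\<in>\<T>. \<Sum>j\<in>UNIV. R T j - 1 / 2 * M T (Inr j) + (if j = CharRight then 0 else J4 T j))"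
  unfolding G_def R_def M_def J4_def by (intro sum_mono boundary_piece_bound v)
 moreover have "(\<Sum>j\<in>UNIV. if j = CharRight then 0 else J4 T j) = (\<Sum>j\<in>{Upper, CharLeft}. J4 T j)" for T
  unfolding UNIV_boundary_part by simp
 ultimately have 3: "- (\<Sum>T\<in>\<T>. \<Sum>j\<in>UNIV. \<kappa> T * G T (Inr j)) \<le>
   (\<Sum>T\<in>\<T>. \<Sum>j\<in>UNIV. R T j) - 1 / 2 * (\<Sum>T\<in>\<T>. \<Sum>j\<in>UNIV. M T (Inr j)) + (\<Sum>T\<in>\<T>. \<Sum>j\<in>{Upper, CharLeft}. J4 T j)"
  by (simp only: sum.distrib sum_subtractf sum_distrib_left sum_negf)
 have "(\<Sum>T\<in>\<T>. \<Sum>i\<in>pieces T. \<kappa> T * G T i) \<le> (\<Sum>T\<in>\<T>. \<delta> / 4 * E T)"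
 proof (rule sum_mono)
  fix T assume "T \<in> \<T>"
  from PI_gsq_bound[OF this V_poly[OF v]] show "(\<Sum>i\<in>pieces T. \<kappa> T * G T i) \<le> \<delta> / 4 * E T"
   unfolding G_def E_def sum_distrib_left .
 qed
 then have 4: "(\<Sum>T\<in>\<T>. \<Sum>i\<in>pieces T. \<kappa> T * G T i) \<le> \<delta> / 4 * (\<Sum>T\<in>\<T>. E T)" by (simp only: sum_distrib_left)
 \<comment> \<open>When the estimates are added, the boundary integrals M of the element
   inequalities cancel against those of the facet bounds, and the terms with \<kappa> use up half of
   \<delta> / 2.\<close>
 have "\<delta> / 4 * (\<Sum>T\<in>\<T>. E T) \<le> - (\<Sum>T\<in>\<T>. W T) + (\<Sum>F\<in>\<F>. S F) + (\<Sum>T\<in>\<T>. \<Sum>j\<in>UNIV. R T j)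
   + (\<Sum>F\<in>\<F>. J3 F) + (\<Sum>T\<in>\<T>. \<Sum>j\<in>{Upper, CharLeft}. J4 T j)"
  using 1 2 3 4 split[of M] split[of "\<lambda>T i. \<kappa> T * G T i"] by linarith
 then show ?thesis unfolding A_h_eq A_J_eq
  unfolding E_def[symmetric] W_def[symmetric] S_def[symmetric] R_def[symmetric] J3_def[symmetric] J4_def[symmetric] by linarith
qed

lemma gradient_zero_constant:
 assumes T: "T \<in> \<T>" and q: "q \<in> poly_space p" and 0: "(LINT z:T|lebesgue. gsq q z) = 0"
 shows "\<exists>r. \<forall>z\<in>closure T. q z = r"
proof -
 have dq: "dx q \<in> poly_space p" "dy q \<in> poly_space p" using poly_space_derivatives(2,3)[OF q] by auto
 have cont: "continuous_on S (gsq q)" for S unfolding gsq_def[abs_def]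
  by (intro continuous_intros poly_space_continuous[OF dq(1)] poly_space_continuous[OF dq(2)])
 have i: "integrable lebesgue (\<lambda>z. indicator T z *\<^sub>R gsq q z)"
  using element_continuous_integrable[OF T cont] unfolding set_integrable_def .
 have nn: "0 \<le> gsq q z" for z unfolding gsq_def by simp
 have "AE z in lebesgue. indicator T z *\<^sub>R gsq q z = 0"
  using integral_nonneg_eq_0_iff_AE[OF i] 0 nn unfolding set_lebesgue_integral_def by (auto simp: indicator_def)
 then have ae: "AE z in lebesgue. z \<in> T \<longrightarrow> gsq q z \<in> {0}" by eventually_elim auto
 have g0: "gsq q z = 0" if "z \<in> T" for z using AE_open_closed[OF open_element[OF T] cont _ ae that] by auto
 have der: "(q has_derivative (\<lambda>_. 0)) (at z)" if z: "z \<in> T" for z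
 proof -
  have "dx q z = 0" "dy q z = 0" using g0[OF z] unfolding gsq_def by (simp_all add: sum_power2_eq_zero_iff)
  then show ?thesis using poly_space_derivatives(1)[OF q, of z] by simp
 qed
 obtain x \<rho> where st: "star_domain T x \<rho>" using star_element[OF T] by blast
 interpret star_domain T x \<rho> by (rule st)
 have x: "x \<in> T" "x \<in> ball x \<rho>" using ball_subset rho_pos by auto
 have "starlike T" unfolding starlike_def using star x unfolding star_shaped_wrt_ball_def by blast
 from has_derivative_zero_unique_connected[OF open_T starlike_imp_connected[OF this] der _ x(1)]
 have "q z = q x" if "z \<in> T" for z using that by blast
 from continuous_constant_on_closure[OF poly_space_continuous[OF q] this] show ?thesis by (intro exI[of _ "q x"] ballI)
qed

text \<open>\<open>stability\<close> bounds the form below by three nonnegative sums. If the form is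
  not positive, every summand vanishes, and v is shown to be zero.\<close>

theorem coercive:
 assumes v: "v \<in> V" and nz: "v \<noteq> (\<lambda>_ _. 0)"
 shows "0 < A_h D b c \<T> v v + A_J D \<T> p \<gamma>1 \<gamma>2 \<gamma>3 v v"
proof (rule ccontr)
 assume le: "\<not> 0 < A_h D b c \<T> v v + A_J D \<T> p \<gamma>1 \<gamma>2 \<gamma>3 v v"
 define E where "E T = (LINT z:T|lebesgue. gsq (v T) z)" for T
 define J1 where "J1 F = jump_form F v v" for F
 define J2 where "J2 T j = boundary_jump_form T j v v" for T j
 have q: "v T \<in> poly_space p" for T by (rule V_poly[OF v])
 have E0: "0 \<le> E T" for T unfolding E_def set_lebesgue_integral_def gsq_def
  by (rule integral_nonneg_AE) (auto simp: indicator_def)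
 have J1: "0 \<le> \<gamma>1 / diameter F ^ 3 * J1 F" if F: "F \<in> \<F>" for F
 proof -
  obtain T T' where T: "T \<in> \<T>" "sides F = {T, T'}" "F \<in> elem_facets T" by (rule interior_facet_neighbours[OF F])
  then have S: "T \<in> sides F" by simp
  have "TB T (Inl F) (\<lambda>z. jump \<T> F v z \<bullet> jump \<T> F v z)"
   by (rule jump_inner_trace[OF F S facet_traces(2)[OF F S _ q] facet_traces(2)[OF F S _ q]])
  from PI_nonneg[OF T(1) Inl_piece[OF T(3)] this inner_ge_zero]
  have "0 \<le> J1 F" unfolding J1_def segment_integral_piece[of F _ T] .
  then show ?thesis using penalties(1) facet_diameter[OF F] by simp
 qed
 have n2: "TB T (Inr j) (\<lambda>z. outer_normal \<Omega> z \<bullet> outer_normal \<Omega> z)" if "T \<in> \<T>" for T j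
  by (rule trace_bounded_inner[OF trace_bounded_normal_components[OF region_trace_normal[OF that]] region_trace_normal[OF that]])
 have J2': "J2 T j = PI T (Inr j) (\<lambda>z. (outer_normal \<Omega> z \<bullet> outer_normal \<Omega> z) * (v T z)\<^sup>2)" for T j
  unfolding J2_def power2_eq_square inner_scaleR_left inner_scaleR_right
  by (rule arg_cong[where f = "PI T (Inr j)"], intro ext) (simp only: ac_simps)
 have J2: "0 \<le> \<gamma>1 / diameter (boundary_piece T j) ^ 3 * J2 T j" if T: "T \<in> \<T>" for T j
 proof -
  have "0 \<le> J2 T j" unfolding J2'
   by (rule PI_nonneg[OF T Inr_piece trace_bounded_mult[OF n2[OF T] trace_bounded_power2[OF poly_traces(1)[OF T Inr_piece q]]]]) simp
  moreover have "0 \<le> diameter (boundary_piece T j)"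
   by (rule diameter_ge_0[OF bounded_subset[OF bounded_closure[OF element_diameter(1)[OF T]]]]) (auto simp: boundary_piece_def frontier_def)
  ultimately show ?thesis using penalties(1) by simp
 qed
 have s: "\<delta> / 4 * (\<Sum>T\<in>\<T>. E T) + (\<Sum>F\<in>\<F>. \<gamma>1 / diameter F ^ 3 * J1 F)
   + (\<Sum>T\<in>\<T>. \<Sum>j\<in>{Upper, CharLeft}. \<gamma>1 / diameter (boundary_piece T j) ^ 3 * J2 T j) \<le> 0"
  using stability[OF v] le unfolding E_def J1_def J2_def by linarith
 have a: "0 \<le> (\<Sum>T\<in>\<T>. E T)" using E0 by (rule sum_nonneg)
 have b': "0 \<le> (\<Sum>F\<in>\<F>. \<gamma>1 / diameter F ^ 3 * J1 F)" using J1 by (rule sum_nonneg)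
 have c': "0 \<le> (\<Sum>T\<in>\<T>. \<Sum>j\<in>{Upper, CharLeft}. \<gamma>1 / diameter (boundary_piece T j) ^ 3 * J2 T j)"
  using J2 by (intro sum_nonneg) auto
 have a': "0 \<le> \<delta> / 4 * (\<Sum>T\<in>\<T>. E T)" using a delta_pos by simp
 have z1: "\<delta> / 4 * (\<Sum>T\<in>\<T>. E T) = 0" and z2: "(\<Sum>F\<in>\<F>. \<gamma>1 / diameter F ^ 3 * J1 F) = 0"
  and z3: "(\<Sum>T\<in>\<T>. \<Sum>j\<in>{Upper, CharLeft}. \<gamma>1 / diameter (boundary_piece T j) ^ 3 * J2 T j) = 0"
  using s a' b' c' by linarith+
 have "\<exists>r. \<forall>z\<in>closure T. v T z = r" if T: "T \<in> \<T>" for T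
 proof -
  have "E T = 0" using z1 delta_pos sum_nonneg_eq_0_iff[OF finite_mesh, of E] E0 T by simp
  then have "(LINT z:T|lebesgue. gsq (v T) z) = 0" unfolding E_def .
  then show ?thesis by (rule gradient_zero_constant[OF T q])
 qed
 then have "\<forall>T\<in>\<T>. \<exists>r. \<forall>z\<in>closure T. v T z = r" by (rule ballI)
 from bchoice[OF this] obtain r where r': "\<forall>T\<in>\<T>. \<forall>z\<in>closure T. v T z = r T" by (rule exE)
 note r = r'[rule_format]
 \<comment> \<open>On a facet the squared jump of a piecewise constant function is the constant (r S
   - r S')^2, and the facet has positive length.\<close>
 have eq: "r T = r T'" if F: "F \<in> \<F>" and fe: "sides F = {T, T'}" for F T T'
 proof -
  have "\<gamma>1 / diameter F ^ 3 * J1 F = 0" by (rule sum_nonneg_0[OF finite_interior_facets _ z2 F]) (rule J1)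
  then have J0: "J1 F = 0" using penalties(1) facet_diameter[OF F] by simp
  obtain S S' where S: "S \<in> \<T>" "S' \<in> \<T>" "S \<noteq> S'" and fe': "sides F = {S, S'}"
   and e: "F \<in> elem_facets S" and FT: "F = frontier S \<inter> frontier S'"
   and nrm: "AE s in lebesgue. s \<in> {0..1} \<longrightarrow> opposite_normals S S' (segment_path F s)"
   by (rule interior_facet_neighbours[OF F])
  have "J1 F = PI S (Inl F) (\<lambda>_. (r S - r S')\<^sup>2)" unfolding J1_def segment_integral_piece[of F _ S]
  proof (rule PI_cong_AE[OF S(1) Inl_piece[OF e] trace_bounded_const])
   show "AE_curve ((piece_path (Inl F))) (piece_set S (Inl F)) (\<lambda>s. jump \<T> F v (piece_path (Inl F) s) \<bullet> jump \<T> F v (piece_path (Inl F) s) = (r S - r S')\<^sup>2)"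
    using nrm
   proof (eventually_elim, intro impI)
    fix s assume n: "s \<in> {0..1} \<longrightarrow> opposite_normals S S' (segment_path F s)" and s: "s \<in> piece_set S (Inl F)"
    define z where "z = segment_path F s"
    have "z \<in> F" using piece_image_eq[OF S(1) Inl_piece[OF e]] s unfolding z_def by auto
    then have zS: "z \<in> closure S" "z \<in> closure S'" using FT by (auto simp: frontier_def)
    have s01: "s \<in> {0..1}" using s piece_set_subset by blast
    have n': "norm (outer_normal S z) = 1" "outer_normal S' z = - outer_normal S z" using n s01 unfolding z_def by auto
    have "jump \<T> F v z = (r S - r S') *\<^sub>R outer_normal S z"
     unfolding jump_def fe' using S(3) by (simp add: r[OF S(1) zS(1)] r[OF S(2) zS(2)] n'(2) algebra_simps)
    moreover have "outer_normal S z \<bullet> outer_normal S z = 1" using n'(1) by (simp add: dot_square_norm)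
    ultimately show "jump \<T> F v (piece_path (Inl F) s) \<bullet> jump \<T> F v (piece_path (Inl F) s) = (r S - r S')\<^sup>2"
     unfolding piece_simps z_def[symmetric] by (simp add: power2_eq_square)
   qed
  qed
  also have "\<dots> = (r S - r S')\<^sup>2 * PI S (Inl F) (\<lambda>_. 1)" using PI_cmult[where T = S and i = "Inl F" and r = "(r S - r S')\<^sup>2" and \<phi> = "\<lambda>_. 1"] by simp
  finally have p0: "(r S - r S')\<^sup>2 * PI S (Inl F) (\<lambda>_. 1) = 0" using J0 by simp
  obtain a a' where ab: "a \<noteq> a'" "segment_path F = linepath a a'" by (rule elem_facetE[OF S(1) e])
  have "PI S (Inl F) (\<lambda>_. 1) = norm (a' - a)"
   unfolding curve_integral_piece unfolding piece_simps ab(2) piece_set_facet[OF S(1) e]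
   by (simp add: vector_derivative_linepath_at set_lebesgue_integral_def)
  then have "r S = r S'" using p0 ab(1) by simp
  then show ?thesis using fe fe' S(3) by (auto simp: doubleton_eq_iff)
 qed
 \<comment> \<open>The penalty on \<open>CharLeft\<close> makes the constant on this element vanish;
   by \<open>mesh_connected\<close> all others equal it.\<close>
 obtain T0 where T0: "T0 \<in> \<T>" "has_length T0 CharLeft" using exists_CharLeft_facet by blast
 have "(\<Sum>j\<in>{Upper, CharLeft}. \<gamma>1 / diameter (boundary_piece T0 j) ^ 3 * J2 T0 j) = 0"

  by (rule sum_nonneg_0[OF finite_mesh _ z3 T0(1)]) (rule sum_nonneg, rule J2)
 from sum_nonneg_0[OF finite_parts _ this, of CharLeft]
 have "\<gamma>1 / diameter (boundary_piece T0 CharLeft) ^ 3 * J2 T0 CharLeft = 0" using J2[OF T0(1)] by simp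
 then have J0: "J2 T0 CharLeft = 0" using penalties(1) boundary_piece_diameter[OF T0] by simp
 have "J2 T0 CharLeft = PI T0 (Inr CharLeft) (\<lambda>_. (r T0)\<^sup>2)" unfolding J2'
 proof (rule PI_cong_AE[OF T0(1) Inr_piece trace_bounded_const])
  show "AE_curve ((piece_path (Inr CharLeft))) (piece_set T0 (Inr CharLeft)) (\<lambda>s. outer_normal \<Omega> (piece_path (Inr CharLeft) s) \<bullet> outer_normal \<Omega> (piece_path (Inr CharLeft) s) * (v T0 (piece_path (Inr CharLeft) s))\<^sup>2 = (r T0)\<^sup>2)"
   using region_normal_AE[OF T0(1), of CharLeft]
  proof (eventually_elim, intro impI)
   fix s assume n: "s \<in> piece_set T0 (Inr CharLeft) \<longrightarrow> velocity (Gam_arc D CharLeft) s \<noteq> 0 \<longrightarrow>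
   region_normal T0 CharLeft s"
    and s: "s \<in> piece_set T0 (Inr CharLeft)" "velocity (piece_path (Inr CharLeft)) s \<noteq> 0"
   have "norm (outer_normal \<Omega> (piece_path (Inr CharLeft) s)) = 1" using n s is_outer_normal_norm unfolding piece_simps by blast
   moreover have "v T0 (piece_path (Inr CharLeft) s) = r T0" using r[OF T0(1)] piece_point[OF T0(1) Inr_piece s(1)] by blast
   ultimately show "outer_normal \<Omega> (piece_path (Inr CharLeft) s) \<bullet> outer_normal \<Omega> (piece_path (Inr CharLeft) s) * (v T0 (piece_path (Inr CharLeft) s))\<^sup>2 = (r T0)\<^sup>2"
    by (simp only: dot_square_norm) simp
  qed
 qed
 also have "\<dots> = (r T0)\<^sup>2 * PI T0 (Inr CharLeft) (\<lambda>_. 1)" using PI_cmult[where T = T0 and i = "Inr CharLeft" and r = "(r T0)\<^sup>2" and \<phi> = "\<lambda>_. 1"] by simp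
 finally have "(r T0)\<^sup>2 * PI T0 (Inr CharLeft) (\<lambda>_. 1) = 0" using J0 by simp
 moreover have "0 < PI T0 (Inr CharLeft) (\<lambda>_. 1)" using T0(2) unfolding has_length_def piece_simps .
 ultimately have r0: "r T0 = 0" by simp
 have "v T = (\<lambda>_. 0)" for T
 proof (cases "T \<in> \<T>")
  case True
  have "r T = 0" using mesh_connected[of r, OF eq True T0(1)] r0 by simp
  then have z: "v T z = 0" if "z \<in> T" for z using r[OF True subsetD[OF closure_subset that]] \<open>r T = 0\<close> by simp
  have "T \<noteq> {}" using element_diameter(2)[OF True] by auto
  then obtain x where "x \<in> T" by (auto simp del: split_paired_Ex)
  from poly_space_eq_zero[OF q open_element[OF True] this z] show ?thesis .
 next
  case False
  then show ?thesis using v V_sub unfolding broken_poly_space_def by blast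
 qed
 then show False using nz by (auto simp: fun_eq_iff)
qed

end

text \<open>The radius in the mesh condition is proportional to the diameter, which is positive
  because a nonempty open set contains two distinct points.\<close>

lemma star_domain_element:
 assumes T: "open T" "T \<noteq> {}" "bounded T" and r: "0 < r" and star: "\<exists>x\<in>T. star_shaped_wrt_ball T x (r * diameter T)"
 shows "\<exists>x \<rho>. star_domain T x \<rho>"
proof -
 obtain x where st: "star_shaped_wrt_ball T x (r * diameter T)" using star by (rule bexE)
 obtain y where y: "y \<in> T" using T(2) by (auto simp del: split_paired_Ex)
 obtain e where e: "0 < e" "ball y e \<subseteq> T" by (rule openE[OF T(1) y])
 have "y + (e / 2, 0) \<in> T" using e(1) by (intro subsetD[OF e(2)]) (simp add: dist_norm norm_Pair)
 from diameter_bounded_bound[OF T(3) y this] have "0 < diameter T" using e(1) by (simp add: dist_norm norm_Pair)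
 then have "star_domain T x (r * diameter T)" using T r st unfolding star_domain_def by simp
 then show ?thesis by (intro exI)
qed

theorem corollary3p9:
  fixes D :: tricomi_data
    and b c :: "real \<Rightarrow> real"
    and H :: "real set" and \<T> :: "real \<Rightarrow> pt set set"
    and f g gt :: "pt \<Rightarrow> real"
    and V :: "broken set"
    and p :: nat
    and h \<delta> rstar Cg Ctr \<gamma>1 \<gamma>2 \<gamma>3 \<beta> \<gamma>star :: real
  assumes "tricomi_domain D"
    and "admissible_multiplier D b c \<delta>"
    and "mesh_family D H \<T> rstar Cg"
    and "trace_constant D H \<T> Ctr"
    and "L2_on (region D) f"
    and "boundary_data D g gt"
    and "\<beta> = beta_const D b c"
    and "\<gamma>star = 288 * \<beta>\<^sup>2 * Ctr\<^sup>2 / \<delta>"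
    and "\<gamma>1 > 0" and "\<gamma>2 > \<gamma>star" and "\<gamma>3 > \<gamma>star"
    and "h \<in> H"
    and "p \<ge> 1"
    and "V \<subseteq> broken_poly_space p (\<T> h)" and "linear_subspace V"
  shows "\<exists>!u. u \<in> V \<and>
    (\<forall>v \<in> V. A_h D b c (\<T> h) u v + A_J D (\<T> h) p \<gamma>1 \<gamma>2 \<gamma>3 u v = L_h D b c (\<T> h) p \<gamma>1 \<gamma>3 f g gt v)"
proof -
 interpret tricomi D by standard (rule assms(1))
 have mf: "is_mesh D (\<T> h)" "0 < rstar"
  and star: "\<And>T. T \<in> \<T> h \<Longrightarrow> \<exists>x\<in>T. star_shaped_wrt_ball T x (rstar * diameter T)"
  using assms(3,12) unfolding mesh_family_def by blast+
 interpret tricomi_mesh D "\<T> h"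
 proof
  show "is_mesh D (\<T> h)" by (rule mf(1))
  fix T assume T: "T \<in> \<T> h"
  have "open T \<and> T \<noteq> {} \<and> T \<subseteq> \<Omega>"
   by (rule bspec[OF mf(1)[unfolded is_mesh_def, THEN conjunct2, THEN conjunct1] T])
  then have o: "open T" "T \<noteq> {}" "T \<subseteq> \<Omega>" by simp_all
  show "\<exists>x \<rho>. star_domain T x \<rho>"
   by (rule star_domain_element[OF o(1,2) bounded_subset[OF bounded_region o(3)] mf(2) star[OF T]])
 qed
 interpret tricomi_multiplier D "\<T> h" b c \<delta> by standard (rule assms(2))
 interpret tricomi_scheme D "\<T> h" b c \<delta> p V by standard (rule assms(14,15))+
 interpret tricomi_stable D "\<T> h" b c \<delta> p V \<beta> Ctr \<gamma>1 \<gamma>2 \<gamma>3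
 proof
  have L: "\<bar>\<phi> z\<bar> \<le> Linf_norm \<Omega> \<phi>" if "z \<in> closure \<Omega>" "continuous_on (closure \<Omega>) \<phi>" for \<phi> z
   by (rule Linf_norm_bound[OF open_region bounded_region that(2,1)])
  fix z assume z: "z \<in> closure \<Omega>"
  show "\<bar>K (snd z) * b (fst z)\<bar> \<le> \<beta>" "\<bar>b (fst z)\<bar> \<le> \<beta>" "\<bar>K (snd z) * c (snd z)\<bar> \<le> \<beta>" "\<bar>c (snd z)\<bar> \<le> \<beta>"
   unfolding assms(7) beta_const_def Let_def case_prod_beta
   using L[OF z continuous_on_mult[OF continuous_coefficients(3,1)]] L[OF z continuous_coefficients(1)]
    L[OF z continuous_on_mult[OF continuous_coefficients(3,2)]] L[OF z continuous_coefficients(2)]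
   by (simp_all add: le_max_iff_disj)
 next
  show "1 \<le> p" by (rule assms(13))
  show "sqrt (elem_boundary_integral D (\<T> h) T (\<lambda>z. (q z)\<^sup>2)) \<le> Ctr * real p * diameter T powr (- (1 / 2)) * sqrt (LINT z:T|lebesgue. (q z)\<^sup>2)"
   if "T \<in> \<T> h" "q \<in> poly_space p" for T q
   using assms(4,12,13) that unfolding trace_constant_def by blast
 qed (use assms(8-11) in auto)
 let ?B = "\<lambda>u v. A_h D b c (\<T> h) u v + A_J D (\<T> h) p \<gamma>1 \<gamma>2 \<gamma>3 u v"
 let ?L = "L_h D b c (\<T> h) p \<gamma>1 \<gamma>3 f g gt"
 note B = bilinear_scheme[of \<gamma>1 \<gamma>2 \<gamma>3] and L = linear_data[OF assms(5,6), of \<gamma>1 \<gamma>3]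
 have fin: "finite (\<T> h \<times> {..p} \<times> {..p})" using finite_mesh by simp
 obtain u where u: "u \<in> V" "\<forall>v\<in>V. ?B u v = ?L v"
  using coercive_solvable[OF fin V_lin subset_trans[OF V_sub broken_poly_space_combinations[OF finite_mesh]] B L coercive] by blast
 show ?thesis
 proof (rule ex1I[of _ u])
  show "u \<in> V \<and> (\<forall>v\<in>V. ?B u v = ?L v)" using u by blast
  fix w assume w: "w \<in> V \<and> (\<forall>v\<in>V. ?B w v = ?L v)"
  show "w = u"
   by (rule coercive_unique[OF V_lin B coercive, where L = ?L]) (use u w in auto)
 qed
qed

end
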